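(* Let $\beta>\beta_c$. There exist constants $c,C>0$ depending only on $\beta$ such that the following holds for every integer $\ell\ge1$. Let $S=\{1,\dots,\ell\}\times\mathbb Z$ be the infinite strip of width $\ell$ with boundary conditions $\eta\in\{\pm1\}^{\mathbb Z^2\setminus S}$ given by $\eta(x,y)=-1$ if $y>0$ and $\eta(x,y)=+1$ if $y\le0$. For an Ising configuration $\sigma$ on $S$ let $\lambda=\lambda(\sigma)$ be its unique open contour in the dual $S^*$ (whose endpoints are $(\frac12,\frac12)$ and $(\ell+\frac12,\frac12)$). For $i\in\mathbb Z$ let $H^*_i=\{\frac12,\dots,\ell+\frac12\}\times\{i+\frac12\}$. Then $$\frac c\ell\le\pi^\eta_S\bigl(\sigma:\ \lambda(\sigma)\text{ stays above }H^*_{-1}\bigr)\le\frac C\ell .$$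
   Context: $\beta_c=\frac12\log(1+\sqrt2)$. $\pi^\eta_S$ is the (unique) Gibbs measure on $\{\pm1\}^S$ of the nearest-neighbour Ising model at inverse temperature $\beta$ (weights $e^{-\beta H}$, $H=-\sum_{x\sim y}\sigma_x\sigma_y$, no field) with spins outside $S$ frozen to $\eta$. Contours: the dual lattice is $\mathbb Z^{2*}=\mathbb Z^2+(\frac12,\frac12)$; each edge $e$ of $\mathbb Z^2$ is crossed by a unique dual edge $e^*$. Given a configuration $\sigma$ on $S$ extended by $\eta$ outside $S$, consider the set of dual edges $e^*$ for all edges $e=(x,y)$ with $\{x,y\}\cap S\neq\emptyset$ and $\sigma_x\ne\sigma_y$. This set of dual edges is decomposed into edge-disjoint simple lines, called contours, by the South-East (SE) splitting rule: at each dual site where four of these dual edges meet, the North edge is joined to the East edge and the South edge is joined to the West edge. A contour is closed if it is a loop and open otherwise. With the b.c. $\eta$ there is almost surely a unique open contour, with endpoints $(\frac12,\frac12)$ and $(\ell+\frac12,\frac12)$. "Stays above $H^*_{-1}$" means that $\lambda$ contains no vertex of $H^*_{-1}$, i.e. all its vertices have second coordinate at least $\frac12$. *)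

theory Defs
  imports "HOL-Probability.Probability"
begin

type_synonym site = "int \<times> int"

section \<open>The Ising model in a region with frozen boundary spins\<close>

definition critical_beta :: real where
  "critical_beta = ln (1 + sqrt 2) / 2"

definition adjacent :: "site \<Rightarrow> site \<Rightarrow> bool" where
  "adjacent x y \<longleftrightarrow> \<bar>fst x - fst y\<bar> + \<bar>snd x - snd y\<bar> = 1"

definition edges_meeting :: "site set \<Rightarrow> site set set" where
  "edges_meeting S = {{x, y} | x y. adjacent x y \<and> {x, y} \<inter> S \<noteq> {}}"

lemma finite_edges_meeting:
  assumes "finite S"
  shows "finite (edges_meeting S)"
proof -
  have *: "y \<in> {(fst x + 1, snd x), (fst x - 1, snd x), (fst x, snd x + 1), (fst x, snd x - 1)}"
    if "adjacent x y" for x y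
    using that unfolding adjacent_def by (cases x; cases y) (auto simp: abs_if split: if_splits)
  have sym: "adjacent y x" if "adjacent x y" for x y
    using that unfolding adjacent_def by (simp add: abs_minus_commute)
  have "edges_meeting S \<subseteq> (\<Union>x\<in>S. (\<lambda>y. {x, y}) `
      {(fst x + 1, snd x), (fst x - 1, snd x), (fst x, snd x + 1), (fst x, snd x - 1)})"
    (is "_ \<subseteq> ?R")
  proof
    fix e assume "e \<in> edges_meeting S"
    then obtain x y where "e = {x, y}" "adjacent x y" "x \<in> S \<or> y \<in> S"
      unfolding edges_meeting_def by blast
    then obtain x y where "e = {x, y}" "adjacent x y" "x \<in> S"
      by (metis insert_commute sym)
    then show "e \<in> ?R" using * by blast
  qed
  moreover have "finite ?R" using assms by auto
  ultimately show ?thesis by (rule finite_subset)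
qed

text \<open>
  An edge is a two-element set \<open>e = {x, y}\<close>, so the inner product below is
  \<open>\<tau> x * \<tau> y\<close>, and each edge is counted once.
\<close>

definition energy :: "site set \<Rightarrow> (site \<Rightarrow> int) \<Rightarrow> real" where
  "energy \<Lambda> \<tau> = - (\<Sum>e\<in>edges_meeting \<Lambda>. real_of_int (\<Prod>x\<in>e. \<tau> x))"

definition boltzmann_weight :: "real \<Rightarrow> site set \<Rightarrow> (site \<Rightarrow> int) \<Rightarrow> real" where
  "boltzmann_weight \<beta> \<Lambda> \<tau> = exp (- \<beta> * energy \<Lambda> \<tau>)"

definition config_space :: "site set \<Rightarrow> (site \<Rightarrow> int) measure" where
  "config_space S = PiM S (\<lambda>_. count_space {-1, 1})"

text \<open>
  The finite-volume Gibbs distribution in a finite \<open>\<Lambda> \<subseteq> S\<close>, as a probability on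
  \<open>config_space S\<close>: the spins in \<open>\<Lambda>\<close> are resampled, those in \<open>S - \<Lambda>\<close> are kept equal to
  those of \<open>\<sigma>\<close>, and those outside \<open>S\<close> are frozen to \<open>\<eta>\<close>.
\<close>

definition ising_kernel ::
  "real \<Rightarrow> site set \<Rightarrow> (site \<Rightarrow> int) \<Rightarrow> site set \<Rightarrow> (site \<Rightarrow> int) \<Rightarrow> (site \<Rightarrow> int) set \<Rightarrow> real" where
  "ising_kernel \<beta> S \<eta> \<Lambda> \<sigma> A =
    (\<Sum>\<tau>\<in>\<Lambda> \<rightarrow>\<^sub>E {-1, 1}.
        boltzmann_weight \<beta> \<Lambda> (override_on \<eta> (override_on \<sigma> \<tau> \<Lambda>) S)
          * indicator A (override_on \<sigma> \<tau> \<Lambda>))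
    / (\<Sum>\<tau>\<in>\<Lambda> \<rightarrow>\<^sub>E {-1, 1}.
        boltzmann_weight \<beta> \<Lambda> (override_on \<eta> (override_on \<sigma> \<tau> \<Lambda>) S))"

text \<open>Gibbs measures on the possibly infinite region \<open>S\<close>, by the DLR equations.\<close>

definition ising_gibbs_measure ::
  "real \<Rightarrow> site set \<Rightarrow> (site \<Rightarrow> int) \<Rightarrow> (site \<Rightarrow> int) measure \<Rightarrow> bool" where
  "ising_gibbs_measure \<beta> S \<eta> \<mu> \<longleftrightarrow>
     prob_space \<mu> \<and> sets \<mu> = sets (config_space S) \<and>
     (\<forall>\<Lambda> A. finite \<Lambda> \<and> \<Lambda> \<subseteq> S \<and> A \<in> sets \<mu> \<longrightarrow>
        measure \<mu> A = (\<integral>\<sigma>. ising_kernel \<beta> S \<eta> \<Lambda> \<sigma> A \<partial>\<mu>))"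


section \<open>Contours\<close>

text \<open>
  The dual site \<open>(i + 1/2, j + 1/2)\<close> is encoded by the pair of integers \<open>(i, j)\<close>; it is the
  centre of the unit square with corners \<open>{i, i + 1} \<times> {j, j + 1}\<close>. A dual edge is the set of
  its two endpoints: the dual edge crossing \<open>e\<close> joins the centres of the two unit squares
  that have \<open>e\<close> as a side.
\<close>

type_synonym dual_site = "int \<times> int"

definition dual_edge :: "site set \<Rightarrow> dual_site set" where
  "dual_edge e = {(i, j). e \<subseteq> {i, i + 1} \<times> {j, j + 1}}"

lemma dual_edge_horizontal: "dual_edge {(a, b), (a + 1, b)} = {(a, b - 1), (a, b)}"
  unfolding dual_edge_def by auto

lemma dual_edge_vertical: "dual_edge {(a, b), (a, b + 1)} = {(a - 1, b), (a, b)}"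
  unfolding dual_edge_def by auto

definition disagreement_edges :: "site set \<Rightarrow> (site \<Rightarrow> int) \<Rightarrow> dual_site set set" where
  "disagreement_edges S \<omega> =
     {dual_edge {x, y} | x y. adjacent x y \<and> {x, y} \<inter> S \<noteq> {} \<and> \<omega> x \<noteq> \<omega> y}"

fun north_edge east_edge south_edge west_edge :: "dual_site \<Rightarrow> dual_site set" where
  "north_edge (i, j) = {(i, j), (i, j + 1)}"
| "east_edge (i, j) = {(i, j), (i + 1, j)}"
| "south_edge (i, j) = {(i, j), (i, j - 1)}"
| "west_edge (i, j) = {(i, j), (i - 1, j)}"

text \<open>
  The South-East splitting rule: \<open>joined E v f g\<close> says that the line arriving at the dual site
  \<open>v\<close> through \<open>f\<close> leaves it through \<open>g\<close>.

  Three edges of \<open>E\<close> can meet at an endpoint of the open contour: there the fourth dual edge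
  also separates two different spins, but it crosses an edge between two frozen sites, and so it
  is not in \<open>E\<close>. The rule is then applied as if this fourth edge were present, and the
  edge of \<open>E\<close> that it would be joined to ends at \<open>v\<close>.
\<close>

definition joined ::
  "dual_site set set \<Rightarrow> dual_site \<Rightarrow> dual_site set \<Rightarrow> dual_site set \<Rightarrow> bool" where
  "joined E v f g \<longleftrightarrow>
     f \<in> E \<and> g \<in> E \<and> f \<noteq> g \<and> v \<in> f \<and> v \<in> g \<and>
     (card {h \<in> E. v \<in> h} \<ge> 3 \<longrightarrow>
        {f, g} = {north_edge v, east_edge v} \<or> {f, g} = {south_edge v, west_edge v})"

definition contours :: "dual_site set set \<Rightarrow> dual_site set set set" where
  "contours E = E // {(f, g). \<exists>v. joined E v f g}\<^sup>*"

definition is_loop :: "dual_site set set \<Rightarrow> dual_site set set \<Rightarrow> bool" where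
  "is_loop E \<gamma> \<longleftrightarrow>
     (\<exists>n>0. \<exists>p :: nat \<Rightarrow> dual_site.
        (\<forall>k. p (k + n) = p k) \<and>
        inj_on (\<lambda>k. {p k, p (Suc k)}) {..<n} \<and>
        \<gamma> = (\<lambda>k. {p k, p (Suc k)}) ` {..<n} \<and>
        (\<forall>k. joined E (p (Suc k)) {p k, p (Suc k)} {p (Suc k), p (Suc (Suc k))}))"

definition open_contours ::
  "site set \<Rightarrow> (site \<Rightarrow> int) \<Rightarrow> (site \<Rightarrow> int) \<Rightarrow> dual_site set set set" where
  "open_contours S \<eta> \<sigma> =
     (let E = disagreement_edges S (override_on \<eta> \<sigma> S)
      in {\<gamma> \<in> contours E. \<not> is_loop E \<gamma>})"


section \<open>The strip\<close>

definition strip :: "nat \<Rightarrow> site set" where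
  "strip l = {1..int l} \<times> UNIV"

definition strip_bc :: "site \<Rightarrow> int" where
  "strip_bc = (\<lambda>(x, y). if y > 0 then -1 else 1)"

definition dual_row :: "nat \<Rightarrow> int \<Rightarrow> dual_site set" where
  "dual_row l i = {0..int l} \<times> {i}"

text \<open>
  The open contour exists and is unique only almost surely; the configurations for which this
  fails, a null set, are left out of the event.
\<close>

definition stays_above_event :: "nat \<Rightarrow> (site \<Rightarrow> int) set" where
  "stays_above_event l =
     {\<sigma> \<in> space (config_space (strip l)).
        \<exists>\<gamma>. open_contours (strip l) strip_bc \<sigma> = {\<gamma>} \<and> \<Union>\<gamma> \<inter> dual_row l (-1) = {}}"

end

(*
  Conditioned on a plus row far below and a minus row far above, the contours in the box between
  them are the subgraphs F of the dual box with boundary {u, w}, where u = (0, 0) and w = (l, 0),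
  with weight t^|F| for t = exp (- 2 * beta). The sum of these weights is, up to normalization,
  the two-point function G(u, w) of the dual Ising model with tanh K = t and free boundary
  conditions; beta > beta_c means that t < sqrt 2 - 1, so that the dual model is subcritical.

  The open contour is explored step by step from u. On reaching the row -1, the end w may be
  replaced by its mirror image w' = (l, -2) at no loss, by a reflection inequality that follows
  from Griffiths' inequality; hence the contour touches the row with probability at most
  G(u, w') / G(u, w). If it does not touch the row, it stays in the upper half of the box, and
  Griffiths' second inequality bounds the probability by G+(u, w) / G(u, w), with G+ the
  two-point function of the upper half.

  The correlations between sites on the sides of a long strip are computed exactly by means of
  the Kadanoff-Ceva fermions, whose linear relations are solved by a Fourier transform along the
  sides. Estimates of the resulting integrals give G(u, w') <= (1 - k / l) G(u, w), for two sites
  on opposite sides of the strip, and G+(u, w) <= (C / l) G(u, w), where G+ is bounded by the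
  correlation of two sites on the same side of a wide strip along the row 0.

  Finally, the DLR equations and a finite-energy bound produce monochromatic rows almost surely,
  and averaging over the last such rows gives the estimates for every Gibbs measure.
*)
theory Submission
  imports Defs
begin

section \<open>Subgraph sums and correlation inequalities\<close>

text \<open>The order 1/l is a quotient of powers. Across a strip of width l, facing sites have
  correlation at least of order exp (-l r) / sqrt l, with r = \<open>rate 0\<close>; two sites at
  distance l on one side of a wide strip have at most order exp (-l r) / (l sqrt l). The exponential
  factors agree because \<open>cosh (rate x) + cos x\<close> is constant in x, so both lattice
  directions share one dispersion relation. The additional 1/l along a side comes from a spectral
  density that vanishes quadratically where \<open>rate\<close> is least. For the lower bound,
  moving w by two rows inserts a cosine of twice the frequency into an integral that lives on
  frequencies of order 1 / sqrt l, a relative loss of order 1/l.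

  The obstacle is that the contour is only a part of the subgraph: loops touch it, and the splitting
  rule decides how. The exploration therefore never sums over contours. It sums over whole
  subgraphs, and revealing one edge acts linearly on every two-point function alike. Exact formulas
  enter only for fixed l and growing height, so an exponential decay in the height, with a rate that
  may depend badly on l, is enough.\<close>

definition sdiff :: "'a set \<Rightarrow> 'a set \<Rightarrow> 'a set" where
  "sdiff A B = {x. (x \<in> A) \<noteq> (x \<in> B)}"

lemma mem_sdiff [simp]: "x \<in> sdiff A B \<longleftrightarrow> (x \<in> A) \<noteq> (x \<in> B)"
  by (simp add: sdiff_def)

lemma sdiff_commute: "sdiff A B = sdiff B A"
  by (auto simp: set_eq_iff)

lemma sdiff_empty [simp]: "sdiff A {} = A" "sdiff {} A = A"
  by (auto simp: set_eq_iff)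

lemma sdiff_self [simp]: "sdiff A A = {}"
  by (auto simp: set_eq_iff)

lemma sdiff_cancel [simp]: "sdiff (sdiff A B) B = A"
  by (auto simp: set_eq_iff)

lemma sdiff_eq_iff: "sdiff A B = C \<longleftrightarrow> A = sdiff C B"
  by (metis sdiff_cancel)

lemma finite_sdiff [simp]: "finite A \<Longrightarrow> finite B \<Longrightarrow> finite (sdiff A B)"
  by (rule finite_subset[of _ "A \<union> B"]) auto

lemma sdiff_subset: "A \<subseteq> V \<Longrightarrow> B \<subseteq> V \<Longrightarrow> sdiff A B \<subseteq> V"
  by auto

lemma bij_sdiff_Pow: "R \<subseteq> V \<Longrightarrow> bij_betw (\<lambda>A. sdiff A R) (Pow V) (Pow V)"
  by (rule bij_betw_byWitness[where f' = "\<lambda>A. sdiff A R"]) auto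

text \<open>A spin configuration is encoded by the set of its minus spins.\<close>

definition spin :: "'v set \<Rightarrow> 'v \<Rightarrow> real" where
  "spin A x = (if x \<in> A then -1 else 1)"

definition spin_prod :: "'v set \<Rightarrow> 'v set \<Rightarrow> real" where
  "spin_prod A B = (\<Prod>x\<in>B. spin A x)"

lemma spin_sdiff: "spin (sdiff A R) x = spin A x * spin R x"
  by (auto simp: spin_def)

lemma spin_sq [simp]: "spin A x * spin A x = 1"
  by (auto simp: spin_def)

lemma spin_prod_sdiff_left: "spin_prod (sdiff A R) B = spin_prod A B * spin_prod R B"
  by (simp add: spin_prod_def spin_sdiff prod.distrib)

lemma spin_prod_sq [simp]: "spin_prod A B * spin_prod A B = 1"
  by (simp add: spin_prod_def flip: prod.distrib)

lemma spin_prod_empty [simp]: "spin_prod A {} = 1" "spin_prod {} B = 1"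
  by (simp_all add: spin_prod_def spin_def)

lemma spin_prod_cases: "spin_prod A B = 1 \<or> spin_prod A B = -1"
  using spin_prod_sq[of A B] by (metis square_eq_1_iff)

lemma spin_prod_sdiff:
  assumes "finite B" "finite C"
  shows "spin_prod A (sdiff B C) = spin_prod A B * spin_prod A C"
proof -
  have eq: "sdiff B C = (B - C) \<union> (C - B)" by auto
  have "spin_prod A B = spin_prod A (B - C) * spin_prod A (B \<inter> C)"
    unfolding spin_prod_def using assms by (subst prod.union_disjoint [symmetric]) (auto intro!: prod.cong)
  moreover have "spin_prod A C = spin_prod A (C - B) * spin_prod A (B \<inter> C)"
    unfolding spin_prod_def using assms by (subst prod.union_disjoint [symmetric]) (auto intro!: prod.cong)
  moreover have "spin_prod A (sdiff B C) = spin_prod A (B - C) * spin_prod A (C - B)"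
    unfolding spin_prod_def eq using assms by (subst prod.union_disjoint) auto
  ultimately show ?thesis
    using spin_prod_sq[of A "B \<inter> C"] by algebra
qed

lemma spin_prod_pair: "spin_prod A (sdiff {v} {w}) = spin A v * spin A w"
  by (subst spin_prod_sdiff) (simp_all add: spin_prod_def)

lemma spin_prod_doubleton: "x \<noteq> y \<Longrightarrow> spin_prod A {x, y} = spin A x * spin A y"
  by (simp add: spin_prod_def)

lemma sum_spin_prod:
  assumes "finite V" "B \<subseteq> V"
  shows "(\<Sum>A\<in>Pow V. spin_prod A B) = (if B = {} then 2 ^ card V else 0)"
proof (cases "B = {}")
  case True
  then show ?thesis using assms by (simp add: card_Pow)
next
  case False
  then obtain x where x: "x \<in> B" by auto
  have fB: "finite B" using assms finite_subset by blast
  have "spin_prod {x} B = (\<Prod>y\<in>B. if y = x then -1 else 1)"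
    unfolding spin_prod_def spin_def by (intro prod.cong) auto
  also have "\<dots> = -1" using x fB by (simp add: prod.delta)
  finally have flip: "spin_prod {x} B = -1" .
  have "(\<Sum>A\<in>Pow V. spin_prod A B) = (\<Sum>A\<in>Pow V. spin_prod (sdiff A {x}) B)"
    by (rule sum.reindex_bij_betw[symmetric, OF bij_sdiff_Pow]) (use x assms in auto)
  also have "\<dots> = - (\<Sum>A\<in>Pow V. spin_prod A B)"
    by (simp add: spin_prod_sdiff_left flip sum_negf)
  finally show ?thesis using False by simp
qed

text \<open>Multiplying out the factors one edge at a time leaves nonnegative multiples of sums of a
  single spin product, and such a sum is \<open>2 ^ card V\<close> or 0. Factors
  \<open>a e + b e * spin_prod A e\<close> with two free coefficients are what duplicating or
  folding a ferromagnet produces.\<close>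

lemma griffiths_first:
  assumes "finite V" "finite U" "B \<subseteq> V" "\<And>e. e \<in> U \<Longrightarrow> e \<subseteq> V"
    and "\<And>e. e \<in> U \<Longrightarrow> a e \<ge> 0" "\<And>e. e \<in> U \<Longrightarrow> b e \<ge> 0"
  shows "(\<Sum>A\<in>Pow V. (\<Prod>e\<in>U. a e + b e * spin_prod A e) * spin_prod A B) \<ge> 0"
  using assms(2-)
proof (induction U arbitrary: B rule: finite_induct)
  case empty
  then show ?case using sum_spin_prod[OF assms(1)] by auto
next
  case (insert e U)
  have fin: "finite B" "finite e" using insert.prems assms(1) by (auto intro: finite_subset[of _ V])
  let ?w = "\<lambda>A. \<Prod>e\<in>U. a e + b e * spin_prod A e"
  have "(\<Sum>A\<in>Pow V. (\<Prod>e\<in>insert e U. a e + b e * spin_prod A e) * spin_prod A B)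
     = (\<Sum>A\<in>Pow V. a e * (?w A * spin_prod A B) + b e * (?w A * spin_prod A (sdiff B e)))"
    using insert.hyps fin by (intro sum.cong) (auto simp: spin_prod_sdiff algebra_simps)
  also have "\<dots> = a e * (\<Sum>A\<in>Pow V. ?w A * spin_prod A B) + b e * (\<Sum>A\<in>Pow V. ?w A * spin_prod A (sdiff B e))"
    by (simp add: sum.distrib sum_distrib_left)
  also have "\<dots> \<ge> 0"
    using insert.prems by (intro add_nonneg_nonneg mult_nonneg_nonneg insert.IH sdiff_subset) auto
  finally show ?case .
qed

section \<open>Sums over subgraphs with prescribed odd vertices\<close>

definition boundary :: "'v set set \<Rightarrow> 'v set" where
  "boundary E = {v. odd (card {e \<in> E. v \<in> e})}"

lemma boundary_empty [simp]: "boundary {} = {}"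
  by (simp add: boundary_def)

lemma boundary_insert:
  assumes "finite E" "e \<notin> E"
  shows "boundary (insert e E) = sdiff (boundary E) e"
proof (rule set_eqI)
  fix v
  have "{f \<in> insert e E. v \<in> f} = (if v \<in> e then insert e {f \<in> E. v \<in> f} else {f \<in> E. v \<in> f})"
    by auto
  then show "v \<in> boundary (insert e E) \<longleftrightarrow> v \<in> sdiff (boundary E) e"
    using assms by (simp add: boundary_def)
qed

lemma boundary_subset:
  assumes "finite E" shows "boundary E \<subseteq> \<Union>E"
proof
  fix v assume "v \<in> boundary E"
  then have "{e \<in> E. v \<in> e} \<noteq> {}" by (auto simp: boundary_def simp del: Collect_empty_eq)
  then show "v \<in> \<Union>E" by auto
qed

lemma prod_spin_prod_boundary:
  assumes "finite E" "\<And>e. e \<in> E \<Longrightarrow> finite e"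
  shows "(\<Prod>e\<in>E. spin_prod R e) = spin_prod R (boundary E)"
  using assms
proof (induction E rule: finite_induct)
  case (insert e E)
  have "finite (boundary E)"
    by (rule finite_subset[OF boundary_subset]) (use insert in auto)
  then show ?case using insert by (simp add: boundary_insert spin_prod_sdiff)
qed simp

text \<open>
  The high-temperature expansion: up to the factor \<open>2 ^ card V\<close>, the sum below is the
  unnormalized expectation of the product of the spins in \<open>B\<close>, for the weight
  \<open>\<Prod>e\<in>U. 1 + J e * spin_prod A e\<close>.
\<close>

definition subgraph_sum :: "('v set \<Rightarrow> real) \<Rightarrow> 'v set set \<Rightarrow> 'v set \<Rightarrow> real" where
  "subgraph_sum J U B = (\<Sum>E | E \<subseteq> U \<and> boundary E = B. \<Prod>e\<in>E. J e)"

text \<open>Adding or removing \<open>e\<close> toggles the parity at both of its ends. The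
  predicate \<open>P\<close> is carried along so that sums restricted by the course of an
  exploration obey the same recursion.\<close>

lemma subgraphs_insert:
  assumes "finite U" "e \<notin> U"
  shows "{E. E \<subseteq> insert e U \<and> boundary E = B \<and> P E} =
    {E. E \<subseteq> U \<and> boundary E = B \<and> P E} \<union>
    insert e ` {E. E \<subseteq> U \<and> boundary E = sdiff B e \<and> P (insert e E)}"
    (is "?L = ?R1 \<union> insert e ` ?R2")
proof (intro set_eqI iffI)
  fix E assume E: "E \<in> ?L"
  show "E \<in> ?R1 \<union> insert e ` ?R2"
  proof (cases "e \<in> E")
    case True
    have fin: "finite (E - {e})" using E assms finite_subset by (metis (no_types, lifting) finite_Diff finite_insert mem_Collect_eq)
    have "boundary (insert e (E - {e})) = sdiff (boundary (E - {e})) e"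
      using fin by (intro boundary_insert) auto
    then have "boundary (E - {e}) = sdiff B e" using True E by (simp add: insert_absorb sdiff_eq_iff)
    then have "E - {e} \<in> ?R2" using E True by (auto simp: insert_absorb)
    moreover have "E = insert e (E - {e})" using True by auto
    ultimately show ?thesis by blast
  qed (use E in auto)
next
  fix E assume "E \<in> ?R1 \<union> insert e ` ?R2"
  then show "E \<in> ?L"
  proof
    assume "E \<in> insert e ` ?R2"
    then obtain E' where E': "E = insert e E'" "E' \<subseteq> U" "boundary E' = sdiff B e" "P E" by auto
    have "finite E'" "e \<notin> E'" using E'(2) assms finite_subset by auto
    then have "boundary E = sdiff (boundary E') e" unfolding E'(1) by (rule boundary_insert)
    then show ?thesis using E' by auto
  qed auto
qed

lemma sum_subgraphs_insert:
  assumes "finite U" "e \<notin> U"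
  shows "(\<Sum>E | E \<subseteq> insert e U \<and> boundary E = B \<and> P E. \<Prod>e\<in>E. J e) =
    (\<Sum>E | E \<subseteq> U \<and> boundary E = B \<and> P E. \<Prod>e\<in>E. J e) +
    J e * (\<Sum>E | E \<subseteq> U \<and> boundary E = sdiff B e \<and> P (insert e E). \<Prod>e\<in>E. (J e :: real))"
proof -
  let ?R1 = "{E. E \<subseteq> U \<and> boundary E = B \<and> P E}"
  let ?R2 = "{E. E \<subseteq> U \<and> boundary E = sdiff B e \<and> P (insert e E)}"
  have fin: "finite ?R1" "finite ?R2" using assms by auto
  have "(\<Sum>E\<in>?R1 \<union> insert e ` ?R2. \<Prod>e\<in>E. J e) = (\<Sum>E\<in>?R1. \<Prod>e\<in>E. J e) + (\<Sum>E\<in>insert e ` ?R2. \<Prod>e\<in>E. J e)"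
    using assms fin by (intro sum.union_disjoint) auto
  also have "(\<Sum>E\<in>insert e ` ?R2. \<Prod>e\<in>E. J e) = (\<Sum>E\<in>?R2. \<Prod>e\<in>insert e E. J e)"
    using assms by (subst sum.reindex) (auto simp: inj_on_def)
  also have "\<dots> = (\<Sum>E\<in>?R2. J e * (\<Prod>e\<in>E. J e))"
    using assms finite_subset[of _ U] by (intro sum.cong refl prod.insert) auto
  finally show ?thesis by (simp add: subgraphs_insert[OF assms] sum_distrib_left)
qed

lemma subgraph_sum_insert:
  assumes "finite U" "e \<notin> U"
  shows "subgraph_sum J (insert e U) B = subgraph_sum J U B + J e * subgraph_sum J U (sdiff B e)"
  using sum_subgraphs_insert[OF assms, where P = "\<lambda>_. True"] by (simp add: subgraph_sum_def)

lemma subgraph_sum_empty: "subgraph_sum J {} B = (if B = {} then 1 else 0)"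
proof -
  have "{E. E \<subseteq> {} \<and> boundary E = B} = (if B = {} then {{}} else {})" by auto
  then show ?thesis by (simp add: subgraph_sum_def)
qed

lemma subgraph_sum_spins:
  assumes "finite V" "finite U" "B \<subseteq> V" "\<And>e. e \<in> U \<Longrightarrow> e \<subseteq> V"
  shows "(\<Sum>A\<in>Pow V. (\<Prod>e\<in>U. 1 + J e * spin_prod A e) * spin_prod A B) = 2 ^ card V * subgraph_sum J U B"
  using assms(2-)
proof (induction U arbitrary: B rule: finite_induct)
  case empty
  then show ?case using sum_spin_prod[OF assms(1)] by (auto simp: subgraph_sum_empty)
next
  case (insert e U)
  have fin: "finite B" "finite e" using insert.prems assms(1) by (auto intro: finite_subset[of _ V])
  let ?w = "\<lambda>A. \<Prod>e\<in>U. 1 + J e * spin_prod A e"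
  have "(\<Sum>A\<in>Pow V. (\<Prod>e\<in>insert e U. 1 + J e * spin_prod A e) * spin_prod A B)
     = (\<Sum>A\<in>Pow V. ?w A * spin_prod A B + J e * (?w A * spin_prod A (sdiff B e)))"
    using insert.hyps fin by (intro sum.cong) (auto simp: spin_prod_sdiff algebra_simps)
  also have "\<dots> = (\<Sum>A\<in>Pow V. ?w A * spin_prod A B) + J e * (\<Sum>A\<in>Pow V. ?w A * spin_prod A (sdiff B e))"
    by (simp add: sum.distrib sum_distrib_left)
  also have "\<dots> = 2 ^ card V * (subgraph_sum J U B + J e * subgraph_sum J U (sdiff B e))"
    using insert.IH[of B] insert.IH[of "sdiff B e"] insert.prems sdiff_subset[of B V e]
    by (simp add: algebra_simps)
  finally show ?case using insert.hyps by (simp add: subgraph_sum_insert)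
qed

text \<open>A vertex of \<open>R\<close> contributes the parity of its degree in \<open>E\<close>,
  so the signs multiply to \<open>spin_prod R (boundary E)\<close>. Flipping the spins of
  \<open>R\<close> thus moves a line of reversed couplings; this is how cuts are shifted and removed
  below.\<close>

lemma subgraph_sum_gauge:
  assumes "finite U" "\<And>e. e \<in> U \<Longrightarrow> finite e" "\<And>e. e \<in> U \<Longrightarrow> J' e = J e * spin_prod R e"
  shows "subgraph_sum J' U B = spin_prod R B * subgraph_sum J U B"
  unfolding subgraph_sum_def sum_distrib_left
proof (rule sum.cong[OF refl])
  fix E assume E: "E \<in> {E. E \<subseteq> U \<and> boundary E = B}"
  have fE: "finite E" using E assms(1) finite_subset by auto
  have "(\<Prod>e\<in>E. J' e) = (\<Prod>e\<in>E. J e * spin_prod R e)" by (rule prod.cong) (use E assms in auto)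
  also have "\<dots> = (\<Prod>e\<in>E. J e) * spin_prod R (boundary E)"
    using prod_spin_prod_boundary[OF fE, of R] E assms(2) by (auto simp: prod.distrib)
  finally show "(\<Prod>e\<in>E. J' e) = spin_prod R B * (\<Prod>e\<in>E. J e)" using E by simp
qed

lemma subgraph_sum_cong:
  assumes "\<And>e. e \<in> U \<Longrightarrow> J e = J' e"
  shows "subgraph_sum J U B = subgraph_sum J' U B"
  unfolding subgraph_sum_def using assms by (intro sum.cong prod.cong) auto

lemma subgraph_sum_nonneg: "(\<And>e. e \<in> U \<Longrightarrow> J e \<ge> 0) \<Longrightarrow> subgraph_sum J U B \<ge> 0"
  unfolding subgraph_sum_def by (intro sum_nonneg prod_nonneg) auto

lemma subgraph_sum_pos:
  assumes "finite U" "\<And>e. e \<in> U \<Longrightarrow> J e \<ge> 0"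
  shows "subgraph_sum J U {} \<ge> 1"
proof -
  have "(\<Sum>E\<in>{{}}. \<Prod>e\<in>E. J e) \<le> subgraph_sum J U {}"
    unfolding subgraph_sum_def using assms by (intro sum_mono2 prod_nonneg) auto
  then show ?thesis by simp
qed

text \<open>Ginibre's duplication: the difference of the two sides becomes a sum over pairs of
  configurations \<open>A\<close> and \<open>sdiff A R\<close>. For a fixed relative configuration
  \<open>R\<close> the product of the two weights is of the form treated by
  \<open>griffiths_first\<close>, and it is multiplied by the nonnegative number
  \<open>1 - spin_prod R C\<close>.\<close>

lemma griffiths_second:
  assumes U: "finite U" "\<And>e. e \<in> U \<Longrightarrow> finite e" and B: "finite B" "finite C"
    and J: "\<And>e. e \<in> U \<Longrightarrow> 0 \<le> J e" "\<And>e. e \<in> U \<Longrightarrow> J e \<le> 1"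
  shows "subgraph_sum J U B * subgraph_sum J U C \<le> subgraph_sum J U {} * subgraph_sum J U (sdiff B C)"
proof -
  define V where "V = \<Union>U \<union> B \<union> C"
  have V: "finite V" "B \<subseteq> V" "C \<subseteq> V" "sdiff B C \<subseteq> V" "\<And>e. e \<in> U \<Longrightarrow> e \<subseteq> V"
    using U B by (auto simp: V_def)
  let ?w = "\<lambda>A. \<Prod>e\<in>U. 1 + J e * spin_prod A e"
  let ?S = "\<lambda>B. \<Sum>A\<in>Pow V. ?w A * spin_prod A B"
  have inner: "0 \<le> (\<Sum>A\<in>Pow V. ?w A * ?w (sdiff A R) * (spin_prod A (sdiff B C) * (1 - spin_prod R C)))"
    if "R \<in> Pow V" for R
  proof -
    \<comment> \<open>Squares of spin products are 1, so each pair of factors is linear in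
      \<open>spin_prod A e\<close>; couplings of at most 1 keep its constant term
      nonnegative.\<close>
    have "?w A * ?w (sdiff A R) = (\<Prod>e\<in>U. (1 + (J e)\<^sup>2 * spin_prod R e) + J e * (1 + spin_prod R e) * spin_prod A e)" for A
    proof -
      have "(1 + J e * spin_prod A e) * (1 + J e * (spin_prod A e * spin_prod R e)) =
        (1 + (J e)\<^sup>2 * spin_prod R e * (spin_prod A e * spin_prod A e)) + J e * (1 + spin_prod R e) * spin_prod A e" for e
        by (simp add: algebra_simps power2_eq_square)
      then show ?thesis by (simp add: spin_prod_sdiff_left flip: prod.distrib)
    qed
    then have "(\<Sum>A\<in>Pow V. ?w A * ?w (sdiff A R) * (spin_prod A (sdiff B C) * (1 - spin_prod R C))) =
      (1 - spin_prod R C) * (\<Sum>A\<in>Pow V. (\<Prod>e\<in>U. (1 + (J e)\<^sup>2 * spin_prod R e) + J e * (1 + spin_prod R e) * spin_prod A e) * spin_prod A (sdiff B C))"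
      by (simp add: sum_distrib_left mult_ac)
    also have "\<dots> \<ge> 0"
    proof (intro mult_nonneg_nonneg griffiths_first V U)
      show "0 \<le> 1 - spin_prod R C" using spin_prod_cases[of R C] by auto
      show "0 \<le> 1 + (J e)\<^sup>2 * spin_prod R e" if "e \<in> U" for e
        using spin_prod_cases[of R e] power_le_one[OF J(1)[OF that] J(2)[OF that], of 2] by (auto simp: add_nonneg_nonneg)
      show "0 \<le> J e" if "e \<in> U" for e using J that by auto
      show "0 \<le> 1 + spin_prod R e" for e using spin_prod_cases[of R e] by auto
    qed
    finally show ?thesis .
  qed
  have "?S {} * ?S (sdiff B C) - ?S B * ?S C
    = (\<Sum>A\<in>Pow V. \<Sum>A'\<in>Pow V. ?w A * ?w A' * (spin_prod A (sdiff B C) - spin_prod A B * spin_prod A' C))"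
  proof -
    have "?S {} * ?S (sdiff B C) = (\<Sum>A\<in>Pow V. \<Sum>A'\<in>Pow V. (?w A * spin_prod A (sdiff B C)) * (?w A' * spin_prod A' {}))"
      by (subst mult.commute) (rule sum_product)
    moreover have "?S B * ?S C = (\<Sum>A\<in>Pow V. \<Sum>A'\<in>Pow V. (?w A * spin_prod A B) * (?w A' * spin_prod A' C))"
      by (rule sum_product)
    ultimately show ?thesis
      by (simp only: sum_subtractf[symmetric]) (intro sum.cong refl, simp add: right_diff_distrib)
  qed
  also have "\<dots> = (\<Sum>A\<in>Pow V. \<Sum>R\<in>Pow V. ?w A * ?w (sdiff A R) * (spin_prod A (sdiff B C) * (1 - spin_prod R C)))"
  proof (rule sum.cong[OF refl])
    fix A assume A: "A \<in> Pow V"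
    have "(\<Sum>A'\<in>Pow V. ?w A * ?w A' * (spin_prod A (sdiff B C) - spin_prod A B * spin_prod A' C)) =
      (\<Sum>R\<in>Pow V. ?w A * ?w (sdiff R A) * (spin_prod A (sdiff B C) - spin_prod A B * spin_prod (sdiff R A) C))"
      by (rule sum.reindex_bij_betw[symmetric, OF bij_sdiff_Pow]) (use A in auto)
    also have "\<dots> = (\<Sum>R\<in>Pow V. ?w A * ?w (sdiff A R) * (spin_prod A (sdiff B C) * (1 - spin_prod R C)))"
      using B by (intro sum.cong refl) (simp add: spin_prod_sdiff spin_prod_sdiff_left sdiff_commute[of _ A] algebra_simps)
    finally show "(\<Sum>A'\<in>Pow V. ?w A * ?w A' * (spin_prod A (sdiff B C) - spin_prod A B * spin_prod A' C)) =
      (\<Sum>R\<in>Pow V. ?w A * ?w (sdiff A R) * (spin_prod A (sdiff B C) * (1 - spin_prod R C)))" .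
  qed
  also have "\<dots> = (\<Sum>R\<in>Pow V. \<Sum>A\<in>Pow V. ?w A * ?w (sdiff A R) * (spin_prod A (sdiff B C) * (1 - spin_prod R C)))"
    by (rule sum.swap)
  also have "\<dots> \<ge> 0" using inner by (rule sum_nonneg)
  finally have le: "?S B * ?S C \<le> ?S {} * ?S (sdiff B C)" by (simp only: diff_ge_0_iff_ge)
  have SS: "?S D = 2 ^ card V * subgraph_sum J U D" if "D \<subseteq> V" for D
    by (rule subgraph_sum_spins) (use V U that in auto)
  have "(2 ^ card V * subgraph_sum J U B) * (2 ^ card V * subgraph_sum J U C) \<le>
      (2 ^ card V * subgraph_sum J U {}) * (2 ^ card V * subgraph_sum J U (sdiff B C))"
    using le by (simp only: SS[OF V(2)] SS[OF V(3)] SS[OF V(4)] SS[OF empty_subsetI])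
  then have "(2 ^ card V * 2 ^ card V) * (subgraph_sum J U B * subgraph_sum J U C) \<le>
      (2 ^ card V * 2 ^ card V) * (subgraph_sum J U {} * subgraph_sum J U (sdiff B C))"
    by (simp only: mult_ac)
  then show ?thesis by (subst (asm) mult_le_cancel_left_pos) auto
qed

text \<open>Edges are added one at a time. A new edge \<open>e\<close> adds \<open>J e\<close> times
  the sum with toggled boundary to the numerator and to the denominator, and
  \<open>griffiths_second\<close> for \<open>B\<close> and \<open>e\<close> says that the quotient
  does not decrease.\<close>

lemma subgraph_sum_ratio_mono:
  assumes "finite U'" "U \<subseteq> U'" "\<And>e. e \<in> U' \<Longrightarrow> finite e" "finite B"
    and J: "\<And>e. e \<in> U' \<Longrightarrow> 0 \<le> J e" "\<And>e. e \<in> U' \<Longrightarrow> J e \<le> 1"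
  shows "subgraph_sum J U B / subgraph_sum J U {} \<le> subgraph_sum J U' B / subgraph_sum J U' {}"
proof -
  have "finite D \<Longrightarrow> D \<subseteq> U' \<Longrightarrow>
    subgraph_sum J U B / subgraph_sum J U {} \<le> subgraph_sum J (U \<union> D) B / subgraph_sum J (U \<union> D) {}" for D
  proof (induction D rule: finite_induct)
    case (insert e D)
    show ?case
    proof (cases "e \<in> U \<union> D")
      case True
      then have "U \<union> insert e D = U \<union> D" by auto
      then show ?thesis using insert by simp
    next
      case False
      let ?U = "U \<union> D"
      have sub: "?U \<subseteq> U'" "e \<in> U'" using insert assms by auto
      have fin: "finite ?U" using sub(1) assms(1) finite_subset by blast
      have J0: "0 \<le> J f" if "f \<in> ?U" for f using that sub J by auto
      have "subgraph_sum J ?U {} \<ge> 1" using J0 by (rule subgraph_sum_pos[OF fin])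
      then have pos: "subgraph_sum J ?U {} > 0" by linarith
      have nn: "subgraph_sum J ?U e \<ge> 0" "0 \<le> J e" using subgraph_sum_nonneg[of ?U J, OF J0] J sub by auto
      have le: "subgraph_sum J ?U B * subgraph_sum J ?U e \<le> subgraph_sum J ?U {} * subgraph_sum J ?U (sdiff B e)"
        using sub fin assms J by (intro griffiths_second) auto
      have pos': "subgraph_sum J ?U {} + J e * subgraph_sum J ?U e > 0"
        using pos nn by (intro add_pos_nonneg mult_nonneg_nonneg)
      have "subgraph_sum J ?U B * (subgraph_sum J ?U {} + J e * subgraph_sum J ?U e) \<le>
        (subgraph_sum J ?U B + J e * subgraph_sum J ?U (sdiff B e)) * subgraph_sum J ?U {}"
        using mult_left_mono[OF le nn(2)] by (simp add: algebra_simps)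
      then have "subgraph_sum J ?U B / subgraph_sum J ?U {} \<le>
         (subgraph_sum J ?U B + J e * subgraph_sum J ?U (sdiff B e)) / (subgraph_sum J ?U {} + J e * subgraph_sum J ?U e)"
        using pos pos' by (simp add: pos_divide_le_eq pos_le_divide_eq mult.commute)
      also have "\<dots> = subgraph_sum J (U \<union> insert e D) B / subgraph_sum J (U \<union> insert e D) {}"
        using subgraph_sum_insert[OF fin False] by simp
      finally show ?thesis using insert by auto
    qed
  qed simp
  from this[of U'] assms show ?thesis by (simp add: Un_absorb1)
qed

text \<open>
  Fixing the relative signs \<open>R\<close> of the spins at reflected sites turns the model on \<open>W \<union> P\<close>
  into a ferromagnet on \<open>W\<close>, to which Griffiths' first inequality applies.
\<close>

lemma reflection_inequality:
  fixes V W P :: "'v set"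
  assumes V: "finite V" "V = W \<union> P" "W \<inter> P = {}"
    and rfl: "\<And>x. \<pi> (\<pi> x) = x" "\<And>x. x \<in> P \<Longrightarrow> \<pi> x \<in> W"
    and U: "finite U" "\<And>e. e \<in> U \<Longrightarrow> e \<subseteq> V"
      "\<And>e. e \<in> U \<Longrightarrow> \<not> e \<subseteq> W \<Longrightarrow> (\<forall>x\<in>e. x \<in> P \<or> \<pi> x = x) \<and> \<pi> ` e \<in> U"
    and z: "z \<in> W" and w: "w \<in> P" and t: "0 \<le> t" "t \<le> 1"
  shows "subgraph_sum (\<lambda>_. t) U (sdiff {z} {w}) \<le> subgraph_sum (\<lambda>_. t) U (sdiff {z} {\<pi> w})"
proof -
  \<comment> \<open>\<open>A0\<close> holds the spins on \<open>W\<close>, and \<open>R\<close>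
    marks the sites of \<open>P\<close> whose spin differs from that of their image. Every
    configuration on \<open>V\<close> arises exactly once.\<close>
  define glue where "glue A0 R = A0 \<union> {x \<in> P. (\<pi> x \<in> A0) \<noteq> (x \<in> R)}" for A0 R
  have finW: "finite W" "finite P" using V by auto
  have \<pi>inj: "inj \<pi>" using rfl(1) by (metis injI)
  have \<pi>\<pi>: "\<pi> ` \<pi> ` e = e" for e using rfl(1) by (simp add: image_image)
  let ?w = "\<lambda>A. \<Prod>e\<in>U. 1 + t * spin_prod A e"
  define UW where "UW = {e \<in> U. e \<subseteq> W}"
  define UP where "UP = {e \<in> U. \<not> e \<subseteq> W}"
  have UWP: "finite UW" "finite UP" "UW \<inter> UP = {}" "U = UW \<union> UP"
    using U by (auto simp: UW_def UP_def)
  have img: "\<pi> ` e \<in> UW" if "e \<in> UP" for e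
  proof -
    have "(\<forall>x\<in>e. x \<in> P \<or> \<pi> x = x)" "\<pi> ` e \<in> U" "e \<subseteq> W \<union> P"
      using that U V by (auto simp: UP_def)
    then show ?thesis using rfl(2) by (fastforce simp: UW_def)
  qed
  have spW: "spin (glue A0 R) x = spin A0 x" if "A0 \<subseteq> W" "x \<in> W" for A0 R x
    using that V by (auto simp: spin_def glue_def)
  have spP: "spin (glue A0 R) x = spin A0 (\<pi> x) * spin R x" if "A0 \<subseteq> W" "R \<subseteq> P" "x \<in> P \<or> x \<in> W \<and> \<pi> x = x" for A0 R x
    using that V by (auto simp: spin_def glue_def)
  \<comment> \<open>If the edge \<open>f\<close> of \<open>W\<close> is the image of an edge in
    \<open>UP\<close>, the factors of both are collected at \<open>f\<close>; their product is
    linear in \<open>spin_prod A0 f\<close> because squares are 1.\<close>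
  define a where "a R f = (if \<pi> ` f \<in> UP then 1 + t\<^sup>2 * spin_prod R (\<pi> ` f) else 1)" for R f
  define b where "b R f = (if \<pi> ` f \<in> UP then t * (1 + spin_prod R (\<pi> ` f)) else t)" for R f
  have weight: "?w (glue A0 R) = (\<Prod>f\<in>UW. a R f + b R f * spin_prod A0 f)"
    if A0: "A0 \<subseteq> W" and R: "R \<subseteq> P" for A0 R
  proof -
    have "?w (glue A0 R) = (\<Prod>e\<in>UW. 1 + t * spin_prod (glue A0 R) e) * (\<Prod>e\<in>UP. 1 + t * spin_prod (glue A0 R) e)"
      using UWP by (simp add: prod.union_disjoint)
    also have "(\<Prod>e\<in>UW. 1 + t * spin_prod (glue A0 R) e) = (\<Prod>e\<in>UW. 1 + t * spin_prod A0 e)"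
    proof (rule prod.cong[OF refl])
      fix e assume "e \<in> UW"
      then have "spin_prod (glue A0 R) e = spin_prod A0 e"
        unfolding spin_prod_def using A0 by (intro prod.cong refl spW) (auto simp: UW_def)
      then show "1 + t * spin_prod (glue A0 R) e = 1 + t * spin_prod A0 e" by simp
    qed
    also have "(\<Prod>e\<in>UP. 1 + t * spin_prod (glue A0 R) e) = (\<Prod>e\<in>UP. 1 + t * (spin_prod A0 (\<pi> ` e) * spin_prod R e))"
    proof (rule prod.cong[OF refl])
      fix e assume e: "e \<in> UP"
      have "spin_prod (glue A0 R) e = (\<Prod>x\<in>e. spin A0 (\<pi> x) * spin R x)"
        unfolding spin_prod_def
      proof (rule prod.cong[OF refl])
        fix x assume x: "x \<in> e"
        show "spin (glue A0 R) x = spin A0 (\<pi> x) * spin R x"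
          using spP[OF A0 R, of x] e x U(2,3)[of e] V by (auto simp: UP_def)
      qed
      also have "\<dots> = spin_prod A0 (\<pi> ` e) * spin_prod R e"
        using inj_on_subset[OF \<pi>inj, of e] by (simp add: prod.distrib spin_prod_def prod.reindex o_def)
      finally show "1 + t * spin_prod (glue A0 R) e = 1 + t * (spin_prod A0 (\<pi> ` e) * spin_prod R e)" by simp
    qed
    also have "\<dots> = (\<Prod>f\<in>(`) \<pi> ` UP. 1 + t * (spin_prod A0 f * spin_prod R (\<pi> ` f)))"
    proof -
      have "inj_on ((`) \<pi>) UP" using \<pi>\<pi> by (metis inj_onI)
      then show ?thesis by (simp add: prod.reindex \<pi>\<pi> o_def)
    qed
    also have "\<dots> = (\<Prod>f\<in>UW. if \<pi> ` f \<in> UP then 1 + t * (spin_prod A0 f * spin_prod R (\<pi> ` f)) else 1)"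
    proof -
      have "(`) \<pi> ` UP = {f \<in> UW. \<pi> ` f \<in> UP}"
      proof (intro set_eqI iffI)
        fix f assume "f \<in> (`) \<pi> ` UP"
        then show "f \<in> {f \<in> UW. \<pi> ` f \<in> UP}" using img \<pi>\<pi> by auto
      next
        fix f assume "f \<in> {f \<in> UW. \<pi> ` f \<in> UP}"
        then show "f \<in> (`) \<pi> ` UP" using \<pi>\<pi>[of f] by (metis (no_types, lifting) image_eqI mem_Collect_eq)
      qed
      then show ?thesis using UWP(1) by (simp add: prod.inter_filter)
    qed
    finally have "?w (glue A0 R) = (\<Prod>f\<in>UW. (1 + t * spin_prod A0 f) * (if \<pi> ` f \<in> UP then 1 + t * (spin_prod A0 f * spin_prod R (\<pi> ` f)) else 1))"
      by (simp add: prod.distrib)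
    also have "\<dots> = (\<Prod>f\<in>UW. a R f + b R f * spin_prod A0 f)"
    proof (rule prod.cong[OF refl])
      fix f
      have "(1 + t * spin_prod A0 f) * (1 + t * (spin_prod A0 f * r)) = (1 + t\<^sup>2 * r * (spin_prod A0 f * spin_prod A0 f)) + t * (1 + r) * spin_prod A0 f" for r
        by (simp add: algebra_simps power2_eq_square)
      then show "(1 + t * spin_prod A0 f) * (if \<pi> ` f \<in> UP then 1 + t * (spin_prod A0 f * spin_prod R (\<pi> ` f)) else 1) = a R f + b R f * spin_prod A0 f"
        by (simp add: a_def b_def)
    qed
    finally show ?thesis .
  qed
  have bij: "bij_betw (\<lambda>(R, A0). glue A0 R) (Pow P \<times> Pow W) (Pow V)"
    by (rule bij_betw_byWitness[where f' = "\<lambda>A. ({x \<in> P. (\<pi> x \<in> A) \<noteq> (x \<in> A)}, A \<inter> W)"])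
       (use V rfl in \<open>auto simp: glue_def\<close>)
  let ?D = "\<lambda>A. ?w A * (spin_prod A (sdiff {z} {\<pi> w}) - spin_prod A (sdiff {z} {w}))"
  have "(\<Sum>A\<in>Pow V. ?D A) = (\<Sum>(R, A0)\<in>Pow P \<times> Pow W. ?D (glue A0 R))"
    by (subst sum.reindex_bij_betw[OF bij, symmetric]) (simp add: case_prod_unfold)
  also have "\<dots> = (\<Sum>R\<in>Pow P. \<Sum>A0\<in>Pow W. ?D (glue A0 R))"
    by (simp add: sum.cartesian_product)
  also have "\<dots> \<ge> 0"
  proof (rule sum_nonneg)
    fix R assume R: "R \<in> Pow P"
    \<comment> \<open>The sites \<open>w\<close> and \<open>\<pi> w\<close> carry the same spin
      unless \<open>w\<close> lies in \<open>R\<close>, hence the factor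
      \<open>1 - spin R w\<close>.\<close>
    have "(\<Sum>A0\<in>Pow W. ?D (glue A0 R)) =
      (1 - spin R w) * (\<Sum>A0\<in>Pow W. (\<Prod>f\<in>UW. a R f + b R f * spin_prod A0 f) * spin_prod A0 (sdiff {z} {\<pi> w}))"
      unfolding sum_distrib_left
    proof (rule sum.cong[OF refl])
      fix A0 assume A0: "A0 \<in> Pow W"
      have "spin_prod (glue A0 R) (sdiff {z} {\<pi> w}) - spin_prod (glue A0 R) (sdiff {z} {w}) =
          (1 - spin R w) * spin_prod A0 (sdiff {z} {\<pi> w})"
        using A0 R z w rfl(2)[OF w] spW[of A0 z R] spW[of A0 "\<pi> w" R] spP[of A0 R w]
        by (simp add: spin_prod_pair algebra_simps)
      then show "?D (glue A0 R) = (1 - spin R w) * ((\<Prod>f\<in>UW. a R f + b R f * spin_prod A0 f) * spin_prod A0 (sdiff {z} {\<pi> w}))"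
        using weight[of A0 R] A0 R by (simp add: mult_ac)
    qed
    also have "\<dots> \<ge> 0"
    proof (intro mult_nonneg_nonneg griffiths_first finW UWP)
      show "0 \<le> 1 - spin R w" by (simp add: spin_def)
      show "sdiff {z} {\<pi> w} \<subseteq> W" using z w rfl by auto
      show "e \<subseteq> W" if "e \<in> UW" for e using that by (simp add: UW_def)
      show "0 \<le> a R e" for e
        using spin_prod_cases[of R "\<pi> ` e"] power_le_one[OF t, of 2] by (auto simp: a_def add_nonneg_nonneg)
      show "0 \<le> b R e" for e
        using spin_prod_cases[of R "\<pi> ` e"] t by (auto simp: b_def)
    qed
    finally show "0 \<le> (\<Sum>A0\<in>Pow W. ?D (glue A0 R))" .
  qed
  finally have le: "(\<Sum>A\<in>Pow V. ?w A * spin_prod A (sdiff {z} {w})) \<le> (\<Sum>A\<in>Pow V. ?w A * spin_prod A (sdiff {z} {\<pi> w}))"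
    by (simp add: right_diff_distrib sum_subtractf)
  have S: "(\<Sum>A\<in>Pow V. ?w A * spin_prod A D) = 2 ^ card V * subgraph_sum (\<lambda>_. t) U D" if "D \<subseteq> V" for D
    by (rule subgraph_sum_spins) (use V(1) U that in auto)
  have "sdiff {z} {w} \<subseteq> V" "sdiff {z} {\<pi> w} \<subseteq> V" using z w rfl V by auto
  with le show ?thesis by (simp add: S)
qed

section \<open>The exploration of a subgraph from one of its ends\<close>

datatype dir = North | East | South | West

fun shift :: "dual_site \<Rightarrow> dir \<Rightarrow> dual_site" where
  "shift (i, j) North = (i, j + 1)"
| "shift (i, j) East = (i + 1, j)"
| "shift (i, j) South = (i, j - 1)"
| "shift (i, j) West = (i - 1, j)"

fun opposite :: "dir \<Rightarrow> dir" where
  "opposite North = South" | "opposite East = West" | "opposite South = North" | "opposite West = East"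

definition edge :: "dual_site \<Rightarrow> dir \<Rightarrow> dual_site set" where
  "edge v d = {v, shift v d}"

lemma finite_edge [simp]: "finite (edge v d)"
  by (simp add: edge_def)

lemma shift_neq [simp]: "shift v d \<noteq> v" "v \<noteq> shift v d"
  by (cases v; cases d; simp)+

lemma shift_opposite [simp]: "shift (shift v d) (opposite d) = v"
  by (cases v; cases d) auto

lemma edge_opposite: "edge (shift v d) (opposite d) = edge v d"
  by (auto simp: edge_def)

text \<open>Taking an edge moves the open end from \<open>v\<close> to its neighbour. Writing the
  odd vertices with \<open>sdiff\<close> instead of as a pair keeps this true when the walk arrives
  at \<open>w\<close> or leaves it.\<close>

lemma sdiff_edge: "sdiff (sdiff {v} {w}) (edge v d) = sdiff {shift v d} {w}"
  by (auto simp: edge_def)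

text \<open>
  \<open>walk L ord E v ds z\<close> explores the unused edges \<open>E\<close> from \<open>v\<close>: it leaves \<open>v\<close> along the first
  direction of the list \<open>ds\<close> whose edge is in \<open>E\<close>, and \<open>z\<close> is the site where it first meets
  \<open>L\<close> or gets stuck. Each step reveals the state of one edge, so the sums over \<open>E\<close> obey the
  same recursion as the two-point functions.
\<close>

inductive walk :: "dual_site set \<Rightarrow> (dual_site \<Rightarrow> dir \<Rightarrow> dir list) \<Rightarrow>
    dual_site set set \<Rightarrow> dual_site \<Rightarrow> dir list \<Rightarrow> dual_site \<Rightarrow> bool"
  for L :: "dual_site set" and ord :: "dual_site \<Rightarrow> dir \<Rightarrow> dir list" where
  hit: "v \<in> L \<Longrightarrow> walk L ord E v ds v"
| stuck: "v \<notin> L \<Longrightarrow> walk L ord E v [] v"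
| take: "v \<notin> L \<Longrightarrow> edge v d \<in> E \<Longrightarrow>
    walk L ord (E - {edge v d}) (shift v d) (ord (shift v d) (opposite d)) z \<Longrightarrow> walk L ord E v (d # ds) z"
| skip: "v \<notin> L \<Longrightarrow> edge v d \<notin> E \<Longrightarrow> walk L ord E v ds z \<Longrightarrow> walk L ord E v (d # ds) z"

lemma walk_hit_iff: "v \<in> L \<Longrightarrow> walk L ord E v ds z \<longleftrightarrow> z = v"
  by (auto elim: walk.cases intro: walk.intros)

lemma walk_Nil_iff: "walk L ord E v [] z \<longleftrightarrow> z = v"
  by (auto elim: walk.cases intro: walk.intros)

lemma walk_Cons_iff:
  assumes "v \<notin> L"
  shows "walk L ord E v (d # ds) z \<longleftrightarrow>
    (if edge v d \<in> E then walk L ord (E - {edge v d}) (shift v d) (ord (shift v d) (opposite d)) z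
     else walk L ord E v ds z)"
  using assms by (auto elim: walk.cases intro: walk.intros)

definition walk_sum :: "dual_site set \<Rightarrow> (dual_site \<Rightarrow> dir \<Rightarrow> dir list) \<Rightarrow> real \<Rightarrow> dual_site \<Rightarrow> dual_site set \<Rightarrow>
    dual_site set set \<Rightarrow> dual_site \<Rightarrow> dir list \<Rightarrow> real" where
  "walk_sum L ord t w Z U v ds =
     (\<Sum>E | E \<subseteq> U \<and> boundary E = sdiff {v} {w} \<and> (\<exists>z\<in>Z. walk L ord E v ds z). \<Prod>e\<in>E. t)"

lemma walk_sum_le: "finite U \<Longrightarrow> t \<ge> 0 \<Longrightarrow> walk_sum L ord t w Z U v ds \<le> subgraph_sum (\<lambda>_. t) U (sdiff {v} {w})"
  unfolding walk_sum_def subgraph_sum_def by (rule sum_mono2) auto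

lemma walk_sum_skip:
  assumes "v \<notin> L" "edge v d \<notin> U"
  shows "walk_sum L ord t w Z U v (d # ds) = walk_sum L ord t w Z U v ds"
  unfolding walk_sum_def
  by (rule sum.cong) (use assms in \<open>auto simp: walk_Cons_iff split: if_splits\<close>)

lemma walk_sum_take:
  assumes "finite U" "v \<notin> L" "edge v d \<in> U"
  defines "U' \<equiv> U - {edge v d}"
  shows "walk_sum L ord t w Z U v (d # ds) =
    walk_sum L ord t w Z U' v ds + t * walk_sum L ord t w Z U' (shift v d) (ord (shift v d) (opposite d))"
proof -
  let ?e = "edge v d"
  have U: "U = insert ?e U'" "finite U'" "?e \<notin> U'" using assms by auto
  have 1: "{E. E \<subseteq> U' \<and> boundary E = sdiff {v} {w} \<and> (\<exists>z\<in>Z. walk L ord E v (d # ds) z)} =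
     {E. E \<subseteq> U' \<and> boundary E = sdiff {v} {w} \<and> (\<exists>z\<in>Z. walk L ord E v ds z)}"
    using U(3) assms(2) by (auto simp: walk_Cons_iff split: if_splits)
  have "insert ?e E - {?e} = E" if "E \<subseteq> U'" for E using that U(3) by auto
  then have 2: "{E. E \<subseteq> U' \<and> boundary E = sdiff (sdiff {v} {w}) ?e \<and> (\<exists>z\<in>Z. walk L ord (insert ?e E) v (d # ds) z)} =
     {E. E \<subseteq> U' \<and> boundary E = sdiff {shift v d} {w} \<and> (\<exists>z\<in>Z. walk L ord E (shift v d) (ord (shift v d) (opposite d)) z)}"
    unfolding sdiff_edge using assms(2) by (auto simp: walk_Cons_iff simp del: insert_Diff_single)
  show ?thesis
    unfolding walk_sum_def U(1) sum_subgraphs_insert[OF U(2,3)] 1 2 ..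
qed

definition mirror :: "dual_site \<Rightarrow> dual_site" where
  "mirror p = (fst p, - 2 - snd p)"

definition row_below :: "dual_site set" where
  "row_below = {p. snd p = -1}"

text \<open>Both sides obey the same recursion when an edge is revealed, so only the ends of the
  exploration matter: a walk that gets stuck off the row contributes nothing, and on the row the
  reflection applies. It still applies there because a deleted edge contains a site above the row
  and so is never the mirror image of an edge that reaches above the row: the lower half stays
  intact.\<close>

lemma walk_sum_touch_le:
  assumes "finite V" "\<And>e. e \<in> U \<Longrightarrow> \<exists>v d. e = edge v d" "\<And>e. e \<in> U \<Longrightarrow> e \<subseteq> V"
    and "\<And>e. e \<in> U \<Longrightarrow> \<exists>p\<in>e. snd p \<ge> 0 \<Longrightarrow> mirror ` e \<in> U"
    and "v \<in> V" "snd v \<ge> -1" "w \<in> V" "snd w \<ge> 0" "\<And>p. p \<in> V \<Longrightarrow> snd p \<ge> 0 \<Longrightarrow> mirror p \<in> V"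
    and t: "0 \<le> t" "t \<le> 1"
  shows "walk_sum row_below ord t w row_below U v ds \<le> subgraph_sum (\<lambda>_. t) U (sdiff {v} {mirror w})"
proof -
  have "finite U" using assms(1,3) by (meson Pow_iff finite_Pow_iff finite_subset subsetI)
  then show ?thesis using assms(2-6)
  \<comment> \<open>A direction whose edge is not in \<open>U\<close> shortens the list and leaves
    \<open>U\<close> as it is, hence the lexicographic order.\<close>
  proof (induction "(card U, length ds)" arbitrary: U v ds rule: wf_induct_rule[OF wf_lex_prod[OF wf_less_than wf_less_than]])
    case (1 U ds v)
    note prems = 1(2-)
    note IH = 1(1)
    show ?case
    proof (cases "v \<in> row_below")
      case True
      have "walk_sum row_below ord t w row_below U v ds \<le> subgraph_sum (\<lambda>_. t) U (sdiff {v} {w})"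
        using prems t by (intro walk_sum_le)
      also have "\<dots> \<le> subgraph_sum (\<lambda>_. t) U (sdiff {v} {mirror w})"
      \<comment> \<open>The row itself, with \<open>v\<close> on it, belongs to the lower part
        \<open>W\<close>, and \<open>w\<close> lies in the upper part \<open>P\<close>.\<close>
      proof (rule reflection_inequality[where V = V and W = "{p \<in> V. snd p \<le> -1}" and P = "{p \<in> V. snd p \<ge> 0}"])
        fix e assume e: "e \<in> U" "\<not> e \<subseteq> {p \<in> V. snd p \<le> - 1}"
        obtain p where p: "p \<in> e" "snd p \<ge> 0" using e prems(3)[OF e(1)] by force
        obtain a d where ad: "e = edge a d" using prems(2) e by blast
        have "\<forall>x\<in>e. snd x \<ge> -1"
          using p unfolding ad edge_def by (cases a; cases d) auto
        then have "\<forall>x\<in>e. x \<in> {p \<in> V. 0 \<le> snd p} \<or> mirror x = x"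
          using prems(3)[OF e(1)] by (fastforce simp: mirror_def prod_eq_iff)
        then show "(\<forall>x\<in>e. x \<in> {p \<in> V. 0 \<le> snd p} \<or> mirror x = x) \<and> mirror ` e \<in> U"
          using prems(4)[OF e(1)] p by auto
      qed (use assms(1,7-9) prems True t in \<open>auto simp: row_below_def mirror_def\<close>)
      finally show ?thesis .
    next
      case False
      then have v0: "snd v \<ge> 0" using prems by (simp add: row_below_def)
      show ?thesis
      proof (cases ds)
        case Nil
        have "walk_sum row_below ord t w row_below U v ds = 0"
          unfolding walk_sum_def Nil walk_Nil_iff using False by auto
        then show ?thesis using t subgraph_sum_nonneg[of U "\<lambda>_. t"] by simp
      next
        case (Cons d ds')
        show ?thesis
        proof (cases "edge v d \<in> U")
          case no: False
          have "walk_sum row_below ord t w row_below U v ds' \<le> subgraph_sum (\<lambda>_. t) U (sdiff {v} {mirror w})"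
            by (rule IH) (use prems Cons in auto)
          then show ?thesis by (simp add: Cons walk_sum_skip[OF False no])
        next
          case yes: True
          let ?U = "U - {edge v d}"
          have less: "card ?U < card U" using prems(1) yes by (rule card_Diff1_less)
          have mir: "mirror ` e \<in> ?U" if e: "e \<in> ?U" "\<exists>p\<in>e. snd p \<ge> 0" for e
          proof -
            obtain a d' where ad: "e = edge a d'" using prems(2) e by blast
            have "\<forall>x\<in>e. snd x \<ge> -1"
              using e(2) unfolding ad edge_def by (cases a; cases d') auto
            then have "\<forall>x\<in>mirror ` e. snd x \<le> -1" by (auto simp: mirror_def)
            moreover have "v \<in> edge v d" by (simp add: edge_def)
            ultimately have "mirror ` e \<noteq> edge v d" using v0 by fastforce
            then show ?thesis using e prems(4) by auto
          qed
          have vV: "shift v d \<in> V" using prems(3)[OF yes] by (auto simp: edge_def)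
          have sv: "snd (shift v d) \<ge> -1" using v0 by (cases v; cases d) auto
          have "walk_sum row_below ord t w row_below ?U v ds' \<le> subgraph_sum (\<lambda>_. t) ?U (sdiff {v} {mirror w})"
            by (rule IH) (use prems less mir in auto)
          moreover have "walk_sum row_below ord t w row_below ?U (shift v d) (ord (shift v d) (opposite d))
              \<le> subgraph_sum (\<lambda>_. t) ?U (sdiff {shift v d} {mirror w})"
            by (rule IH) (use prems less mir vV sv in auto)
          ultimately have "walk_sum row_below ord t w row_below U v ds \<le>
              subgraph_sum (\<lambda>_. t) ?U (sdiff {v} {mirror w}) + t * subgraph_sum (\<lambda>_. t) ?U (sdiff {shift v d} {mirror w})"
            unfolding Cons walk_sum_take[OF prems(1) False yes] using t by (intro add_mono mult_left_mono) auto
          also have "\<dots> = subgraph_sum (\<lambda>_. t) (insert (edge v d) ?U) (sdiff {v} {mirror w})"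
            using prems(1) by (subst subgraph_sum_insert) (auto simp: sdiff_edge)
          also have "insert (edge v d) ?U = U" using yes by auto
          finally show ?thesis .
        qed
      qed
    qed
  qed
qed

text \<open>In cross-multiplied form: the weight of the walks that reach \<open>w\<close>, relative
  to the full graph, is at most the two-point function of the upper half. Induction along the
  exploration. An edge of the upper half is compensated by the monotonicity of edge correlations,
  and an edge down to the row leads only to walks that are not counted.\<close>

lemma walk_sum_avoid_le:
  assumes "finite U" "\<And>e. e \<in> U \<Longrightarrow> finite e"
    and "snd v \<ge> -1" "snd w \<ge> 0" and t: "0 \<le> t" "t \<le> 1"
  defines "up \<equiv> \<lambda>U :: dual_site set set. {e \<in> U. \<forall>p\<in>e. snd p \<ge> 0}"
  shows "walk_sum row_below ord t w {w} U v ds * subgraph_sum (\<lambda>_. t) (up U) {}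
    \<le> subgraph_sum (\<lambda>_. t) (up U) (sdiff {v} {w}) * subgraph_sum (\<lambda>_. t) U {}"
  using assms(1-3)
proof (induction "(card U, length ds)" arbitrary: U v ds rule: wf_induct_rule[OF wf_lex_prod[OF wf_less_than wf_less_than]])
  case (1 U ds v)
  note prems = 1(2-)
  note IH = 1(1)
  let ?Z = "\<lambda>U :: dual_site set set. subgraph_sum (\<lambda>_. t) U"
  let ?N = "walk_sum row_below ord t w {w}"
  have nn: "?Z U B \<ge> 0" for U B using t by (intro subgraph_sum_nonneg) auto
  show ?case
  proof (cases "v \<in> row_below")
    case True
    have "v \<noteq> w" using True assms(4) by (auto simp: row_below_def)
    then have "?N U v ds = 0" unfolding walk_sum_def by (simp add: walk_hit_iff[OF True])
    then show ?thesis using nn by (simp add: mult_nonneg_nonneg)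
  next
    case False
    then have v0: "snd v \<ge> 0" using prems by (simp add: row_below_def)
    show ?thesis
    proof (cases ds)
      case Nil
      show ?thesis
      proof (cases "v = w")
        case True
        then have "?N U v ds = ?Z U {}" by (simp add: Nil walk_sum_def walk_Nil_iff subgraph_sum_def)
        then show ?thesis using True by simp
      next
        case False
        then have "?N U v ds = 0" by (simp add: Nil walk_sum_def walk_Nil_iff)
        then show ?thesis using nn by (simp add: mult_nonneg_nonneg)
      qed
    next
      case (Cons d ds')
      show ?thesis
      proof (cases "edge v d \<in> U")
        case no: False
        have "?N U v ds' * ?Z (up U) {} \<le> ?Z (up U) (sdiff {v} {w}) * ?Z U {}"
          by (rule IH) (use prems Cons in auto)
        then show ?thesis by (simp add: Cons walk_sum_skip[OF False no])
      next
        case yes: True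
        let ?e = "edge v d"
        let ?U = "U - {?e}"
        have less: "card ?U < card U" using prems(1) yes by (rule card_Diff1_less)
        have sv: "snd (shift v d) \<ge> -1" using v0 by (cases v; cases d) auto
        have IH1: "?N ?U v ds' * ?Z (up ?U) {} \<le> ?Z (up ?U) (sdiff {v} {w}) * ?Z ?U {}"
          by (rule IH) (use prems less in auto)
        have IH2: "?N ?U (shift v d) (ord (shift v d) (opposite d)) * ?Z (up ?U) {} \<le> ?Z (up ?U) (sdiff {shift v d} {w}) * ?Z ?U {}"
          by (rule IH) (use prems less sv in auto)
        have N: "?N U v ds = ?N ?U v ds' + t * ?N ?U (shift v d) (ord (shift v d) (opposite d))"
          unfolding Cons by (rule walk_sum_take[OF prems(1) False yes])
        have fin: "finite ?U" "finite (up ?U)" "up ?U \<subseteq> ?U" using prems by (auto simp: up_def)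
        have U_eq: "insert ?e ?U = U" using yes by auto
        have ZU: "?Z U {} = ?Z ?U {} + t * ?Z ?U ?e"
          using subgraph_sum_insert[OF fin(1), of ?e "\<lambda>_. t" "{}"] U_eq by simp
        have pos: "?Z (up ?U) {} > 0" "?Z ?U {} > 0"
          using subgraph_sum_pos[OF fin(2), of "\<lambda>_. t"] subgraph_sum_pos[OF fin(1), of "\<lambda>_. t"] t by auto
        show ?thesis
        proof (cases "snd (shift v d) \<ge> 0")
          case True
          have upU: "up U = insert ?e (up ?U)" "?e \<notin> up ?U"
            using True v0 yes by (auto simp: up_def edge_def)
          have Zup: "?Z (up U) B = ?Z (up ?U) B + t * ?Z (up ?U) (sdiff B ?e)" for B
            unfolding upU(1) by (rule subgraph_sum_insert[OF fin(2) upU(2)])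
          \<comment> \<open>The edge correlation is larger in the larger graph, so adding the edge
            multiplies the full partition function by at least the factor it gives for the upper
            half.\<close>
          have "?Z (up ?U) ?e / ?Z (up ?U) {} \<le> ?Z ?U ?e / ?Z ?U {}"
            using fin prems t by (intro subgraph_sum_ratio_mono) auto
          then have "?Z ?U {} * ?Z (up ?U) ?e \<le> ?Z ?U ?e * ?Z (up ?U) {}"
            using pos by (simp add: field_simps)
          then have ZZ: "?Z ?U {} * ?Z (up U) {} \<le> ?Z U {} * ?Z (up ?U) {}"
            using t by (simp add: Zup ZU algebra_simps mult_left_mono)
          have "?N U v ds * ?Z (up ?U) {} \<le> ?Z (up U) (sdiff {v} {w}) * ?Z ?U {}"
            using IH1 mult_left_mono[OF IH2 t(1)] by (simp add: N Zup sdiff_edge algebra_simps)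
          then have "(?N U v ds * ?Z (up ?U) {}) * ?Z (up U) {} \<le> (?Z (up U) (sdiff {v} {w}) * ?Z ?U {}) * ?Z (up U) {}"
            using nn by (rule mult_right_mono)
          also have "\<dots> \<le> ?Z (up U) (sdiff {v} {w}) * (?Z U {} * ?Z (up ?U) {})"
            using mult_left_mono[OF ZZ nn] by (simp add: mult.assoc)
          finally have "?Z (up ?U) {} * (?N U v ds * ?Z (up U) {}) \<le> ?Z (up ?U) {} * (?Z (up U) (sdiff {v} {w}) * ?Z U {})"
            by (simp add: mult_ac)
          then show ?thesis using pos(1) by (simp only: mult_le_cancel_left_pos)
        next
          case below: False
          then have row: "shift v d \<in> row_below" using sv by (simp add: row_below_def)
          have "shift v d \<noteq> w" using below assms(4) by auto
          then have "?N ?U (shift v d) (ord (shift v d) (opposite d)) = 0"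
            unfolding walk_sum_def by (simp add: walk_hit_iff[OF row])
          then have N': "?N U v ds = ?N ?U v ds'" using N by simp
          have upU: "up U = up ?U" using below yes by (auto simp: up_def edge_def)
          have "?Z ?U {} \<le> ?Z U {}" using nn t by (simp add: ZU)
          then have "?Z (up ?U) (sdiff {v} {w}) * ?Z ?U {} \<le> ?Z (up ?U) (sdiff {v} {w}) * ?Z U {}"
            using nn by (rule mult_left_mono)
          with IH1 show ?thesis unfolding N' upU by linarith
        qed
      qed
    qed
  qed
qed

section \<open>The open contour\<close>

fun partner :: "dir \<Rightarrow> dir" where
  "partner North = East" | "partner East = North" | "partner South = West" | "partner West = South"

lemma UNIV_dir: "UNIV = {North, East, South, West}"
  using dir.exhaust by auto

instance dir :: finite
  by standard (simp add: UNIV_dir)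

lemma card_UNIV_dir: "card (UNIV :: dir set) = 4"
  by (simp add: UNIV_dir)

lemma edge_inject [simp]: "edge v d = edge v d' \<longleftrightarrow> d = d'"
  by (cases v; cases d; cases d') (auto simp: edge_def doubleton_eq_iff)

lemma mem_edge: "v \<in> edge a d \<Longrightarrow> \<exists>d'. edge a d = edge v d'"
  by (metis edge_def edge_opposite insertE singletonD)

lemma compass_edges: "north_edge v = edge v North" "east_edge v = edge v East"
  "south_edge v = edge v South" "west_edge v = edge v West"
  by (cases v; simp add: edge_def)+

lemma joined_commute: "joined E v f g \<Longrightarrow> joined E v g f"
  by (auto simp: joined_def insert_commute)

text \<open>
  The contour of an interface between \<open>u\<close> and \<open>w\<close>: the missing edges West of \<open>u\<close> and East of
  \<open>w\<close> are the ones that cross edges between frozen sites. The last assumption replaces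
  finiteness: every line stays in a finite part of \<open>E\<close>.
\<close>

locale interface_graph =
  fixes E :: "dual_site set set" and u w :: dual_site
  assumes edges: "\<And>e. e \<in> E \<Longrightarrow> \<exists>v d. e = edge v d"
    and parity: "\<And>v. even (card {e \<in> E. v \<in> e}) \<longleftrightarrow> v \<noteq> u \<and> v \<noteq> w"
    and uw: "u \<noteq> w" and no_west: "edge u West \<notin> E" and no_east: "edge w East \<notin> E"
    and confined: "\<And>f. f \<in> E \<Longrightarrow>
      \<exists>F. finite F \<and> f \<in> F \<and> F \<subseteq> E \<and> (\<forall>g\<in>F. \<forall>h\<in>E. g \<inter> h \<noteq> {} \<longrightarrow> h \<in> F)"
begin

definition dirs :: "dual_site \<Rightarrow> dir set" where
  "dirs v = {d. edge v d \<in> E}"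

lemma incident: "{e \<in> E. v \<in> e} = edge v ` dirs v"
proof (intro set_eqI iffI)
  fix e assume e: "e \<in> {e \<in> E. v \<in> e}"
  then obtain a d where "e = edge a d" using edges by blast
  then obtain d' where "e = edge v d'" using mem_edge e by blast
  then show "e \<in> edge v ` dirs v" using e by (auto simp: dirs_def)
qed (auto simp: dirs_def edge_def)

lemma card_incident: "card {e \<in> E. v \<in> e} = card (dirs v)"
  unfolding incident by (rule card_image) (auto simp: inj_on_def)

lemma even_dirs: "even (card (dirs v)) \<longleftrightarrow> v \<noteq> u \<and> v \<noteq> w"
  using parity[of v] by (simp add: card_incident)

lemma joined_iff:
  "joined E v (edge v d) (edge v d') \<longleftrightarrow>
     d \<in> dirs v \<and> d' \<in> dirs v \<and> d \<noteq> d' \<and> (card (dirs v) \<ge> 3 \<longrightarrow> d' = partner d)"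
  unfolding joined_def card_incident compass_edges doubleton_eq_iff edge_inject
  by (cases d; cases d') (auto simp: dirs_def edge_def)

lemma joinedE:
  assumes "joined E v f g"
  obtains d d' where "f = edge v d" "g = edge v d'" "d \<in> dirs v" "d' \<in> dirs v" "d \<noteq> d'"
    "card (dirs v) \<ge> 3 \<longrightarrow> d' = partner d"
proof -
  have "f \<in> {e \<in> E. v \<in> e}" "g \<in> {e \<in> E. v \<in> e}" using assms by (auto simp: joined_def)
  then obtain d d' where "f = edge v d" "g = edge v d'" unfolding incident by blast
  then show ?thesis using that assms joined_iff by blast
qed

text \<open>Two different continuations at \<open>v\<close> would force degree at least 3, where the
  rule leaves only the partner. So a line goes on in at most one way at either end, and contours are
  paths or cycles.\<close>

lemma joined_unique:
  assumes "joined E v f g" "joined E v f g'"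
  shows "g = g'"
proof -
  obtain d d1 where 1: "f = edge v d" "g = edge v d1" "d \<in> dirs v" "d1 \<in> dirs v" "d \<noteq> d1"
    "card (dirs v) \<ge> 3 \<longrightarrow> d1 = partner d" using assms(1) by (rule joinedE)
  obtain d' d2 where 2: "f = edge v d'" "g' = edge v d2" "d' \<in> dirs v" "d2 \<in> dirs v" "d' \<noteq> d2"
    "card (dirs v) \<ge> 3 \<longrightarrow> d2 = partner d'" using assms(2) by (rule joinedE)
  have "d1 = d2"
  proof (rule ccontr)
    assume "d1 \<noteq> d2"
    then have "card {d, d1, d2} = 3" using 1 2 by simp
    moreover have "card {d, d1, d2} \<le> card (dirs v)" using 1 2 by (intro card_mono) auto
    ultimately show False using 1 2 \<open>d1 \<noteq> d2\<close> by simp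
  qed
  then show ?thesis using 1 2 by simp
qed

text \<open>By parity \<open>u\<close> has one or three edges. With three, South is the one that the
  rule would join to the missing West edge, so a line ends there; with one, the choice is
  forced.\<close>

definition first_dir :: dir where
  "first_dir = (if South \<in> dirs u then South else if North \<in> dirs u then North else East)"

definition last_dir :: dir where
  "last_dir = (if North \<in> dirs w then North else if South \<in> dirs w then South else West)"

lemma card_dirs_full: "card (dirs v) = 4 \<Longrightarrow> d \<in> dirs v"
  using card_subset_eq[of UNIV "dirs v"] by (auto simp: card_UNIV_dir)

lemma card_dirs_le: "card (dirs v) \<le> 4"
  using card_mono[of UNIV "dirs v"] by (simp add: card_UNIV_dir)

lemma dirs_3:
  assumes "card (dirs v) \<ge> 3" "x \<notin> dirs v"
  shows "dirs v = UNIV - {x}"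
proof (rule card_subset_eq)
  show "card (dirs v) = card (UNIV - {x})"
  proof -
    have "card (dirs v) \<le> card (UNIV - {x})" using assms by (intro card_mono) auto
    moreover have "card (UNIV - {x}) = 3" by (cases x) (auto simp: UNIV_dir)
    ultimately show ?thesis using assms by simp
  qed
qed (use assms in auto)

lemma dirs_1: "card (dirs v) < 3 \<Longrightarrow> odd (card (dirs v)) \<Longrightarrow> d \<in> dirs v \<Longrightarrow> d' \<in> dirs v \<Longrightarrow> d = d'"
proof -
  assume a: "card (dirs v) < 3" "odd (card (dirs v))" "d \<in> dirs v" "d' \<in> dirs v"
  then have "card (dirs v) = 1" by presburger
  then show "d = d'" using a by (auto simp: card_1_singleton_iff)
qed

lemma first_dir_mem: "first_dir \<in> dirs u"
proof -
  have "dirs u \<noteq> {}" using even_dirs[of u] by auto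
  then obtain d where "d \<in> dirs u" by auto
  then show ?thesis using no_west by (cases d) (auto simp: first_dir_def dirs_def)
qed

lemma last_dir_mem: "last_dir \<in> dirs w"
proof -
  have "dirs w \<noteq> {}" using even_dirs[of w] by auto
  then obtain d where "d \<in> dirs w" by auto
  then show ?thesis using no_east by (cases d) (auto simp: last_dir_def dirs_def)
qed

lemma not_joined_first: "\<not> joined E u (edge u first_dir) g"
proof
  assume "joined E u (edge u first_dir) g"
  then obtain d d' where j: "edge u first_dir = edge u d" "g = edge u d'" "d \<in> dirs u" "d' \<in> dirs u" "d \<noteq> d'"
    "card (dirs u) \<ge> 3 \<longrightarrow> d' = partner d" by (rule joinedE)
  have odd: "odd (card (dirs u))" using even_dirs[of u] by simp
  show False
  proof (cases "card (dirs u) \<ge> 3")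
    case True
    have "West \<notin> dirs u" using no_west by (simp add: dirs_def)
    then have eq: "dirs u = UNIV - {West}" by (rule dirs_3[OF True])
    then have "first_dir = South" by (simp add: first_dir_def)
    then show False using True j eq by simp
  next
    case False
    then show False using dirs_1[of u d d'] odd j(3-5) by simp
  qed
qed

lemma not_joined_last: "\<not> joined E w (edge w last_dir) g"
proof
  assume "joined E w (edge w last_dir) g"
  then obtain d d' where j: "edge w last_dir = edge w d" "g = edge w d'" "d \<in> dirs w" "d' \<in> dirs w" "d \<noteq> d'"
    "card (dirs w) \<ge> 3 \<longrightarrow> d' = partner d" by (rule joinedE)
  have odd: "odd (card (dirs w))" using even_dirs[of w] by simp
  show False
  proof (cases "card (dirs w) \<ge> 3")
    case True
    have "East \<notin> dirs w" using no_east by (simp add: dirs_def)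
    then have eq: "dirs w = UNIV - {East}" by (rule dirs_3[OF True])
    then have "last_dir = North" by (simp add: last_dir_def)
    then show False using True j eq by simp
  next
    case False
    then show False using dirs_1[of w d d'] odd j(3-5) by simp
  qed
qed

text \<open>Away from \<open>u\<close> and \<open>w\<close> an even degree supplies a second edge,
  and the partner if four edges meet. At \<open>u\<close> and \<open>w\<close>, three edges leave
  exactly one unpaired, the one named by \<open>first_dir\<close> or
  \<open>last_dir\<close>.\<close>

lemma joined_exists:
  assumes "d \<in> dirs v" "\<not> (v = u \<and> d = first_dir)" "\<not> (v = w \<and> d = last_dir)"
  shows "\<exists>d'. joined E v (edge v d) (edge v d')"
proof (cases "card (dirs v) \<ge> 3")
  case True
  have "partner d \<in> dirs v"
  proof (cases "v = u \<or> v = w")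
    case False
    then have "even (card (dirs v))" using even_dirs by auto
    then have "card (dirs v) = 4" using True card_dirs_le[of v] by presburger
    then show ?thesis by (rule card_dirs_full)
  next
    case uw: True
    have "West \<notin> dirs u" "East \<notin> dirs w" using no_west no_east by (auto simp: dirs_def)
    then have "dirs v = UNIV - {if v = u then West else East}"
      using dirs_3[OF True] uw by auto
    then show ?thesis
      using assms uw by (cases d) (auto simp: first_dir_def last_dir_def split: if_splits)
  qed
  moreover have "partner d \<noteq> d" by (cases d) auto
  ultimately have "joined E v (edge v d) (edge v (partner d))" using assms unfolding joined_iff by auto
  then show ?thesis ..
next
  case False
  have "\<exists>d'\<in>dirs v. d' \<noteq> d"
  proof (rule ccontr)
    assume "\<not> ?thesis"
    then have eq: "dirs v = {d}" using assms(1) by blast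
    then have "v = u \<or> v = w" using even_dirs[of v] by auto
    then show False using first_dir_mem last_dir_mem eq assms by auto
  qed
  then show ?thesis using assms False unfolding joined_iff by auto
qed

section \<open>Contours as paths of joined edges\<close>

definition line_rel :: "(dual_site set \<times> dual_site set) set" where
  "line_rel = {(f, g). \<exists>v. joined E v f g}"

lemma line_rel_sym: "(f, g) \<in> line_rel\<^sup>* \<Longrightarrow> (g, f) \<in> line_rel\<^sup>*"
proof -
  have "sym line_rel" by (auto simp: line_rel_def sym_def dest: joined_commute)
  then show "(f, g) \<in> line_rel\<^sup>* \<Longrightarrow> (g, f) \<in> line_rel\<^sup>*" using sym_rtrancl symD by metis
qed

definition step_edge :: "(nat \<Rightarrow> dual_site) \<Rightarrow> nat \<Rightarrow> dual_site set" where
  "step_edge p i = {p i, p (Suc i)}"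

text \<open>Edges are distinct, but a site may occur twice: two strands of one line can touch where
  the rule separates them.\<close>

definition line_path :: "(nat \<Rightarrow> dual_site) \<Rightarrow> nat \<Rightarrow> bool" where
  "line_path p k \<longleftrightarrow> k > 0 \<and> (\<forall>i<k. step_edge p i \<in> E) \<and>
     (\<forall>i. Suc i < k \<longrightarrow> joined E (p (Suc i)) (step_edge p i) (step_edge p (Suc i))) \<and>
     inj_on (step_edge p) {..<k}"

lemma not_singleton: "{x} \<notin> E"
  using edges[of "{x}"] by (auto simp: edge_def)

lemma line_path_neq: "line_path p k \<Longrightarrow> i < k \<Longrightarrow> p i \<noteq> p (Suc i)"
  using not_singleton[of "p i"] unfolding line_path_def step_edge_def by (metis insert_absorb2)

lemma line_path_connected:
  assumes "line_path p k" "i < k"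
  shows "(step_edge p 0, step_edge p i) \<in> line_rel\<^sup>*"
  using assms(2)
proof (induction i)
  case (Suc i)
  then have "joined E (p (Suc i)) (step_edge p i) (step_edge p (Suc i))"
    using assms(1) by (simp add: line_path_def)
  then have "(step_edge p i, step_edge p (Suc i)) \<in> line_rel"
    unfolding line_rel_def by blast
  moreover have "(step_edge p 0, step_edge p i) \<in> line_rel\<^sup>*" using Suc by simp
  ultimately show ?case by (rule rtrancl_into_rtrancl[rotated])
qed simp

text \<open>An edge inside the path has its unique continuations at both ends within the path. The
  only old edge that can follow is therefore the first one, met at its free end, and then the path
  has closed up.\<close>

lemma line_path_fresh:
  assumes p: "line_path p k" and j: "joined E (p k) (step_edge p (k - 1)) g" and g: "g \<in> step_edge p ` {..<k}"
  shows "g = step_edge p 0 \<and> p k = p 0"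
proof -
  obtain i where i: "i < k" "g = step_edge p i" using g by auto
  have k: "k > 0" using p by (simp add: line_path_def)
  have neq: "step_edge p (k - 1) \<noteq> g" and mem: "p k \<in> g" using j by (auto simp: joined_def)
  have inj: "a < k \<Longrightarrow> b < k \<Longrightarrow> step_edge p a = step_edge p b \<Longrightarrow> a = b" for a b
    using p by (auto simp: line_path_def inj_on_def)
  have j': "joined E (p k) g (step_edge p (k - 1))" using j by (rule joined_commute)
  have chain: "joined E (p (Suc a)) (step_edge p a) (step_edge p (Suc a))" if "Suc a < k" for a
    using p that by (auto simp: line_path_def)
  consider "p k = p (Suc i)" | "p k = p i" using mem i(2) by (auto simp: step_edge_def)
  then show ?thesis
  proof cases
    case 1
    have "Suc i < k" using i neq by (metis Suc_lessI diff_Suc_1)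
    then have "step_edge p (Suc i) = step_edge p (k - 1)"
      using joined_unique[of "p k" g] j' chain[of i] 1 i by simp
    then have "Suc i = k - 1" using inj[of "Suc i" "k - 1"] \<open>Suc i < k\<close> by simp
    then have "p (k - 1) = p (Suc (k - 1))" using 1 k by simp
    then show ?thesis using line_path_neq[OF p, of "k - 1"] k by simp
  next
    case 2
    show ?thesis
    proof (cases i)
      case 0
      then show ?thesis using 2 i by simp
    next
      case (Suc a)
      then have "joined E (p k) g (step_edge p a)"
        using chain[of a] i 2 by (auto dest: joined_commute)
      then have "step_edge p a = step_edge p (k - 1)" using joined_unique j' by blast
      then have "a = k - 1" using inj[of a "k - 1"] i Suc by simp
      then show ?thesis using i Suc by simp
    qed
  qed
qed

lemma line_path_extend:
  assumes p: "line_path p k" and j: "joined E (p k) (step_edge p (k - 1)) (edge (p k) d)"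
    and new: "edge (p k) d \<notin> step_edge p ` {..<k}"
  defines "q \<equiv> p(Suc k := shift (p k) d)"
  shows "line_path q (Suc k)" "step_edge q ` {..<Suc k} = insert (edge (p k) d) (step_edge p ` {..<k})"
    "\<And>i. i \<le> k \<Longrightarrow> q i = p i"
proof -
  have k: "k > 0" using p by (simp add: line_path_def)
  have old: "step_edge q i = step_edge p i" if "i < k" for i using that by (simp add: step_edge_def q_def)
  have last: "step_edge q k = edge (p k) d" by (simp add: step_edge_def q_def edge_def)
  have img: "step_edge q ` {..<k} = step_edge p ` {..<k}" using old by (intro image_cong) auto
  show "step_edge q ` {..<Suc k} = insert (edge (p k) d) (step_edge p ` {..<k})"
    using img last by (simp add: lessThan_Suc)
  show "\<And>i. i \<le> k \<Longrightarrow> q i = p i" by (simp add: q_def)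
  have "inj_on (step_edge q) {..<k}"
    using p old by (auto simp: line_path_def inj_on_def)
  then have "inj_on (step_edge q) {..<Suc k}"
    using new img last by (simp add: lessThan_Suc)
  moreover have "joined E (q (Suc i)) (step_edge q i) (step_edge q (Suc i))" if "Suc i < Suc k" for i
  proof (cases "Suc i < k")
    case True
    then show ?thesis using p old by (simp add: line_path_def q_def)
  next
    case False
    then have "Suc i = k" using that by simp
    then show ?thesis using j last old[of i] by (auto simp: q_def)
  qed
  moreover have "step_edge q i \<in> E" if "i < Suc k" for i
    using that p old last j by (cases "i = k") (auto simp: line_path_def joined_def)
  ultimately show "line_path q (Suc k)" by (simp add: line_path_def)
qed

text \<open>A path whose ends have no continuation outside it is closed under joining, hence a whole
  contour. This covers the interface, whose ends do not continue at all, and loops, whose ends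
  continue into each other.\<close>

lemma line_path_class:
  assumes p: "line_path p k"
    and ends: "\<And>h. joined E (p 0) (step_edge p 0) h \<Longrightarrow> h \<in> step_edge p ` {..<k}"
      "\<And>h. joined E (p k) (step_edge p (k - 1)) h \<Longrightarrow> h \<in> step_edge p ` {..<k}"
    and f: "f \<in> step_edge p ` {..<k}"
  shows "line_rel\<^sup>* `` {f} = step_edge p ` {..<k}"
proof (intro set_eqI iffI)
  fix h assume "h \<in> step_edge p ` {..<k}"
  then have "(step_edge p 0, h) \<in> line_rel\<^sup>*" "(step_edge p 0, f) \<in> line_rel\<^sup>*"
    using f line_path_connected[OF p] by auto
  then show "h \<in> line_rel\<^sup>* `` {f}" by (auto dest: line_rel_sym)
next
  fix h assume "h \<in> line_rel\<^sup>* `` {f}"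
  then have "(f, h) \<in> line_rel\<^sup>*" by simp
  then show "h \<in> step_edge p ` {..<k}"
  proof (induction rule: rtrancl_induct)
    case (step y z)
    then obtain i where i: "i < k" "y = step_edge p i" by auto
    obtain v where v: "joined E v y z" using step(2) by (auto simp: line_rel_def)
    have "v \<in> y" using v by (simp add: joined_def)
    then consider "v = p i" | "v = p (Suc i)" using i by (auto simp: step_edge_def)
    then show ?case
    proof cases
      case 1
      show ?thesis
      proof (cases i)
        case (Suc a)
        then have "joined E v y (step_edge p a)" using p i 1 by (auto simp: line_path_def dest: joined_commute)
        then show ?thesis using joined_unique v i Suc by fastforce
      qed (use ends(1) v 1 i in auto)
    next
      case 2
      show ?thesis
      proof (cases "Suc i = k")
        case True
        then show ?thesis using ends(2) v 2 i by auto
      next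
        case False
        then have "joined E v y (step_edge p (Suc i))" using p i 2 by (auto simp: line_path_def)
        then show ?thesis using joined_unique v i False by (metis Suc_lessI image_eqI lessThan_iff)
      qed
    qed
  qed (use f in simp)
qed

definition interface :: "dual_site set set" where
  "interface = line_rel\<^sup>* `` {edge u first_dir}"

text \<open>
  The rule followed by the interface when it enters a site through the edge in direction \<open>d\<close>.
  At \<open>w\<close> the North edge would be joined to the missing East edge.
\<close>

fun turn_order :: "dir \<Rightarrow> dir list" where
  "turn_order North = [East, South, West]"
| "turn_order East = [North, South, West]"
| "turn_order South = [West, North, East]"
| "turn_order West = [South, North, East]"

definition next_dirs :: "dual_site \<Rightarrow> dir \<Rightarrow> dir list" where
  "next_dirs v d = (if v = w \<and> d = North then [] else turn_order d)"

lemma walk_skip_append: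
  assumes "v \<notin> L" "\<And>d. d \<in> set pre \<Longrightarrow> edge v d \<notin> F"
  shows "walk L ord F v (pre @ ds) z \<longleftrightarrow> walk L ord F v ds z"
  using assms(2) by (induction pre) (auto simp: walk_Cons_iff[OF assms(1)])

lemma walk_all_skip:
  assumes "v \<notin> L" "\<And>d. d \<in> set ds \<Longrightarrow> edge v d \<notin> F"
  shows "walk L ord F v ds z \<longleftrightarrow> z = v"
  using walk_skip_append[OF assms, where ds = "[]"] by (simp add: walk_Nil_iff)

lemma walk_choose:
  assumes "v \<notin> L" "edge v d \<in> F" "d \<in> set ds"
    "hd ds = d \<or> (\<forall>x\<in>set ds. edge v x \<in> F \<longrightarrow> x = d)"
  shows "walk L ord F v ds z \<longleftrightarrow> walk L ord (F - {edge v d}) (shift v d) (ord (shift v d) (opposite d)) z"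
proof -
  obtain pre post where ds: "ds = pre @ d # post" "d \<notin> set pre" using assms(3) split_list_first by metis
  have "edge v x \<notin> F" if "x \<in> set pre" for x
  proof
    assume "edge v x \<in> F"
    then show False using assms(4) ds that by (cases pre) auto
  qed
  then show ?thesis using assms by (simp add: ds walk_skip_append walk_Cons_iff)
qed

lemma interface_walk_aux:
  assumes F: "finite F" "F \<subseteq> E" "\<And>g h. g \<in> F \<Longrightarrow> h \<in> E \<Longrightarrow> g \<inter> h \<noteq> {} \<Longrightarrow> h \<in> F"
    and p: "line_path p k" "p 0 = u" "step_edge p 0 = edge u first_dir" "step_edge p ` {..<k} \<subseteq> F"
      "\<And>i. i < k \<Longrightarrow> p i \<notin> L" "step_edge p (k - 1) = edge (p k) d"
  shows "\<exists>q m. line_path q m \<and> q 0 = u \<and> step_edge q 0 = edge u first_dir \<and> (\<forall>i<m. q i \<notin> L) \<and>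
    walk L next_dirs (F - step_edge p ` {..<k}) (p k) (next_dirs (p k) d) (q m) \<and>
    (q m \<in> L \<or> q m = w \<and> step_edge q (m - 1) = edge w last_dir)"
  using p
proof (induction "card (F - step_edge p ` {..<k})" arbitrary: p k d rule: less_induct)
  case less
  note p = less.prems
  let ?R = "F - step_edge p ` {..<k}"
  have k: "k > 0" using p(1) by (simp add: line_path_def)
  have "edge (p k) d \<in> F" using p(4,6) k by (metis diff_less image_subset_iff lessThan_iff zero_less_one)
  then have d: "d \<in> dirs (p k)" using F(2) by (auto simp: dirs_def)
  show ?case
  proof (cases "p k \<in> L")
    case True
    then show ?thesis using p by (intro exI[of _ p] exI[of _ k]) (auto intro: walk.intros)
  next
    case notL: False
    show ?thesis
    proof (cases "p k = w \<and> d = last_dir")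
      case True
      \<comment> \<open>The walk has to stop although edges at \<open>w\<close> may remain. If one
        remains, then \<open>w\<close> has degree 3 and was entered from the North, where the list
        of directions is empty by definition.\<close>
      have "edge w x \<notin> ?R" if "x \<in> set (next_dirs w d)" for x
      proof
        assume "edge w x \<in> ?R"
        then have x: "x \<in> dirs w" "edge w x \<in> F" "edge w x \<notin> step_edge p ` {..<k}" using F(2) by (auto simp: dirs_def)
        have "edge w d \<in> step_edge p ` {..<k}" using p(6) k True by (metis diff_less image_eqI lessThan_iff zero_less_one)
        then have "x \<noteq> d" using x by auto
        have "card (dirs w) \<ge> 3"
          using dirs_1[of w x d] d x \<open>x \<noteq> d\<close> True even_dirs[of w] by (metis not_le)
        moreover have "East \<notin> dirs w" using no_east by (simp add: dirs_def)
        ultimately have "dirs w = UNIV - {East}" by (rule dirs_3)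
        then have "d = North" using True by (simp add: last_dir_def)
        then show False using that by (simp add: next_dirs_def)
      qed
      then have "walk L next_dirs ?R w (next_dirs w d) w"
        using walk_all_skip[of w L "next_dirs w d" ?R] notL True by simp
      then show ?thesis using p True by (intro exI[of _ p] exI[of _ k]) auto
    next
      case notw: False
      have notu: "\<not> (p k = u \<and> d = first_dir)"
      proof
        assume a: "p k = u \<and> d = first_dir"
        then have "step_edge p (k - 1) = step_edge p 0" using p by simp
        moreover have "inj_on (step_edge p) {..<k}" using p(1) by (simp add: line_path_def)
        ultimately have "k - 1 = 0" using k by (elim inj_onD) auto
        then have "k = 1" using k by simp
        then show False using line_path_neq[OF p(1), of 0] a p(2) by simp
      qed
      obtain d' where j: "joined E (p k) (edge (p k) d) (edge (p k) d')"
        using joined_exists[OF d notu notw] by blast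
      have j': "joined E (p k) (step_edge p (k - 1)) (edge (p k) d')" using j p(6) by simp
      have d': "d' \<in> dirs (p k)" "d' \<noteq> d" "card (dirs (p k)) \<ge> 3 \<Longrightarrow> d' = partner d"
        using j unfolding joined_iff by auto
      have new: "edge (p k) d' \<notin> step_edge p ` {..<k}"
      proof
        assume "edge (p k) d' \<in> step_edge p ` {..<k}"
        from line_path_fresh[OF p(1) j' this] have "edge (p k) d' = step_edge p 0" and pk: "p k = p 0" by blast+
        then have "edge u d' = edge u first_dir" using p(2,3) by simp
        then have "d' = first_dir" by simp
        moreover have "p k = u" using pk p(2) by simp
        ultimately show False using joined_commute[OF j] not_joined_first by simp
      qed
      have "edge (p k) d' \<in> F"
        using F(3)[OF \<open>edge (p k) d \<in> F\<close>, of "edge (p k) d'"] d'(1) by (auto simp: edge_def dirs_def)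
      then have inR: "edge (p k) d' \<in> ?R" using new by simp
      define q where "q = p(Suc k := shift (p k) d')"
      note ext = line_path_extend[OF p(1) j' new, folded q_def]
      have R': "F - step_edge q ` {..<Suc k} = ?R - {edge (p k) d'}" unfolding ext(2) by auto
      have "\<exists>q' m. line_path q' m \<and> q' 0 = u \<and> step_edge q' 0 = edge u first_dir \<and> (\<forall>i<m. q' i \<notin> L) \<and>
        walk L next_dirs (F - step_edge q ` {..<Suc k}) (q (Suc k)) (next_dirs (q (Suc k)) (opposite d')) (q' m) \<and>
        (q' m \<in> L \<or> q' m = w \<and> step_edge q' (m - 1) = edge w last_dir)"
      proof (rule less.hyps)
        show "card (F - step_edge q ` {..<Suc k}) < card ?R"
          unfolding R' using F(1) inR by (intro card_Diff1_less) auto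
        show "line_path q (Suc k)" by (rule ext(1))
        show "q 0 = u" using p(2) by (simp add: q_def)
        show "step_edge q 0 = edge u first_dir" using p(3) k by (simp add: step_edge_def q_def)
        show "step_edge q ` {..<Suc k} \<subseteq> F" unfolding ext(2) using p(4) \<open>edge (p k) d' \<in> F\<close> by simp
        show "q i \<notin> L" if "i < Suc k" for i using that p(5) notL ext(3)[of i] by (cases "i = k") auto
        show "step_edge q (Suc k - 1) = edge (q (Suc k)) (opposite d')"
          by (simp add: q_def step_edge_def edge_opposite) (simp add: edge_def)
      qed
      moreover have "walk L next_dirs ?R (p k) (next_dirs (p k) d) z \<longleftrightarrow>
         walk L next_dirs (F - step_edge q ` {..<Suc k}) (q (Suc k)) (next_dirs (q (Suc k)) (opposite d')) z" for z
      proof -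
        have notN: "\<not> (p k = w \<and> d = North)"
        proof
          assume a: "p k = w \<and> d = North"
          then have "last_dir = North" using d by (simp add: last_dir_def)
          then show False using notw a by simp
        qed
        have mem: "d' \<in> set (next_dirs (p k) d)"
          using notN d'(2) by (cases d; cases d') (auto simp: next_dirs_def)
        \<comment> \<open>Where at least three edges meet, the partner comes first in the list;
          otherwise \<open>d'\<close> is the only direction left.\<close>
        have "hd (next_dirs (p k) d) = d' \<or> (\<forall>x\<in>set (next_dirs (p k) d). edge (p k) x \<in> ?R \<longrightarrow> x = d')"
        proof (cases "card (dirs (p k)) \<ge> 3")
          case True
          then show ?thesis using d'(3) notN by (cases d) (auto simp: next_dirs_def)
        next
          case False
          have "x = d'" if "x \<in> set (next_dirs (p k) d)" "edge (p k) x \<in> ?R" for x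
          proof (rule ccontr)
            assume "x \<noteq> d'"
            have "x \<noteq> d" using that(1) by (cases d) (auto simp: next_dirs_def split: if_splits)
            have "x \<in> dirs (p k)" using that(2) F(2) by (auto simp: dirs_def)
            then have "card {d, d', x} \<le> card (dirs (p k))" using d d' by (intro card_mono) auto
            then show False using False \<open>x \<noteq> d\<close> \<open>x \<noteq> d'\<close> d'(2) by simp
          qed
          then show ?thesis by blast
        qed
        from walk_choose[OF notL inR mem this, of next_dirs z]
        show ?thesis unfolding R' by (simp add: q_def)
      qed
      ultimately show ?thesis by simp
    qed
  qed
qed

text \<open>The walk starts as if it had entered \<open>u\<close> through the missing West edge: the
  order South, North, East then selects \<open>first_dir\<close>.\<close>

lemma interface_walk:
  assumes F: "finite F" "F \<subseteq> E" "\<And>g h. g \<in> F \<Longrightarrow> h \<in> E \<Longrightarrow> g \<inter> h \<noteq> {} \<Longrightarrow> h \<in> F"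
    and u: "edge u first_dir \<in> F" "u \<notin> L"
  obtains q m where "line_path q m" "q 0 = u" "step_edge q 0 = edge u first_dir" "\<And>i. i < m \<Longrightarrow> q i \<notin> L"
    "walk L next_dirs F u (turn_order West) (q m)"
    "q m \<in> L \<or> q m = w \<and> step_edge q (m - 1) = edge w last_dir"
proof -
  define p where "p i = (if i = 0 then u else shift u first_dir)" for i :: nat
  have e0: "step_edge p 0 = edge u first_dir" by (simp add: step_edge_def p_def edge_def)
  have "edge u first_dir \<in> E" using first_dir_mem by (simp add: dirs_def)
  then have path: "line_path p 1" using e0 by (simp add: line_path_def lessThan_Suc)
  have "\<exists>q m. line_path q m \<and> q 0 = u \<and> step_edge q 0 = edge u first_dir \<and> (\<forall>i<m. q i \<notin> L) \<and>
    walk L next_dirs (F - step_edge p ` {..<1}) (p 1) (next_dirs (p 1) (opposite first_dir)) (q m) \<and>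
    (q m \<in> L \<or> q m = w \<and> step_edge q (m - 1) = edge w last_dir)"
    by (rule interface_walk_aux[OF F path]) (use u e0 edge_opposite in \<open>auto simp: p_def\<close>)
  then obtain q m where q: "line_path q m" "q 0 = u" "step_edge q 0 = edge u first_dir" "\<forall>i<m. q i \<notin> L"
    "walk L next_dirs (F - {edge u first_dir}) (shift u first_dir) (next_dirs (shift u first_dir) (opposite first_dir)) (q m)"
    "q m \<in> L \<or> q m = w \<and> step_edge q (m - 1) = edge w last_dir"
    using e0 by (auto simp: p_def lessThan_Suc)
  have skip: "edge u x \<notin> F" if "x \<notin> dirs u" for x using that F(2) by (auto simp: dirs_def)
  have "walk L next_dirs F u (turn_order West) (q m)"
    using q(5) u skip[of South] skip[of North]
    by (auto simp: walk_Cons_iff[OF u(2)] first_dir_def split: if_splits)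
  with q that show ?thesis by blast
qed

lemma interface_path:
  obtains q m where "line_path q m" "q 0 = u" "step_edge q 0 = edge u first_dir"
    "q m = w" "step_edge q (m - 1) = edge w last_dir" "interface = step_edge q ` {..<m}"
proof -
  have "edge u first_dir \<in> E" using first_dir_mem by (simp add: dirs_def)
  from confined[OF this] obtain F where
    "finite F \<and> edge u first_dir \<in> F \<and> F \<subseteq> E \<and> (\<forall>g\<in>F. \<forall>h\<in>E. g \<inter> h \<noteq> {} \<longrightarrow> h \<in> F)" ..
  then have F: "finite F" "F \<subseteq> E" "\<And>g h. g \<in> F \<Longrightarrow> h \<in> E \<Longrightarrow> g \<inter> h \<noteq> {} \<Longrightarrow> h \<in> F" "edge u first_dir \<in> F"
    by blast+
  obtain q m where q: "line_path q m" "q 0 = u" "step_edge q 0 = edge u first_dir"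
    "q m = w" "step_edge q (m - 1) = edge w last_dir"
    by (rule interface_walk[OF F, where L = "{}"]) auto
  have "0 < m" using q(1) by (simp add: line_path_def)
  then have "interface = step_edge q ` {..<m}"
    unfolding interface_def
    by (intro line_path_class q) (use q not_joined_first not_joined_last in \<open>auto intro!: image_eqI[of _ _ 0]\<close>)
  with q that show ?thesis by blast
qed

lemma first_last_in_interface: "edge u first_dir \<in> interface" "edge w last_dir \<in> interface"
proof -
  obtain q m where q: "line_path q m" "q 0 = u" "step_edge q 0 = edge u first_dir"
    "q m = w" "step_edge q (m - 1) = edge w last_dir" "interface = step_edge q ` {..<m}"
    by (rule interface_path)
  have "0 < m" using q(1) by (simp add: line_path_def)
  then show "edge u first_dir \<in> interface" "edge w last_dir \<in> interface"
    using q(3,5) unfolding q(6) by (metis image_eqI lessThan_iff, metis diff_less image_eqI lessThan_iff zero_less_one)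
qed

lemma loop_of_closed_path:
  assumes p: "line_path p k" and closed: "p k = p 0" "joined E (p k) (step_edge p (k - 1)) (step_edge p 0)"
  shows "is_loop E (step_edge p ` {..<k})"
proof -
  have k: "k > 0" using p by (simp add: line_path_def)
  define q where "q j = p (j mod k)" for j
  have q0: "q j = p (j mod k)" "q (Suc j) = p (Suc (j mod k))" for j
    using closed(1) by (auto simp: q_def mod_Suc)
  have q2: "{q (Suc j), q (Suc (Suc j))} = step_edge p (if Suc (j mod k) = k then 0 else Suc (j mod k))" for j
    using q0[of "Suc j"] by (auto simp: step_edge_def mod_Suc)
  have e: "{q j, q (Suc j)} = step_edge p (j mod k)" for j using q0[of j] by (simp add: step_edge_def)
  have img: "{q j, q (Suc j)} = step_edge p j" if "j < k" for j using e[of j] that by simp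
  show ?thesis unfolding is_loop_def
  proof (intro exI[of _ k] exI[of _ q] conjI k allI)
    show "q (j + k) = q j" for j by (simp add: q_def)
    show "inj_on (\<lambda>j. {q j, q (Suc j)}) {..<k}"
      using p img by (auto simp: line_path_def inj_on_def)
    show "step_edge p ` {..<k} = (\<lambda>j. {q j, q (Suc j)}) ` {..<k}"
      using img by (intro image_cong) auto
    show "joined E (q (Suc j)) {q j, q (Suc j)} {q (Suc j), q (Suc (Suc j))}" for j
    proof -
      have "joined E (p (Suc (j mod k))) (step_edge p (j mod k))
          (step_edge p (if Suc (j mod k) = k then 0 else Suc (j mod k)))"
      proof (cases "Suc (j mod k) = k")
        case True
        then have "j mod k = k - 1" by simp
        then show ?thesis using closed(2) True by simp
      next
        case False
        then have "Suc (j mod k) < k" using k by (metis Suc_lessI mod_less_divisor)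
        then show ?thesis using False p by (simp add: line_path_def)
      qed
      then show ?thesis unfolding q2 unfolding e by (simp only: q0(2))
    qed
  qed
qed

text \<open>A line that starts off the interface never reaches one of its two end edges, so it can
  always be continued; as \<open>F\<close> is finite, it must return to an edge already used, and
  this can only be its first edge.\<close>

lemma not_interface_loop_aux:
  assumes F: "finite F" "F \<subseteq> E" "\<And>g h. g \<in> F \<Longrightarrow> h \<in> E \<Longrightarrow> g \<inter> h \<noteq> {} \<Longrightarrow> h \<in> F"
    and p: "line_path p k" "step_edge p 0 = f" "step_edge p ` {..<k} \<subseteq> F" and f: "f \<notin> interface"
  shows "is_loop E (line_rel\<^sup>* `` {f})"
  using p
proof (induction "card (F - step_edge p ` {..<k})" arbitrary: p k rule: less_induct)
  case less
  note p = less.prems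
  have k: "k > 0" using p(1) by (simp add: line_path_def)
  let ?f = "step_edge p (k - 1)"
  have fE: "?f \<in> E" "?f \<in> F" using p k by (auto simp: line_path_def)
  have "p k \<in> ?f" using k by (simp add: step_edge_def)
  then have "?f \<in> edge (p k) ` dirs (p k)" using fE incident[of "p k"] by auto
  then obtain d where d: "?f = edge (p k) d" "d \<in> dirs (p k)" by auto
  have "?f \<notin> interface"
  proof
    assume "?f \<in> interface"
    moreover have "(?f, f) \<in> line_rel\<^sup>*" using line_path_connected[OF p(1), of "k - 1"] k p(2) by (auto dest: line_rel_sym)
    ultimately show False using f by (auto simp: interface_def intro: rtrancl_trans)
  qed
  then have "\<not> (p k = u \<and> d = first_dir)" "\<not> (p k = w \<and> d = last_dir)"
    using first_last_in_interface d by auto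
  then obtain d' where j: "joined E (p k) ?f (edge (p k) d')" using joined_exists[OF d(2)] d(1) by auto
  show ?case
  proof (cases "edge (p k) d' \<in> step_edge p ` {..<k}")
    case True
    then have c: "edge (p k) d' = step_edge p 0" "p k = p 0" using line_path_fresh[OF p(1) j] by auto
    then have "is_loop E (step_edge p ` {..<k})" using loop_of_closed_path[OF p(1)] j by simp
    moreover have "line_rel\<^sup>* `` {f} = step_edge p ` {..<k}"
    proof (rule line_path_class[OF p(1)])
      show "f \<in> step_edge p ` {..<k}" using p(2) k by auto
      show "h \<in> step_edge p ` {..<k}" if "joined E (p 0) (step_edge p 0) h" for h
      proof -
        have "joined E (p 0) (step_edge p 0) ?f" using joined_commute[OF j] c by simp
        then have "h = ?f" using joined_unique that by blast
        then show ?thesis using k by auto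
      qed
      show "h \<in> step_edge p ` {..<k}" if "joined E (p k) ?f h" for h
        using joined_unique[OF that j] True by simp
    qed
    ultimately show ?thesis by simp
  next
    case False
    have "edge (p k) d' \<in> F"
      using F(3)[OF fE(2), of "edge (p k) d'"] j by (auto simp: joined_def)
    define q where "q = p(Suc k := shift (p k) d')"
    note ext = line_path_extend[OF p(1) j False, folded q_def]
    have R': "F - step_edge q ` {..<Suc k} = (F - step_edge p ` {..<k}) - {edge (p k) d'}" unfolding ext(2) by auto
    show ?thesis
    proof (rule less.hyps)
      show "card (F - step_edge q ` {..<Suc k}) < card (F - step_edge p ` {..<k})"
        unfolding R' using F(1) False \<open>edge (p k) d' \<in> F\<close> by (intro card_Diff1_less) auto
      show "line_path q (Suc k)" by (rule ext(1))
      show "step_edge q 0 = f" using p(2) k by (simp add: step_edge_def q_def)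
      show "step_edge q ` {..<Suc k} \<subseteq> F" unfolding ext(2) using p(3) \<open>edge (p k) d' \<in> F\<close> by simp
    qed
  qed
qed

lemma not_interface_loop:
  assumes "f \<in> E" "f \<notin> interface"
  shows "is_loop E (line_rel\<^sup>* `` {f})"
proof -
  from confined[OF assms(1)] obtain F where
    "finite F \<and> f \<in> F \<and> F \<subseteq> E \<and> (\<forall>g\<in>F. \<forall>h\<in>E. g \<inter> h \<noteq> {} \<longrightarrow> h \<in> F)" ..
  then have F: "finite F" "F \<subseteq> E" "\<And>g h. g \<in> F \<Longrightarrow> h \<in> E \<Longrightarrow> g \<inter> h \<noteq> {} \<Longrightarrow> h \<in> F" "f \<in> F"
    by blast+
  obtain v d where f: "f = edge v d" using edges assms by blast
  define p where "p i = (if i = 0 then v else shift v d)" for i :: nat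
  have e0: "step_edge p 0 = f" by (simp add: step_edge_def p_def edge_def f)
  then have "line_path p 1" using assms by (simp add: line_path_def lessThan_Suc)
  show ?thesis
  proof (rule not_interface_loop_aux[OF F(1-3)])
    show "line_path p 1" "step_edge p 0 = f" "f \<notin> interface" by fact+
    show "step_edge p ` {..<1} \<subseteq> F" using F(4) e0 by (simp add: lessThan_Suc)
  qed
qed

text \<open>In a loop every edge continues at both ends, but the first edge of the interface has no
  continuation at \<open>u\<close>.\<close>

lemma interface_not_loop: "\<not> is_loop E interface"
proof
  assume "is_loop E interface"
  then obtain n p where np: "n > 0" "(\<forall>k. p (k + n) = p k) \<and> inj_on (\<lambda>k. {p k, p (Suc k)}) {..<n} \<and>
      interface = (\<lambda>k. {p k, p (Suc k)}) ` {..<n} \<and>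
      (\<forall>k. joined E (p (Suc k)) {p k, p (Suc k)} {p (Suc k), p (Suc (Suc k))})"
    unfolding is_loop_def by (elim exE conjE) (rule that, assumption+, intro conjI)
  then have n: "n > 0" and p: "\<And>k. p (k + n) = p k"
    and img: "interface = (\<lambda>k. {p k, p (Suc k)}) ` {..<n}"
    and j: "\<And>k. joined E (p (Suc k)) {p k, p (Suc k)} {p (Suc k), p (Suc (Suc k))}"
    using np by blast+
  obtain k where k: "edge u first_dir = {p k, p (Suc k)}" using first_last_in_interface img by auto
  \<comment> \<open>The predecessor of the index \<open>k\<close> is taken one period later, since
    \<open>k\<close> may be 0.\<close>
  have "Suc (k + n - 1) = k + n" "Suc (Suc (k + n - 1)) = Suc k + n" using n by auto
  then have "joined E (p k) {p (k + n - 1), p k} {p k, p (Suc k)}"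
    using j[of "k + n - 1"] p[of k] p[of "Suc k"] by simp
  then have "joined E (p k) {p k, p (Suc k)} {p (k + n - 1), p k}" by (rule joined_commute)
  moreover have "u = p k \<or> u = p (Suc k)" using k by (auto simp: edge_def)
  ultimately show False using j[of k] not_joined_first k by metis
qed

theorem open_contour_unique: "{\<gamma> \<in> contours E. \<not> is_loop E \<gamma>} = {interface}"
proof (intro set_eqI iffI)
  fix \<gamma> assume "\<gamma> \<in> {\<gamma> \<in> contours E. \<not> is_loop E \<gamma>}"
  then obtain f where f: "f \<in> E" "\<gamma> = line_rel\<^sup>* `` {f}" "\<not> is_loop E \<gamma>"
    by (auto simp: contours_def line_rel_def elim!: quotientE)
  then have "f \<in> interface" using not_interface_loop by blast
  then have "(edge u first_dir, f) \<in> line_rel\<^sup>*" by (simp add: interface_def)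
  then have "\<gamma> = interface" unfolding f(2) interface_def by (auto intro: rtrancl_trans line_rel_sym)
  then show "\<gamma> \<in> {interface}" by simp
next
  fix \<gamma> assume "\<gamma> \<in> {interface}"
  moreover have "interface \<in> contours E"
    unfolding contours_def interface_def line_rel_def
    by (intro quotientI) (use first_dir_mem in \<open>simp add: dirs_def\<close>)
  ultimately show "\<gamma> \<in> {\<gamma> \<in> contours E. \<not> is_loop E \<gamma>}" using interface_not_loop by simp
qed

text \<open>This turns a property of the contour into one of the exploration with the absorbing set
  \<open>L\<close>. The walk sees only the finite part \<open>F\<close> that contains the edges at
  \<open>u\<close>, so the event becomes a function of the edges in a box.\<close>

theorem interface_avoids:
  assumes F: "finite F" "F \<subseteq> E" "\<And>g h. g \<in> F \<Longrightarrow> h \<in> E \<Longrightarrow> g \<inter> h \<noteq> {} \<Longrightarrow> h \<in> F"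
    and u: "\<And>d. d \<in> dirs u \<Longrightarrow> edge u d \<in> F" "u \<notin> L"
  shows "\<Union>interface \<inter> L \<noteq> {} \<Longrightarrow> \<exists>z\<in>L. walk L next_dirs F u (turn_order West) z"
    and "\<Union>interface \<inter> L = {} \<Longrightarrow> walk L next_dirs F u (turn_order West) w"
proof -
  obtain q m where q: "line_path q m" "q 0 = u" "step_edge q 0 = edge u first_dir" "\<And>i. i < m \<Longrightarrow> q i \<notin> L"
    "walk L next_dirs F u (turn_order West) (q m)"
    "q m \<in> L \<or> q m = w \<and> step_edge q (m - 1) = edge w last_dir"
    by (rule interface_walk[OF F, where L = L]) (use u first_dir_mem in auto)
  have m: "m > 0" using q(1) by (simp add: line_path_def)
  show "\<exists>z\<in>L. walk L next_dirs F u (turn_order West) z" if "\<Union>interface \<inter> L \<noteq> {}"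
  proof (cases "q m \<in> L")
    case False
    then have e: "q m = w" "step_edge q (m - 1) = edge w last_dir" using q(6) by auto
    have "interface = step_edge q ` {..<m}"
      unfolding interface_def
      by (intro line_path_class q(1)) (use q e m not_joined_first not_joined_last in \<open>auto intro!: image_eqI[of _ _ 0]\<close>)
    moreover from that obtain x where x: "x \<in> \<Union>interface" "x \<in> L" by (meson Int_emptyI)
    ultimately obtain i where i: "i < m" "x \<in> step_edge q i" by (metis UnionE image_iff lessThan_iff)
    have "x = q i \<or> x = q (Suc i)" using i(2) by (simp add: step_edge_def)
    then have False using i(1) x(2) q(4) False by (metis Suc_lessI)
    then show ?thesis ..
  qed (use q in auto)
  show "walk L next_dirs F u (turn_order West) w" if disj: "\<Union>interface \<inter> L = {}"
  proof (cases "q m \<in> L")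
    case True
    have "step_edge q (m - 1) \<in> interface"
      unfolding interface_def using line_path_connected[OF q(1), of "m - 1"] m q(3) by simp
    moreover have "q m \<in> step_edge q (m - 1)" using m by (simp add: step_edge_def)
    ultimately show ?thesis using True disj by auto
  qed (use q in auto)
qed

end

section \<open>Two-point functions on grids\<close>

text \<open>
  In each of the disjoint cuts \<open>\<Lambda> k\<close> a fixed part of the weight does not depend on the relative
  sign of the two sides, and this part contributes nothing to the correlation.
\<close>

lemma separated_decay:
  fixes V :: "'v set"
  assumes V: "finite V" "\<And>e. e \<in> U \<Longrightarrow> e \<subseteq> V" "a \<in> V" "v \<in> V"
    and R: "\<And>k. k < K \<Longrightarrow> R k \<subseteq> V" "\<And>k. k < K \<Longrightarrow> spin (R k) a * spin (R k) v = -1"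
    and disj: "\<And>k k' e. k < k' \<Longrightarrow> k' < K \<Longrightarrow> e \<in> U \<Longrightarrow> spin_prod (R k) e = 1 \<or> spin_prod (R k') e = 1"
    and card: "\<And>k. k < K \<Longrightarrow> card {e \<in> U. spin_prod (R k) e = -1} \<le> N"
    and t: "0 < t" "t < 1"
  shows "subgraph_sum (\<lambda>_. t) U (sdiff {a} {v}) \<le> (1 - ((1 - t) / 2) ^ N) ^ K * subgraph_sum (\<lambda>_. t) U {}"
proof -
  have U: "finite U" using V(1,2) by (meson Pow_iff finite_Pow_iff finite_subset subsetI)
  define \<Lambda> where "\<Lambda> k = {e \<in> U. spin_prod (R k) e = -1}" for k
  define Rest where "Rest k = {e \<in> U. \<forall>k'<k. spin_prod (R k') e = 1}" for k
  let ?w = "\<lambda>E A. \<Prod>e\<in>E. 1 + t * spin_prod A e"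
  define \<delta> where "\<delta> = (1 - t) ^ N"
  have fin: "finite (\<Lambda> k)" "finite (Rest k)" for k using U by (auto simp: \<Lambda>_def Rest_def)
  have factor: "1 - t \<le> 1 + t * spin_prod A e" "1 + t * spin_prod A e \<le> 2" "0 \<le> 1 + t * spin_prod A e" for A e
    using spin_prod_cases[of A e] t by auto
  have wpos: "?w E A \<ge> 0" for E A by (intro prod_nonneg factor)
  have low: "\<delta> \<le> ?w (\<Lambda> k) A" if "k < K" for k A
  proof -
    have "\<delta> \<le> (1 - t) ^ card (\<Lambda> k)" unfolding \<delta>_def \<Lambda>_def using card[OF that] t by (intro power_decreasing) auto
    also have "\<dots> = (\<Prod>e\<in>\<Lambda> k. 1 - t)" by simp
    also have "\<dots> \<le> ?w (\<Lambda> k) A" using factor t by (intro prod_mono) auto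
    finally show ?thesis .
  qed
  have high: "?w (\<Lambda> k) A \<le> 2 ^ N" if "k < K" for k A
  proof -
    have "?w (\<Lambda> k) A \<le> (\<Prod>e\<in>\<Lambda> k. 2)" by (intro prod_mono conjI factor)
    also have "\<dots> \<le> 2 ^ N" using card[OF that] by (simp add: \<Lambda>_def power_increasing)
    finally show ?thesis .
  qed
  have Rest_Suc: "?w (Rest k) A = ?w (\<Lambda> k) A * ?w (Rest (Suc k)) A" if "k < K" for k A
  proof -
    have "Rest k = \<Lambda> k \<union> Rest (Suc k)"
    proof (intro set_eqI iffI)
      fix e assume "e \<in> Rest k"
      then show "e \<in> \<Lambda> k \<union> Rest (Suc k)"
        using spin_prod_cases[of "R k" e] by (auto simp: \<Lambda>_def Rest_def less_Suc_eq)
    next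
      fix e assume "e \<in> \<Lambda> k \<union> Rest (Suc k)"
      then show "e \<in> Rest k"
      proof
        assume "e \<in> \<Lambda> k"
        then show "e \<in> Rest k" using disj[of _ k e] that by (fastforce simp: \<Lambda>_def Rest_def)
      qed (auto simp: Rest_def)
    qed
    moreover have "\<Lambda> k \<inter> Rest (Suc k) = {}" by (auto simp: \<Lambda>_def Rest_def)
    ultimately show ?thesis using fin by (simp add: prod.union_disjoint)
  qed
  \<comment> \<open>In the first \<open>k\<close> cuts the constant \<open>\<delta>\<close> has been
    subtracted from the weight; each factor stays nonnegative since \<open>\<delta>\<close> is a
    lower bound for it.\<close>
  define F where "F k A = (\<Prod>k'<k. ?w (\<Lambda> k') A - \<delta>) * ?w (Rest k) A" for k A
  let ?s = "\<lambda>A. spin_prod A (sdiff {a} {v})"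
  have F0: "F 0 A = ?w U A" for A by (simp add: F_def Rest_def)
  have FSuc: "F k A = F (Suc k) A + \<delta> * ((\<Prod>k'<k. ?w (\<Lambda> k') A - \<delta>) * ?w (Rest (Suc k)) A)" if "k < K" for k A
    by (simp add: F_def Rest_Suc[OF that] algebra_simps)
  have zero: "(\<Sum>A\<in>Pow V. ((\<Prod>k'<k. ?w (\<Lambda> k') A - \<delta>) * ?w (Rest (Suc k)) A) * ?s A) = 0" (is "?S = 0") if "k < K" for k
  proof -
    have flip1: "?w (\<Lambda> k') (sdiff A (R k)) = ?w (\<Lambda> k') A" if "k' < k" for k' A
    proof (rule prod.cong[OF refl])
      fix e assume "e \<in> \<Lambda> k'"
      then have "spin_prod (R k) e = 1" using disj[of k' k e] that \<open>k < K\<close> by (auto simp: \<Lambda>_def)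
      then show "1 + t * spin_prod (sdiff A (R k)) e = 1 + t * spin_prod A e" by (simp add: spin_prod_sdiff_left)
    qed
    have flip2: "?w (Rest (Suc k)) (sdiff A (R k)) = ?w (Rest (Suc k)) A" for A
      by (rule prod.cong[OF refl]) (auto simp: Rest_def spin_prod_sdiff_left)
    have flip3: "?s (sdiff A (R k)) = - ?s A" for A
      using R(2)[OF that] by (simp add: spin_prod_pair spin_sdiff algebra_simps)
    have "?S = (\<Sum>A\<in>Pow V. ((\<Prod>k'<k. ?w (\<Lambda> k') (sdiff A (R k)) - \<delta>) * ?w (Rest (Suc k)) (sdiff A (R k))) * ?s (sdiff A (R k)))"
      by (rule sum.reindex_bij_betw[symmetric, OF bij_sdiff_Pow[OF R(1)[OF that]]])
    also have "\<dots> = - ?S" by (simp add: flip1 flip2 flip3 sum_negf)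
    finally show ?thesis by simp
  qed
  have "k \<le> K \<Longrightarrow> (\<Sum>A\<in>Pow V. ?w U A * ?s A) = (\<Sum>A\<in>Pow V. F k A * ?s A)" for k
  proof (induction k)
    case (Suc k)
    then have "(\<Sum>A\<in>Pow V. ?w U A * ?s A) = (\<Sum>A\<in>Pow V. F (Suc k) A * ?s A) +
       \<delta> * (\<Sum>A\<in>Pow V. ((\<Prod>k'<k. ?w (\<Lambda> k') A - \<delta>) * ?w (Rest (Suc k)) A) * ?s A)"
      by (simp add: FSuc sum.distrib sum_distrib_left algebra_simps)
    then show ?case using zero[of k] Suc by simp
  qed (simp add: F0)
  then have "(\<Sum>A\<in>Pow V. ?w U A * ?s A) = (\<Sum>A\<in>Pow V. F K A * ?s A)" by simp
  also have "\<dots> \<le> (\<Sum>A\<in>Pow V. (1 - ((1 - t) / 2) ^ N) ^ K * ?w U A)"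
  proof (rule sum_mono)
    fix A assume "A \<in> Pow V"
    have split: "?w U A = (\<Prod>k'<k. ?w (\<Lambda> k') A) * ?w (Rest k) A" if "k \<le> K" for k
      using that
    proof (induction k)
      case (Suc k)
      then show ?case using Rest_Suc[of k A] by (simp add: mult_ac)
    qed (simp add: Rest_def)
    let ?q = "1 - ((1 - t) / 2) ^ N"
    \<comment> \<open>A cut has weight at most \<open>2 ^ N\<close>, so subtracting
      \<open>\<delta>\<close> removes at least the fraction \<open>((1 - t) / 2) ^ N\<close> of
      it.\<close>
    have "?w (\<Lambda> k) A - \<delta> \<le> ?q * ?w (\<Lambda> k) A" if "k < K" for k
    proof -
      have "((1 - t) / 2) ^ N * ?w (\<Lambda> k) A \<le> ((1 - t) / 2) ^ N * 2 ^ N"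
        using high[OF that] t by (intro mult_left_mono) auto
      also have "\<dots> = \<delta>" by (simp add: \<delta>_def power_divide)
      finally show ?thesis by (simp add: algebra_simps)
    qed
    then have "(\<Prod>k'<K. ?w (\<Lambda> k') A - \<delta>) \<le> (\<Prod>k'<K. ?q * ?w (\<Lambda> k') A)"
      using low by (intro prod_mono) auto
    also have "\<dots> = ?q ^ K * (\<Prod>k'<K. ?w (\<Lambda> k') A)" by (simp add: prod.distrib)
    finally have le: "(\<Prod>k'<K. ?w (\<Lambda> k') A - \<delta>) \<le> ?q ^ K * (\<Prod>k'<K. ?w (\<Lambda> k') A)" .
    have "0 \<le> ?w (Rest K) A" by (rule wpos)
    then have "F K A \<le> ?q ^ K * ?w U A"
      unfolding F_def split[OF order_refl] using mult_right_mono[OF le] by (simp only: mult.assoc)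
    moreover have "0 \<le> F K A" unfolding F_def using low by (intro mult_nonneg_nonneg prod_nonneg factor) auto
    moreover have "?s A \<le> 1" using spin_prod_cases[of A "sdiff {a} {v}"] by auto
    ultimately show "F K A * ?s A \<le> ?q ^ K * ?w U A"
      by (smt (verit) mult_left_le)
  qed
  also have "\<dots> = (1 - ((1 - t) / 2) ^ N) ^ K * (\<Sum>A\<in>Pow V. ?w U A * spin_prod A {})"
    by (simp add: sum_distrib_left)
  finally have "(\<Sum>A\<in>Pow V. ?w U A * ?s A) \<le> \<dots>" .
  moreover have "(\<Sum>A\<in>Pow V. ?w U A * spin_prod A D) = 2 ^ card V * subgraph_sum (\<lambda>_. t) U D" if "D \<subseteq> V" for D
    by (rule subgraph_sum_spins) (use V U that in auto)
  moreover have "sdiff {a} {v} \<subseteq> V" using V by auto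
  ultimately have "2 ^ card V * subgraph_sum (\<lambda>_. t) U (sdiff {a} {v}) \<le>
     2 ^ card V * ((1 - ((1 - t) / 2) ^ N) ^ K * subgraph_sum (\<lambda>_. t) U {})"
    by (simp only: empty_subsetI) (simp add: mult_ac)
  then show ?thesis by (subst (asm) mult_le_cancel_left_pos) auto
qed

text \<open>
  The three-term relation: reversing the sign of one coupling is \<open>exp (-2 K s s') = c - s * s s'\<close>
  with \<open>t = tanh K\<close>, \<open>c = cosh (2 * K)\<close> and \<open>s = sinh (2 * K)\<close>.
\<close>

definition cosh2 :: "real \<Rightarrow> real" where "cosh2 t = (1 + t\<^sup>2) / (1 - t\<^sup>2)"
definition sinh2 :: "real \<Rightarrow> real" where "sinh2 t = 2 * t / (1 - t\<^sup>2)"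

lemma subgraph_sum_flip_edge:
  assumes U: "finite U" "{v, v'} \<in> U" "v \<noteq> v'" and t: "0 < t" "t < 1"
    and J: "J {v, v'} = t" "J' {v, v'} = - t" "\<And>e. e \<in> U \<Longrightarrow> e \<noteq> {v, v'} \<Longrightarrow> J' e = J e"
  shows "subgraph_sum J' U (sdiff {a} {v}) =
    cosh2 t * subgraph_sum J U (sdiff {a} {v}) - sinh2 t * subgraph_sum J U (sdiff {a} {v'})"
proof -
  define U0 where "U0 = U - {{v, v'}}"
  have U0: "U = insert {v, v'} U0" "finite U0" "{v, v'} \<notin> U0" using U by (auto simp: U0_def)
  have s: "sdiff (sdiff {a} {v}) {v, v'} = sdiff {a} {v'}" "sdiff (sdiff {a} {v'}) {v, v'} = sdiff {a} {v}"
    using U(3) by auto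
  have J'J: "subgraph_sum J' U0 B = subgraph_sum J U0 B" for B
    using J(3) by (intro subgraph_sum_cong) (auto simp: U0_def)
  define p where "p = subgraph_sum J U0 (sdiff {a} {v})"
  define q where "q = subgraph_sum J U0 (sdiff {a} {v'})"
  have D: "1 - t\<^sup>2 \<noteq> 0" using t by (smt (verit) power_less_one_iff zero_less_numeral)
  then have "(1 - t\<^sup>2) * cosh2 t = 1 + t\<^sup>2" "(1 - t\<^sup>2) * sinh2 t = 2 * t"
    by (simp_all add: cosh2_def sinh2_def)
  then have "(1 - t\<^sup>2) * (cosh2 t - sinh2 t * t) = (1 - t\<^sup>2) * 1"
    "(1 - t\<^sup>2) * (cosh2 t * t - sinh2 t) = (1 - t\<^sup>2) * (- t)"
    by algebra+
  then have "cosh2 t - sinh2 t * t = 1" "cosh2 t * t - sinh2 t = - t"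
    using D by (simp_all only: mult_cancel_left) auto
  then have "p - t * q = cosh2 t * (p + t * q) - sinh2 t * (q + t * p)" by algebra
  then show ?thesis
    unfolding U0(1) subgraph_sum_insert[OF U0(2,3)] s J'J J by (simp add: p_def q_def)
qed

definition grid :: "nat \<Rightarrow> nat \<Rightarrow> nat \<Rightarrow> dual_site set" where
  "grid n M M' = {0..int n} \<times> {- int M..int M'}"

definition grid_edges :: "dual_site set \<Rightarrow> dual_site set set" where
  "grid_edges V = {edge v d | v d. v \<in> V \<and> shift v d \<in> V}"

lemma grid_edges_subset: "e \<in> grid_edges V \<Longrightarrow> e \<subseteq> V"
  by (auto simp: grid_edges_def edge_def)

lemma finite_grid_edges: "finite V \<Longrightarrow> finite (grid_edges V)"
  by (rule finite_subset[of _ "Pow V"]) (auto dest: grid_edges_subset)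

lemma grid_edges_mono: "V \<subseteq> V' \<Longrightarrow> grid_edges V \<subseteq> grid_edges V'"
  by (auto simp: grid_edges_def)

lemma finite_grid: "finite (grid n M M')"
  by (simp add: grid_def)

lemma grid_edges_cases:
  assumes "e \<in> grid_edges V"
  obtains (vertical) x y where "e = {(x, y), (x, y + 1)}" "(x, y) \<in> V" "(x, y + 1) \<in> V"
  | (horizontal) x y where "e = {(x, y), (x + 1, y)}" "(x, y) \<in> V" "(x + 1, y) \<in> V"
proof -
  obtain x y d where e: "e = edge (x, y) d" "(x, y) \<in> V" "shift (x, y) d \<in> V"
    using assms by (auto simp: grid_edges_def)
  show ?thesis
  proof (cases d)
    case North then show ?thesis using e that(1)[of x y] by (simp add: edge_def)
  next
    case South then show ?thesis using e that(1)[of x "y - 1"] by (simp add: edge_def insert_commute)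
  next
    case East then show ?thesis using e that(2)[of x y] by (simp add: edge_def)
  next
    case West then show ?thesis using e that(2)[of "x - 1" y] by (simp add: edge_def insert_commute)
  qed
qed

lemma vertical_mem: "(x, y) \<in> V \<Longrightarrow> (x, y + 1) \<in> V \<Longrightarrow> {(x, y), (x, y + 1)} \<in> grid_edges V"
  unfolding grid_edges_def edge_def by (intro CollectI exI[of _ "(x, y)"] exI[of _ North]) simp

lemma horizontal_mem: "(x, y) \<in> V \<Longrightarrow> (x + 1, y) \<in> V \<Longrightarrow> {(x, y), (x + 1, y)} \<in> grid_edges V"
  unfolding grid_edges_def edge_def by (intro CollectI exI[of _ "(x, y)"] exI[of _ East]) simp

definition two_point :: "real \<Rightarrow> dual_site set \<Rightarrow> dual_site \<Rightarrow> dual_site \<Rightarrow> real" where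
  "two_point t V a v = subgraph_sum (\<lambda>_. t) (grid_edges V) (sdiff {a} {v}) / subgraph_sum (\<lambda>_. t) (grid_edges V) {}"

text \<open>The layers of vertical edges between successive rows are disjoint cuts with
  \<open>Suc n\<close> edges each, and \<open>M'\<close> or \<open>M\<close> of them separate the
  source from the top or bottom row. The base is below 1 for each fixed width, which suffices to
  make the boundary terms of the Fourier sums vanish.\<close>

lemma grid_decay:
  assumes t: "0 < t" "t < 1" and i: "0 \<le> i" "i \<le> int n"
  shows "two_point t (grid n M M') (0, 0) (i, int M') \<le> (1 - ((1 - t) / 2) ^ Suc n) ^ M'"
    "two_point t (grid n M M') (0, 0) (i, - int M) \<le> (1 - ((1 - t) / 2) ^ Suc n) ^ M"
proof -
  let ?V = "grid n M M'"
  let ?U = "grid_edges ?V"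
  have pos: "subgraph_sum (\<lambda>_. t) ?U {} > 0"
    using subgraph_sum_pos[of ?U "\<lambda>_. t"] finite_grid_edges[OF finite_grid] t by (smt (verit))
  have layer: "card {e \<in> ?U. spin_prod (R \<inter> ?V) e = -1} \<le> Suc n"
    if R: "\<And>x x' y. (x, y) \<in> R \<longleftrightarrow> (x', y) \<in> R" and k: "\<And>x y. ((x, y) \<in> R) \<noteq> ((x, y + 1) \<in> R) \<longleftrightarrow> y = k" for R k
  proof -
    have "{e \<in> ?U. spin_prod (R \<inter> ?V) e = -1} \<subseteq> (\<lambda>x. {(x, k), (x, k + 1)}) ` {0..int n}"
    proof
      fix e assume e: "e \<in> {e \<in> ?U. spin_prod (R \<inter> ?V) e = -1}"
      then have "e \<in> ?U" by simp
      then show "e \<in> (\<lambda>x. {(x, k), (x, k + 1)}) ` {0..int n}"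
      proof (cases rule: grid_edges_cases)
        case (vertical x y)
        then have "((x, y) \<in> R) \<noteq> ((x, y + 1) \<in> R)" using e
          by (auto simp: spin_prod_doubleton spin_def split: if_splits)
        then show ?thesis using vertical k by (auto simp: grid_def)
      next
        case (horizontal x y)
        then show ?thesis using e R[of x y "x + 1"] by (auto simp: spin_prod_doubleton spin_def split: if_splits)
      qed
    qed
    then have "card {e \<in> ?U. spin_prod (R \<inter> ?V) e = -1} \<le> card {0..int n}"
      by (meson card_image_le card_mono finite_atLeastAtMost_int finite_imageI order_trans)
    then show ?thesis by simp
  qed
  have same: "spin_prod (R \<inter> ?V) e = 1 \<or> spin_prod (R' \<inter> ?V) e = 1"
    if "e \<in> ?U" and R: "\<And>x x' y. (x, y) \<in> R \<longleftrightarrow> (x', y) \<in> R" "\<And>x y. ((x, y) \<in> R) \<noteq> ((x, y + 1) \<in> R) \<longleftrightarrow> y = k"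
      and R': "\<And>x x' y. (x, y) \<in> R' \<longleftrightarrow> (x', y) \<in> R'" "\<And>x y. ((x, y) \<in> R') \<noteq> ((x, y + 1) \<in> R') \<longleftrightarrow> y = k'"
      and "k \<noteq> k'" for e R R' k k'
    using that(1)
  proof (cases rule: grid_edges_cases)
    case (vertical x y)
    then show ?thesis using R(2)[of x y] R'(2)[of x y] \<open>k \<noteq> k'\<close> by (auto simp: spin_prod_doubleton spin_def)
  next
    case (horizontal x y)
    then show ?thesis using R(1)[of x y "x + 1"] by (auto simp: spin_prod_doubleton spin_def)
  qed
  have "subgraph_sum (\<lambda>_. t) ?U (sdiff {(0, 0)} {(i, int M')}) \<le> (1 - ((1 - t) / 2) ^ Suc n) ^ M' * subgraph_sum (\<lambda>_. t) ?U {}"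
  proof (rule separated_decay[where R = "\<lambda>k. {p. snd p > int k} \<inter> ?V" and V = ?V])
    fix k assume "k < M'"
    show "card {e \<in> ?U. spin_prod ({p. snd p > int k} \<inter> ?V) e = -1} \<le> Suc n"
      by (rule layer[where k = "int k"]) auto
  next
    fix k k' e assume "k < k'" "k' < M'" "e \<in> ?U"
    then show "spin_prod ({p. snd p > int k} \<inter> ?V) e = 1 \<or> spin_prod ({p. snd p > int k'} \<inter> ?V) e = 1"
      by (intro same[where k = "int k" and k' = "int k'"]) auto
  qed (use i t finite_grid grid_edges_subset in \<open>auto simp: grid_def spin_def\<close>)
  then show "two_point t ?V (0, 0) (i, int M') \<le> (1 - ((1 - t) / 2) ^ Suc n) ^ M'"
    using pos by (simp add: two_point_def divide_le_eq)
  have "subgraph_sum (\<lambda>_. t) ?U (sdiff {(0, 0)} {(i, - int M)}) \<le> (1 - ((1 - t) / 2) ^ Suc n) ^ M * subgraph_sum (\<lambda>_. t) ?U {}"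
  proof (rule separated_decay[where R = "\<lambda>k. {p. snd p < - int k} \<inter> ?V" and V = ?V])
    fix k assume "k < M"
    show "card {e \<in> ?U. spin_prod ({p. snd p < - int k} \<inter> ?V) e = -1} \<le> Suc n"
      by (rule layer[where k = "- int k - 1"]) auto
  next
    fix k k' e assume "k < k'" "k' < M" "e \<in> ?U"
    then show "spin_prod ({p. snd p < - int k} \<inter> ?V) e = 1 \<or> spin_prod ({p. snd p < - int k'} \<inter> ?V) e = 1"
      by (intro same[where k = "- int k - 1" and k' = "- int k' - 1"]) auto
  qed (use i t finite_grid grid_edges_subset in \<open>auto simp: grid_def spin_def\<close>)
  then show "two_point t ?V (0, 0) (i, - int M) \<le> (1 - ((1 - t) / 2) ^ Suc n) ^ M"
    using pos by (simp add: two_point_def divide_le_eq)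
qed

section \<open>The exact solution\<close>

lemma cosh2_sinh2:
  assumes "0 < t" "t < 1"
  shows "(cosh2 t)\<^sup>2 - (sinh2 t)\<^sup>2 = 1" "sinh2 t = t * (cosh2 t + 1)" "t * sinh2 t = cosh2 t - 1"
proof -
  have D: "1 - t\<^sup>2 \<noteq> 0" using assms by (smt (verit) power_less_one_iff zero_less_numeral)
  then have "(1 - t\<^sup>2) * cosh2 t = 1 + t\<^sup>2" "(1 - t\<^sup>2) * sinh2 t = 2 * t"
    by (simp_all add: cosh2_def sinh2_def)
  then have "(1 - t\<^sup>2)\<^sup>2 * ((cosh2 t)\<^sup>2 - (sinh2 t)\<^sup>2) = (1 - t\<^sup>2)\<^sup>2 * 1"
    "(1 - t\<^sup>2) * sinh2 t = (1 - t\<^sup>2) * (t * (cosh2 t + 1))"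
    "(1 - t\<^sup>2) * (t * sinh2 t) = (1 - t\<^sup>2) * (cosh2 t - 1)"
    by algebra+
  then show "(cosh2 t)\<^sup>2 - (sinh2 t)\<^sup>2 = 1" "sinh2 t = t * (cosh2 t + 1)" "t * sinh2 t = cosh2 t - 1"
    using D by (simp_all only: mult_cancel_left) auto
qed

text \<open>
  The Kadanoff--Ceva fermions of the strip: \<open>fermion m k v\<close> is the correlation of the spins at
  \<open>(0, 0)\<close> and \<open>v\<close> with the signs of the couplings reversed on the first \<open>m\<close> vertical edges
  between the rows \<open>k\<close> and \<open>k + 1\<close>. It obeys linear equations with constant coefficients.
\<close>

locale grid_model =
  fixes n M M' :: nat and t :: real
  assumes t: "0 < t" "t < 1"
begin

abbreviation "V \<equiv> grid n M M'"
abbreviation "U \<equiv> grid_edges V"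
abbreviation "c \<equiv> cosh2 t"
abbreviation "s \<equiv> sinh2 t"
abbreviation "G \<equiv> two_point t V (0, 0)"

lemma t2: "1 - t\<^sup>2 > 0"
  using t by (simp add: power_less_one_iff abs_square_less_1)

lemma c_ge_1: "c \<ge> 1" and s_pos: "s > 0"
  using t2 t by (simp_all add: cosh2_def sinh2_def le_divide_eq)

lemma finite_U: "finite U"
  by (intro finite_grid_edges finite_grid)

definition cut :: "int \<Rightarrow> int \<Rightarrow> dual_site set \<Rightarrow> real" where
  "cut m k e = (if \<exists>x. 0 \<le> x \<and> x < m \<and> e = {(x, k), (x, k + 1)} then - t else t)"

lemma cut_vertical: "cut m k {(x, y), (x, y + 1)} = (if y = k \<and> 0 \<le> x \<and> x < m then - t else t)"
  by (auto simp: cut_def doubleton_eq_iff)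

lemma cut_horizontal: "cut m k {(x, y), (x + 1, y)} = t"
  by (auto simp: cut_def doubleton_eq_iff)

definition fermion :: "int \<Rightarrow> int \<Rightarrow> dual_site \<Rightarrow> real" where
  "fermion m k v = subgraph_sum (cut m k) U (sdiff {(0, 0)} {v}) / subgraph_sum (\<lambda>_. t) U {}"

text \<open>Lengthening the cut past column \<open>i\<close> reverses one more coupling, that of an
  edge ending at the second spin, so the three-term relation applies.\<close>

lemma fermion_vertical:
  assumes "0 \<le> i" "i \<le> int n" "- int M \<le> j" "j < int M'"
  shows "fermion (i + 1) j (i, j) = c * fermion i j (i, j) - s * fermion i j (i, j + 1)"
    and "fermion (i + 1) j (i, j + 1) = c * fermion i j (i, j + 1) - s * fermion i j (i, j)"
proof -
  let ?e = "{(i, j), (i, j + 1)}"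
  have e: "?e \<in> U" using assms by (intro vertical_mem) (auto simp: grid_def)
  have J: "cut i j ?e = t" "cut (i + 1) j ?e = - t" using assms by (auto simp: cut_vertical)
  have J': "cut (i + 1) j e = cut i j e" if "e \<in> U" "e \<noteq> ?e" for e
    using that(1)
  proof (cases rule: grid_edges_cases)
    case (vertical x y)
    then show ?thesis using that(2) by (auto simp: cut_vertical)
  qed (simp add: cut_horizontal)
  have "subgraph_sum (cut (i + 1) j) U (sdiff {(0, 0)} {(i, j)}) =
    c * subgraph_sum (cut i j) U (sdiff {(0, 0)} {(i, j)}) - s * subgraph_sum (cut i j) U (sdiff {(0, 0)} {(i, j + 1)})"
    by (rule subgraph_sum_flip_edge) (use finite_U e t J J' in auto)
  then show "fermion (i + 1) j (i, j) = c * fermion i j (i, j) - s * fermion i j (i, j + 1)"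
    by (simp add: fermion_def diff_divide_distrib)
  have e': "{(i, j + 1), (i, j)} = ?e" by auto
  have "subgraph_sum (cut (i + 1) j) U (sdiff {(0, 0)} {(i, j + 1)}) =
    c * subgraph_sum (cut i j) U (sdiff {(0, 0)} {(i, j + 1)}) - s * subgraph_sum (cut i j) U (sdiff {(0, 0)} {(i, j)})"
    by (rule subgraph_sum_flip_edge) (use finite_U e t J J' in \<open>auto simp: e'\<close>)
  then show "fermion (i + 1) j (i, j + 1) = c * fermion i j (i, j + 1) - s * fermion i j (i, j)"
    by (simp add: fermion_def diff_divide_distrib)
qed

text \<open>Flipping the spins of row \<open>j\<close> up to column \<open>i\<close> moves the cut
  from above the row to below it, at the price of one reversed horizontal edge, which the three-term
  relation removes. The sign depends on whether the source is among the flipped spins, which happens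
  for \<open>j = 0\<close>.\<close>

lemma fermion_horizontal:
  assumes i: "0 \<le> i" "i < int n" and j: "- int M \<le> j" "j \<le> int M'"
  shows "fermion (i + 1) (j - 1) (i, j) = (if j = 0 then 1 else -1) * (c * fermion (i + 1) j (i, j) - s * fermion (i + 1) j (i + 1, j))"
    and "fermion (i + 1) (j - 1) (i + 1, j) = (if j = 0 then -1 else 1) * (c * fermion (i + 1) j (i + 1, j) - s * fermion (i + 1) j (i, j))"
proof -
  let ?e = "{(i, j), (i + 1, j)}"
  define J where "J e = (if e = ?e then - t else cut (i + 1) j e)" for e
  define R where "R = {p :: dual_site. snd p = j \<and> fst p \<le> i}"
  have e: "?e \<in> U" using assms by (intro horizontal_mem) (auto simp: grid_def)
  have Je: "cut (i + 1) j ?e = t" "J ?e = - t" "\<And>e. e \<noteq> ?e \<Longrightarrow> J e = cut (i + 1) j e"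
    by (auto simp: J_def cut_horizontal)
  have gauge: "cut (i + 1) (j - 1) e = J e * spin_prod R e" if "e \<in> U" for e
    using that
  proof (cases rule: grid_edges_cases)
    case (vertical x y)
    then have "0 \<le> x" "e \<noteq> ?e" by (auto simp: grid_def doubleton_eq_iff)
    then show ?thesis using vertical
      by (auto simp: J_def cut_vertical spin_prod_doubleton spin_def R_def)
  next
    case (horizontal x y)
    have "{(x, y), (x + 1, y)} = ?e \<longleftrightarrow> x = i \<and> y = j" by (auto simp: doubleton_eq_iff)
    then show ?thesis using horizontal
      by (auto simp: J_def cut_horizontal spin_prod_doubleton spin_def R_def)
  qed
  have fin: "finite e" if "e \<in> U" for e using grid_edges_subset[OF that] finite_grid finite_subset by blast
  have g: "subgraph_sum (cut (i + 1) (j - 1)) U (sdiff {(0, 0)} {v}) =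
      spin R (0, 0) * spin R v * subgraph_sum J U (sdiff {(0, 0)} {v})" for v
    using subgraph_sum_gauge[of U "cut (i + 1) (j - 1)" J R "sdiff {(0, 0)} {v}", OF finite_U fin gauge]
    by (simp add: spin_prod_pair)
  have R0: "spin R (0, 0) = (if j = 0 then -1 else 1)" "spin R (i, j) = -1" "spin R (i + 1, j) = 1"
    using i by (auto simp: R_def spin_def)
  have "subgraph_sum J U (sdiff {(0, 0)} {(i, j)}) =
    c * subgraph_sum (cut (i + 1) j) U (sdiff {(0, 0)} {(i, j)}) - s * subgraph_sum (cut (i + 1) j) U (sdiff {(0, 0)} {(i + 1, j)})"
    by (rule subgraph_sum_flip_edge) (use finite_U e t Je in auto)
  then show "fermion (i + 1) (j - 1) (i, j) = (if j = 0 then 1 else -1) * (c * fermion (i + 1) j (i, j) - s * fermion (i + 1) j (i + 1, j))"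
    unfolding fermion_def g R0 by (simp add: diff_divide_distrib)
  have e': "{(i + 1, j), (i, j)} = ?e" by auto
  have "subgraph_sum J U (sdiff {(0, 0)} {(i + 1, j)}) =
    c * subgraph_sum (cut (i + 1) j) U (sdiff {(0, 0)} {(i + 1, j)}) - s * subgraph_sum (cut (i + 1) j) U (sdiff {(0, 0)} {(i, j)})"
    by (rule subgraph_sum_flip_edge) (use finite_U e t Je in \<open>auto simp: e'\<close>)
  then show "fermion (i + 1) (j - 1) (i + 1, j) = (if j = 0 then -1 else 1) * (c * fermion (i + 1) j (i + 1, j) - s * fermion (i + 1) j (i, j))"
    unfolding fermion_def g R0 by (simp add: diff_divide_distrib)
qed

lemma fermion_no_cut:
  assumes "m \<le> 0 \<or> k \<ge> int M' \<or> k < - int M"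
  shows "fermion m k v = G v"
proof -
  have "cut m k e = t" if "e \<in> U" for e
    using that
  proof (cases rule: grid_edges_cases)
    case (vertical x y)
    then show ?thesis using assms by (auto simp: cut_vertical grid_def)
  qed (simp add: cut_horizontal)
  then show ?thesis by (simp add: fermion_def two_point_def subgraph_sum_cong[of U "cut m k" "\<lambda>_. t"])
qed

text \<open>A cut through the whole width is undone by flipping all spins above it; the sign tells
  whether it separates \<open>v\<close> from the source.\<close>

lemma fermion_full_cut:
  "fermion (int n + 1) k v = (if (0 > k) = (snd v > k) then 1 else -1) * G v"
proof -
  define R where "R = {p :: dual_site. snd p > k}"
  have gauge: "cut (int n + 1) k e = t * spin_prod R e" if "e \<in> U" for e
    using that
  proof (cases rule: grid_edges_cases)
    case (vertical x y)
    then show ?thesis by (auto simp: cut_vertical grid_def spin_prod_doubleton spin_def R_def)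
  next
    case (horizontal x y)
    then show ?thesis by (auto simp: cut_horizontal spin_prod_doubleton spin_def R_def)
  qed
  have fin: "finite e" if "e \<in> U" for e using grid_edges_subset[OF that] finite_grid finite_subset by blast
  have "subgraph_sum (cut (int n + 1) k) U (sdiff {(0, 0)} {v}) =
      spin R (0, 0) * spin R v * subgraph_sum (\<lambda>_. t) U (sdiff {(0, 0)} {v})"
    using subgraph_sum_gauge[of U "cut (int n + 1) k" "\<lambda>_. t" R "sdiff {(0, 0)} {v}", OF finite_U fin gauge]
    by (simp add: spin_prod_pair)
  moreover have "spin R (0, 0) * spin R v = (if (0 > k) = (snd v > k) then 1 else -1)"
    by (auto simp: spin_def R_def)
  ultimately show ?thesis by (simp add: fermion_def two_point_def)
qed

text \<open>
  The four corners of a site. The extra signs below the row of the source make the gauge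
  relation the same on all rows, and the source moves to the left boundary condition.
\<close>

definition "NW i j = (if j \<ge> 0 then 1 else -1) * fermion i j (i, j)"
definition "SW i j = (if j \<ge> 1 then 1 else -1) * fermion i (j - 1) (i, j)"
definition "NE i j = (if j \<ge> 0 then 1 else -1) * fermion (i + 1) j (i, j)"
definition "SE i j = (if j \<ge> 1 then 1 else -1) * fermion (i + 1) (j - 1) (i, j)"

lemma corners_vertical:
  assumes "0 \<le> i" "i \<le> int n"
  shows "- int M \<le> j \<Longrightarrow> j < int M' \<Longrightarrow> NE i j = c * NW i j - s * SW i (j + 1)"
    and "- int M < j \<Longrightarrow> j \<le> int M' \<Longrightarrow> SE i j = c * SW i j - s * NW i (j - 1)"
    and "NE i (int M') = NW i (int M')" "NW i (int M') = G (i, int M')"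
    and "SE i (- int M) = SW i (- int M)" "SW i (- int M) = - G (i, - int M)"
  using fermion_vertical[OF assms, of j] fermion_vertical[OF assms, of "j - 1"]
  by (auto simp: NW_def SW_def NE_def SE_def fermion_no_cut algebra_simps)

text \<open>Crossing a horizontal edge is diagonal in the sum and the difference of the two corners,
  with factors \<open>1 / t\<close> and \<open>t\<close>, because \<open>s / t = c + 1\<close> and
  \<open>s * t = c - 1\<close>.\<close>

lemma corners_horizontal:
  assumes "0 \<le> i" "i < int n" "- int M \<le> j" "j \<le> int M'"
  shows "NW (i + 1) j + SW (i + 1) j = (NE i j + SE i j) / t"
    and "NW (i + 1) j - SW (i + 1) j = (NE i j - SE i j) * t"
proof -
  have 1: "SE i j = - (c * NE i j - s * NW (i + 1) j)"
    unfolding SE_def NE_def NW_def using fermion_horizontal(1)[OF assms]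
    by (cases "j \<ge> 1"; cases "j = 0") (simp_all add: algebra_simps)
  have 2: "SW (i + 1) j = c * NW (i + 1) j - s * NE i j"
    unfolding SW_def NE_def NW_def using fermion_horizontal(2)[OF assms]
    by (cases "j \<ge> 1"; cases "j = 0") (simp_all add: algebra_simps)
  have cs: "s * (1 / t) = c + 1" "s * t = c - 1" "c\<^sup>2 - s\<^sup>2 = 1"
    using cosh2_sinh2[OF t] t by (simp_all add: field_simps)
  have "s * (NW (i + 1) j + SW (i + 1) j) = s * ((NE i j + SE i j) * (1 / t))"
    using 1 2 cs by algebra
  then have "NW (i + 1) j + SW (i + 1) j = (NE i j + SE i j) * (1 / t)"
    using s_pos by (simp only: mult_cancel_left) auto
  then show "NW (i + 1) j + SW (i + 1) j = (NE i j + SE i j) / t" by simp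
  have "s * (NW (i + 1) j - SW (i + 1) j) = s * ((NE i j - SE i j) * t)"
    using 1 2 cs by algebra
  then show "NW (i + 1) j - SW (i + 1) j = (NE i j - SE i j) * t" using s_pos by simp
qed

lemma G_source: "G (0, 0) = 1"
proof -
  have "subgraph_sum (\<lambda>_. t) U {} \<ge> 1" using subgraph_sum_pos[of U "\<lambda>_. t"] finite_U t by auto
  then show ?thesis by (simp add: two_point_def)
qed

text \<open>The cut is empty in column 0, so both corners are the correlation itself up to the added
  signs. These differ only in row 0: the difference is known completely, and the sum is an unknown
  of the linear system.\<close>

lemma corners_left:
  "NW 0 j - SW 0 j = (if j = 0 then 2 else 0)"
  "NW 0 j + SW 0 j = (if j = 0 then 0 else 2 * (sgn (real_of_int j) * G (0, j)))"
  by (auto simp: NW_def SW_def fermion_no_cut G_source sgn_if)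

text \<open>In the last column the cut on the right has full width. The sum of the two corners
  vanishes, which is the second boundary condition.\<close>

lemma corners_right: "NE (int n) j = G (int n, j)" "SE (int n) j = - G (int n, j)"
  using fermion_full_cut[of j "(int n, j)"] fermion_full_cut[of "j - 1" "(int n, j)"]
  by (auto simp: NE_def SE_def)

end

section \<open>Fourier transform along a column, with boundary terms at its ends\<close>

lemma sum_level_transfer:
  fixes \<alpha> \<beta> \<gamma> F :: "int \<Rightarrow> real"
  assumes "\<And>j. a \<le> j \<Longrightarrow> j < b \<Longrightarrow> \<gamma> j = c * \<alpha> j - s * \<beta> (j + 1)" "\<gamma> b = \<alpha> b" "a \<le> b"
  shows "(\<Sum>j\<in>{a..b}. \<gamma> j * F j) = c * (\<Sum>j\<in>{a..b}. \<alpha> j * F j) - s * (\<Sum>j\<in>{a..b}. \<beta> j * F (j - 1))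
    + (s * \<beta> a * F (a - 1) + (1 - c) * \<alpha> b * F b)"
proof -
  have I: "{a..b} = insert b {a..<b}" "{a..b} = insert a {a<..b}" using assms(3) by auto
  have shift: "(\<Sum>j\<in>{a..<b}. \<beta> (j + 1) * F j) = (\<Sum>j\<in>{a<..b}. \<beta> j * F (j - 1))"
    by (rule sum.reindex_bij_witness[of _ "\<lambda>j. j - 1" "\<lambda>j. j + 1"]) auto
  have "(\<Sum>j\<in>{a..<b}. \<gamma> j * F j) = (\<Sum>j\<in>{a..<b}. c * (\<alpha> j * F j) - s * (\<beta> (j + 1) * F j))"
    by (intro sum.cong refl) (simp add: assms(1) left_diff_distrib mult.assoc)
  also have "\<dots> = c * (\<Sum>j\<in>{a..<b}. \<alpha> j * F j) - s * (\<Sum>j\<in>{a<..b}. \<beta> j * F (j - 1))"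
    by (simp add: sum_subtractf sum_distrib_left[symmetric] shift)
  finally have "(\<Sum>j\<in>{a..<b}. \<gamma> j * F j) = \<dots>" .
  moreover have "(\<Sum>j\<in>{a..b}. \<gamma> j * F j) = \<gamma> b * F b + (\<Sum>j\<in>{a..<b}. \<gamma> j * F j)"
    "(\<Sum>j\<in>{a..b}. \<alpha> j * F j) = \<alpha> b * F b + (\<Sum>j\<in>{a..<b}. \<alpha> j * F j)"
    unfolding I(1) by simp_all
  moreover have "(\<Sum>j\<in>{a..b}. \<beta> j * F (j - 1)) = \<beta> a * F (a - 1) + (\<Sum>j\<in>{a<..b}. \<beta> j * F (j - 1))"
    unfolding I(2) by simp
  ultimately show ?thesis using assms(2) by (simp add: algebra_simps)
qed

lemma sum_level_transfer':
  fixes \<alpha> \<beta> \<delta> F :: "int \<Rightarrow> real"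
  assumes "\<And>j. a < j \<Longrightarrow> j \<le> b \<Longrightarrow> \<delta> j = c * \<beta> j - s * \<alpha> (j - 1)" "\<delta> a = \<beta> a" "a \<le> b"
  shows "(\<Sum>j\<in>{a..b}. \<delta> j * F j) = c * (\<Sum>j\<in>{a..b}. \<beta> j * F j) - s * (\<Sum>j\<in>{a..b}. \<alpha> j * F (j + 1))
    + (s * \<alpha> b * F (b + 1) + (1 - c) * \<beta> a * F a)"
proof -
  have neg: "(\<Sum>j\<in>{a..b}. f j) = (\<Sum>j\<in>{-b..-a}. f (- j))" for f :: "int \<Rightarrow> real"
    by (rule sum.reindex_bij_witness[of _ uminus uminus]) auto
  have "(\<Sum>j\<in>{-b..-a}. \<delta> (- j) * F (- j)) = c * (\<Sum>j\<in>{-b..-a}. \<beta> (- j) * F (- j))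
    - s * (\<Sum>j\<in>{-b..-a}. \<alpha> (- j) * F (- (j - 1))) + (s * \<alpha> (- (- b)) * F (- (- b - 1)) + (1 - c) * \<beta> (- (- a)) * F (- (- a)))"
    by (rule sum_level_transfer[where \<alpha> = "\<lambda>j. \<beta> (- j)" and \<beta> = "\<lambda>j. \<alpha> (- j)"])
       (use assms in \<open>auto simp: algebra_simps\<close>)
  then show ?thesis by (simp add: neg[of "\<lambda>j. \<delta> j * F j"] neg[of "\<lambda>j. \<beta> j * F j"] neg[of "\<lambda>j. \<alpha> j * F (j + 1)"] add.commute)
qed

lemma abs_boundary_terms:
  fixes s c :: real
  assumes "0 \<le> s" "1 \<le> c" "\<bar>x\<bar> \<le> \<epsilon>" "\<bar>y\<bar> \<le> \<epsilon>" "\<bar>f\<bar> \<le> 1" "\<bar>g\<bar> \<le> 1"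
  shows "\<bar>s * x * f + (1 - c) * y * g\<bar> \<le> (c + s) * \<epsilon>"
proof -
  have e: "0 \<le> \<epsilon>" using assms by linarith
  have "\<bar>x * f\<bar> \<le> \<epsilon> * 1" "\<bar>y * g\<bar> \<le> \<epsilon> * 1" unfolding abs_mult using assms e by (intro mult_mono; simp)+
  then have "\<bar>s * (x * f)\<bar> \<le> s * \<epsilon>" "\<bar>(1 - c) * (y * g)\<bar> \<le> (c - 1) * \<epsilon>"
    using assms unfolding abs_mult by (auto intro!: mult_mono)
  then have "\<bar>s * (x * f) + (1 - c) * (y * g)\<bar> \<le> s * \<epsilon> + (c - 1) * \<epsilon>" by linarith
  also have "\<dots> \<le> (c + s) * \<epsilon>" using e by (simp add: algebra_simps)
  finally show ?thesis by (simp add: mult.assoc)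
qed

text \<open>The sine transform of the half sums and the cosine transform of the half differences
  form a closed pair, on which the vertical relation acts by a symmetric real matrix. The phase
  \<psi> replaces complex exponentials and is free for choosing the Fourier coefficient
  later.\<close>

lemma fourier_level_transfer:
  fixes \<alpha> \<beta> \<gamma> \<delta> :: "int \<Rightarrow> real" and \<phi> \<psi> :: real
  assumes \<gamma>: "\<And>j. a \<le> j \<Longrightarrow> j < b \<Longrightarrow> \<gamma> j = c * \<alpha> j - s * \<beta> (j + 1)" "\<gamma> b = \<alpha> b"
    and \<delta>: "\<And>j. a < j \<Longrightarrow> j \<le> b \<Longrightarrow> \<delta> j = c * \<beta> j - s * \<alpha> (j - 1)" "\<delta> a = \<beta> a"
    and ab: "a \<le> b" and cs: "0 \<le> s" "1 \<le> c" and \<epsilon>: "\<bar>\<alpha> b\<bar> \<le> \<epsilon>" "\<bar>\<beta> a\<bar> \<le> \<epsilon>"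
  defines "sn \<equiv> \<lambda>j. sin (real_of_int j * \<phi> + \<psi>)" and "cn \<equiv> \<lambda>j. cos (real_of_int j * \<phi> + \<psi>)"
  defines "x \<equiv> \<Sum>j\<in>{a..b}. (\<alpha> j + \<beta> j) / 2 * sn j" and "v \<equiv> \<Sum>j\<in>{a..b}. (\<alpha> j - \<beta> j) / 2 * cn j"
  shows "\<bar>(\<Sum>j\<in>{a..b}. (\<gamma> j + \<delta> j) / 2 * sn j) - ((c - s * cos \<phi>) * x + (- s * sin \<phi>) * v)\<bar> \<le> (c + s) * \<epsilon>"
    and "\<bar>(\<Sum>j\<in>{a..b}. (\<gamma> j - \<delta> j) / 2 * cn j) - ((- s * sin \<phi>) * x + (c + s * cos \<phi>) * v)\<bar> \<le> (c + s) * \<epsilon>"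
proof -
  note G = sum_level_transfer[of a b \<gamma> c \<alpha> s \<beta> sn, OF \<gamma> ab] sum_level_transfer[of a b \<gamma> c \<alpha> s \<beta> cn, OF \<gamma> ab]
  note D = sum_level_transfer'[of a b \<delta> c \<beta> s \<alpha> sn, OF \<delta> ab] sum_level_transfer'[of a b \<delta> c \<beta> s \<alpha> cn, OF \<delta> ab]
  have sn: "sn (j + 1) = sn j * cos \<phi> + cn j * sin \<phi>" "sn (j - 1) = sn j * cos \<phi> - cn j * sin \<phi>" for j
    unfolding sn_def cn_def sin_add[symmetric] sin_diff[symmetric] by (simp_all add: algebra_simps)
  have cn: "cn (j + 1) = cn j * cos \<phi> - sn j * sin \<phi>" "cn (j - 1) = cn j * cos \<phi> + sn j * sin \<phi>" for j
    unfolding sn_def cn_def cos_add[symmetric] cos_diff[symmetric] by (simp_all add: algebra_simps)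
  have bnd: "\<bar>sn j\<bar> \<le> 1" "\<bar>cn j\<bar> \<le> 1" for j by (simp_all add: sn_def cn_def)
  note err = abs_boundary_terms[OF cs]
  define e1 where "e1 = s * \<beta> a * sn (a - 1) + (1 - c) * \<alpha> b * sn b"
  define e2 where "e2 = s * \<alpha> b * sn (b + 1) + (1 - c) * \<beta> a * sn a"
  define e3 where "e3 = s * \<beta> a * cn (a - 1) + (1 - c) * \<alpha> b * cn b"
  define e4 where "e4 = s * \<alpha> b * cn (b + 1) + (1 - c) * \<beta> a * cn a"
  have e: "\<bar>e1\<bar> \<le> (c + s) * \<epsilon>" "\<bar>e2\<bar> \<le> (c + s) * \<epsilon>" "\<bar>e3\<bar> \<le> (c + s) * \<epsilon>" "\<bar>e4\<bar> \<le> (c + s) * \<epsilon>"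
    unfolding e1_def e2_def e3_def e4_def using \<epsilon> bnd by (intro err; simp)+
  have e12: "\<bar>(e1 + e2) / 2\<bar> \<le> (c + s) * \<epsilon>" and e34: "\<bar>(e3 - e4) / 2\<bar> \<le> (c + s) * \<epsilon>"
    using e by (simp_all add: abs_le_iff)
  define as where "as = (\<Sum>j\<in>{a..b}. \<alpha> j * sn j)"
  define ac where "ac = (\<Sum>j\<in>{a..b}. \<alpha> j * cn j)"
  define bs where "bs = (\<Sum>j\<in>{a..b}. \<beta> j * sn j)"
  define bc where "bc = (\<Sum>j\<in>{a..b}. \<beta> j * cn j)"
  have sums: "(\<Sum>j\<in>{a..b}. \<beta> j * sn (j - 1)) = bs * cos \<phi> - bc * sin \<phi>" "(\<Sum>j\<in>{a..b}. \<alpha> j * sn (j + 1)) = as * cos \<phi> + ac * sin \<phi>"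
    "(\<Sum>j\<in>{a..b}. \<beta> j * cn (j - 1)) = bc * cos \<phi> + bs * sin \<phi>" "(\<Sum>j\<in>{a..b}. \<alpha> j * cn (j + 1)) = ac * cos \<phi> - as * sin \<phi>"
    unfolding sn cn as_def ac_def bs_def bc_def
    by (simp_all add: right_diff_distrib distrib_left sum.distrib sum_subtractf sum_distrib_right mult.assoc[symmetric])
  have g: "(\<Sum>j\<in>{a..b}. \<gamma> j * sn j) = c * as - s * (bs * cos \<phi> - bc * sin \<phi>) + e1"
    "(\<Sum>j\<in>{a..b}. \<delta> j * sn j) = c * bs - s * (as * cos \<phi> + ac * sin \<phi>) + e2"
    "(\<Sum>j\<in>{a..b}. \<gamma> j * cn j) = c * ac - s * (bc * cos \<phi> + bs * sin \<phi>) + e3"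
    "(\<Sum>j\<in>{a..b}. \<delta> j * cn j) = c * bc - s * (ac * cos \<phi> - as * sin \<phi>) + e4"
    unfolding sums[symmetric] unfolding e1_def e2_def e3_def e4_def as_def ac_def bs_def bc_def by (rule G D; assumption)+
  have xv: "x = (as + bs) / 2" "v = (ac - bc) / 2"
    unfolding x_def v_def as_def ac_def bs_def bc_def
    by (simp_all add: sum.distrib sum_subtractf sum_divide_distrib[symmetric] algebra_simps add_divide_distrib diff_divide_distrib)
  have "(\<Sum>j\<in>{a..b}. (\<gamma> j + \<delta> j) / 2 * sn j) = ((\<Sum>j\<in>{a..b}. \<gamma> j * sn j) + (\<Sum>j\<in>{a..b}. \<delta> j * sn j)) / 2"
    by (simp add: sum.distrib[symmetric] sum_divide_distrib algebra_simps add_divide_distrib)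
  also have "\<dots> = (c - s * cos \<phi>) * x + (- s * sin \<phi>) * v + (e1 + e2) / 2"
    unfolding g xv by (simp add: field_simps)
  finally have "(\<Sum>j\<in>{a..b}. (\<gamma> j + \<delta> j) / 2 * sn j) - ((c - s * cos \<phi>) * x + (- s * sin \<phi>) * v) = (e1 + e2) / 2"
    by simp
  then show "\<bar>(\<Sum>j\<in>{a..b}. (\<gamma> j + \<delta> j) / 2 * sn j) - ((c - s * cos \<phi>) * x + (- s * sin \<phi>) * v)\<bar> \<le> (c + s) * \<epsilon>"
    using e12 by (simp only:)
  have "(\<Sum>j\<in>{a..b}. (\<gamma> j - \<delta> j) / 2 * cn j) = ((\<Sum>j\<in>{a..b}. \<gamma> j * cn j) - (\<Sum>j\<in>{a..b}. \<delta> j * cn j)) / 2"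
    by (simp add: sum_subtractf[symmetric] sum_divide_distrib algebra_simps diff_divide_distrib)
  also have "\<dots> = (- s * sin \<phi>) * x + (c + s * cos \<phi>) * v + (e3 - e4) / 2"
    unfolding g xv by (simp add: field_simps)
  finally have "(\<Sum>j\<in>{a..b}. (\<gamma> j - \<delta> j) / 2 * cn j) - ((- s * sin \<phi>) * x + (c + s * cos \<phi>) * v) = (e3 - e4) / 2"
    by simp
  then show "\<bar>(\<Sum>j\<in>{a..b}. (\<gamma> j - \<delta> j) / 2 * cn j) - ((- s * sin \<phi>) * x + (c + s * cos \<phi>) * v)\<bar> \<le> (c + s) * \<epsilon>"
    using e34 by (simp only:)
qed

text \<open>
  The entries of the symmetrized transfer matrix \<open>N\<close> of one column; its powers are
  \<open>N ^ m = cheb T m * N - cheb T (m - 1)\<close>, where \<open>T\<close> is the trace, since \<open>det N = 1\<close>.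
\<close>

fun cheb :: "real \<Rightarrow> nat \<Rightarrow> real" where
  "cheb T 0 = 0"
| "cheb T (Suc 0) = 1"
| "cheb T (Suc (Suc m)) = T * cheb T (Suc m) - cheb T m"

definition "N11 t \<phi> = (cosh2 t - sinh2 t * cos \<phi>) / t"
definition "N12 t \<phi> = - sinh2 t * sin \<phi>"
definition "N22 t \<phi> = t * (cosh2 t + sinh2 t * cos \<phi>)"
definition "trc t \<phi> = N11 t \<phi> + N22 t \<phi>"

text \<open>The matrix \<open>W\<close> leads from the left corners in column 0 to the right corners
  in column \<open>m\<close>: \<open>m + 1\<close> vertical factors alternate with \<open>m\<close>
  horizontal ones. Splitting square roots of the horizontal factor off turns it into the power
  \<open>m + 1\<close> of \<open>N\<close>; the factors \<open>t\<close> and \<open>1 / t\<close>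
  are what remains at the two ends.\<close>

definition "E11 t m \<phi> = cheb (trc t \<phi>) (Suc m) * N11 t \<phi> - cheb (trc t \<phi>) m"
definition "W11 t m \<phi> = t * E11 t m \<phi>"
definition "W12 t m \<phi> = cheb (trc t \<phi>) (Suc m) * N12 t \<phi>"
definition "W22 t m \<phi> = (cheb (trc t \<phi>) (Suc m) * N22 t \<phi> - cheb (trc t \<phi>) m) / t"

lemma det_N:
  assumes "0 < t" "t < 1"
  shows "N11 t \<phi> * N22 t \<phi> - (N12 t \<phi>)\<^sup>2 = 1"
proof -
  have "N11 t \<phi> * N22 t \<phi> = (cosh2 t - sinh2 t * cos \<phi>) * (cosh2 t + sinh2 t * cos \<phi>)"
    using assms by (simp add: N11_def N22_def)
  moreover have "(cos \<phi>)\<^sup>2 + (sin \<phi>)\<^sup>2 = 1" by simp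
  ultimately show ?thesis using cosh2_sinh2(1)[OF assms] unfolding N12_def by algebra
qed

lemma cheb_det: "(cheb T (Suc m))\<^sup>2 - T * cheb T (Suc m) * cheb T m + (cheb T m)\<^sup>2 = 1"
proof (induction m)
  case (Suc m)
  have "cheb T (Suc (Suc m)) = T * cheb T (Suc m) - cheb T m" by simp
  with Suc show ?case by algebra
qed simp

lemma det_W:
  assumes "0 < t" "t < 1"
  shows "W11 t m \<phi> * W22 t m \<phi> - (W12 t m \<phi>)\<^sup>2 = 1"
proof -
  let ?S = "cheb (trc t \<phi>) (Suc m)" and ?S' = "cheb (trc t \<phi>) m"
  have "W11 t m \<phi> * W22 t m \<phi> = (?S * N11 t \<phi> - ?S') * (?S * N22 t \<phi> - ?S')"
    using assms by (simp add: W11_def W22_def E11_def)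
  moreover have "trc t \<phi> = N11 t \<phi> + N22 t \<phi>" by (simp add: trc_def)
  ultimately show ?thesis using det_N[OF assms, of \<phi>] cheb_det[of "trc t \<phi>" m] unfolding W12_def by algebra
qed

lemma W_step:
  assumes "0 < t" "t < 1"
  shows "W11 t (Suc m) \<phi> = N11 t \<phi> * W11 t m \<phi> + t * N12 t \<phi> * W12 t m \<phi>"
    and "W12 t (Suc m) \<phi> = N11 t \<phi> * W12 t m \<phi> + t * N12 t \<phi> * W22 t m \<phi>"
    and "W12 t (Suc m) \<phi> = N12 t \<phi> / t * W11 t m \<phi> + N22 t \<phi> * W12 t m \<phi>"
    and "W22 t (Suc m) \<phi> = N12 t \<phi> / t * W12 t m \<phi> + N22 t \<phi> * W22 t m \<phi>"
proof -
  define S where "S = cheb (trc t \<phi>) (Suc m)"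
  define S' where "S' = cheb (trc t \<phi>) m"
  have S2: "cheb (trc t \<phi>) (Suc (Suc m)) = (N11 t \<phi> + N22 t \<phi>) * S - S'" by (simp add: trc_def S_def S'_def)
  note d = det_N[OF assms, of \<phi>]
  have *: "((N11 t \<phi> + N22 t \<phi>) * S - S') * N11 t \<phi> - S = N11 t \<phi> * (S * N11 t \<phi> - S') + N12 t \<phi> * (S * N12 t \<phi>)"
    "((N11 t \<phi> + N22 t \<phi>) * S - S') * N22 t \<phi> - S = N12 t \<phi> * (S * N12 t \<phi>) + N22 t \<phi> * (S * N22 t \<phi> - S')"
    using d by algebra+
  show "W11 t (Suc m) \<phi> = N11 t \<phi> * W11 t m \<phi> + t * N12 t \<phi> * W12 t m \<phi>"
    unfolding W11_def W12_def E11_def S2 S_def[symmetric] S'_def[symmetric] * by (simp add: algebra_simps)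
  show "W22 t (Suc m) \<phi> = N12 t \<phi> / t * W12 t m \<phi> + N22 t \<phi> * W22 t m \<phi>"
    unfolding W22_def W12_def S2 S_def[symmetric] S'_def[symmetric] * by (simp add: add_divide_distrib)
  show "W12 t (Suc m) \<phi> = N11 t \<phi> * W12 t m \<phi> + t * N12 t \<phi> * W22 t m \<phi>"
    unfolding W22_def W12_def S2 S_def[symmetric] S'_def[symmetric] using assms by (simp add: field_simps)
  show "W12 t (Suc m) \<phi> = N12 t \<phi> / t * W11 t m \<phi> + N22 t \<phi> * W12 t m \<phi>"
    unfolding W11_def W12_def E11_def S2 S_def[symmetric] S'_def[symmetric] using assms by (simp add: field_simps)
qed

lemma N_bounds:
  assumes "0 < t" "t < 1"
  defines "B \<equiv> (cosh2 t + sinh2 t) / t"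
  shows "\<bar>N11 t \<phi>\<bar> \<le> B" "\<bar>t * N12 t \<phi>\<bar> \<le> B" "\<bar>N12 t \<phi> / t\<bar> \<le> B" "\<bar>N22 t \<phi>\<bar> \<le> B"
    "\<bar>N12 t \<phi>\<bar> \<le> B" "\<bar>trc t \<phi>\<bar> \<le> 2 * B"
proof -
  have t2: "1 - t\<^sup>2 > 0" using assms by (simp add: power_less_one_iff abs_square_less_1)
  have cs: "cosh2 t \<ge> 1" "sinh2 t > 0" using t2 assms by (simp_all add: cosh2_def sinh2_def le_divide_eq)
  have s: "\<bar>sinh2 t * x\<bar> \<le> sinh2 t" if "\<bar>x\<bar> \<le> 1" for x
    using cs that by (simp add: abs_mult mult_le_cancel_left1)
  have cs1: "\<bar>sinh2 t * cos \<phi>\<bar> \<le> sinh2 t" "\<bar>sinh2 t * sin \<phi>\<bar> \<le> sinh2 t" by (rule s, simp)+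
  have t1: "\<bar>t * x\<bar> \<le> \<bar>x\<bar> / t" "\<bar>x\<bar> \<le> \<bar>x\<bar> / t" for x
  proof -
    have "\<bar>t * x\<bar> \<le> \<bar>x\<bar>" using assms by (simp add: abs_mult mult_left_le_one_le)
    moreover show "\<bar>x\<bar> \<le> \<bar>x\<bar> / t" using assms by (simp add: le_divide_eq mult_left_le)
    ultimately show "\<bar>t * x\<bar> \<le> \<bar>x\<bar> / t" by linarith
  qed
  have le: "\<bar>x\<bar> / t \<le> B" if "\<bar>x\<bar> \<le> cosh2 t + sinh2 t" for x
    unfolding B_def using that assms by (intro divide_right_mono) auto
  have "\<bar>N12 t \<phi>\<bar> = \<bar>sinh2 t * sin \<phi>\<bar>" by (simp add: N12_def abs_mult)
  then have n12: "\<bar>N12 t \<phi>\<bar> \<le> cosh2 t + sinh2 t" using cs cs1 by linarith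
  show 1: "\<bar>N11 t \<phi>\<bar> \<le> B" unfolding N11_def using assms le[of "cosh2 t - sinh2 t * cos \<phi>"] cs cs1 by simp
  show "\<bar>t * N12 t \<phi>\<bar> \<le> B" "\<bar>N12 t \<phi>\<bar> \<le> B" using t1[of "N12 t \<phi>"] le[OF n12] by linarith+
  show "\<bar>N12 t \<phi> / t\<bar> \<le> B" using le[OF n12] assms by simp
  show 2: "\<bar>N22 t \<phi>\<bar> \<le> B"
    unfolding N22_def using t1(1)[of "cosh2 t + sinh2 t * cos \<phi>"] le[of "cosh2 t + sinh2 t * cos \<phi>"] cs cs1 by linarith
  show "\<bar>trc t \<phi>\<bar> \<le> 2 * B" unfolding trc_def using 1 2 by linarith
qed

lemma cheb_bound:
  assumes "\<bar>T\<bar> \<le> K"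
  shows "\<bar>cheb T m\<bar> \<le> (K + 1) ^ m \<and> \<bar>cheb T (Suc m)\<bar> \<le> (K + 1) ^ Suc m"
proof (induction m)
  case (Suc m)
  have K: "0 \<le> K" using assms by linarith
  have "\<bar>T * cheb T (Suc m)\<bar> \<le> K * (K + 1) ^ Suc m"
    unfolding abs_mult using Suc assms K by (intro mult_mono) auto
  moreover have "(K + 1) ^ m \<le> (K + 1) ^ Suc m" using K by (intro power_increasing) auto
  ultimately have "\<bar>cheb T (Suc (Suc m))\<bar> \<le> K * (K + 1) ^ Suc m + (K + 1) ^ Suc m"
    using Suc unfolding cheb.simps(3) by linarith
  also have "\<dots> = (K + 1) ^ Suc (Suc m)" by (simp add: algebra_simps)
  finally show ?case using Suc by simp
qed (use assms in auto)

lemma W12_bound: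
  assumes "0 < t" "t < 1"
  obtains C where "C \<ge> 0" "\<And>\<phi>. \<bar>W12 t n \<phi>\<bar> \<le> C"
proof -
  define B where "B = (cosh2 t + sinh2 t) / t"
  have B: "B \<ge> 0" using N_bounds(1)[OF assms, of 0] by (simp add: B_def)
  have "\<bar>W12 t n \<phi>\<bar> \<le> (2 * B + 1) ^ Suc n * B" for \<phi>
    unfolding W12_def abs_mult
    using cheb_bound[of "trc t \<phi>" "2 * B" n] N_bounds(5,6)[OF assms, of \<phi>] B
    by (intro mult_mono) (auto simp: B_def)
  with that[of "(2 * B + 1) ^ Suc n * B"] B show ?thesis by simp
qed

context grid_model
begin

definition "P1 \<phi> \<psi> i = (\<Sum>j\<in>{- int M..int M'}. (NW i j + SW i j) / 2 * sin (real_of_int j * \<phi> + \<psi>))"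
definition "P2 \<phi> \<psi> i = (\<Sum>j\<in>{- int M..int M'}. (NW i j - SW i j) / 2 * cos (real_of_int j * \<phi> + \<psi>))"
definition "Q1 \<phi> \<psi> i = (\<Sum>j\<in>{- int M..int M'}. (NE i j + SE i j) / 2 * sin (real_of_int j * \<phi> + \<psi>))"
definition "Q2 \<phi> \<psi> i = (\<Sum>j\<in>{- int M..int M'}. (NE i j - SE i j) / 2 * cos (real_of_int j * \<phi> + \<psi>))"

lemma Q_of_P:
  assumes i: "0 \<le> i" "i \<le> int n" and \<epsilon>: "\<bar>G (i, int M')\<bar> \<le> \<epsilon>" "\<bar>G (i, - int M)\<bar> \<le> \<epsilon>"
  shows "\<bar>Q1 \<phi> \<psi> i - (t * N11 t \<phi> * P1 \<phi> \<psi> i + N12 t \<phi> * P2 \<phi> \<psi> i)\<bar> \<le> (c + s) * \<epsilon>"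
    and "\<bar>Q2 \<phi> \<psi> i - (N12 t \<phi> * P1 \<phi> \<psi> i + N22 t \<phi> / t * P2 \<phi> \<psi> i)\<bar> \<le> (c + s) * \<epsilon>"
proof -
  have N: "t * N11 t \<phi> = c - s * cos \<phi>" "N12 t \<phi> = - s * sin \<phi>" "N22 t \<phi> / t = c + s * cos \<phi>"
    using t by (simp_all add: N11_def N12_def N22_def)
  have "\<bar>NW i (int M')\<bar> \<le> \<epsilon>" "\<bar>SW i (- int M)\<bar> \<le> \<epsilon>"
    using corners_vertical(4,6)[OF i] \<epsilon> by simp_all
  note * = fourier_level_transfer[where a = "- int M" and b = "int M'" and \<alpha> = "NW i" and \<beta> = "SW i"
    and \<gamma> = "NE i" and \<delta> = "SE i" and c = c and s = s and \<phi> = \<phi> and \<psi> = \<psi>, OF corners_vertical(1)[OF i] corners_vertical(3)[OF i]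
    corners_vertical(2)[OF i] corners_vertical(5)[OF i] _ _ c_ge_1 this]
  show "\<bar>Q1 \<phi> \<psi> i - (t * N11 t \<phi> * P1 \<phi> \<psi> i + N12 t \<phi> * P2 \<phi> \<psi> i)\<bar> \<le> (c + s) * \<epsilon>"
    unfolding N Q1_def P1_def P2_def by (rule *(1)) (use s_pos in auto)
  show "\<bar>Q2 \<phi> \<psi> i - (N12 t \<phi> * P1 \<phi> \<psi> i + N22 t \<phi> / t * P2 \<phi> \<psi> i)\<bar> \<le> (c + s) * \<epsilon>"
    unfolding N Q2_def P1_def P2_def by (rule *(2)) (use s_pos in auto)
qed

lemma P_of_Q:
  assumes "0 \<le> i" "i < int n"
  shows "P1 \<phi> \<psi> (i + 1) = Q1 \<phi> \<psi> i / t" "P2 \<phi> \<psi> (i + 1) = Q2 \<phi> \<psi> i * t"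
  unfolding P1_def P2_def Q1_def Q2_def sum_divide_distrib sum_distrib_right
  by (intro sum.cong refl; simp add: corners_horizontal[OF assms])+

text \<open>Each column multiplies the accumulated error by a matrix with entries at most
  \<open>B\<close> and adds a new boundary error. The resulting constant depends on the width alone,
  while \<epsilon> vanishes with growing height.\<close>

lemma Q_eq_W_P:
  assumes \<epsilon>: "\<And>i. 0 \<le> i \<Longrightarrow> i \<le> int n \<Longrightarrow> \<bar>G (i, int M')\<bar> \<le> \<epsilon> \<and> \<bar>G (i, - int M)\<bar> \<le> \<epsilon>"
  defines "B \<equiv> (c + s) / t"
  shows "i \<le> n \<Longrightarrow> \<bar>Q1 \<phi> \<psi> (int i) - (W11 t i \<phi> * P1 \<phi> \<psi> 0 + W12 t i \<phi> * P2 \<phi> \<psi> 0)\<bar> \<le> (2 * B + 1) ^ Suc i * (c + s) * \<epsilon> \<and>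
    \<bar>Q2 \<phi> \<psi> (int i) - (W12 t i \<phi> * P1 \<phi> \<psi> 0 + W22 t i \<phi> * P2 \<phi> \<psi> 0)\<bar> \<le> (2 * B + 1) ^ Suc i * (c + s) * \<epsilon>"
proof (induction i)
  case 0
  have B: "B \<ge> 0" using N_bounds(1)[OF t, of 0] by (simp add: B_def)
  have \<epsilon>0: "\<epsilon> \<ge> 0" using \<epsilon>[of 0] by auto
  have "(c + s) * \<epsilon> \<le> (2 * B + 1) * ((c + s) * \<epsilon>)" using B \<epsilon>0 c_ge_1 s_pos by (simp add: algebra_simps)
  moreover have "W11 t 0 \<phi> = t * N11 t \<phi>" "W12 t 0 \<phi> = N12 t \<phi>" "W22 t 0 \<phi> = N22 t \<phi> / t"
    by (simp_all add: W11_def E11_def W12_def W22_def)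
  ultimately show ?case using Q_of_P[of 0 \<epsilon> \<phi> \<psi>] \<epsilon>[of 0] by (auto simp: mult.assoc)
next
  case (Suc i)
  have B: "B \<ge> 0" using N_bounds(1)[OF t, of 0] by (simp add: B_def)
  have \<epsilon>0: "\<epsilon> \<ge> 0" using \<epsilon>[of 0] by auto
  define K where "K = (2 * B + 1) ^ Suc i * (c + s) * \<epsilon>"
  define e1 where "e1 = Q1 \<phi> \<psi> (int i) - (W11 t i \<phi> * P1 \<phi> \<psi> 0 + W12 t i \<phi> * P2 \<phi> \<psi> 0)"
  define e2 where "e2 = Q2 \<phi> \<psi> (int i) - (W12 t i \<phi> * P1 \<phi> \<psi> 0 + W22 t i \<phi> * P2 \<phi> \<psi> 0)"
  have e: "\<bar>e1\<bar> \<le> K" "\<bar>e2\<bar> \<le> K" using Suc by (auto simp: e1_def e2_def K_def)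
  have K0: "0 \<le> K" using e by linarith
  have i: "0 \<le> int i" "int i < int n" using Suc by auto
  have P: "P1 \<phi> \<psi> (int (Suc i)) = Q1 \<phi> \<psi> (int i) / t" "P2 \<phi> \<psi> (int (Suc i)) = Q2 \<phi> \<psi> (int i) * t"
    using P_of_Q[OF i] by (simp_all add: add.commute)
  have tt: "t * N11 t \<phi> * (x / t) = N11 t \<phi> * x" "N12 t \<phi> * (x * t) = t * N12 t \<phi> * x"
    "N12 t \<phi> * (x / t) = N12 t \<phi> / t * x" "N22 t \<phi> / t * (x * t) = N22 t \<phi> * x" for x
    using t by simp_all
  define h1 where "h1 = Q1 \<phi> \<psi> (int (Suc i)) - (N11 t \<phi> * Q1 \<phi> \<psi> (int i) + t * N12 t \<phi> * Q2 \<phi> \<psi> (int i))"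
  define h2 where "h2 = Q2 \<phi> \<psi> (int (Suc i)) - (N12 t \<phi> / t * Q1 \<phi> \<psi> (int i) + N22 t \<phi> * Q2 \<phi> \<psi> (int i))"
  have h: "\<bar>h1\<bar> \<le> (c + s) * \<epsilon>" "\<bar>h2\<bar> \<le> (c + s) * \<epsilon>"
    using Q_of_P[of "int (Suc i)" \<epsilon> \<phi> \<psi>] \<epsilon>[of "int (Suc i)"] Suc.prems unfolding P tt h1_def h2_def by auto
  have prod: "\<bar>x * y\<bar> \<le> B * K" if "\<bar>x\<bar> \<le> B" "\<bar>y\<bar> \<le> K" for x y
    unfolding abs_mult using that B by (intro mult_mono) auto
  note N = N_bounds[OF t, of \<phi>, folded B_def]
  have K1: "2 * (B * K) + (c + s) * \<epsilon> \<le> (2 * B + 1) ^ Suc (Suc i) * (c + s) * \<epsilon>"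
  proof -
    have "1 \<le> (2 * B + 1) ^ Suc i" using B by (intro one_le_power) auto
    then have "1 * ((c + s) * \<epsilon>) \<le> (2 * B + 1) ^ Suc i * ((c + s) * \<epsilon>)"
      using c_ge_1 s_pos \<epsilon>0 by (intro mult_right_mono) auto
    then have "(c + s) * \<epsilon> \<le> K" by (simp add: K_def mult.assoc)
    moreover have "(2 * B + 1) ^ Suc (Suc i) * (c + s) * \<epsilon> = 2 * (B * K) + K" by (simp add: K_def algebra_simps)
    ultimately show ?thesis by linarith
  qed
  have "Q1 \<phi> \<psi> (int (Suc i)) - (W11 t (Suc i) \<phi> * P1 \<phi> \<psi> 0 + W12 t (Suc i) \<phi> * P2 \<phi> \<psi> 0) =
      N11 t \<phi> * e1 + t * N12 t \<phi> * e2 + h1"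
    unfolding W_step(1,2)[OF t] e1_def e2_def h1_def by (simp add: algebra_simps)
  moreover have "Q2 \<phi> \<psi> (int (Suc i)) - (W12 t (Suc i) \<phi> * P1 \<phi> \<psi> 0 + W22 t (Suc i) \<phi> * P2 \<phi> \<psi> 0) =
      N12 t \<phi> / t * e1 + N22 t \<phi> * e2 + h2"
    unfolding W_step(3,4)[OF t] e1_def e2_def h2_def by (simp add: algebra_simps)
  ultimately show ?case
    using prod[OF N(1) e(1)] prod[OF N(2) e(2)] prod[OF N(3) e(1)] prod[OF N(4) e(2)] h K1 by linarith
qed

end

text \<open>
  The exact solution: up to boundary terms that vanish as the height of the grid grows, the
  Fourier series of the correlations along the two long sides are \<open>1 / W11\<close> and \<open>- W12 / W11\<close>.
\<close>

theorem grid_fourier: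
  assumes t: "0 < t" "t < 1" and W: "\<And>\<phi>. W11 t n \<phi> \<ge> t"
  obtains C where "C \<ge> 0"
    "\<forall>M M' \<epsilon> \<phi> \<psi>. (\<forall>i. 0 \<le> i \<and> i \<le> int n \<longrightarrow>
        \<bar>two_point t (grid n M M') (0, 0) (i, int M')\<bar> \<le> \<epsilon> \<and> \<bar>two_point t (grid n M M') (0, 0) (i, - int M)\<bar> \<le> \<epsilon>) \<longrightarrow>
      \<bar>(\<Sum>j\<in>{- int M..int M'}. two_point t (grid n M M') (0, 0) (int n, j) * cos (real_of_int j * \<phi> + \<psi>)) - cos \<psi> / W11 t n \<phi>\<bar> \<le> C * \<epsilon> \<and>
      \<bar>(\<Sum>j\<in>{- int M..int M'}. sgn (real_of_int j) * two_point t (grid n M M') (0, 0) (0, j) * sin (real_of_int j * \<phi> + \<psi>))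
         - - cos \<psi> * W12 t n \<phi> / W11 t n \<phi>\<bar> \<le> C * \<epsilon>"
proof -
  obtain D where D: "D \<ge> 0" "\<And>\<phi>. \<bar>W12 t n \<phi>\<bar> \<le> D" using W12_bound[OF t] by blast
  define c where "c = cosh2 t" define s where "s = sinh2 t"
  define B where "B = (c + s) / t"
  define K where "K = (2 * B + 1) ^ Suc n * (c + s)"
  have t2: "1 - t\<^sup>2 > 0" using t by (simp add: power_less_one_iff abs_square_less_1)
  have cs: "c \<ge> 1" "s > 0" using t2 t by (simp_all add: c_def s_def cosh2_def sinh2_def le_divide_eq)
  have K: "K \<ge> 0" using cs t by (simp add: K_def B_def)
  define C where "C = K + D * K / t + K / t"
  have C: "C \<ge> 0" using K D t by (simp add: C_def)
  show ?thesis
  proof (rule that[OF C], intro allI impI)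
    fix M M' :: nat and \<epsilon> \<phi> \<psi> :: real
    interpret grid_model n M M' t by standard (rule t)+
    assume "\<forall>i. 0 \<le> i \<and> i \<le> int n \<longrightarrow> \<bar>G (i, int M')\<bar> \<le> \<epsilon> \<and> \<bar>G (i, - int M)\<bar> \<le> \<epsilon>"
    then have \<epsilon>: "\<bar>G (i, int M')\<bar> \<le> \<epsilon> \<and> \<bar>G (i, - int M)\<bar> \<le> \<epsilon>" if "0 \<le> i" "i \<le> int n" for i
      using that by blast
    have \<epsilon>0: "\<epsilon> \<ge> 0" using \<epsilon>[of 0] by auto
    define e1 where "e1 = Q1 \<phi> \<psi> (int n) - (W11 t n \<phi> * P1 \<phi> \<psi> 0 + W12 t n \<phi> * P2 \<phi> \<psi> 0)"
    define e2 where "e2 = Q2 \<phi> \<psi> (int n) - (W12 t n \<phi> * P1 \<phi> \<psi> 0 + W22 t n \<phi> * P2 \<phi> \<psi> 0)"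
    have e: "\<bar>e1\<bar> \<le> K * \<epsilon>" "\<bar>e2\<bar> \<le> K * \<epsilon>"
      using Q_eq_W_P[OF \<epsilon>, of n \<phi> \<psi>] by (simp_all add: e1_def e2_def K_def B_def c_def s_def)
    \<comment> \<open>Only row 0 contributes: this is the source.\<close>
    have "P2 \<phi> \<psi> 0 = (\<Sum>j\<in>{- int M..int M'}. if j = 0 then cos \<psi> else 0)"
      unfolding P2_def corners_left by (intro sum.cong) auto
    then have P2: "P2 \<phi> \<psi> 0 = cos \<psi>" by simp
    have Q1: "Q1 \<phi> \<psi> (int n) = 0" by (simp add: Q1_def corners_right)
    let ?g = "\<Sum>j\<in>{- int M..int M'}. G (int n, j) * cos (real_of_int j * \<phi> + \<psi>)"
    let ?h = "\<Sum>j\<in>{- int M..int M'}. sgn (real_of_int j) * G (0, j) * sin (real_of_int j * \<phi> + \<psi>)"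
    have Q2: "Q2 \<phi> \<psi> (int n) = ?g" by (simp add: Q2_def corners_right)
    have P1: "P1 \<phi> \<psi> 0 = ?h" unfolding P1_def corners_left by (intro sum.cong) auto
    define w where "w = W11 t n \<phi>"
    have w: "w \<ge> t" "w > 0" using W[of \<phi>] t by (simp_all add: w_def)
    define g where "g = ?g" define h where "h = ?h"
    define a where "a = W12 t n \<phi>" define d where "d = W22 t n \<phi>"
    have 1: "w * h = - cos \<psi> * a - e1"
      \<comment> \<open>The condition on the right side makes the first equation determine the
        unknown left sum \<open>h\<close>. Inserting it into the second one leaves
        \<open>W11 * W22 - W12^2 = 1\<close> in the numerator.\<close>
      using e1_def unfolding Q1 P2 P1 h_def[symmetric] w_def[symmetric] a_def[symmetric] by simp
    then have h: "h = (- cos \<psi> * a) / w - e1 / w" using w by (simp add: field_simps)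
    have "w * d = 1 + a * a" using det_W[OF t, of n \<phi>] by (simp add: w_def a_def d_def power2_eq_square)
    moreover have "e2 = g - (a * h + d * cos \<psi>)"
      using e2_def unfolding Q2 P2 P1 h_def[symmetric] g_def[symmetric] a_def[symmetric] d_def[symmetric] by simp
    ultimately have "w * g = cos \<psi> + w * e2 - a * e1" using 1 by algebra
    then have g: "g = cos \<psi> / w + (e2 - a * (e1 / w))" using w by (simp add: field_simps)
    have ew: "\<bar>e1 / w\<bar> \<le> K * \<epsilon> / t"
      unfolding abs_divide using e w t by (intro frac_le) auto
    have "\<bar>W12 t n \<phi> * (e1 / w)\<bar> \<le> D * (K * \<epsilon> / t)"
      unfolding abs_mult[of "W12 t n \<phi>"] using ew D by (intro mult_mono) auto
    moreover have "C * \<epsilon> = K * \<epsilon> + D * (K * \<epsilon> / t) + K * \<epsilon> / t" by (simp add: C_def algebra_simps)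
    moreover have "0 \<le> D * (K * \<epsilon> / t)" "0 \<le> K * \<epsilon> / t" "0 \<le> K * \<epsilon>" using D K t \<epsilon>0 by auto
    ultimately show "\<bar>?g - cos \<psi> / W11 t n \<phi>\<bar> \<le> C * \<epsilon> \<and> \<bar>?h - - cos \<psi> * W12 t n \<phi> / W11 t n \<phi>\<bar> \<le> C * \<epsilon>"
      using g h e ew unfolding w_def[symmetric] a_def[symmetric] g_def[symmetric] h_def[symmetric] by linarith
  qed
qed

section \<open>Fourier integrals\<close>

lemma sin_ge_quarter:
  assumes "0 \<le> x" "x \<le> pi / 2"
  shows "sin x \<ge> x / 4"
proof (cases "x \<le> pi / 3")
  case True
  show ?thesis
  proof (cases "x = 0")
    case False
    then have "0 < x" using assms by simp
    then obtain z where z: "0 < z" "z < x" "sin x - sin 0 = (x - 0) * cos z"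
      using MVT2[of 0 x sin cos] by (auto intro: DERIV_sin)
    have "cos (pi / 3) \<le> cos z" using z True pi_gt_zero by (intro cos_monotone_0_pi_le) auto
    then have "1 / 2 \<le> cos z" by (simp add: cos_60)
    then have "x * (1 / 2) \<le> x * cos z" using assms by (intro mult_left_mono) auto
    then show ?thesis using z assms by simp
  qed simp
next
  case False
  have "sin (pi / 6) \<le> sin x" using False assms pi_gt_zero by (intro sin_monotone_2pi_le) auto
  then have "1 / 2 \<le> sin x" by (simp add: sin_30)
  then show ?thesis using assms pi_less_4 by simp
qed

lemma one_minus_cos_bounds:
  assumes "\<bar>x\<bar> \<le> pi"
  shows "x\<^sup>2 / 32 \<le> 1 - cos x" "1 - cos x \<le> x\<^sup>2 / 2"
proof -
  have eq: "1 - cos x = 2 * (sin (\<bar>x\<bar> / 2))\<^sup>2"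
    using cos_double_sin[of "\<bar>x\<bar> / 2"] by simp
  have "\<bar>x\<bar> / 8 \<le> sin (\<bar>x\<bar> / 2)" using sin_ge_quarter[of "\<bar>x\<bar> / 2"] assms by simp
  then have "(\<bar>x\<bar> / 8)\<^sup>2 \<le> (sin (\<bar>x\<bar> / 2))\<^sup>2" by (intro power_mono) auto
  then show "x\<^sup>2 / 32 \<le> 1 - cos x" by (simp add: eq power_divide)
  have "\<bar>sin (\<bar>x\<bar> / 2)\<bar> \<le> \<bar>\<bar>x\<bar> / 2\<bar>" by (rule abs_sin_x_le_abs_x)
  then have "(sin (\<bar>x\<bar> / 2))\<^sup>2 \<le> (\<bar>x\<bar> / 2)\<^sup>2" by (metis abs_le_square_iff)
  then show "1 - cos x \<le> x\<^sup>2 / 2" by (simp add: eq power_divide)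
qed

lemma integral_cos_int:
  "((\<lambda>x. cos (real_of_int k * x)) has_integral (if k = 0 then 2 * pi else 0)) {-pi..pi}"
proof (cases "k = 0")
  case True
  then show ?thesis using has_integral_const_real[of "1::real" "-pi" pi] by simp
next
  case False
  have "((\<lambda>x. cos (real_of_int k * x)) has_integral (sin (real_of_int k * pi) / k - sin (real_of_int k * - pi) / k)) {-pi..pi}"
  proof (rule fundamental_theorem_of_calculus)
    fix x assume "x \<in> {-pi..pi}"
    show "((\<lambda>x. sin (real_of_int k * x) / k) has_vector_derivative cos (real_of_int k * x)) (at x within {-pi..pi})"
      using False by (auto simp flip: has_real_derivative_iff_has_vector_derivative intro!: derivative_eq_intros)
  qed simp
  moreover have "sin (real_of_int k * pi) = 0" using sin_npi_int[of k] by (simp add: mult.commute)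
  ultimately show ?thesis using False by simp
qed

lemma integral_sin_sin:
  "integral {-pi..pi} (\<lambda>x. sin x * sin (real (Suc l) * x)) = (if l = 0 then pi else 0)"
proof -
  have "((\<lambda>x. (cos (real_of_int (int l) * x) - cos (real_of_int (int l + 2) * x)) / 2) has_integral
      ((if int l = 0 then 2 * pi else 0) - (if int l + 2 = 0 then 2 * pi else 0)) / 2) {-pi..pi}"
    by (intro has_integral_divide has_integral_diff integral_cos_int)
  moreover have "(cos (real_of_int (int l) * x) - cos (real_of_int (int l + 2) * x)) / 2 = sin x * sin (real (Suc l) * x)" for x
    using cos_diff[of "real (Suc l) * x" x] cos_add[of "real (Suc l) * x" x] by (simp add: algebra_simps)
  ultimately show ?thesis by (auto dest: integral_unique)
qed

text \<open>As a function of \<open>l\<close> the integral satisfies the recurrence solved by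
  \<open>exp (l * g)\<close> and \<open>exp (- l * g)\<close>, and being bounded it has no growing
  component.\<close>

lemma poisson_integral:
  fixes g :: real
  assumes g: "g > 0" and l: "l \<ge> 1"
  shows "integral {-pi..pi} (\<lambda>x. sin (real l * x) * sin x / (cosh g - cos x)) = 2 * pi * exp (- real l * g)"
proof -
  have ch: "cosh g > 1" using g cosh_real_strict_mono[of 0 g] by simp
  have pos: "cosh g - cos x > 0" for x using ch cos_le_one[of x] by linarith
  define F where "F l = integral {-pi..pi} (\<lambda>x. sin (real l * x) * sin x / (cosh g - cos x))" for l :: nat
  have int: "(\<lambda>x. sin (real l * x) * sin x / (cosh g - cos x)) integrable_on {-pi..pi}" for l :: nat
    using pos by (intro integrable_continuous_interval continuous_intros) (auto simp: less_imp_neq[symmetric] dest: less_imp_neq)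
  have rec: "F (Suc (Suc l)) - 2 * cosh g * F (Suc l) + F l = - 2 * (if l = 0 then pi else 0)" for l
  proof -
    have "F (Suc (Suc l)) - 2 * cosh g * F (Suc l) + F l =
      integral {-pi..pi} (\<lambda>x. sin (real (Suc (Suc l)) * x) * sin x / (cosh g - cos x)
        - 2 * cosh g * (sin (real (Suc l) * x) * sin x / (cosh g - cos x)) + sin (real l * x) * sin x / (cosh g - cos x))"
    proof (rule integral_unique[symmetric])
      have HI: "((\<lambda>x. sin (real l * x) * sin x / (cosh g - cos x)) has_integral F l) {-pi..pi}" for l
        unfolding F_def using int by (rule integrable_integral)
      show "((\<lambda>x. sin (real (Suc (Suc l)) * x) * sin x / (cosh g - cos x)
        - 2 * cosh g * (sin (real (Suc l) * x) * sin x / (cosh g - cos x)) + sin (real l * x) * sin x / (cosh g - cos x))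
        has_integral F (Suc (Suc l)) - 2 * cosh g * F (Suc l) + F l) {-pi..pi}"
        by (intro has_integral_add has_integral_diff has_integral_mult_right HI)
    qed
    also have "\<dots> = integral {-pi..pi} (\<lambda>x. - 2 * (sin x * sin (real (Suc l) * x)))"
    proof (rule Henstock_Kurzweil_Integration.integral_cong)
      fix x :: real
      have s: "sin (real (Suc (Suc l)) * x) + sin (real l * x) = 2 * cos x * sin (real (Suc l) * x)"
        using sin_add[of "real (Suc l) * x" x] sin_diff[of "real (Suc l) * x" x] by (simp add: algebra_simps)
      define D where "D = cosh g - cos x"
      have D: "D \<noteq> 0" using pos[of x] by (simp add: D_def)
      have "sin (real (Suc (Suc l)) * x) * sin x / D - 2 * cosh g * (sin (real (Suc l) * x) * sin x / D) + sin (real l * x) * sin x / D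
        = ((sin (real (Suc (Suc l)) * x) + sin (real l * x)) - 2 * cosh g * sin (real (Suc l) * x)) * sin x / D"
        by (simp add: add_divide_distrib diff_divide_distrib algebra_simps)
      also have "\<dots> = (- 2 * (sin x * sin (real (Suc l) * x))) * D / D"
        unfolding s by (simp add: D_def algebra_simps)
      also have "\<dots> = - 2 * (sin x * sin (real (Suc l) * x))" using D by simp
      finally show "sin (real (Suc (Suc l)) * x) * sin x / (cosh g - cos x)
        - 2 * cosh g * (sin (real (Suc l) * x) * sin x / (cosh g - cos x)) + sin (real l * x) * sin x / (cosh g - cos x)
        = - 2 * (sin x * sin (real (Suc l) * x))" unfolding D_def .
    qed
    also have "\<dots> = - 2 * (if l = 0 then pi else 0)" by (simp only: integral_mult_right integral_sin_sin)
    finally show ?thesis .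
  qed
  \<comment> \<open>The recurrence for \<open>F\<close> has an inhomogeneous term at
    \<open>l = 0\<close> only; changing the value there from 0 to \<open>2 * pi\<close> absorbs
    it.\<close>
  define K where "K l = (if l = 0 then 2 * pi else F l)" for l
  have F0: "F 0 = 0" by (simp add: F_def)
  have Krec: "K (Suc (Suc l)) = 2 * cosh g * K (Suc l) - K l" for l
    using rec[of l] F0 by (cases "l = 0") (auto simp: K_def)
  \<comment> \<open>\<open>d\<close> isolates the growing component: it is multiplied by
    \<open>exp g\<close> at each step, so it must be 0.\<close>
  define d where "d l = K (Suc l) - exp (- g) * K l" for l
  have "2 * cosh g = exp g + exp (- g)" by (simp add: cosh_def)
  then have dstep: "d (Suc l) = exp g * d l" for l
    unfolding d_def Krec by (simp add: algebra_simps flip: exp_add)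
  have dpow: "d l = exp g ^ l * d 0" for l by (induction l) (simp_all add: dstep)
  have Fb: "\<bar>F l\<bar> \<le> 2 * pi / (cosh g - 1)" for l
  proof -
    have "norm (F l) \<le> integral {-pi..pi} (\<lambda>x::real. 1 / (cosh g - 1))"
      unfolding F_def
    proof (rule integral_norm_bound_integral[OF int])
      fix x assume "x \<in> {-pi..pi}"
      have "\<bar>sin (real l * x) * sin x\<bar> \<le> 1 * 1" unfolding abs_mult by (intro mult_mono) auto
      moreover have "cosh g - 1 \<le> \<bar>cosh g - cos x\<bar>" by (rule order_trans[OF _ abs_ge_self]) simp
      ultimately show "norm (sin (real l * x) * sin x / (cosh g - cos x)) \<le> 1 / (cosh g - 1)"
        unfolding real_norm_def abs_divide using ch by (intro frac_le) auto
    qed (intro integrable_const_ivl)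
    then show ?thesis by simp
  qed
  have Kb: "\<bar>K l\<bar> \<le> 2 * pi / (cosh g - 1) + 2 * pi" for l
    using Fb[of l] ch by (auto simp: K_def intro: order_trans[OF Fb] add_increasing add_increasing2)
  have d0: "d 0 = 0"
  proof (rule ccontr)
    assume "d 0 \<noteq> 0"
    define B where "B = 2 * pi / (cosh g - 1) + 2 * pi"
    have db: "\<bar>d l\<bar> \<le> 2 * B" for l
    proof -
      have "\<bar>exp (- g) * K l\<bar> \<le> 1 * \<bar>K l\<bar>" unfolding abs_mult using g by (intro mult_right_mono) auto
      then show ?thesis using Kb[of l] Kb[of "Suc l"] by (simp add: d_def B_def)
    qed
    have "1 < exp g" using g by simp
    then obtain m where "2 * B / \<bar>d 0\<bar> < exp g ^ m" using real_arch_pow by blast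
    then have "2 * B < \<bar>d m\<bar>" using \<open>d 0 \<noteq> 0\<close> by (simp add: dpow[of m] abs_mult field_simps)
    then show False using db[of m] by simp
  qed
  then have Kstep: "K (Suc l) = exp (- g) * K l" for l using dpow[of l] by (simp add: d_def)
  have "K l = exp (- g) ^ l * (2 * pi)" for l
    by (induction l) (simp_all add: Kstep K_def[of 0])
  then have "K l = 2 * pi * exp (- real l * g)" by (simp add: exp_of_nat_mult[symmetric] mult.commute)
  then show ?thesis using l by (simp add: K_def F_def)
qed

text \<open>Together with \<open>exp_neg_le_lorentz\<close> this replaces Gaussian integrals: only
  the order \<open>1 / sqrt b\<close> matters.\<close>

lemma integral_lorentz:
  assumes "b > 0"
  shows "integral {-pi..pi} (\<lambda>x. 1 / (1 + b * x\<^sup>2)) \<le> pi / sqrt b"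
proof -
  have "((\<lambda>x. 1 / (1 + b * x\<^sup>2)) has_integral (arctan (sqrt b * pi) / sqrt b - arctan (sqrt b * - pi) / sqrt b)) {-pi..pi}"
  proof (rule fundamental_theorem_of_calculus)
    fix x assume "x \<in> {-pi..pi}"
    have "1 + b * x\<^sup>2 > 0" using assms by (simp add: add_pos_nonneg)
    then show "((\<lambda>x. arctan (sqrt b * x) / sqrt b) has_vector_derivative 1 / (1 + b * x\<^sup>2)) (at x within {-pi..pi})"
      using assms by (auto simp flip: has_real_derivative_iff_has_vector_derivative
          intro!: derivative_eq_intros simp: power_mult_distrib inverse_eq_divide)
  qed simp
  then have "integral {-pi..pi} (\<lambda>x. 1 / (1 + b * x\<^sup>2)) = 2 * arctan (sqrt b * pi) / sqrt b"
    by (simp add: integral_unique arctan_minus)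
  also have "\<dots> \<le> pi / sqrt b" using arctan_ubound[of "sqrt b * pi"] assms by (intro divide_right_mono) auto
  finally show ?thesis .
qed

lemma exp_neg_le_lorentz: "x \<ge> 0 \<Longrightarrow> exp (- x) \<le> 1 / (1 + (x::real))"
  using exp_ge_add_one_self[of x] by (simp add: exp_minus inverse_eq_divide frac_le)

lemma cosh_diff_bounds:
  fixes x y :: real
  assumes "0 \<le> x" "x \<le> y"
  shows "(y - x) * sinh x \<le> cosh y - cosh x" "cosh y - cosh x \<le> (y - x) * sinh y"
proof -
  have "(y - x) * sinh x \<le> cosh y - cosh x \<and> cosh y - cosh x \<le> (y - x) * sinh y"
  proof (cases "x = y")
    case False
    then have "x < y" using assms by simp
    have "(cosh has_real_derivative sinh z) (at z)" for z :: real by (auto intro!: derivative_eq_intros)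
    then obtain z where z: "x < z" "z < y" "cosh y - cosh x = (y - x) * sinh z"
      using MVT2[OF \<open>x < y\<close>, of cosh sinh] by blast
    have "sinh x \<le> sinh z" "sinh z \<le> sinh y" using z by simp_all
    then show ?thesis using z by (auto intro!: mult_left_mono)
  qed simp
  then show "(y - x) * sinh x \<le> cosh y - cosh x" "cosh y - cosh x \<le> (y - x) * sinh y" by simp_all
qed

lemma arcosh_mono: "1 \<le> x \<Longrightarrow> x \<le> y \<Longrightarrow> arcosh x \<le> arcosh (y :: real)"
  using arcosh_real_strict_mono[of x y] by (cases "x = y") (simp_all del: arcosh_less_iff_real)

lemma exp_neg_mult: "exp (- a * b) = 1 / exp (a * b :: real)"
  by (simp add: exp_minus inverse_eq_divide)

section \<open>The dispersion relation of the subcritical model\<close>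

locale subcritical =
  fixes t :: real
  assumes t0: "0 < t" and tc: "t\<^sup>2 + 2 * t < 1"
begin

lemma t1: "t < 1"
  using t0 tc zero_le_power2[of t] by linarith

lemmas tt = t0 t1

abbreviation "c \<equiv> cosh2 t"
abbreviation "s \<equiv> sinh2 t"

lemma t2: "1 - t\<^sup>2 > 0"
  using tc t0 by linarith

lemma s_bounds: "0 < s" "s < 1" "1 \<le> c"
  using t0 tc t2 by (simp_all add: sinh2_def cosh2_def divide_less_eq le_divide_eq)

text \<open>Subcriticality enters here: it gives \<open>s < 1\<close>, so the difference of the
  diagonal entries is positive for every frequency.\<close>

lemma N_diff: "N11 t \<phi> - N22 t \<phi> = (1 + t\<^sup>2) / t * (1 - s * cos \<phi>)"
proof -
  have "(1 - t\<^sup>2) * c = 1 + t\<^sup>2" using t2 by (simp add: cosh2_def)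
  moreover have "t * N11 t \<phi> = c - s * cos \<phi>" "N22 t \<phi> = t * (c + s * cos \<phi>)"
    using t0 by (simp_all add: N11_def N22_def)
  ultimately have "t * (N11 t \<phi> - N22 t \<phi>) = (1 + t\<^sup>2) * (1 - s * cos \<phi>)" by algebra
  then show ?thesis using t0 by (simp add: field_simps)
qed

lemma s_cos: "\<bar>s * cos \<phi>\<bar> < 1"
proof -
  have "\<bar>s * cos \<phi>\<bar> \<le> s * 1" unfolding abs_mult using s_bounds by (intro mult_mono) auto
  then show ?thesis using s_bounds by linarith
qed

lemma N_less: "N22 t \<phi> < N11 t \<phi>"
proof -
  have "0 < (1 + t\<^sup>2) / t * (1 - s * cos \<phi>)"
    using t0 s_cos[of \<phi>] by (intro mult_pos_pos divide_pos_pos add_pos_nonneg) auto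
  then show ?thesis using N_diff[of \<phi>] by linarith
qed

lemma N22_pos: "0 < N22 t \<phi>"
  using t0 s_cos[of \<phi>] s_bounds by (simp add: N22_def)

lemma trc_eq: "trc t \<phi> = trc t 0 + 2 * (1 - cos \<phi>)"
proof -
  have "s / t = c + 1" "t * s = c - 1" using cosh2_sinh2(2,3)[OF tt] t0 by (simp_all add: field_simps)
  then have "s / t - t * s = 2" by simp
  moreover have "trc t \<phi> - trc t 0 = (s / t - t * s) * (1 - cos \<phi>)"
    by (simp add: trc_def N11_def N22_def algebra_simps add_divide_distrib diff_divide_distrib)
  ultimately show ?thesis by simp
qed

text \<open>At frequency 0 the matrix is diagonal with determinant 1 and two different positive
  entries, so its trace exceeds 2. This is the spectral gap.\<close>

lemma trc_0: "trc t 0 > 2"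
proof -
  have "N11 t 0 * N22 t 0 = 1" using det_N[OF tt, of 0] by (simp add: N12_def)
  then have "(trc t 0)\<^sup>2 - 2\<^sup>2 = (N11 t 0 - N22 t 0)\<^sup>2" by (simp add: trc_def power2_eq_square algebra_simps)
  also have "\<dots> > 0" using N_less[of 0] by simp
  finally have "2\<^sup>2 < (trc t 0)\<^sup>2" by simp
  moreover have "0 < trc t 0" using N_less[of 0] N22_pos[of 0] by (simp add: trc_def)
  ultimately show ?thesis by (meson less_imp_le power_less_imp_less_base)
qed

text \<open>Onsager's dispersion relation: the eigenvalues of \<open>N\<close> are
  \<open>exp (rate \<phi>)\<close> and \<open>exp (- rate \<phi>)\<close>.\<close>

definition rate :: "real \<Rightarrow> real" where
  "rate \<phi> = arcosh (trc t \<phi> / 2)"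

lemma trc_ge: "trc t \<phi> / 2 \<ge> trc t 0 / 2" "trc t \<phi> / 2 > 1"
proof -
  define x where "x = cos \<phi>"
  have "x \<le> 1" by (simp add: x_def)
  moreover have "trc t \<phi> = trc t 0 + 2 * (1 - x)" unfolding x_def by (rule trc_eq)
  ultimately show "trc t \<phi> / 2 \<ge> trc t 0 / 2" by simp
  then show "trc t \<phi> / 2 > 1" using trc_0 by linarith
qed

lemma cosh_rate: "cosh (rate \<phi>) = trc t \<phi> / 2"
  using trc_ge(2)[of \<phi>] by (simp add: rate_def)

lemma rate_pos: "rate \<phi> > 0"
  using trc_ge(2)[of \<phi>] by (simp add: rate_def)

lemma rate_ge: "rate 0 \<le> rate \<phi>"
  unfolding rate_def using trc_ge(1)[of \<phi>] trc_ge(2)[of 0] by (intro arcosh_mono) auto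

text \<open>\<open>cosh (rate x) + cos x\<close> does not depend on \<open>x\<close>. This symmetry
  between the two lattice directions lets the Poisson integral be used in either variable.\<close>

lemma cosh_rate_diff: "cosh (rate k) - cos x = cosh (rate x) - cos k"
  using trc_eq[of k] trc_eq[of x] by (simp add: cosh_rate field_simps)

lemma sinh_rate: "sinh (rate 0) \<le> sinh (rate \<phi>)" "0 < sinh (rate \<phi>)"
  using rate_ge[of \<phi>] rate_pos[of \<phi>] by simp_all

lemma continuous_trc: "continuous_on A (trc t)"
proof -
  have "continuous_on A (\<lambda>\<phi>. trc t 0 + 2 * (1 - cos \<phi>))" by (intro continuous_intros)
  then show ?thesis by (simp only: trc_eq[symmetric])
qed

lemma continuous_rate [continuous_intros]: "continuous_on A rate"
  unfolding rate_def by (rule continuous_on_arcosh') (use trc_ge(2) in \<open>auto intro!: continuous_intros continuous_trc less_imp_le\<close>)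

lemma continuous_on_rate_compose [continuous_intros]: "continuous_on A f \<Longrightarrow> continuous_on A (\<lambda>x. rate (f x))"
  using continuous_on_compose2[OF continuous_rate[of UNIV]] by auto

text \<open>Since \<open>cosh (rate \<phi>) - cosh (rate 0) = 1 - cos \<phi>\<close>, the minimum at
  0 is nondegenerate: the exponentials of \<open>- n * rate \<phi>\<close> live on frequencies of
  order \<open>1 / sqrt n\<close>.\<close>

lemma rate_bounds:
  obtains a b where "a > 0" "b > 0"
    "\<And>\<phi>. \<bar>\<phi>\<bar> \<le> pi \<Longrightarrow> rate 0 + a * \<phi>\<^sup>2 \<le> rate \<phi> \<and> rate \<phi> \<le> rate 0 + b * \<phi>\<^sup>2"
proof -
  have diff: "cosh (rate \<phi>) - cosh (rate 0) = 1 - cos \<phi>" for \<phi>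
    using trc_eq[of \<phi>] by (simp add: cosh_rate field_simps)
  have mono: "sinh (rate \<phi>) \<le> sinh (rate pi)" for \<phi>
  proof -
    define x where "x = cos \<phi>"
    have "-1 \<le> x" by (simp add: x_def)
    moreover have "trc t \<phi> = trc t 0 + 2 * (1 - x)" unfolding x_def by (rule trc_eq)
    ultimately have "trc t \<phi> \<le> trc t pi" using trc_eq[of pi] by simp
    then have "rate \<phi> \<le> rate pi" unfolding rate_def
      using trc_ge(2)[of \<phi>] by (intro arcosh_mono) auto
    then show ?thesis by simp
  qed
  show ?thesis
  proof (rule that[of "1 / (32 * sinh (rate pi))" "1 / (2 * sinh (rate 0))"])
    fix \<phi> :: real assume \<phi>: "\<bar>\<phi>\<bar> \<le> pi"
    note b = one_minus_cos_bounds[OF \<phi>]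
    note cd = cosh_diff_bounds[OF less_imp_le[OF rate_pos[of 0]] rate_ge[of \<phi>], unfolded diff]
    have "(rate \<phi> - rate 0) * sinh (rate \<phi>) \<le> (rate \<phi> - rate 0) * sinh (rate pi)"
      using mono rate_ge[of \<phi>] by (intro mult_left_mono) auto
    then have "\<phi>\<^sup>2 / 32 \<le> (rate \<phi> - rate 0) * sinh (rate pi)" using cd b by linarith
    then have 1: "\<phi>\<^sup>2 / 32 / sinh (rate pi) \<le> rate \<phi> - rate 0" using sinh_rate(2)[of pi] by (simp add: pos_divide_le_eq)
    have "(rate \<phi> - rate 0) * sinh (rate 0) \<le> \<phi>\<^sup>2 / 2" using cd b by linarith
    then have 2: "rate \<phi> - rate 0 \<le> \<phi>\<^sup>2 / 2 / sinh (rate 0)" using sinh_rate(2)[of 0] by (simp add: pos_le_divide_eq)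
    show "rate 0 + 1 / (32 * sinh (rate pi)) * \<phi>\<^sup>2 \<le> rate \<phi> \<and> rate \<phi> \<le> rate 0 + 1 / (2 * sinh (rate 0)) * \<phi>\<^sup>2"
      using 1 2 by (simp add: mult.commute)
  qed (use sinh_rate in auto)
qed

lemma cheb_sinh: "cheb (trc t \<phi>) m * sinh (rate \<phi>) = sinh (real m * rate \<phi>)"
proof (induction "trc t \<phi>" m rule: cheb.induct)
  case (3 m)
  have "sinh (real (Suc (Suc m)) * rate \<phi>) + sinh (real m * rate \<phi>) = trc t \<phi> * sinh (real (Suc m) * rate \<phi>)"
    using sinh_add[of "real (Suc m) * rate \<phi>" "rate \<phi>"] sinh_diff[of "real (Suc m) * rate \<phi>" "rate \<phi>"] cosh_rate[of \<phi>]
    by (simp add: algebra_simps)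
  then show ?case using 3 by (simp add: algebra_simps)
qed auto

text \<open>A diagonal entry of a symmetric matrix is at most its largest eigenvalue,
  \<open>cosh (rate \<phi>) + sinh (rate \<phi>)\<close>; it is at least half the trace because it
  is the larger of the two.\<close>

lemma N11_rate: "cosh (rate \<phi>) \<le> N11 t \<phi>" "N11 t \<phi> - cosh (rate \<phi>) \<le> sinh (rate \<phi>)"
proof -
  show "cosh (rate \<phi>) \<le> N11 t \<phi>" using N_less[of \<phi>] by (simp add: cosh_rate trc_def)
  have "(N11 t \<phi> - cosh (rate \<phi>))\<^sup>2 = (cosh (rate \<phi>))\<^sup>2 - N11 t \<phi> * N22 t \<phi>"
    by (simp add: cosh_rate trc_def power2_eq_square field_simps)
  also have "\<dots> \<le> (sinh (rate \<phi>))\<^sup>2"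
    using det_N[OF tt, of \<phi>] cosh_square_eq[of "rate \<phi>"] zero_le_power2[of "N12 t \<phi>"] by linarith
  finally show "N11 t \<phi> - cosh (rate \<phi>) \<le> sinh (rate \<phi>)"
    using sinh_rate(2)[of \<phi>] by (metis less_imp_le power2_le_imp_le)
qed

lemma E11_eq: "E11 t m \<phi> = cosh (real (Suc m) * rate \<phi>) + (N11 t \<phi> - cosh (rate \<phi>)) * cheb (trc t \<phi>) (Suc m)"
proof -
  define S where "S = sinh (rate \<phi>)"
  have S: "S \<noteq> 0" using sinh_rate(2)[of \<phi>] by (simp add: S_def)
  have "sinh (real m * rate \<phi>) = sinh (real (Suc m) * rate \<phi>) * cosh (rate \<phi>) - cosh (real (Suc m) * rate \<phi>) * S"
    using sinh_diff[of "real (Suc m) * rate \<phi>" "rate \<phi>"] by (simp add: S_def algebra_simps)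
  then have "E11 t m \<phi> * S = (cosh (real (Suc m) * rate \<phi>) + (N11 t \<phi> - cosh (rate \<phi>)) * cheb (trc t \<phi>) (Suc m)) * S"
    using cheb_sinh[of \<phi> m] cheb_sinh[of \<phi> "Suc m"] unfolding E11_def S_def[symmetric] by algebra
  then show ?thesis using S by simp
qed

lemma cheb_nonneg: "0 \<le> cheb (trc t \<phi>) m"
proof -
  have "0 \<le> cheb (trc t \<phi>) m * sinh (rate \<phi>)" unfolding cheb_sinh using rate_pos[of \<phi>] by simp
  then show ?thesis using sinh_rate(2)[of \<phi>] by (simp add: zero_le_mult_iff)
qed

lemma E11_bounds: "cosh (real (Suc m) * rate \<phi>) \<le> E11 t m \<phi>" "E11 t m \<phi> \<le> exp (real (Suc m) * rate \<phi>)" "1 \<le> E11 t m \<phi>"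
proof -
  show 1: "cosh (real (Suc m) * rate \<phi>) \<le> E11 t m \<phi>"
    unfolding E11_eq using N11_rate(1)[of \<phi>] cheb_nonneg[of \<phi> "Suc m"] by simp
  then show "1 \<le> E11 t m \<phi>" using cosh_real_ge_1[of "real (Suc m) * rate \<phi>"] by linarith
  have "(N11 t \<phi> - cosh (rate \<phi>)) * cheb (trc t \<phi>) (Suc m) \<le> sinh (rate \<phi>) * cheb (trc t \<phi>) (Suc m)"
    using N11_rate(2)[of \<phi>] cheb_nonneg by (intro mult_right_mono)
  then have "E11 t m \<phi> \<le> cosh (real (Suc m) * rate \<phi>) + sinh (real (Suc m) * rate \<phi>)"
    unfolding E11_eq using cheb_sinh[of \<phi> "Suc m"] by (simp add: mult.commute)
  then show "E11 t m \<phi> \<le> exp (real (Suc m) * rate \<phi>)" by (simp add: cosh_plus_sinh)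
qed

lemma W11_ge: "t \<le> W11 t m \<phi>"
  using E11_bounds(3)[of m \<phi>] t0 by (simp add: W11_def mult_le_cancel_left1)

lemma W11_bounds:
  "exp (- real (Suc m) * rate \<phi>) / t \<le> 1 / W11 t m \<phi>" "1 / W11 t m \<phi> \<le> 2 / t * exp (- real (Suc m) * rate \<phi>)"
proof -
  have E: "0 < E11 t m \<phi>" using E11_bounds(3)[of m \<phi>] by linarith
  have "exp (- real (Suc m) * rate \<phi>) = 1 / exp (real (Suc m) * rate \<phi>)"
    by (rule exp_neg_mult)
  then have "exp (- real (Suc m) * rate \<phi>) \<le> 1 / E11 t m \<phi>"
    using E11_bounds(2)[of m \<phi>] E by (simp add: frac_le)
  then have "exp (- real (Suc m) * rate \<phi>) / t \<le> 1 / E11 t m \<phi> / t" using t0 by (intro divide_right_mono) auto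
  then show "exp (- real (Suc m) * rate \<phi>) / t \<le> 1 / W11 t m \<phi>" by (simp add: W11_def mult.commute)
  have "exp (real (Suc m) * rate \<phi>) / 2 \<le> cosh (real (Suc m) * rate \<phi>)" by (simp add: cosh_def)
  also have "\<dots> \<le> E11 t m \<phi>" by (rule E11_bounds)
  finally have "1 / E11 t m \<phi> \<le> 1 / (exp (real (Suc m) * rate \<phi>) / 2)" using E by (intro frac_le) auto
  then have "1 / E11 t m \<phi> / t \<le> 2 * exp (- real (Suc m) * rate \<phi>) / t"
    unfolding exp_neg_mult using t0 by (intro divide_right_mono) auto
  then show "1 / W11 t m \<phi> \<le> 2 / t * exp (- real (Suc m) * rate \<phi>)" by (simp add: W11_def mult.commute)
qed

lemma continuous_cheb: "continuous_on A (\<lambda>\<phi>. cheb (trc t \<phi>) m)"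
  by (induction "0 :: real" m rule: cheb.induct) (auto intro!: continuous_intros continuous_trc)

lemma continuous_N: "continuous_on A (N11 t)" "continuous_on A (N12 t)"
  unfolding N11_def[abs_def] N12_def[abs_def] using t0 by (auto intro!: continuous_intros)

lemma continuous_W: "continuous_on A (W11 t m)" "continuous_on A (W12 t m)"
  unfolding W11_def[abs_def] W12_def[abs_def] E11_def[abs_def]
  by (auto intro!: continuous_intros continuous_cheb continuous_N)

lemma continuous_inv_W11: "continuous_on A (\<lambda>\<phi>. 1 / W11 t m \<phi>)"
  using W11_ge[of m] t0 by (intro continuous_intros continuous_W) (metis not_le)

end

lemma integral_ge_on_subinterval:
  fixes f :: "real \<Rightarrow> real"
  assumes "continuous_on {a..b} f" "\<And>x. x \<in> {a..b} \<Longrightarrow> 0 \<le> f x"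
    and "a \<le> p" "p \<le> q" "q \<le> b" "\<And>x. p \<le> x \<Longrightarrow> x \<le> q \<Longrightarrow> k \<le> f x"
  shows "k * (q - p) \<le> integral {a..b} f"
proof -
  have sub: "{p..q} \<subseteq> {a..b}" using assms by auto
  have int: "f integrable_on {p..q}" "f integrable_on {a..b}"
    using assms(1) continuous_on_subset[OF assms(1) sub] by (auto intro: integrable_continuous_interval)
  have "k * (q - p) = integral {p..q} (\<lambda>_. k)" using assms by simp
  also have "\<dots> \<le> integral {p..q} f" using int assms by (intro integral_le) auto
  also have "\<dots> \<le> integral {a..b} f" using int assms sub by (intro integral_subset_le) auto
  finally show ?thesis .
qed

section \<open>Symmetry and monotonicity of two-point functions\<close>

lemma boundary_image:
  assumes "inj f"
  shows "boundary ((`) f ` E) = f ` boundary E"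
proof (rule set_eqI)
  fix v
  show "v \<in> boundary ((`) f ` E) \<longleftrightarrow> v \<in> f ` boundary E"
  proof (cases "v \<in> range f")
    case True
    then obtain x where x: "v = f x" by auto
    have "{e \<in> (`) f ` E. f x \<in> e} = (`) f ` {e \<in> E. x \<in> e}"
      using assms by (auto dest: injD)
    moreover have "inj_on ((`) f) {e \<in> E. x \<in> e}" using assms by (simp add: inj_on_def inj_image_eq_iff)
    ultimately have "card {e \<in> (`) f ` E. f x \<in> e} = card {e \<in> E. x \<in> e}" by (simp add: card_image)
    then have "f x \<in> boundary ((`) f ` E) \<longleftrightarrow> x \<in> boundary E" by (simp add: boundary_def)
    then show ?thesis using assms by (simp add: x inj_image_mem_iff)
  next
    case False
    then have "{e \<in> (`) f ` E. v \<in> e} = {}" by auto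
    then show ?thesis using False by (auto simp: boundary_def simp del: Collect_empty_eq)
  qed
qed

lemma subgraph_sum_image:
  assumes "inj f"
  shows "subgraph_sum (\<lambda>_. t) ((`) f ` U) (f ` B) = subgraph_sum (\<lambda>_. t) U B"
proof -
  have inj: "inj ((`) f)" using assms by (simp add: inj_on_def inj_image_eq_iff)
  have "{E. E \<subseteq> (`) f ` U \<and> boundary E = f ` B} = (`) ((`) f) ` {E. E \<subseteq> U \<and> boundary E = B}"
    using assms by (fastforce simp: subset_image_iff boundary_image inj_image_eq_iff)
  moreover have "inj_on ((`) ((`) f)) A" for A using inj by (simp add: inj_on_def inj_image_eq_iff)
  ultimately have "subgraph_sum (\<lambda>_. t) ((`) f ` U) (f ` B) =
      (\<Sum>E | E \<subseteq> U \<and> boundary E = B. \<Prod>e\<in>(`) f ` E. t)"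
    by (simp add: subgraph_sum_def sum.reindex)
  also have "\<dots> = subgraph_sum (\<lambda>_. t) U B"
    unfolding subgraph_sum_def using inj by (intro sum.cong refl) (simp add: card_image inj_on_subset)
  finally show ?thesis .
qed

lemma sdiff_image:
  assumes "inj f" shows "sdiff (f ` A) (f ` B) = f ` sdiff A B"
proof -
  have eq: "sdiff C D = (C - D) \<union> (D - C)" for C D :: "'c set" by auto
  have eq': "sdiff C D = (C - D) \<union> (D - C)" for C D :: "'d set" by auto
  show ?thesis using assms unfolding eq eq' by (auto simp: image_Un image_set_diff sdiff_def)
qed

text \<open>Transposition turns the bottom row of a half strip into a piece of the left side of a
  grid, where the exact solution is available.\<close>

lemma two_point_swap: "two_point t (prod.swap ` V) (prod.swap a) (prod.swap v) = two_point t V a v"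
proof -
  have sub: "grid_edges (prod.swap ` V) \<subseteq> (`) prod.swap ` grid_edges V" for V
  proof
    fix e assume "e \<in> grid_edges (prod.swap ` V)"
    then show "e \<in> (`) prod.swap ` grid_edges V"
    proof (cases rule: grid_edges_cases)
      case (vertical x y)
      then have "{(y, x), (y + 1, x)} \<in> grid_edges V" by (intro horizontal_mem) auto
      then have "prod.swap ` {(y, x), (y + 1, x)} \<in> (`) prod.swap ` grid_edges V" by (rule imageI)
      then show ?thesis using vertical by simp
    next
      case (horizontal x y)
      then have "{(y, x), (y, x + 1)} \<in> grid_edges V" by (intro vertical_mem) auto
      then have "prod.swap ` {(y, x), (y, x + 1)} \<in> (`) prod.swap ` grid_edges V" by (rule imageI)
      then show ?thesis using horizontal by simp
    qed
  qed
  have ss: "(`) prod.swap ` (`) prod.swap ` A = A" for A :: "dual_site set set" by (simp add: image_image)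
  have "grid_edges V \<subseteq> (`) prod.swap ` grid_edges (prod.swap ` V)"
    using sub[of "prod.swap ` V"] by (simp add: image_image)
  then have "(`) prod.swap ` grid_edges V \<subseteq> (`) prod.swap ` (`) prod.swap ` grid_edges (prod.swap ` V)"
    by (rule image_mono)
  then have eq: "grid_edges (prod.swap ` V) = (`) prod.swap ` grid_edges V"
    unfolding ss using sub[of V] by (rule equalityI[rotated])
  have sd: "sdiff {prod.swap a} {prod.swap v} = prod.swap ` sdiff {a} {v}"
    using sdiff_image[of prod.swap "{a}" "{v}"] by simp
  show ?thesis
    unfolding two_point_def eq sd using subgraph_sum_image[of prod.swap t "grid_edges V" "{}"]
    by (simp add: subgraph_sum_image)
qed

lemma two_point_mono:
  assumes "finite V'" "V \<subseteq> V'" "0 \<le> t" "t \<le> 1"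
  shows "two_point t V a v \<le> two_point t V' a v"
  unfolding two_point_def
proof (rule subgraph_sum_ratio_mono)
  show "finite e" if "e \<in> grid_edges V'" for e using grid_edges_subset[OF that] assms(1) finite_subset by blast
qed (use assms finite_grid_edges grid_edges_mono in auto)

lemma two_point_nonneg: "0 \<le> t \<Longrightarrow> 0 \<le> two_point t V a v"
  unfolding two_point_def by (intro divide_nonneg_nonneg subgraph_sum_nonneg) auto

lemma integral_sum_cos:
  fixes y :: int and g :: "int \<Rightarrow> real"
  assumes "finite A" "y \<in> A"
  shows "((\<lambda>\<phi>. \<Sum>j\<in>A. g j * cos (real_of_int (j - y) * \<phi>)) has_integral 2 * pi * g y) {-pi..pi}"
proof -
  have "((\<lambda>\<phi>. \<Sum>j\<in>A. g j * cos (real_of_int (j - y) * \<phi>)) has_integral (\<Sum>j\<in>A. g j * (if j - y = 0 then 2 * pi else 0))) {-pi..pi}"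
    by (intro has_integral_sum assms has_integral_mult_right integral_cos_int)
  moreover have "(\<Sum>j\<in>A. g j * (if j - y = 0 then 2 * pi else 0)) = (\<Sum>j\<in>A. if j = y then 2 * pi * g y else 0)"
    by (intro sum.cong) auto
  ultimately show ?thesis using assms by (simp add: sum.delta)
qed

lemma has_integral_diff_bound:
  fixes f g :: "real \<Rightarrow> real"
  assumes "(f has_integral I) {-pi..pi}" "(g has_integral J) {-pi..pi}" "\<And>x. \<bar>f x - g x\<bar> \<le> B"
  shows "\<bar>I - J\<bar> \<le> 2 * pi * B"
proof -
  have "norm (integral {-pi..pi} (\<lambda>x. f x - g x)) \<le> integral {-pi..pi} (\<lambda>x::real. B)"
    using has_integral_diff[OF assms(1,2)] assms(3)
    by (intro integral_norm_bound_integral) (auto simp: has_integral_integrable)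
  moreover have "integral {-pi..pi} (\<lambda>x. f x - g x) = I - J"
    using has_integral_diff[OF assms(1,2)] by (rule integral_unique)
  ultimately show ?thesis by simp
qed

section \<open>Correlations across an infinite strip\<close>

context subcritical
begin

text \<open>In the limit of infinite height, \<open>2 * pi\<close> times the correlation of
  \<open>(0, 0)\<close> with the site at height \<open>y\<close> on the opposite side;
  \<open>end_side\<close> is the analogue for the same side.\<close>

definition side :: "nat \<Rightarrow> int \<Rightarrow> real" where
  "side n y = integral {-pi..pi} (\<lambda>\<phi>. cos (real_of_int y * \<phi>) / W11 t n \<phi>)"

definition end_side :: "nat \<Rightarrow> nat \<Rightarrow> real" where
  "end_side n y = integral {-pi..pi} (\<lambda>\<phi>. - sin (real y * \<phi>) * W12 t n \<phi> / W11 t n \<phi>)"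

lemma W11_pos: "0 < W11 t n \<phi>"
  using W11_ge[of n \<phi>] t0 by linarith

lemma side_has_integral: "((\<lambda>\<phi>. cos (real_of_int y * \<phi>) / W11 t n \<phi>) has_integral side n y) {-pi..pi}"
  unfolding side_def using W11_pos
  by (intro integrable_integral integrable_continuous_interval continuous_intros continuous_W)
     (auto simp: less_imp_neq[symmetric])

lemma end_side_has_integral:
  "((\<lambda>\<phi>. - sin (real y * \<phi>) * W12 t n \<phi> / W11 t n \<phi>) has_integral end_side n y) {-pi..pi}"
  unfolding end_side_def using W11_pos
  by (intro integrable_integral integrable_continuous_interval continuous_intros continuous_W)
     (auto simp: less_imp_neq[symmetric])

lemma grid_limit:
  assumes "\<epsilon> > 0"
  obtains M0 where "\<And>M M' y. M0 \<le> M \<Longrightarrow> M0 \<le> M' \<Longrightarrow> - int M \<le> y \<Longrightarrow> y \<le> int M' \<Longrightarrow>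
      \<bar>2 * pi * two_point t (grid n M M') (0, 0) (int n, y) - side n y\<bar> \<le> \<epsilon>"
    "\<And>M M' y. M0 \<le> M \<Longrightarrow> M0 \<le> M' \<Longrightarrow> 1 \<le> y \<Longrightarrow> y \<le> M' \<Longrightarrow>
      \<bar>2 * pi * two_point t (grid n M M') (0, 0) (0, int y) - end_side n y\<bar> \<le> \<epsilon>"
proof -
  obtain C where C: "C \<ge> 0"
    "\<forall>M M' \<epsilon> \<phi> \<psi>. (\<forall>i. 0 \<le> i \<and> i \<le> int n \<longrightarrow>
        \<bar>two_point t (grid n M M') (0, 0) (i, int M')\<bar> \<le> \<epsilon> \<and> \<bar>two_point t (grid n M M') (0, 0) (i, - int M)\<bar> \<le> \<epsilon>) \<longrightarrow>
      \<bar>(\<Sum>j\<in>{- int M..int M'}. two_point t (grid n M M') (0, 0) (int n, j) * cos (real_of_int j * \<phi> + \<psi>)) - cos \<psi> / W11 t n \<phi>\<bar> \<le> C * \<epsilon> \<and>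
      \<bar>(\<Sum>j\<in>{- int M..int M'}. sgn (real_of_int j) * two_point t (grid n M M') (0, 0) (0, j) * sin (real_of_int j * \<phi> + \<psi>))
         - - cos \<psi> * W12 t n \<phi> / W11 t n \<phi>\<bar> \<le> C * \<epsilon>"
    by (rule grid_fourier[OF tt W11_ge[of n]]) (rule that)
  define \<rho> where "\<rho> = 1 - ((1 - t) / 2) ^ Suc n"
  have "((1 - t) / 2) ^ Suc n > 0" using t1 by simp
  moreover have "((1 - t) / 2) ^ Suc n \<le> 1" using t0 t1 by (intro power_le_one) auto
  ultimately have \<rho>: "0 \<le> \<rho>" "\<rho> < 1" by (simp_all add: \<rho>_def)
  have "(\<lambda>M. 2 * pi * (C * \<rho> ^ M)) \<longlonglongrightarrow> 2 * pi * (C * 0)"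
    by (intro tendsto_intros LIMSEQ_realpow_zero \<rho>)
  then have "eventually (\<lambda>M. 2 * pi * (C * \<rho> ^ M) < \<epsilon>) sequentially"
    using assms by (intro order_tendstoD) auto
  then obtain M0 where M0: "2 * pi * (C * \<rho> ^ M0) < \<epsilon>" by (auto simp: eventually_sequentially)
  have small: "\<bar>two_point t (grid n M M') (0, 0) (i, int M')\<bar> \<le> \<rho> ^ M0 \<and> \<bar>two_point t (grid n M M') (0, 0) (i, - int M)\<bar> \<le> \<rho> ^ M0"
    if "M0 \<le> M" "M0 \<le> M'" and i: "0 \<le> i \<and> i \<le> int n" for M M' i
  proof -
    have "\<rho> ^ M \<le> \<rho> ^ M0" "\<rho> ^ M' \<le> \<rho> ^ M0" using \<rho> that by (auto intro: power_decreasing)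
    then show ?thesis
      using grid_decay[OF tt, of i n M M'] i two_point_nonneg[of t] t0 unfolding \<rho>_def[symmetric] by auto
  qed
  show ?thesis
  proof (rule that[of M0])
    fix M M' :: nat and y :: int assume M: "M0 \<le> M" "M0 \<le> M'" and y: "- int M \<le> y" "y \<le> int M'"
    let ?G = "two_point t (grid n M M') (0, 0)"
    \<comment> \<open>The phase \<open>- y * \<phi>\<close> shifts the cosine series so that
      integration picks out the coefficient at \<open>y\<close>.\<close>
    have "\<bar>(\<Sum>j\<in>{- int M..int M'}. ?G (int n, j) * cos (real_of_int (j - y) * \<phi>)) - cos (real_of_int y * \<phi>) / W11 t n \<phi>\<bar> \<le> C * \<rho> ^ M0" for \<phi>
      using C(2)[rule_format, OF small[OF M], of \<phi> "- real_of_int y * \<phi>"] by (simp add: algebra_simps)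
    from has_integral_diff_bound[OF integral_sum_cos side_has_integral this] y
    have "\<bar>2 * pi * ?G (int n, y) - side n y\<bar> \<le> 2 * pi * (C * \<rho> ^ M0)" by simp
    then show "\<bar>2 * pi * ?G (int n, y) - side n y\<bar> \<le> \<epsilon>" using M0 by linarith
  next
    fix M M' y :: nat assume M: "M0 \<le> M" "M0 \<le> M'" and y: "1 \<le> y" "y \<le> M'"
    let ?G = "two_point t (grid n M M') (0, 0)"
    have "\<bar>(\<Sum>j\<in>{- int M..int M'}. (sgn (real_of_int j) * ?G (0, j)) * cos (real_of_int (j - int y) * \<phi>))
        - - sin (real y * \<phi>) * W12 t n \<phi> / W11 t n \<phi>\<bar> \<le> C * \<rho> ^ M0" for \<phi>
    proof -
      \<comment> \<open>With the phase \<open>pi / 2 - y * \<phi>\<close> the sine series becomes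
        the same shifted cosine series, and the factor \<open>cos \<psi>\<close> becomes
        \<open>sin (y * \<phi>)\<close>.\<close>
      have 1: "sin (real_of_int j * \<phi> + (pi / 2 - real y * \<phi>)) = cos (real_of_int (j - int y) * \<phi>)" for j
        using sin_cos_eq[of "real_of_int j * \<phi> + (pi / 2 - real y * \<phi>)"] cos_minus[of "real_of_int (j - int y) * \<phi>"]
        by (simp add: algebra_simps)
      have 2: "cos (pi / 2 - real y * \<phi>) = sin (real y * \<phi>)" by (simp add: sin_cos_eq)
      show ?thesis
        using C(2)[rule_format, OF small[OF M], of \<phi> "pi / 2 - real y * \<phi>"] unfolding 1 2 by blast
    qed
    from has_integral_diff_bound[OF integral_sum_cos end_side_has_integral this] y
    have "\<bar>2 * pi * (sgn (real_of_int (int y)) * ?G (0, int y)) - end_side n y\<bar> \<le> 2 * pi * (C * \<rho> ^ M0)" by simp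
    then show "\<bar>2 * pi * ?G (0, int y) - end_side n y\<bar> \<le> \<epsilon>" using M0 y by simp
  qed
qed

text \<open>Laplace's method with crude constants: \<open>1 / W11\<close> is
  \<open>exp (- (n + 1) * rate \<phi>)\<close> up to constant factors, so its integral is of order
  \<open>exp (- n * rate 0) / sqrt n\<close>. The difference of the coefficients at 0 and 2 has the
  additional factor \<open>1 - cos (2 * \<phi>)\<close>, which is of order \<open>1 / n\<close>
  where the mass lies.\<close>

lemma side_bounds:
  obtains k where "k > 0"
    "\<And>n. n \<ge> 1 \<Longrightarrow> k * exp (- real n * rate 0) / sqrt (real n) \<le> side n 0"
    "\<And>n. n \<ge> 1 \<Longrightarrow> k / real n * side n 0 \<le> side n 0 - side n 2"
proof -
  obtain a b where ab: "a > 0" "b > 0"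
    "\<And>\<phi>. \<bar>\<phi>\<bar> \<le> pi \<Longrightarrow> rate 0 + a * \<phi>\<^sup>2 \<le> rate \<phi> \<and> rate \<phi> \<le> rate 0 + b * \<phi>\<^sup>2" by (rule rate_bounds) (rule that)
  \<comment> \<open>The lower bound for \<open>1 / W11\<close> on frequencies up to
    \<open>1 / sqrt n\<close>; the 2 in the exponent bounds \<open>(n + 1) / n\<close>.\<close>
  define K where "K n = exp (- real (Suc n) * rate 0) * exp (- 2 * b) / t" for n
  have cont: "continuous_on {-pi..pi} (\<lambda>\<phi>. 1 / W11 t n \<phi>)" for n by (rule continuous_inv_W11)
  have lower: "K n \<le> 1 / W11 t n \<phi>" if n: "n \<ge> 1" and \<phi>: "0 \<le> \<phi>" "\<phi> \<le> 1 / sqrt (real n)" for n \<phi>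
  proof -
    have sq: "\<phi>\<^sup>2 \<le> 1 / real n" using power_mono[OF \<phi>(2,1), of 2] by (simp add: power_divide)
    have "1 / sqrt (real n) \<le> 1" using n by simp
    then have "\<bar>\<phi>\<bar> \<le> pi" using \<phi> pi_gt3 by linarith
    then have "rate \<phi> \<le> rate 0 + b * \<phi>\<^sup>2" using ab by blast
    also have "\<dots> \<le> rate 0 + b * (1 / real n)" using sq ab by (intro add_left_mono mult_left_mono) auto
    finally have "real (Suc n) * rate \<phi> \<le> real (Suc n) * (rate 0 + b * (1 / real n))" by (intro mult_left_mono) auto
    also have "\<dots> = real (Suc n) * rate 0 + b * (real (Suc n) / real n)" by (simp add: algebra_simps)
    also have "\<dots> \<le> real (Suc n) * rate 0 + b * 2" using n ab by (intro add_left_mono mult_left_mono) (auto simp: divide_le_eq)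
    finally have "- real (Suc n) * rate 0 + - 2 * b \<le> - real (Suc n) * rate \<phi>"
      unfolding mult_minus_left by linarith
    then have "exp (- real (Suc n) * rate 0 + - 2 * b) \<le> exp (- real (Suc n) * rate \<phi>)"
      by (simp only: exp_le_cancel_iff)
    then have "K n \<le> exp (- real (Suc n) * rate \<phi>) / t" unfolding K_def exp_add[symmetric] using t0 by (intro divide_right_mono) auto
    also have "\<dots> \<le> 1 / W11 t n \<phi>" by (rule W11_bounds)
    finally show ?thesis .
  qed
  have Kpos: "K n > 0" for n using t0 by (simp add: K_def)
  define D where "D = 2 * pi / (t * sqrt a)"
  have D: "D > 0" using t0 ab by (simp add: D_def)
  have side0: "side n 0 = integral {-pi..pi} (\<lambda>\<phi>. 1 / W11 t n \<phi>)" for n by (simp add: side_def)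
  have s1: "K n / (2 * sqrt (real n)) \<le> side n 0" if n: "n \<ge> 1" for n
  proof -
    have "1 / sqrt (real n) \<le> 1" using n by simp
    then have "K n * (1 / sqrt (real n) - 0) \<le> side n 0"
      unfolding side0 using lower[OF n] W11_pos pi_gt3 less_imp_le
      by (intro integral_ge_on_subinterval[OF cont]) (auto intro: less_imp_le order_trans)
    moreover have "K n / (2 * sqrt (real n)) \<le> K n / sqrt (real n)" using Kpos[of n] n by (intro divide_left_mono) auto
    ultimately show ?thesis by simp
  qed
  have s2: "side n 0 \<le> D * exp (- real (Suc n) * rate 0) / sqrt (real n)" if n: "n \<ge> 1" for n
  proof -
    define X where "X = 2 / t * exp (- real (Suc n) * rate 0)"
    have X: "X \<ge> 0" using t0 by (simp add: X_def)
    have an: "real n * a > 0" using n ab by simp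
    have "side n 0 \<le> integral {-pi..pi} (\<lambda>\<phi>. X * (1 / (1 + (real n * a) * \<phi>\<^sup>2)))"
      unfolding side0
    proof (rule integral_le)
      show "(\<lambda>\<phi>. 1 / W11 t n \<phi>) integrable_on {-pi..pi}" by (intro integrable_continuous_interval cont)
      have "1 + (real n * a) * \<phi>\<^sup>2 > 0" for \<phi> using ab(1) by (intro add_pos_nonneg mult_nonneg_nonneg) auto
      then have "1 + (real n * a) * \<phi>\<^sup>2 \<noteq> 0" for \<phi> by (metis less_irrefl)
      then show "(\<lambda>\<phi>. X * (1 / (1 + (real n * a) * \<phi>\<^sup>2))) integrable_on {-pi..pi}"
        by (intro integrable_continuous_interval continuous_intros) auto
      fix \<phi> :: real assume "\<phi> \<in> {-pi..pi}"
      then have "rate 0 + a * \<phi>\<^sup>2 \<le> rate \<phi>" using ab by auto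
      then have "real (Suc n) * (rate 0 + a * \<phi>\<^sup>2) \<le> real (Suc n) * rate \<phi>" by (intro mult_left_mono) auto
      moreover have "real n * (a * \<phi>\<^sup>2) \<le> real (Suc n) * (a * \<phi>\<^sup>2)" using ab by (intro mult_right_mono) auto
      ultimately have "real (Suc n) * rate 0 + real n * a * \<phi>\<^sup>2 \<le> real (Suc n) * rate \<phi>"
        unfolding distrib_left mult.assoc by linarith
      then have "- real (Suc n) * rate \<phi> \<le> - real (Suc n) * rate 0 + - (real n * a * \<phi>\<^sup>2)"
        unfolding mult_minus_left by linarith
      then have "exp (- real (Suc n) * rate \<phi>) \<le> exp (- real (Suc n) * rate 0) * exp (- (real n * a * \<phi>\<^sup>2))"
        unfolding exp_add[symmetric] by (simp only: exp_le_cancel_iff)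
      also have "\<dots> \<le> exp (- real (Suc n) * rate 0) * (1 / (1 + real n * a * \<phi>\<^sup>2))"
        using ab(1) by (intro mult_left_mono exp_neg_le_lorentz) auto
      finally have "2 / t * exp (- real (Suc n) * rate \<phi>) \<le> 2 / t * (exp (- real (Suc n) * rate 0) * (1 / (1 + real n * a * \<phi>\<^sup>2)))"
        using t0 by (intro mult_left_mono) auto
      with W11_bounds(2)[of n \<phi>] show "1 / W11 t n \<phi> \<le> X * (1 / (1 + (real n * a) * \<phi>\<^sup>2))"
        unfolding X_def mult.assoc by (rule order_trans)
    qed
    also have "\<dots> \<le> X * (pi / sqrt (real n * a))"
      unfolding integral_mult_right using X integral_lorentz[OF an] by (intro mult_left_mono) auto
    also have "\<dots> = D * exp (- real (Suc n) * rate 0) / sqrt (real n)"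
      by (simp add: X_def D_def real_sqrt_mult mult_ac)
    finally show ?thesis .
  qed
  have s3: "K n / (64 * real n * sqrt (real n)) \<le> side n 0 - side n 2" if n: "n \<ge> 1" for n
  proof -
    define r where "r = 1 / sqrt (real n)"
    have r: "0 < r" "r \<le> 1" "r\<^sup>2 = 1 / real n" using n by (auto simp: r_def power_divide)
    have "((\<lambda>\<phi>. cos (real_of_int 0 * \<phi>) / W11 t n \<phi> - cos (real_of_int 2 * \<phi>) / W11 t n \<phi>) has_integral side n 0 - side n 2) {-pi..pi}"
      by (intro has_integral_diff side_has_integral)
    then have eq: "side n 0 - side n 2 = integral {-pi..pi} (\<lambda>\<phi>. (1 - cos (2 * \<phi>)) * (1 / W11 t n \<phi>))"
      by (auto simp: diff_divide_distrib dest: integral_unique)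
    \<comment> \<open>The left half of the window is left out, so that the sine stays at least of
      order \<open>1 / sqrt n\<close>.\<close>
    have "(1 / (32 * real n) * K n) * (r - r / 2) \<le> side n 0 - side n 2"
      unfolding eq
    proof (rule integral_ge_on_subinterval)
      show "continuous_on {-pi..pi} (\<lambda>\<phi>. (1 - cos (2 * \<phi>)) * (1 / W11 t n \<phi>))"
        by (intro continuous_on_mult cont continuous_intros)
      show "0 \<le> (1 - cos (2 * \<phi>)) * (1 / W11 t n \<phi>)" for \<phi> using W11_pos[of n \<phi>] by simp
      show "- pi \<le> r / 2" "r / 2 \<le> r" "r \<le> pi" using r pi_gt3 by auto
      fix \<phi> assume \<phi>: "r / 2 \<le> \<phi>" "\<phi> \<le> r"
      have "\<phi> / 4 \<le> sin \<phi>" using \<phi> r pi_gt3 by (intro sin_ge_quarter) auto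
      then have "r / 8 \<le> sin \<phi>" using \<phi> by simp
      then have "(r / 8)\<^sup>2 \<le> (sin \<phi>)\<^sup>2" using r by (intro power_mono) auto
      then have "1 / (64 * real n) \<le> (sin \<phi>)\<^sup>2" using r by (simp add: power_divide)
      then have "1 / (32 * real n) \<le> 1 - cos (2 * \<phi>)" by (simp add: cos_double_sin)
      then show "1 / (32 * real n) * K n \<le> (1 - cos (2 * \<phi>)) * (1 / W11 t n \<phi>)"
        using lower[OF n, of \<phi>] \<phi> r Kpos[of n] by (intro mult_mono) (auto simp: r_def)
    qed
    then show ?thesis by (simp add: r_def mult_ac)
  qed
  \<comment> \<open>The first term serves the lower bound for \<open>side n 0\<close>; the second is
    the quotient of the constants in \<open>s3\<close> and \<open>s2\<close>.\<close>
  define k where "k = min (exp (- rate 0 - 2 * b) / (2 * t)) (exp (- 2 * b) / (64 * t * D))"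
  have k: "k > 0" using t0 D by (simp add: k_def)
  show ?thesis
  proof (rule that[OF k])
    fix n :: nat assume n: "n \<ge> 1"
    have "k * exp (- real n * rate 0) / sqrt (real n) \<le> (exp (- rate 0 - 2 * b) / (2 * t)) * exp (- real n * rate 0) / sqrt (real n)"
      by (intro divide_right_mono mult_right_mono) (auto simp: k_def)
    also have "\<dots> = K n / (2 * sqrt (real n))"
    proof -
      have "exp (- rate 0 - 2 * b) * exp (- real n * rate 0) = exp (- real (Suc n) * rate 0) * exp (- 2 * b)"
        unfolding exp_add[symmetric] by (simp add: algebra_simps)
      then show ?thesis using t0 by (simp add: K_def mult_ac)
    qed
    finally show "k * exp (- real n * rate 0) / sqrt (real n) \<le> side n 0" using s1[OF n] by linarith
    have side_nn: "0 \<le> D * exp (- real (Suc n) * rate 0) / sqrt (real n)" using D by simp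
    have "k / real n * side n 0 \<le> (exp (- 2 * b) / (64 * t * D)) / real n * (D * exp (- real (Suc n) * rate 0) / sqrt (real n))"
    proof (intro mult_mono divide_right_mono)
      have "0 \<le> K n / (2 * sqrt (real n))" using Kpos[of n] by simp
      then show "0 \<le> side n 0" using s1[OF n] by linarith
      show "0 \<le> exp (- 2 * b) / (64 * t * D) / real n" using t0 D by simp
    qed (use s2[OF n] in \<open>auto simp: k_def\<close>)
    also have "\<dots> = K n / (64 * real n * sqrt (real n))"
      using D t0 by (simp add: K_def field_simps)
    finally show "k / real n * side n 0 \<le> side n 0 - side n 2" using s3[OF n] by linarith
  qed
qed

end

section \<open>Correlations along the side of a half plane\<close>

context subcritical
begin

text \<open>The limit of \<open>E11\<close> divided by its Chebyshev factor as the width grows,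
  since consecutive Chebyshev factors have a quotient tending to
  \<open>exp (- rate \<phi>)\<close>.\<close>

definition gap :: "real \<Rightarrow> real" where "gap \<phi> = N11 t \<phi> - exp (- rate \<phi>)"

lemma gap_ge: "sinh (rate \<phi>) \<le> gap \<phi>" "0 < gap \<phi>"
proof -
  show "sinh (rate \<phi>) \<le> gap \<phi>"
    using N11_rate(1)[of \<phi>] cosh_minus_sinh[of "rate \<phi>"] by (simp add: gap_def)
  then show "0 < gap \<phi>" using sinh_rate(2)[of \<phi>] by linarith
qed

text \<open>This is the characteristic equation of \<open>N\<close> at its eigenvalue
  \<open>exp (- rate \<phi>)\<close>.\<close>

lemma gap_prod: "gap \<phi> * (N22 t \<phi> - exp (- rate \<phi>)) = (N12 t \<phi>)\<^sup>2"
proof -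
  define x where "x = exp (- rate \<phi>)"
  have "x * exp (rate \<phi>) = 1" by (simp add: x_def flip: exp_add)
  moreover have "exp (rate \<phi>) + x = N11 t \<phi> + N22 t \<phi>"
    using cosh_rate[of \<phi>] by (simp add: cosh_def x_def trc_def)
  ultimately have "x * (N11 t \<phi> + N22 t \<phi>) = 1 + x\<^sup>2" by algebra
  then show ?thesis using det_N[OF tt, of \<phi>] unfolding gap_def x_def[symmetric] by algebra
qed

text \<open>The spectral weight in a representation of \<open>1 / gap\<close>. It vanishes
  quadratically at 0, where \<open>rate\<close> is least, and this yields the extra factor
  \<open>1 / l\<close> along a side.\<close>

definition dens :: "real \<Rightarrow> real" where "dens k = (sin k / sinh (rate k))\<^sup>2"

lemma cosh_rate_gt: "0 < cosh (rate k) - cos x"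
proof -
  have "1 < cosh (rate k)" using rate_pos[of k] cosh_real_strict_mono[of 0 "rate k"] by simp
  moreover have "cos x \<le> 1" by simp
  ultimately show ?thesis by linarith
qed

lemma continuous_dens: "continuous_on A dens"
  unfolding dens_def[abs_def] using sinh_rate(2) by (intro continuous_intros) (metis less_irrefl)

lemma kernel_integral: "((\<lambda>k. (sin k)\<^sup>2 / (cosh (rate k) - cos \<phi>)) has_integral 2 * pi * exp (- rate \<phi>)) {-pi..pi}"
proof -
  have "(\<lambda>k. (sin k)\<^sup>2 / (cosh (rate k) - cos \<phi>)) integrable_on {-pi..pi}"
    using cosh_rate_gt by (intro integrable_continuous_interval continuous_intros) (metis less_irrefl)
  moreover have "integral {-pi..pi} (\<lambda>k. (sin k)\<^sup>2 / (cosh (rate k) - cos \<phi>)) = 2 * pi * exp (- rate \<phi>)"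
    using poisson_integral[OF rate_pos[of \<phi>], of 1] by (simp add: cosh_rate_diff[of _ \<phi>] power2_eq_square)
  ultimately show ?thesis by (metis integrable_integral)
qed

definition resolvent :: "real \<Rightarrow> real" where
  "resolvent \<phi> = integral {-pi..pi} (\<lambda>k. dens k / (cosh (rate k) - cos \<phi>))"

text \<open>
  The difference of the two sides is \<open>a + b * cos \<phi>\<close> for some constants, and it vanishes
  at \<open>0\<close> and \<open>pi\<close>, so that \<open>a\<close> and \<open>b\<close> need not be computed.
\<close>

lemma spectral_representation: "(sin \<phi>)\<^sup>2 * resolvent \<phi> = 2 * pi * (N22 t \<phi> - exp (- rate \<phi>))"
proof -
  define A where "A = integral {-pi..pi} (\<lambda>k. dens k * cosh (rate k))"
  define B where "B = integral {-pi..pi} dens"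
  have step: "(sin \<phi>)\<^sup>2 * resolvent \<phi> = A + B * cos \<phi> - 2 * pi * exp (- rate \<phi>)" for \<phi>
  proof -
    have "((\<lambda>k. dens k * cosh (rate k)) has_integral A) {-pi..pi}"
      unfolding A_def by (intro integrable_integral integrable_continuous_interval continuous_intros continuous_dens)
    moreover have "((\<lambda>k. dens k * cos \<phi>) has_integral B * cos \<phi>) {-pi..pi}"
      unfolding B_def by (intro has_integral_mult_left integrable_integral integrable_continuous_interval continuous_dens)
    ultimately have "((\<lambda>k. dens k * cosh (rate k) + dens k * cos \<phi> - (sin k)\<^sup>2 / (cosh (rate k) - cos \<phi>))
        has_integral A + B * cos \<phi> - 2 * pi * exp (- rate \<phi>)) {-pi..pi}"
      by (intro has_integral_diff has_integral_add kernel_integral)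
    moreover have "dens k * cosh (rate k) + dens k * cos \<phi> - (sin k)\<^sup>2 / (cosh (rate k) - cos \<phi>)
        = (sin \<phi>)\<^sup>2 * (dens k / (cosh (rate k) - cos \<phi>))" for k
    proof -
      define D where "D = cosh (rate k) - cos \<phi>"
      have D: "D \<noteq> 0" using cosh_rate_gt[of k \<phi>] by (simp add: D_def)
      have "dens k * (sinh (rate k))\<^sup>2 = (sin k)\<^sup>2" using sinh_rate(2)[of k] by (simp add: dens_def power_divide)
      moreover have "(cosh (rate k))\<^sup>2 = (sinh (rate k))\<^sup>2 + 1" by (rule cosh_square_eq)
      moreover have "(sin \<phi>)\<^sup>2 + (cos \<phi>)\<^sup>2 = 1" by simp
      ultimately have "(dens k * cosh (rate k) + dens k * cos \<phi>) * D - (sin k)\<^sup>2 = (sin \<phi>)\<^sup>2 * dens k"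
        unfolding D_def by algebra
      then have "((dens k * cosh (rate k) + dens k * cos \<phi>) * D - (sin k)\<^sup>2) / D = (sin \<phi>)\<^sup>2 * dens k / D" by simp
      then show ?thesis using D by (simp add: diff_divide_distrib D_def[symmetric])
    qed
    ultimately have "((\<lambda>k. (sin \<phi>)\<^sup>2 * (dens k / (cosh (rate k) - cos \<phi>))) has_integral A + B * cos \<phi> - 2 * pi * exp (- rate \<phi>)) {-pi..pi}"
      by simp
    then show ?thesis unfolding resolvent_def by (metis integral_mult_right integral_unique)
  qed
  \<comment> \<open>Where the sine vanishes, \<open>N\<close> is diagonal and its smaller entry is
    the smaller eigenvalue.\<close>
  have ends: "exp (- rate \<phi>) = N22 t \<phi>" if "sin \<phi> = 0" for \<phi>
    using gap_prod[of \<phi>] gap_ge(2)[of \<phi>] that by (simp add: N12_def)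
  have "A + B = 2 * pi * (t * (c + s))" using step[of 0] ends[of 0] by (simp add: N22_def)
  moreover have "A - B = 2 * pi * (t * (c - s))" using step[of pi] ends[of pi] by (simp add: N22_def)
  ultimately have "A + B * cos \<phi> = 2 * pi * (t * (c + s * cos \<phi>))" by algebra
  then show ?thesis using step[of \<phi>] by (simp add: N22_def algebra_simps)
qed

lemma inverse_gap:
  assumes "sin \<phi> \<noteq> 0"
  shows "1 / gap \<phi> = resolvent \<phi> / (2 * pi * s\<^sup>2)"
proof -
  have "2 * pi * s\<^sup>2 * (sin \<phi>)\<^sup>2 = gap \<phi> * (2 * pi * (N22 t \<phi> - exp (- rate \<phi>)))"
    using gap_prod[of \<phi>] by (simp add: N12_def power_mult_distrib)
  also have "\<dots> = gap \<phi> * resolvent \<phi> * (sin \<phi>)\<^sup>2" using spectral_representation[of \<phi>] by (simp add: mult_ac)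
  finally have "2 * pi * s\<^sup>2 = gap \<phi> * resolvent \<phi>" using assms by simp
  moreover have "gap \<phi> \<noteq> 0" "2 * pi * s\<^sup>2 \<noteq> 0" using gap_ge(2)[of \<phi>] s_bounds(1) by auto
  ultimately show ?thesis by (simp only: frac_eq_eq) (simp add: mult.commute)
qed

text \<open>The limit of \<open>end_side\<close> for infinite width, by the estimate in
  \<open>end_side_le\<close>.\<close>

definition half_plane :: "nat \<Rightarrow> real" where
  "half_plane l = integral {-pi..pi} (\<lambda>\<phi>. sin (real l * \<phi>) * (s / t * sin \<phi> / gap \<phi>))"

lemma continuous_gap: "continuous_on A gap"
  unfolding gap_def[abs_def] by (intro continuous_intros continuous_N)

lemma half_plane_has_integral:
  "((\<lambda>\<phi>. sin (real l * \<phi>) * (s / t * sin \<phi> / gap \<phi>)) has_integral half_plane l) {-pi..pi}"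
  unfolding half_plane_def using gap_ge(2)
  by (intro integrable_integral integrable_continuous_interval continuous_intros continuous_gap) (metis less_irrefl)

text \<open>The integral that defines \<open>half_plane\<close> oscillates and shows no decay.
  Inserting the resolvent for \<open>1 / gap\<close>, exchanging the integrals and evaluating the
  inner one by \<open>poisson_integral\<close> gives a positive integrand with an explicit
  exponential.\<close>

lemma half_plane_eq:
  assumes l: "l \<ge> 1"
  shows "half_plane l = 1 / (s * t) * integral {-pi..pi} (\<lambda>k. dens k * exp (- real l * rate k))"
proof -
  define f where "f \<phi> k = sin (real l * \<phi>) * sin \<phi> * (dens k / (cosh (rate k) - cos \<phi>))" for \<phi> k
  have "half_plane l = integral {-pi..pi} (\<lambda>\<phi>. 1 / (2 * pi * (s * t)) * integral {-pi..pi} (f \<phi>))"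
    unfolding half_plane_def
  proof (rule integral_spike[of "{-pi, 0, pi}"])
    fix \<phi> assume "\<phi> \<in> {-pi..pi} - {-pi, 0, pi}"
    then have "sin \<phi> \<noteq> 0" using sin_eq_0_pi[of \<phi>] by auto
    then have "s / t * sin \<phi> / gap \<phi> = s / t * sin \<phi> * (resolvent \<phi> / (2 * pi * s\<^sup>2))"
      using inverse_gap[of \<phi>] by (metis mult.right_neutral times_divide_eq_right)
    then have "s / t * sin \<phi> / gap \<phi> = sin \<phi> * resolvent \<phi> / (2 * pi * (s * t))"
      using s_bounds(1) t0 by (simp add: power2_eq_square field_simps)
    moreover have "integral {-pi..pi} (f \<phi>) = sin (real l * \<phi>) * sin \<phi> * resolvent \<phi>"
      unfolding f_def resolvent_def by (rule integral_mult_right)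
    ultimately show "1 / (2 * pi * (s * t)) * integral {-pi..pi} (f \<phi>) = sin (real l * \<phi>) * (s / t * sin \<phi> / gap \<phi>)"
      by simp
  qed simp
  also have "\<dots> = 1 / (2 * pi * (s * t)) * integral {-pi..pi} (\<lambda>\<phi>. integral {-pi..pi} (f \<phi>))"
    by (rule integral_mult_right)
  also have "integral {-pi..pi} (\<lambda>\<phi>. integral {-pi..pi} (f \<phi>)) = integral {-pi..pi} (\<lambda>k. integral {-pi..pi} (\<lambda>\<phi>. f \<phi> k))"
  proof -
    have "continuous_on (cbox (-pi, -pi) (pi, pi)) (\<lambda>(\<phi>, k). f \<phi> k)"
      unfolding f_def case_prod_unfold using cosh_rate_gt
      by (intro continuous_intros continuous_on_compose2[OF continuous_dens[of UNIV]]) (auto, metis less_irrefl)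
    from integral_swap_continuous[OF this] show ?thesis by simp
  qed
  also have "\<dots> = integral {-pi..pi} (\<lambda>k. 2 * pi * (dens k * exp (- real l * rate k)))"
  proof (rule Henstock_Kurzweil_Integration.integral_cong)
    fix k
    have "integral {-pi..pi} (\<lambda>\<phi>. f \<phi> k) = integral {-pi..pi} (\<lambda>\<phi>. dens k * (sin (real l * \<phi>) * sin \<phi> / (cosh (rate k) - cos \<phi>)))"
      unfolding f_def by (simp add: mult_ac)
    also have "\<dots> = dens k * (2 * pi * exp (- real l * rate k))"
      unfolding integral_mult_right poisson_integral[OF rate_pos l] ..
    finally show "integral {-pi..pi} (\<lambda>\<phi>. f \<phi> k) = 2 * pi * (dens k * exp (- real l * rate k))" by simp
  qed
  also have "\<dots> = 2 * pi * integral {-pi..pi} (\<lambda>k. dens k * exp (- real l * rate k))"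
    by (rule integral_mult_right)
  finally show ?thesis by simp
qed

text \<open>The weight is at most of order \<open>k\<^sup>2\<close> and the exponential confines
  \<open>k\<close> to order \<open>1 / sqrt l\<close>, which makes the integral smaller by the
  factor \<open>1 / l\<close> than in \<open>side_bounds\<close>.\<close>

lemma half_plane_le:
  obtains C where "C > 0" "\<And>l. l \<ge> 1 \<Longrightarrow> half_plane l \<le> C * exp (- real l * rate 0) / (real l * sqrt (real l))"
proof -
  obtain a b where ab: "a > 0" "b > 0"
    "\<And>\<phi>. \<bar>\<phi>\<bar> \<le> pi \<Longrightarrow> rate 0 + a * \<phi>\<^sup>2 \<le> rate \<phi> \<and> rate \<phi> \<le> rate 0 + b * \<phi>\<^sup>2" by (rule rate_bounds) (rule that)
  define C where "C = 1 / (s * t) * (2 * pi / (a * sqrt (a / 2))) / (sinh (rate 0))\<^sup>2"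
  have C: "C > 0" using s_bounds t0 ab sinh_rate(2)[of 0] pi_gt_zero by (simp add: C_def)
  show ?thesis
  proof (rule that[OF C])
    fix l :: nat assume l: "l \<ge> 1"
    \<comment> \<open>The excess exponent \<open>l * a * k\<^sup>2\<close> is split into two equal
      parts \<open>d * k\<^sup>2\<close>: one exponential absorbs the factor
      \<open>k\<^sup>2\<close> of the weight, the other makes the integral converge like
      \<open>1 / sqrt d\<close>.\<close>
    define d where "d = real l * a / 2"
    have d: "d > 0" using l ab by (simp add: d_def)
    define X where "X = exp (- real l * rate 0) / (sinh (rate 0))\<^sup>2 / d"
    have X: "X \<ge> 0" using d by (simp add: X_def)
    have "integral {-pi..pi} (\<lambda>k. dens k * exp (- real l * rate k)) \<le> integral {-pi..pi} (\<lambda>k. X * (1 / (1 + d * k\<^sup>2)))"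
    proof (rule integral_le)
      show "(\<lambda>k. dens k * exp (- real l * rate k)) integrable_on {-pi..pi}"
        by (intro integrable_continuous_interval continuous_intros continuous_dens)
      have "1 + d * k\<^sup>2 > 0" for k using d by (intro add_pos_nonneg mult_nonneg_nonneg) auto
      then have "1 + d * k\<^sup>2 \<noteq> 0" for k by (metis less_irrefl)
      then show "(\<lambda>k. X * (1 / (1 + d * k\<^sup>2))) integrable_on {-pi..pi}"
        by (intro integrable_continuous_interval continuous_intros) auto
      fix k :: real assume k: "k \<in> {-pi..pi}"
      define x where "x = d * k\<^sup>2"
      have x: "x \<ge> 0" using d by (simp add: x_def)
      have "(sin k)\<^sup>2 \<le> k\<^sup>2" using abs_sin_x_le_abs_x[of k] by (simp add: abs_le_square_iff)
      moreover have "(sinh (rate 0))\<^sup>2 \<le> (sinh (rate k))\<^sup>2" using sinh_rate(1)[of k] sinh_rate(2)[of 0] by (intro power_mono) auto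
      ultimately have dens: "dens k \<le> k\<^sup>2 / (sinh (rate 0))\<^sup>2"
        unfolding dens_def power_divide using sinh_rate(2)[of 0] by (intro frac_le) auto
      have "rate 0 + a * k\<^sup>2 \<le> rate k" using ab k by auto
      then have "real l * (rate 0 + a * k\<^sup>2) \<le> real l * rate k" by (intro mult_left_mono) auto
      moreover have "real l * (rate 0 + a * k\<^sup>2) = real l * rate 0 + (x + x)" by (simp add: x_def d_def algebra_simps)
      ultimately have "- real l * rate k \<le> - real l * rate 0 + (- x + - x)" unfolding mult_minus_left by linarith
      then have "exp (- real l * rate k) \<le> exp (- real l * rate 0) * (exp (- x) * exp (- x))"
        unfolding exp_add[symmetric] by (simp only: exp_le_cancel_iff)
      also have "\<dots> \<le> exp (- real l * rate 0) * (1 / (1 + x) * (1 / (1 + x)))"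
        using x by (intro mult_left_mono mult_mono exp_neg_le_lorentz) auto
      finally have e: "exp (- real l * rate k) \<le> exp (- real l * rate 0) * (1 / (1 + x) * (1 / (1 + x)))" .
      have "dens k * exp (- real l * rate k) \<le> k\<^sup>2 / (sinh (rate 0))\<^sup>2 * (exp (- real l * rate 0) * (1 / (1 + x) * (1 / (1 + x))))"
        by (intro mult_mono dens e) auto
      also have "\<dots> = X * (x / (1 + x) * (1 / (1 + x)))"
        using d by (simp add: X_def x_def field_simps)
      also have "\<dots> \<le> X * (1 * (1 / (1 + x)))" using x X by (intro mult_left_mono mult_right_mono) auto
      finally show "dens k * exp (- real l * rate k) \<le> X * (1 / (1 + d * k\<^sup>2))" by (simp add: x_def)
    qed
    also have "\<dots> \<le> X * (pi / sqrt d)"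
      unfolding integral_mult_right using X integral_lorentz[OF d] by (intro mult_left_mono) auto
    finally have "half_plane l \<le> 1 / (s * t) * (X * (pi / sqrt d))"
      unfolding half_plane_eq[OF l] using s_bounds t0 by (intro mult_left_mono) auto
    also have "\<dots> = C * exp (- real l * rate 0) / (real l * sqrt (real l))"
    proof -
      have "sqrt d = sqrt (real l) * sqrt (a / 2)" by (simp add: d_def flip: real_sqrt_mult)
      then show ?thesis by (simp add: C_def X_def d_def mult_ac)
    qed
    finally show "half_plane l \<le> C * exp (- real l * rate 0) / (real l * sqrt (real l))" .
  qed
qed

text \<open>The identity \<open>E = S * gap \<phi> + x\<close> with
  \<open>x = exp (- (n + 1) * rate \<phi>)\<close> shows that replacing the strip by the half plane
  changes the integrand by an amount exponentially small in the width.\<close>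

lemma end_side_le: "end_side n y \<le> half_plane y + 2 * pi * (s / t * (exp (- real (Suc n) * rate 0) / sinh (rate 0)))"
proof -
  have bound: "\<bar>- sin (real y * \<phi>) * W12 t n \<phi> / W11 t n \<phi> - sin (real y * \<phi>) * (s / t * sin \<phi> / gap \<phi>)\<bar>
     \<le> s / t * (exp (- real (Suc n) * rate 0) / sinh (rate 0))" for \<phi>
  proof -
    define S where "S = cheb (trc t \<phi>) (Suc n)"
    define E where "E = E11 t n \<phi>"
    define h where "h = sinh (rate \<phi>)"
    define x where "x = exp (- real (Suc n) * rate \<phi>)"
    have h: "h > 0" unfolding h_def by (rule sinh_rate)
    have E1: "1 \<le> E" unfolding E_def by (rule E11_bounds)
    have "sinh (real n * rate \<phi>) = sinh (real (Suc n) * rate \<phi>) * cosh (rate \<phi>) - cosh (real (Suc n) * rate \<phi>) * sinh (rate \<phi>)"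
      using sinh_diff[of "real (Suc n) * rate \<phi>" "rate \<phi>"] by (simp add: algebra_simps)
    moreover have "x = cosh (real (Suc n) * rate \<phi>) - sinh (real (Suc n) * rate \<phi>)"
      using cosh_minus_sinh[of "real (Suc n) * rate \<phi>"] unfolding x_def mult_minus_left by simp
    moreover have "exp (- rate \<phi>) = cosh (rate \<phi>) - sinh (rate \<phi>)" by (rule cosh_minus_sinh[symmetric])
    ultimately have "h * E = h * (S * gap \<phi> + x)"
      using cheb_sinh[of \<phi> n] cheb_sinh[of \<phi> "Suc n"]
      unfolding E_def E11_def gap_def S_def h_def by algebra
    then have E: "E = S * gap \<phi> + x" using h by simp
    have g: "gap \<phi> > 0" by (rule gap_ge)
    have diff: "S / E - 1 / gap \<phi> = - (x / (E * gap \<phi>))"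
      using E1 g by (simp add: E field_simps)
    have "x / (E * gap \<phi>) \<le> exp (- real (Suc n) * rate 0) / sinh (rate 0)"
    proof (rule frac_le)
      have "real (Suc n) * rate 0 \<le> real (Suc n) * rate \<phi>" using rate_ge[of \<phi>] by (intro mult_left_mono) auto
      then show "x \<le> exp (- real (Suc n) * rate 0)" unfolding x_def mult_minus_left by (simp only: exp_le_cancel_iff neg_le_iff_le)
      have "1 * sinh (rate 0) \<le> E * gap \<phi>"
        using E1 sinh_rate(2)[of 0] order_trans[OF sinh_rate(1) gap_ge(1)] by (intro mult_mono) auto
      then show "sinh (rate 0) \<le> E * gap \<phi>" by simp
    qed (use sinh_rate in \<open>auto simp: x_def\<close>)
    moreover have "0 \<le> x / (E * gap \<phi>)" using E1 g by (simp add: x_def)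
    ultimately have d: "\<bar>S / E - 1 / gap \<phi>\<bar> \<le> exp (- real (Suc n) * rate 0) / sinh (rate 0)" unfolding diff by simp
    have "- sin (real y * \<phi>) * W12 t n \<phi> / W11 t n \<phi> - sin (real y * \<phi>) * (s / t * sin \<phi> / gap \<phi>)
      = (sin (real y * \<phi>) * sin \<phi>) * (s / t * (S / E - 1 / gap \<phi>))"
      using t0 E1 g by (simp add: W12_def W11_def N12_def S_def[symmetric] E_def[symmetric] field_simps)
    also have "\<bar>\<dots>\<bar> \<le> 1 * (s / t * (exp (- real (Suc n) * rate 0) / sinh (rate 0)))"
    proof -
      have "\<bar>sin (real y * \<phi>) * sin \<phi>\<bar> \<le> 1 * 1" unfolding abs_mult by (intro mult_mono) auto
      moreover have "\<bar>s / t * (S / E - 1 / gap \<phi>)\<bar> \<le> s / t * (exp (- real (Suc n) * rate 0) / sinh (rate 0))"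
        unfolding abs_mult using d s_bounds(1) t0 by (intro mult_mono) auto
      ultimately show ?thesis unfolding abs_mult[of "sin (real y * \<phi>) * sin \<phi>"] by (intro mult_mono) auto
    qed
    finally show ?thesis by simp
  qed
  from has_integral_diff_bound[OF end_side_has_integral half_plane_has_integral this] show ?thesis by linarith
qed

section \<open>The two estimates for finite grids\<close>

theorem grid_reflected_le:
  obtains k where "k > 0"
    "\<forall>l\<ge>1. \<exists>M0. \<forall>M\<ge>M0. \<forall>M'\<ge>M0. two_point t (grid l M M') (0, 0) (int l, -2) \<le>
        (1 - k / real l) * two_point t (grid l M M') (0, 0) (int l, 0)"
proof -
  obtain k0 where k0: "k0 > 0"
    "\<And>n. n \<ge> 1 \<Longrightarrow> k0 * exp (- real n * rate 0) / sqrt (real n) \<le> side n 0"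
    "\<And>n. n \<ge> 1 \<Longrightarrow> k0 / real n * side n 0 \<le> side n 0 - side n 2" by (rule side_bounds, (rule that)?)
  \<comment> \<open>Half of \<open>k0\<close> pays for the errors of the finite grid; the bound 1
    keeps \<open>1 - k / l\<close> nonnegative.\<close>
  define k where "k = min 1 (k0 / 2)"
  have k: "0 < k" "k \<le> 1" "k \<le> k0 / 2" using k0 by (auto simp: k_def)
  show ?thesis
  proof (rule that[OF k(1)], intro allI impI)
    fix l :: nat assume l: "l \<ge> 1"
    have pos: "side l 0 > 0" using k0(1) k0(2)[OF l] l by (smt (verit) divide_pos_pos exp_gt_zero mult_pos_pos of_nat_0_less_iff real_sqrt_gt_zero less_le_trans zero_less_one)
    \<comment> \<open>The error occurs twice, once for each correlation, and uses up half of the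
      difference \<open>k0 / l * side l 0\<close>.\<close>
    define \<epsilon> where "\<epsilon> = k0 / (4 * real l) * side l 0"
    have \<epsilon>: "\<epsilon> > 0" using k0(1) pos l by (simp add: \<epsilon>_def)
    obtain M0 where M0: "\<And>M M' y. M0 \<le> M \<Longrightarrow> M0 \<le> M' \<Longrightarrow> - int M \<le> y \<Longrightarrow> y \<le> int M' \<Longrightarrow>
      \<bar>2 * pi * two_point t (grid l M M') (0, 0) (int l, y) - side l y\<bar> \<le> \<epsilon>"
      by (rule grid_limit[OF \<epsilon>, of l], (rule that)?)
    show "\<exists>M0. \<forall>M\<ge>M0. \<forall>M'\<ge>M0. two_point t (grid l M M') (0, 0) (int l, -2) \<le>
        (1 - k / real l) * two_point t (grid l M M') (0, 0) (int l, 0)"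
    proof (intro exI[of _ "max M0 2"] allI impI)
      fix M M' assume M: "max M0 2 \<le> M" "max M0 2 \<le> M'"
      let ?G = "\<lambda>y. two_point t (grid l M M') (0, 0) (int l, y)"
      have "side l (-2) = side l 2" by (simp add: side_def)
      then have G2: "2 * pi * ?G (-2) \<le> side l 2 + \<epsilon>" using M0[of M M' "-2"] M by (simp; linarith)
      have G0: "side l 0 - \<epsilon> \<le> 2 * pi * ?G 0" using M0[of M M' 0] M by (simp; linarith)
      have kl: "0 \<le> 1 - k / real l" using k l by simp
      have "side l 2 + \<epsilon> \<le> (1 - k0 / real l) * side l 0 + \<epsilon>" using k0(3)[OF l] by (simp add: algebra_simps)
      also have "\<dots> = (1 - (k0 / 2) / real l) * side l 0 - \<epsilon>" using l by (simp add: \<epsilon>_def field_simps)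
      also have "\<dots> \<le> (1 - k / real l) * side l 0 - \<epsilon>"
        using k pos by (intro diff_right_mono mult_right_mono diff_left_mono divide_right_mono) auto
      also have "\<dots> \<le> (1 - k / real l) * (side l 0 - \<epsilon>)" using k \<epsilon> by (simp add: algebra_simps)
      also have "\<dots> \<le> (1 - k / real l) * (2 * pi * ?G 0)" using G0 kl by (intro mult_left_mono)
      finally have "side l 2 + \<epsilon> \<le> 2 * pi * ((1 - k / real l) * ?G 0)" by (simp only: mult_ac)
      with G2 have "2 * pi * ?G (-2) \<le> 2 * pi * ((1 - k / real l) * ?G 0)" by (rule order_trans)
      then show "?G (-2) \<le> (1 - k / real l) * ?G 0" by simp
    qed
  qed
qed

theorem half_strip_le:
  obtains C where "C > 0"
    "\<forall>l\<ge>1. \<exists>M0. \<forall>n. \<forall>M\<ge>M0. \<forall>M'\<ge>M0. two_point t ({0..int l} \<times> {0..int n}) (0, 0) (int l, 0) \<le>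
        C / real l * two_point t (grid l M M') (0, 0) (int l, 0)"
proof -
  obtain k0 where k0: "k0 > 0"
    "\<And>n. n \<ge> 1 \<Longrightarrow> k0 * exp (- real n * rate 0) / sqrt (real n) \<le> side n 0"
    "\<And>n. n \<ge> 1 \<Longrightarrow> k0 / real n * side n 0 \<le> side n 0 - side n 2" by (rule side_bounds, (rule that)?)
  obtain C0 where C0: "C0 > 0" "\<And>l. l \<ge> 1 \<Longrightarrow> half_plane l \<le> C0 * exp (- real l * rate 0) / (real l * sqrt (real l))"
    by (rule half_plane_le) (rule that)
  \<comment> \<open>A factor 3 comes from the bound \<open>3 * h\<close> and a factor 2 from
    \<open>side l 0 / 2\<close>, a lower bound for the correlation in the finite grid.\<close>
  define C where "C = 6 * C0 / k0"
  have C: "C > 0" using k0 C0 by (simp add: C_def)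
  show ?thesis
  proof (rule that[OF C], intro allI impI)
    fix l :: nat assume l: "l \<ge> 1"
    define h where "h = C0 * exp (- real l * rate 0) / (real l * sqrt (real l))"
    have h: "h > 0" using C0 l by (simp add: h_def)
    \<comment> \<open>The width \<open>m\<close> and the height of the enlarged grid depend on
      \<open>n\<close>, but the bound does not. One \<open>h\<close> bounds
      \<open>half_plane l\<close>, one pays for the finite width and one for the finite
      height.\<close>
    have half: "2 * pi * two_point t ({0..int l} \<times> {0..int n}) (0, 0) (int l, 0) \<le> 3 * h" for n
    proof -
      have "(\<lambda>m. 2 * pi * (s / t * (exp (- rate 0) ^ m / sinh (rate 0)))) \<longlonglongrightarrow> 2 * pi * (s / t * (0 / sinh (rate 0)))"
        using rate_pos[of 0] by (intro tendsto_intros LIMSEQ_realpow_zero) (auto simp: sinh_rate(2) less_imp_neq[symmetric])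
      then have "eventually (\<lambda>m. 2 * pi * (s / t * (exp (- rate 0) ^ m / sinh (rate 0))) < h) sequentially"
        using h by (intro order_tendstoD) auto
      then obtain m0 where m0: "\<And>m. m \<ge> m0 \<Longrightarrow> 2 * pi * (s / t * (exp (- rate 0) ^ m / sinh (rate 0))) < h"
        by (auto simp: eventually_sequentially)
      define m where "m = max m0 n"
      have "exp (- rate 0) ^ Suc m = exp (- real (Suc m) * rate 0)" unfolding exp_of_nat_mult[symmetric] by (simp add: algebra_simps)
      then have m1: "2 * pi * (s / t * (exp (- real (Suc m) * rate 0) / sinh (rate 0))) < h"
        using m0[of "Suc m"] by (simp add: m_def)
      obtain M0 where M0: "\<And>M M' y. M0 \<le> M \<Longrightarrow> M0 \<le> M' \<Longrightarrow> 1 \<le> y \<Longrightarrow> y \<le> M' \<Longrightarrow>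
        \<bar>2 * pi * two_point t (grid m M M') (0, 0) (0, int y) - end_side m y\<bar> \<le> h"
        by (rule grid_limit[OF h, of m], (rule that)?)
      define K where "K = max M0 l"
      have swap: "prod.swap ` ({0..int l} \<times> {0..int n}) = {0..int n} \<times> {0..int l}" by auto
      have "two_point t ({0..int l} \<times> {0..int n}) (0, 0) (int l, 0) = two_point t ({0..int n} \<times> {0..int l}) (0, 0) (0, int l)"
        using two_point_swap[of t "{0..int l} \<times> {0..int n}" "(0, 0)" "(int l, 0)"] unfolding swap by simp
      also have "\<dots> \<le> two_point t (grid m K K) (0, 0) (0, int l)"
        by (rule two_point_mono) (use t0 t1 finite_grid in \<open>auto simp: grid_def K_def m_def\<close>)
      finally have "2 * pi * two_point t ({0..int l} \<times> {0..int n}) (0, 0) (int l, 0) \<le> 2 * pi * two_point t (grid m K K) (0, 0) (0, int l)"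
        by (intro mult_left_mono) auto
      also have "\<dots> \<le> end_side m l + h" using M0[of K K l] l by (simp add: K_def; linarith)
      also have "\<dots> \<le> half_plane l + h + h" using end_side_le[of m l] m1 by linarith
      also have "\<dots> \<le> 3 * h" using C0(2)[OF l, folded h_def] by linarith
      finally show ?thesis .
    qed
    have pos: "side l 0 > 0" using k0(1) k0(2)[OF l] l by (smt (verit) divide_pos_pos exp_gt_zero mult_pos_pos of_nat_0_less_iff real_sqrt_gt_zero less_le_trans zero_less_one)
    then have \<epsilon>: "side l 0 / 2 > 0" by simp
    obtain M0 where M0: "\<And>M M' y. M0 \<le> M \<Longrightarrow> M0 \<le> M' \<Longrightarrow> - int M \<le> y \<Longrightarrow> y \<le> int M' \<Longrightarrow>
      \<bar>2 * pi * two_point t (grid l M M') (0, 0) (int l, y) - side l y\<bar> \<le> side l 0 / 2"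
      by (rule grid_limit[OF \<epsilon>, of l], (rule that)?)
    show "\<exists>M0. \<forall>n. \<forall>M\<ge>M0. \<forall>M'\<ge>M0. two_point t ({0..int l} \<times> {0..int n}) (0, 0) (int l, 0) \<le>
        C / real l * two_point t (grid l M M') (0, 0) (int l, 0)"
    proof (intro exI[of _ M0] allI impI)
      fix n M M' assume M: "M0 \<le> M" "M0 \<le> M'"
      let ?G = "two_point t (grid l M M') (0, 0) (int l, 0)"
      have "side l 0 / 2 \<le> 2 * pi * ?G" using M0[OF M, of 0] by (simp; linarith)
      then have "k0 * exp (- real l * rate 0) / sqrt (real l) \<le> 2 * (2 * pi * ?G)" using k0(2)[OF l] by linarith
      then have "(3 * C0 / (k0 * real l)) * (k0 * exp (- real l * rate 0) / sqrt (real l)) \<le> (3 * C0 / (k0 * real l)) * (2 * (2 * pi * ?G))"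
        using C0 k0 by (intro mult_left_mono) auto
      moreover have "(3 * C0 / (k0 * real l)) * (k0 * exp (- real l * rate 0) / sqrt (real l)) = 3 * h"
        using k0 l by (simp add: h_def field_simps)
      moreover have "(3 * C0 / (k0 * real l)) * (2 * (2 * pi * ?G)) = 2 * pi * (C / real l * ?G)"
        by (simp add: C_def)
      ultimately have "2 * pi * two_point t ({0..int l} \<times> {0..int n}) (0, 0) (int l, 0) \<le> 2 * pi * (C / real l * ?G)"
        using half[of n] by linarith
      then show "two_point t ({0..int l} \<times> {0..int n}) (0, 0) (int l, 0) \<le> C / real l * ?G"
        by (rule mult_left_le_imp_le) simp
    qed
  qed
qed

end

section \<open>Spins and even subgraphs\<close>

lemma adjacent_cases:
  assumes "adjacent x y"
  obtains a b where "{x, y} = {(a, b), (a + 1, b)}" | a b where "{x, y} = {(a, b), (a, b + 1)}"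
proof -
  obtain a b c d where xy: "x = (a, b)" "y = (c, d)" by (cases x; cases y)
  have "(c = a + 1 \<and> d = b) \<or> (a = c + 1 \<and> d = b) \<or> (c = a \<and> d = b + 1) \<or> (c = a \<and> b = d + 1)"
    using assms unfolding adjacent_def xy by (auto simp: abs_if split: if_splits)
  then show ?thesis using that unfolding xy by (auto simp: insert_commute)
qed

lemma adjacent_horizontal: "adjacent (a, b) (a + 1, b)"
  and adjacent_vertical: "adjacent (a, b) (a, b + 1)"
  by (simp_all add: adjacent_def)

text \<open>Each dual edge is written as the North or East edge of its lower or left end. A vertical
  dual edge may cross an edge to a frozen site, hence \<open>l + 1\<close> columns; a horizontal one
  crosses an edge inside a column of the strip.\<close>

lemma disagreement_edges_strip:
  "disagreement_edges (strip l) \<omega> =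
     {edge (i, j) North | i j. 0 \<le> i \<and> i \<le> int l \<and> l \<ge> 1 \<and> \<omega> (i, j + 1) \<noteq> \<omega> (i + 1, j + 1)} \<union>
     {edge (i, j) East | i j. 0 \<le> i \<and> i < int l \<and> \<omega> (i + 1, j) \<noteq> \<omega> (i + 1, j + 1)}" (is "?L = ?N \<union> ?E")
proof (intro set_eqI iffI)
  fix e assume "e \<in> ?L"
  then obtain x y where e: "e = dual_edge {x, y}" "adjacent x y" "{x, y} \<inter> strip l \<noteq> {}" "\<omega> x \<noteq> \<omega> y"
    unfolding disagreement_edges_def by blast
  from e(2) show "e \<in> ?N \<union> ?E"
  proof (cases rule: adjacent_cases)
    case (1 a b)
    have "\<omega> (a, b) \<noteq> \<omega> (a + 1, b)" using e(4) 1 by (auto simp: doubleton_eq_iff)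
    moreover have "0 \<le> a" "a \<le> int l" "l \<ge> 1" using e(3) unfolding 1 by (auto simp: strip_def)
    moreover have "e = edge (a, b - 1) North" unfolding e(1) 1 dual_edge_horizontal by (simp add: edge_def)
    ultimately have "e \<in> ?N" by (intro CollectI exI[of _ a] exI[of _ "b - 1"]) simp
    then show ?thesis ..
  next
    case (2 a b)
    have "\<omega> (a, b) \<noteq> \<omega> (a, b + 1)" using e(4) 2 by (auto simp: doubleton_eq_iff)
    moreover have "1 \<le> a" "a \<le> int l" using e(3) unfolding 2 by (auto simp: strip_def)
    moreover have "e = edge (a - 1, b) East" unfolding e(1) 2 dual_edge_vertical by (simp add: edge_def)
    ultimately have "e \<in> ?E" by (intro CollectI exI[of _ "a - 1"] exI[of _ b]) simp
    then show ?thesis ..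
  qed
next
  fix e assume "e \<in> ?N \<union> ?E"
  then show "e \<in> ?L"
  proof
    assume "e \<in> ?N"
    then obtain i j where e: "e = edge (i, j) North" "0 \<le> i" "i \<le> int l" "l \<ge> 1" "\<omega> (i, j + 1) \<noteq> \<omega> (i + 1, j + 1)" by blast
    have "e = dual_edge {(i, j + 1), (i + 1, j + 1)}" unfolding dual_edge_horizontal e(1) by (simp add: edge_def)
    moreover have "{(i, j + 1), (i + 1, j + 1)} \<inter> strip l \<noteq> {}" using e by (cases "i = 0") (auto simp: strip_def)
    ultimately show ?thesis unfolding disagreement_edges_def using e adjacent_horizontal by blast
  next
    assume "e \<in> ?E"
    then obtain i j where e: "e = edge (i, j) East" "0 \<le> i" "i < int l" "\<omega> (i + 1, j) \<noteq> \<omega> (i + 1, j + 1)" by blast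
    have "e = dual_edge {(i + 1, j), (i + 1, j + 1)}" unfolding dual_edge_vertical e(1) by (simp add: edge_def)
    moreover have "{(i + 1, j), (i + 1, j + 1)} \<inter> strip l \<noteq> {}" using e by (auto simp: strip_def)
    ultimately show ?thesis unfolding disagreement_edges_def using e adjacent_vertical by blast
  qed
qed

lemma north_east_edges [simp]:
  "edge (i, j) North = edge (i', j') North \<longleftrightarrow> i = i' \<and> j = j'"
  "edge (i, j) East = edge (i', j') East \<longleftrightarrow> i = i' \<and> j = j'"
  "edge (i, j) North \<noteq> edge (i', j') East" "edge (i, j) East \<noteq> edge (i', j') North"
  by (auto simp: edge_def doubleton_eq_iff)

lemma south_west_edges: "edge (i, j) South = edge (i, j - 1) North" "edge (i, j) West = edge (i - 1, j) East"
  by (auto simp: edge_def)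

lemma mem_disagreement:
  assumes "l \<ge> 1"
  shows "edge (i, j) North \<in> disagreement_edges (strip l) \<omega> \<longleftrightarrow> 0 \<le> i \<and> i \<le> int l \<and> \<omega> (i, j + 1) \<noteq> \<omega> (i + 1, j + 1)"
    "edge (i, j) East \<in> disagreement_edges (strip l) \<omega> \<longleftrightarrow> 0 \<le> i \<and> i < int l \<and> \<omega> (i + 1, j) \<noteq> \<omega> (i + 1, j + 1)"
    "edge (i, j) South \<in> disagreement_edges (strip l) \<omega> \<longleftrightarrow> 0 \<le> i \<and> i \<le> int l \<and> \<omega> (i, j) \<noteq> \<omega> (i + 1, j)"
    "edge (i, j) West \<in> disagreement_edges (strip l) \<omega> \<longleftrightarrow> 1 \<le> i \<and> i \<le> int l \<and> \<omega> (i, j) \<noteq> \<omega> (i, j + 1)"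
  using assms by (auto simp: disagreement_edges_strip south_west_edges)

lemma card_incident_edges:
  assumes "\<And>e. e \<in> E \<Longrightarrow> \<exists>v d. e = edge v d"
  shows "card {e \<in> E. v \<in> e} = of_bool (edge v North \<in> E) + of_bool (edge v East \<in> E) + of_bool (edge v South \<in> E) + of_bool (edge v West \<in> E)"
proof -
  have "{e \<in> E. v \<in> e} = edge v ` {d. edge v d \<in> E}"
  proof (intro set_eqI iffI)
    fix e assume e: "e \<in> {e \<in> E. v \<in> e}"
    then obtain a d where "e = edge a d" using assms by blast
    then obtain d' where "e = edge v d'" using mem_edge e by blast
    then show "e \<in> edge v ` {d. edge v d \<in> E}" using e by auto
  qed (auto simp: edge_def)
  then have "card {e \<in> E. v \<in> e} = card {d. edge v d \<in> E}" by (simp add: card_image inj_on_def)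
  also have "\<dots> = (\<Sum>d\<in>UNIV. of_bool (edge v d \<in> E))" by (simp add: Collect_conj_eq[symmetric])
  also have "\<dots> = of_bool (edge v North \<in> E) + of_bool (edge v East \<in> E) + of_bool (edge v South \<in> E) + of_bool (edge v West \<in> E)"
    by (simp add: UNIV_dir)
  finally show ?thesis .
qed

definition strip_spins :: "nat \<Rightarrow> (site \<Rightarrow> int) \<Rightarrow> bool" where
  "strip_spins l \<omega> \<longleftrightarrow> (\<forall>p. \<omega> p \<in> {-1, 1}) \<and> (\<forall>p. p \<notin> strip l \<longrightarrow> \<omega> p = strip_bc p)"

definition plus_row :: "nat \<Rightarrow> nat \<Rightarrow> (site \<Rightarrow> int) \<Rightarrow> bool" where
  "plus_row l n \<sigma> \<longleftrightarrow> (\<forall>x\<in>{1..int l}. \<sigma> (x, - int n) = 1)"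

definition minus_row :: "nat \<Rightarrow> nat \<Rightarrow> (site \<Rightarrow> int) \<Rightarrow> bool" where
  "minus_row l n \<sigma> \<longleftrightarrow> (\<forall>x\<in>{1..int l}. \<sigma> (x, int n) = -1)"

lemma strip_spins_cases: "strip_spins l \<omega> \<Longrightarrow> \<omega> p = 1 \<or> \<omega> p = -1"
  unfolding strip_spins_def by (metis insertE singletonD)

lemma strip_spins_sides:
  assumes "strip_spins l \<omega>"
  shows "\<omega> (0, y) = (if y > 0 then -1 else 1)" "\<omega> (int l + 1, y) = (if y > 0 then -1 else 1)"
  using assms by (auto simp: strip_spins_def strip_def strip_bc_def)

lemma even_cycle:
  fixes a b c d :: int
  assumes "a = 1 \<or> a = -1" "b = 1 \<or> b = -1" "c = 1 \<or> c = -1" "d = 1 \<or> d = -1"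
  shows "even (of_bool (d \<noteq> c) + of_bool (b \<noteq> c) + of_bool (a \<noteq> b) + of_bool (a \<noteq> d) :: nat)"
  using assms by (elim disjE) simp_all

text \<open>Around a unit square the spin changes an even number of times. On the two sides of the
  strip the fourth edge joins frozen sites and is not counted; it carries a change exactly at height
  0.\<close>

lemma disagreement_even:
  assumes l: "l \<ge> 1" and \<omega>: "strip_spins l \<omega>"
  shows "even (card {e \<in> disagreement_edges (strip l) \<omega>. v \<in> e}) \<longleftrightarrow> v \<noteq> (0, 0) \<and> v \<noteq> (int l, 0)"
proof -
  obtain i j where v: "v = (i, j)" by (cases v)
  let ?E = "disagreement_edges (strip l) \<omega>"
  have card: "card {e \<in> ?E. v \<in> e} = of_bool (edge v North \<in> ?E) + of_bool (edge v East \<in> ?E) +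
      of_bool (edge v South \<in> ?E) + of_bool (edge v West \<in> ?E)" for v
    by (rule card_incident_edges) (auto simp: disagreement_edges_strip)
  note cyc = even_cycle[OF strip_spins_cases[OF \<omega>, of "(i, j)"] strip_spins_cases[OF \<omega>, of "(i + 1, j)"]
    strip_spins_cases[OF \<omega>, of "(i + 1, j + 1)"] strip_spins_cases[OF \<omega>, of "(i, j + 1)"]]
  consider "i < 0" | "i > int l" | "i = 0" | "i = int l" | "1 \<le> i" "i < int l" by linarith
  then show ?thesis
  proof cases
    case 3
    then have "\<omega> (i, j) \<noteq> \<omega> (i, j + 1) \<longleftrightarrow> j = 0" by (simp add: strip_spins_sides[OF \<omega>])
    moreover have "card {e \<in> disagreement_edges (strip l) \<omega>. v \<in> e} =
       of_bool (\<omega> (i, j + 1) \<noteq> \<omega> (i + 1, j + 1)) + of_bool (\<omega> (i + 1, j) \<noteq> \<omega> (i + 1, j + 1)) + of_bool (\<omega> (i, j) \<noteq> \<omega> (i + 1, j))"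
      unfolding card v mem_disagreement[OF l] using 3 l by simp
    ultimately show ?thesis using cyc l 3 by (cases "j = 0") (simp_all add: v)
  next
    case 4
    then have "\<omega> (i + 1, j) \<noteq> \<omega> (i + 1, j + 1) \<longleftrightarrow> j = 0" by (simp add: strip_spins_sides[OF \<omega>])
    moreover have "card {e \<in> disagreement_edges (strip l) \<omega>. v \<in> e} =
       of_bool (\<omega> (i, j + 1) \<noteq> \<omega> (i + 1, j + 1)) + of_bool (\<omega> (i, j) \<noteq> \<omega> (i + 1, j)) + of_bool (\<omega> (i, j) \<noteq> \<omega> (i, j + 1))"
      unfolding card v mem_disagreement[OF l] using 4 l by simp
    ultimately show ?thesis using cyc l 4 by (cases "j = 0") (simp_all add: v)
  next
    case 5
    then have "card {e \<in> disagreement_edges (strip l) \<omega>. v \<in> e} =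
       of_bool (\<omega> (i, j + 1) \<noteq> \<omega> (i + 1, j + 1)) + of_bool (\<omega> (i + 1, j) \<noteq> \<omega> (i + 1, j + 1)) +
       of_bool (\<omega> (i, j) \<noteq> \<omega> (i + 1, j)) + of_bool (\<omega> (i, j) \<noteq> \<omega> (i, j + 1))"
      unfolding card v mem_disagreement[OF l] by simp
    then show ?thesis using cyc 5 by (simp add: v)
  qed (use l in \<open>auto simp: card v mem_disagreement[OF l]\<close>)
qed

definition box :: "nat \<Rightarrow> nat \<Rightarrow> nat \<Rightarrow> site set" where
  "box l n n' = {1..int l} \<times> {- int n<..<int n'}"

text \<open>The unit squares between the rows \<open>- n\<close> and \<open>n'\<close> have heights
  \<open>- n\<close> to \<open>n' - 1\<close>.\<close>

definition dual_box :: "nat \<Rightarrow> nat \<Rightarrow> nat \<Rightarrow> dual_site set" where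
  "dual_box l n n' = grid l n (n' - 1)"

lemma mem_dual_box: "n' \<ge> 1 \<Longrightarrow> (i, j) \<in> dual_box l n n' \<longleftrightarrow> 0 \<le> i \<and> i \<le> int l \<and> - int n \<le> j \<and> j < int n'"
  by (auto simp: dual_box_def grid_def of_nat_diff)

lemma finite_dual_box: "finite (dual_box l n n')"
  by (simp add: dual_box_def finite_grid)

lemma plus_row_sites: "strip_spins l \<omega> \<Longrightarrow> plus_row l n \<omega> \<Longrightarrow> 0 \<le> x \<Longrightarrow> x \<le> int l + 1 \<Longrightarrow> \<omega> (x, - int n) = 1"
  by (cases "x = 0 \<or> x = int l + 1") (auto simp: strip_spins_sides plus_row_def)

lemma minus_row_sites: "strip_spins l \<omega> \<Longrightarrow> minus_row l n \<omega> \<Longrightarrow> n \<ge> 1 \<Longrightarrow> 0 \<le> x \<Longrightarrow> x \<le> int l + 1 \<Longrightarrow> \<omega> (x, int n) = -1"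
  by (cases "x = 0 \<or> x = int l + 1") (auto simp: strip_spins_sides minus_row_def)

lemma dual_box_closed:
  assumes l: "l \<ge> 1" and n': "n' \<ge> 1" and \<omega>: "strip_spins l \<omega>" and rows: "plus_row l n \<omega>" "minus_row l n' \<omega>"
    and v: "v \<in> dual_box l n n'" and e: "edge v d \<in> disagreement_edges (strip l) \<omega>"
  shows "shift v d \<in> dual_box l n n'"
proof -
  obtain i j where ij: "v = (i, j)" by (cases v)
  note p = plus_row_sites[OF \<omega> rows(1)] minus_row_sites[OF \<omega> rows(2) n']
  show ?thesis
  proof (cases d)
    case North
    then have "j + 1 \<noteq> int n'" using e p(2)[of i] p(2)[of "i + 1"] by (auto simp: ij mem_disagreement[OF l])
    then show ?thesis using v North by (auto simp: ij mem_dual_box[OF n'])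
  next
    case South
    then have "j \<noteq> - int n" using e p(1)[of i] p(1)[of "i + 1"] by (auto simp: ij mem_disagreement[OF l])
    then show ?thesis using v South by (auto simp: ij mem_dual_box[OF n'])
  next
    case East
    then show ?thesis using v e by (auto simp: ij mem_dual_box[OF n'] mem_disagreement[OF l])
  next
    case West
    then show ?thesis using v e by (auto simp: ij mem_dual_box[OF n'] mem_disagreement[OF l])
  qed
qed

lemma dual_box_component:
  assumes l: "l \<ge> 1" and n': "n' \<ge> 1" and \<omega>: "strip_spins l \<omega>" and rows: "plus_row l n \<omega>" "minus_row l n' \<omega>"
    and g: "g \<in> disagreement_edges (strip l) \<omega> \<inter> grid_edges (dual_box l n n')"
    and h: "h \<in> disagreement_edges (strip l) \<omega>" and gh: "v \<in> g" "v \<in> h"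
  shows "h \<in> disagreement_edges (strip l) \<omega> \<inter> grid_edges (dual_box l n n')"
proof -
  have v: "v \<in> dual_box l n n'" using g gh grid_edges_subset by blast
  obtain a d' where "h = edge a d'" using h by (auto simp: disagreement_edges_strip)
  then obtain d where d: "h = edge v d" using mem_edge gh by blast
  then have "shift v d \<in> dual_box l n n'" using dual_box_closed[OF l n' \<omega> rows v] h by simp
  then show ?thesis using h d v unfolding grid_edges_def by blast
qed

lemma boundary_dual_box:
  assumes l: "l \<ge> 1" and n': "n' \<ge> 1" and \<omega>: "strip_spins l \<omega>" and rows: "plus_row l n \<omega>" "minus_row l n' \<omega>"
  shows "boundary (disagreement_edges (strip l) \<omega> \<inter> grid_edges (dual_box l n n')) = sdiff {(0, 0)} {(int l, 0)}"
proof -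
  let ?E = "disagreement_edges (strip l) \<omega>" and ?U = "grid_edges (dual_box l n n')"
  have eq: "{e \<in> ?E \<inter> ?U. v \<in> e} = (if v \<in> dual_box l n n' then {e \<in> ?E. v \<in> e} else {})" for v
  proof (cases "v \<in> dual_box l n n'")
    case True
    have "e \<in> ?U" if e: "e \<in> ?E" "v \<in> e" for e
    proof -
      obtain a d' where "e = edge a d'" using e by (auto simp: disagreement_edges_strip)
      then obtain d where d: "e = edge v d" using mem_edge e by blast
      then have "shift v d \<in> dual_box l n n'" using dual_box_closed[OF l n' \<omega> rows True] e by simp
      then show ?thesis using d True unfolding grid_edges_def by blast
    qed
    then show ?thesis using True by auto
  qed (auto dest: grid_edges_subset)
  have "(0, 0) \<in> dual_box l n n'" "(int l, 0) \<in> dual_box l n n'" using n' by (auto simp: mem_dual_box)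
  then show ?thesis
    using l unfolding boundary_def eq by (auto simp: disagreement_even[OF l \<omega>] sdiff_def)
qed

text \<open>
  The spins are recovered from an even subgraph by counting the edges crossed from the left side;
  the parity at the dual sites makes this consistent with the other boundary values.
\<close>

lemma disagreement_surjective:
  assumes l: "l \<ge> 1" and n: "n \<ge> 1" "n' \<ge> 1"
    and F: "F \<subseteq> grid_edges (dual_box l n n')" "boundary F = sdiff {(0, 0)} {(int l, 0)}"
  obtains g :: "site \<Rightarrow> int" where "\<And>p. g p \<in> {-1, 1}"
    "\<And>\<omega>. (\<And>p. p \<in> {0..int l + 1} \<times> {- int n..int n'} \<Longrightarrow> \<omega> p = g p) \<Longrightarrow>
       disagreement_edges (strip l) \<omega> \<inter> grid_edges (dual_box l n n') = F"
    "\<And>y. - int n \<le> y \<Longrightarrow> y \<le> int n' \<Longrightarrow> g (0, y) = strip_bc (0, y) \<and> g (int l + 1, y) = strip_bc (int l + 1, y)"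
    "\<And>x. g (x, - int n) = 1" "\<And>x. g (x, int n') = -1"
proof -
  define g :: "site \<Rightarrow> int" where
    "g = (\<lambda>(x, y). (if y > 0 then -1 else 1) * (-1) ^ card {i. 0 \<le> i \<and> i < x \<and> edge (i, y - 1) North \<in> F})"
  have mem: "0 \<le> i \<and> i \<le> int l \<and> - int n \<le> j \<and> j + 1 < int n'" if "edge (i, j) North \<in> F" for i j
    using that F(1) grid_edges_subset[of "edge (i, j) North" "dual_box l n n'"] by (auto simp: edge_def mem_dual_box[OF n(2)])
  have memE: "0 \<le> i \<and> i < int l \<and> - int n \<le> j \<and> j < int n'" if "edge (i, j) East \<in> F" for i j
    using that F(1) grid_edges_subset[of "edge (i, j) East" "dual_box l n n'"] by (auto simp: edge_def mem_dual_box[OF n(2)])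
  have g_cases: "g p = 1 \<or> g p = -1" for p
  proof -
    have pm: "(-1 :: int) ^ k = 1 \<or> (-1 :: int) ^ k = -1" for k :: nat by (induction k) auto
    define k where "k = card {i. 0 \<le> i \<and> i < fst p \<and> edge (i, snd p - 1) North \<in> F}"
    have "g p = (if snd p > 0 then -1 else 1) * (-1) ^ k"
      by (simp only: g_def case_prod_unfold k_def)
    then show ?thesis using pm[of k] by auto
  qed
  have g0: "g (0, y) = (if y > 0 then -1 else 1)" for y
  proof -
    have "{i :: int. 0 \<le> i \<and> i < 0 \<and> edge (i, y - 1) North \<in> F} = {}" by auto
    then show ?thesis by (simp only: g_def prod.case card.empty power_0 mult_1_right)
  qed
  have gstep: "g (x + 1, y) = (if edge (x, y - 1) North \<in> F then - g (x, y) else g (x, y))" if "x \<ge> 0" for x y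
  proof -
    have less: "i < x + 1 \<longleftrightarrow> i = x \<or> i < x" for i by auto
    have eq: "{i. 0 \<le> i \<and> i < x + 1 \<and> edge (i, y - 1) North \<in> F} =
      (if edge (x, y - 1) North \<in> F then insert x {i. 0 \<le> i \<and> i < x \<and> edge (i, y - 1) North \<in> F}
       else {i. 0 \<le> i \<and> i < x \<and> edge (i, y - 1) North \<in> F})"
      unfolding less using that by auto
    have fin: "finite {i. 0 \<le> i \<and> i < x \<and> edge (i, y - 1) North \<in> F}"
      by (rule finite_subset[of _ "{0..<x}"]) auto
    show ?thesis unfolding g_def prod.case eq using fin by simp
  qed
  have finF: "finite F" using F(1) finite_grid_edges[OF finite_dual_box] finite_subset by blast
  have edgesF: "\<exists>v d. e = edge v d" if "e \<in> F" for e using that F(1) unfolding grid_edges_def by blast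
  have par: "odd (of_bool (edge v North \<in> F) + of_bool (edge v East \<in> F) + of_bool (edge v South \<in> F) + of_bool (edge v West \<in> F) :: nat)
      \<longleftrightarrow> v = (0, 0) \<or> v = (int l, 0)" for v
  proof -
    have "card {e \<in> F. v \<in> e} = of_bool (edge v North \<in> F) + of_bool (edge v East \<in> F) +
        of_bool (edge v South \<in> F) + of_bool (edge v West \<in> F)"
      by (rule card_incident_edges[OF edgesF])
    moreover have "v \<in> boundary F \<longleftrightarrow> v = (0, 0) \<or> v = (int l, 0)"
      using l unfolding F(2) by auto
    ultimately show ?thesis by (simp add: boundary_def)
  qed
  \<comment> \<open>By parity at the dual sites, vertical neighbours disagree exactly across the
    East edges of \<open>F\<close>. On the two frozen columns the only change is at height 0, where
    the edge is missing from \<open>F\<close> and the odd vertices \<open>(0, 0)\<close> and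
    \<open>(l, 0)\<close> make up for it.\<close>
  have change: "(g (x, j) \<noteq> g (x, j + 1)) = (if x = 0 then j = 0 else (edge (x - 1, j) East \<in> F) \<noteq> (x = int l + 1 \<and> j = 0))"
    if "0 \<le> x" "x \<le> int l + 1" for x j
    using that
  proof (induction x rule: int_ge_induct)
    case base
    then show ?case by (simp add: g0)
  next
    case (step x)
    then have x: "0 \<le> x" "x \<le> int l" by auto
    have IH: "(g (x, j) \<noteq> g (x, j + 1)) = (if x = 0 then j = 0 else edge (x - 1, j) East \<in> F)"
      using step x by auto
    have W: "edge (x, j) West \<in> F \<longleftrightarrow> x \<noteq> 0 \<and> edge (x - 1, j) East \<in> F"
      using memE[of "x - 1" j] by (auto simp: south_west_edges)
    have E: "x = int l \<Longrightarrow> edge (x, j) East \<notin> F" using memE[of x j] by auto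
    have c: "g (x, j) = 1 \<or> g (x, j) = -1" "g (x, j + 1) = 1 \<or> g (x, j + 1) = -1" by (rule g_cases)+
    have "(g (x + 1, j) \<noteq> g (x + 1, j + 1)) =
      ((g (x, j) \<noteq> g (x, j + 1)) \<noteq> ((edge (x, j) North \<in> F) \<noteq> (edge (x, j) South \<in> F)))"
      using c gstep[OF x(1), of j] gstep[OF x(1), of "j + 1"] by (auto simp: south_west_edges)
    also have "\<dots> = ((edge (x, j) East \<in> F) \<noteq> (x = int l \<and> j = 0))"
      using par[of "(x, j)"] IH W E l by (auto split: if_splits)
    finally show ?case using x by auto
  qed
  have row_low: "g (x, - int n) = 1" for x
  proof -
    have "{i. 0 \<le> i \<and> i < x \<and> edge (i, - int n - 1) North \<in> F} = {}" using mem[of _ "- int n - 1"] by auto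
    then show ?thesis by (simp only: g_def prod.case) simp
  qed
  have row_high: "g (x, int n') = -1" for x
  proof -
    have "{i. 0 \<le> i \<and> i < x \<and> edge (i, int n' - 1) North \<in> F} = {}" using mem[of _ "int n' - 1"] by auto
    then show ?thesis using n by (simp only: g_def prod.case) simp
  qed
  have right: "g (int l + 1, y) = (if y > 0 then -1 else 1)" if "- int n \<le> y" for y
    using that
  proof (induction y rule: int_ge_induct)
    case base
    then show ?case using row_low by simp
  next
    case (step y)
    have "edge (int l, y) East \<notin> F" using memE[of "int l" y] by auto
    then have "(g (int l + 1, y) \<noteq> g (int l + 1, y + 1)) = (y = 0)"
      using change[of "int l + 1" y] by auto
    then show ?case using step g_cases[of "(int l + 1, y + 1)"] by (auto split: if_splits)
  qed
  show ?thesis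
  proof (rule that[of g])
    show "g p \<in> {-1, 1}" for p using g_cases[of p] by auto
    show "g (0, y) = strip_bc (0, y) \<and> g (int l + 1, y) = strip_bc (int l + 1, y)" if "- int n \<le> y" "y \<le> int n'" for y
      using g0 right[OF that(1)] by (simp add: strip_bc_def)
    fix \<omega> :: "site \<Rightarrow> int"
    assume \<omega>: "\<And>p. p \<in> {0..int l + 1} \<times> {- int n..int n'} \<Longrightarrow> \<omega> p = g p"
    have N: "edge (i, j) North \<in> disagreement_edges (strip l) \<omega> \<longleftrightarrow> edge (i, j) North \<in> F"
      if "(i, j) \<in> dual_box l n n'" "(i, j + 1) \<in> dual_box l n n'" for i j
    proof -
      have r: "0 \<le> i" "i \<le> int l" "- int n \<le> j" "j + 1 < int n'" using that by (auto simp: mem_dual_box[OF n(2)])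
      then have "\<omega> (i, j + 1) = g (i, j + 1)" "\<omega> (i + 1, j + 1) = g (i + 1, j + 1)" by (auto intro!: \<omega>)
      then show ?thesis using gstep[OF r(1), of "j + 1"] g_cases[of "(i, j + 1)"] r by (auto simp: mem_disagreement[OF l])
    qed
    have E: "edge (i, j) East \<in> disagreement_edges (strip l) \<omega> \<longleftrightarrow> edge (i, j) East \<in> F"
      if "(i, j) \<in> dual_box l n n'" "(i + 1, j) \<in> dual_box l n n'" for i j
    proof -
      have r: "0 \<le> i" "i < int l" "- int n \<le> j" "j < int n'" using that by (auto simp: mem_dual_box[OF n(2)])
      then have "\<omega> (i + 1, j) = g (i + 1, j)" "\<omega> (i + 1, j + 1) = g (i + 1, j + 1)" by (auto intro!: \<omega>)
      then show ?thesis using change[of "i + 1" j] r by (auto simp: mem_disagreement[OF l])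
    qed
    have "e \<in> disagreement_edges (strip l) \<omega> \<longleftrightarrow> e \<in> F" if "e \<in> grid_edges (dual_box l n n')" for e
      using that
    proof (cases rule: grid_edges_cases)
      case (vertical x y)
      then show ?thesis using N[of x y] by (simp add: edge_def)
    next
      case (horizontal x y)
      then show ?thesis using E[of x y] by (simp add: edge_def)
    qed
    then show "disagreement_edges (strip l) \<omega> \<inter> grid_edges (dual_box l n n') = F" using F(1) by auto
  qed (use row_low row_high in auto)
qed

text \<open>Infinitely many rows in both directions, so that every edge of the configuration lies in
  some enclosed box; this gives the assumption \<open>confined\<close> of
  \<open>interface_graph\<close>.\<close>

definition good_rows :: "nat \<Rightarrow> (site \<Rightarrow> int) \<Rightarrow> bool" where
  "good_rows l \<sigma> \<longleftrightarrow> (\<forall>N. (\<exists>n\<ge>N. plus_row l n \<sigma>) \<and> (\<exists>n\<ge>N. minus_row l n \<sigma>))"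

lemma interface_graph_disagreement:
  assumes l: "l \<ge> 1" and \<omega>: "strip_spins l \<omega>" and good: "good_rows l \<omega>"
  shows "interface_graph (disagreement_edges (strip l) \<omega>) (0, 0) (int l, 0)"
proof
  let ?E = "disagreement_edges (strip l) \<omega>"
  show "\<exists>v d. e = edge v d" if "e \<in> ?E" for e using that by (auto simp: disagreement_edges_strip)
  show "even (card {e \<in> ?E. v \<in> e}) \<longleftrightarrow> v \<noteq> (0, 0) \<and> v \<noteq> (int l, 0)" for v
    by (rule disagreement_even[OF l \<omega>])
  show "(0, 0) \<noteq> (int l, 0 :: int)" using l by simp
  show "edge (0, 0) West \<notin> ?E" "edge (int l, 0) East \<notin> ?E" by (simp_all add: mem_disagreement[OF l])
  fix f assume f: "f \<in> ?E"
  obtain i j where ij: "f = edge (i, j) North \<and> 0 \<le> i \<and> i \<le> int l \<or> f = edge (i, j) East \<and> 0 \<le> i \<and> i < int l"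
    using f by (auto simp: disagreement_edges_strip)
  obtain n where n: "n \<ge> nat \<bar>j\<bar> + 2" "plus_row l n \<omega>" using good by (auto simp: good_rows_def)
  obtain n' where n': "n' \<ge> nat \<bar>j\<bar> + 2" "minus_row l n' \<omega>" using good by (auto simp: good_rows_def)
  have n'1: "n' \<ge> 1" using n' by simp
  let ?F = "?E \<inter> grid_edges (dual_box l n n')"
  have "f \<in> grid_edges (dual_box l n n')"
  proof -
    have "- int n \<le> j" "j + 1 < int n'" using n n' by auto
    then have "(i, j) \<in> dual_box l n n' \<and> (f = edge (i, j) North \<and> shift (i, j) North \<in> dual_box l n n' \<or>
        f = edge (i, j) East \<and> shift (i, j) East \<in> dual_box l n n')"
      using ij by (auto simp: mem_dual_box[OF n'1])
    then show ?thesis unfolding grid_edges_def by blast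
  qed
  moreover have "finite ?F" by (intro finite_Int disjI2 finite_grid_edges finite_dual_box)
  moreover have "\<forall>g\<in>?F. \<forall>h\<in>?E. g \<inter> h \<noteq> {} \<longrightarrow> h \<in> ?F"
    using dual_box_component[OF l n'1 \<omega> n(2) n'(2)] by blast
  ultimately show "\<exists>F. finite F \<and> f \<in> F \<and> F \<subseteq> ?E \<and> (\<forall>g\<in>F. \<forall>h\<in>?E. g \<inter> h \<noteq> {} \<longrightarrow> h \<in> F)"
    using f by blast
qed

text \<open>The event depends on the configuration only through the edges in the dual box. The
  unbounded \<open>row_below\<close> may replace \<open>dual_row\<close>, because the contour keeps
  to the columns 0 to \<open>l\<close>.\<close>

lemma stays_above_walk:
  assumes l: "l \<ge> 1" and \<sigma>: "\<sigma> \<in> space (config_space (strip l))"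
    and \<omega>: "strip_spins l (override_on strip_bc \<sigma> (strip l))" and good: "good_rows l (override_on strip_bc \<sigma> (strip l))"
    and rows: "plus_row l n (override_on strip_bc \<sigma> (strip l))" "minus_row l n' (override_on strip_bc \<sigma> (strip l))" and n': "n' \<ge> 1"
  defines "F \<equiv> disagreement_edges (strip l) (override_on strip_bc \<sigma> (strip l)) \<inter> grid_edges (dual_box l n n')"
    and "w \<equiv> \<lambda>F z. walk row_below (interface_graph.next_dirs (int l, 0)) F (0, 0) [South, North, East] z"
  shows "\<sigma> \<in> stays_above_event l \<Longrightarrow> w F (int l, 0)"
    and "\<sigma> \<notin> stays_above_event l \<Longrightarrow> \<exists>z\<in>row_below. w F z"
proof -
  let ?\<omega> = "override_on strip_bc \<sigma> (strip l)"
  let ?E = "disagreement_edges (strip l) ?\<omega>"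
  interpret interface_graph ?E "(0, 0)" "(int l, 0)" by (rule interface_graph_disagreement[OF l \<omega> good])
  have F: "finite F" "F \<subseteq> ?E" "\<And>g h. g \<in> F \<Longrightarrow> h \<in> ?E \<Longrightarrow> g \<inter> h \<noteq> {} \<Longrightarrow> h \<in> F"
    using dual_box_component[OF l n' \<omega> rows] finite_grid_edges[OF finite_dual_box, of l n n'] unfolding F_def by blast+
  have start: "edge (0, 0) d \<in> F" if "d \<in> dirs (0, 0)" for d
  proof -
    have "(0, 0) \<in> dual_box l n n'" using n' by (simp add: mem_dual_box)
    moreover have "edge (0, 0) d \<in> ?E" using that by (simp add: dirs_def)
    ultimately show ?thesis using dual_box_closed[OF l n' \<omega> rows] unfolding F_def grid_edges_def by blast
  qed
  have u: "(0, 0) \<notin> row_below" by (simp add: row_below_def)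
  have sub: "interface \<subseteq> ?E"
  proof -
    obtain q m where "line_path q m" "interface = step_edge q ` {..<m}" by (rule interface_path)
    then show ?thesis by (auto simp: line_path_def)
  qed
  have cols: "fst p \<in> {0..int l}" if p: "p \<in> \<Union>interface" for p
  proof -
    obtain e where "e \<in> ?E" "p \<in> e" using p sub by blast
    then show ?thesis by (auto simp: disagreement_edges_strip edge_def)
  qed
  have event: "\<sigma> \<in> stays_above_event l \<longleftrightarrow> \<Union>interface \<inter> row_below = {}"
  proof -
    have eq: "open_contours (strip l) strip_bc \<sigma> = {interface}"
      unfolding open_contours_def Let_def by (rule open_contour_unique)
    have "\<Union>interface \<inter> dual_row l (-1) = \<Union>interface \<inter> row_below"
    proof -
      have "p \<in> dual_row l (-1) \<longleftrightarrow> p \<in> row_below" if "p \<in> \<Union>interface" for p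
        using cols[OF that] by (cases p) (simp add: dual_row_def row_below_def)
      then show ?thesis by blast
    qed
    then show ?thesis
      using \<sigma> by (simp add: stays_above_event_def eq del: Union_iff)
  qed
  note avoids = interface_avoids[OF F start u]
  show "w F (int l, 0)" if "\<sigma> \<in> stays_above_event l"
    using avoids(2) that unfolding event w_def by simp
  show "\<exists>z\<in>row_below. w F z" if "\<sigma> \<notin> stays_above_event l"
    using avoids(1) that unfolding event w_def by simp
qed

section \<open>Resampling a box between monochromatic rows\<close>

context
  fixes l n n' :: nat and \<sigma> :: "site \<Rightarrow> int"
  assumes l: "l \<ge> 1" and n: "n \<ge> 1" and n': "n' \<ge> 1"
    and \<sigma>: "\<sigma> \<in> strip l \<rightarrow>\<^sub>E {-1, 1}" and rows: "plus_row l n \<sigma>" "minus_row l n' \<sigma>"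
begin

definition resampled :: "(site \<Rightarrow> int) \<Rightarrow> site \<Rightarrow> int" where
  "resampled \<tau> = override_on strip_bc (override_on \<sigma> \<tau> (box l n n')) (strip l)"

definition resampled_edges :: "(site \<Rightarrow> int) \<Rightarrow> dual_site set set" where
  "resampled_edges \<tau> = disagreement_edges (strip l) (resampled \<tau>) \<inter> grid_edges (dual_box l n n')"

lemma resampled_spins:
  assumes "\<tau> \<in> box l n n' \<rightarrow>\<^sub>E {-1, 1}"
  shows "strip_spins l (resampled \<tau>)" "plus_row l n (resampled \<tau>)" "minus_row l n' (resampled \<tau>)"
proof -
  have "resampled \<tau> p \<in> {-1, 1}" for p
    using assms \<sigma> by (cases p) (auto simp: resampled_def override_on_def strip_bc_def PiE_iff)
  then show "strip_spins l (resampled \<tau>)" by (simp add: strip_spins_def) (simp add: resampled_def override_on_def)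
  show "plus_row l n (resampled \<tau>)" "minus_row l n' (resampled \<tau>)"
    using rows by (auto simp: resampled_def override_on_def plus_row_def minus_row_def box_def strip_def)
qed

lemma bij_resampled_edges:
  "bij_betw resampled_edges (box l n n' \<rightarrow>\<^sub>E {-1, 1})
     {F. F \<subseteq> grid_edges (dual_box l n n') \<and> boundary F = sdiff {(0, 0)} {(int l, 0)}}" (is "bij_betw _ ?T ?Fs")
  unfolding bij_betw_def
proof
  show "inj_on resampled_edges ?T"
  proof (rule inj_onI)
    fix \<tau> \<tau>' assume T: "\<tau> \<in> ?T" "\<tau>' \<in> ?T" and eq: "resampled_edges \<tau> = resampled_edges \<tau>'"
    note s = resampled_spins(1)[OF T(1)] resampled_spins(1)[OF T(2)]
    have "resampled \<tau> (x, y) = resampled \<tau>' (x, y)" if y: "- int n < y" "y < int n'" and x: "0 \<le> x" "x \<le> int l" for x y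
      using x
    proof (induction x rule: int_ge_induct)
      case base
      then show ?case by (simp add: strip_spins_sides(1)[OF s(1)] strip_spins_sides(1)[OF s(2)])
    next
      case (step x)
      have "edge (x, y - 1) North \<in> grid_edges (dual_box l n n')"
        unfolding grid_edges_def using step y n' by (intro CollectI exI[of _ "(x, y - 1)"] exI[of _ North]) (auto simp: mem_dual_box)
      then have "edge (x, y - 1) North \<in> disagreement_edges (strip l) (resampled \<tau>) \<longleftrightarrow>
          edge (x, y - 1) North \<in> disagreement_edges (strip l) (resampled \<tau>')"
        using eq unfolding resampled_edges_def by blast
      then have "resampled \<tau> (x, y) \<noteq> resampled \<tau> (x + 1, y) \<longleftrightarrow> resampled \<tau>' (x, y) \<noteq> resampled \<tau>' (x + 1, y)"
        using step by (simp add: mem_disagreement[OF l])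
      moreover have "resampled \<tau> (x, y) = resampled \<tau>' (x, y)" using step by simp
      ultimately show ?case using strip_spins_cases[OF s(1), of "(x + 1, y)"] strip_spins_cases[OF s(2), of "(x + 1, y)"]
        strip_spins_cases[OF s(1), of "(x, y)"] by auto
    qed
    then have "resampled \<tau> p = resampled \<tau>' p" if "p \<in> box l n n'" for p
      using that by (cases p) (auto simp: box_def)
    then have "\<tau> p = \<tau>' p" if "p \<in> box l n n'" for p
      using that by (auto simp: resampled_def override_on_def box_def strip_def)
    then show "\<tau> = \<tau>'" by (rule PiE_ext[OF T])
  qed
  show "resampled_edges ` ?T = ?Fs"
  proof (intro equalityI subsetI)
    fix F assume "F \<in> resampled_edges ` ?T"
    then show "F \<in> ?Fs" using boundary_dual_box[OF l n'] resampled_spins by (auto simp: resampled_edges_def)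
  next
    fix F assume "F \<in> ?Fs"
    then have F: "F \<subseteq> grid_edges (dual_box l n n')" "boundary F = sdiff {(0, 0)} {(int l, 0)}" by auto
    obtain g :: "site \<Rightarrow> int" where g: "\<And>p. g p \<in> {-1, 1}"
      "\<And>\<omega>. (\<And>p. p \<in> {0..int l + 1} \<times> {- int n..int n'} \<Longrightarrow> \<omega> p = g p) \<Longrightarrow>
         disagreement_edges (strip l) \<omega> \<inter> grid_edges (dual_box l n n') = F"
      "\<And>y. - int n \<le> y \<Longrightarrow> y \<le> int n' \<Longrightarrow> g (0, y) = strip_bc (0, y) \<and> g (int l + 1, y) = strip_bc (int l + 1, y)"
      "\<And>x. g (x, - int n) = 1" "\<And>x. g (x, int n') = -1"
      using disagreement_surjective[OF l n n' F] by metis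
    define \<tau> where "\<tau> = restrict g (box l n n')"
    have \<tau>: "\<tau> \<in> ?T" using g(1) by (auto simp: \<tau>_def)
    have "resampled \<tau> p = g p" if p: "p \<in> {0..int l + 1} \<times> {- int n..int n'}" for p
    proof -
      obtain x y where xy: "p = (x, y)" "0 \<le> x" "x \<le> int l + 1" "- int n \<le> y" "y \<le> int n'" using p by auto
      consider "x = 0" | "x = int l + 1" | "y = - int n" "1 \<le> x" "x \<le> int l" | "y = int n'" "1 \<le> x" "x \<le> int l" | "p \<in> box l n n'"
        using xy unfolding box_def by (cases "y = - int n \<or> y = int n'") force+
      then show ?thesis
      proof cases
        case 3
        then show ?thesis using resampled_spins(2)[OF \<tau>] g(4) xy by (simp add: plus_row_def)
      next
        case 4
        then show ?thesis using resampled_spins(3)[OF \<tau>] g(5) xy by (simp add: minus_row_def)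
      next
        case 5
        then show ?thesis by (auto simp: resampled_def override_on_def \<tau>_def box_def strip_def)
      qed (use g(3)[of y] xy in \<open>auto simp: resampled_def override_on_def strip_def\<close>)
    qed
    then have "resampled_edges \<tau> = F" unfolding resampled_edges_def by (rule g(2))
    then show "F \<in> resampled_edges ` ?T" using \<tau> by blast
  qed
qed

lemma bij_dual_edge:
  assumes \<omega>: "strip_spins l \<omega>"
  shows "bij_betw dual_edge {e \<in> edges_meeting (box l n n'). (\<Prod>x\<in>e. \<omega> x) = -1}
    (disagreement_edges (strip l) \<omega> \<inter> grid_edges (dual_box l n n'))" (is "bij_betw _ ?A ?B")
proof -
  have form: "\<exists>a b. e = {(a, b), (a + 1, b)} \<or> e = {(a, b), (a, b + 1)}" if e: "e \<in> edges_meeting \<Lambda>" for e \<Lambda>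
  proof -
    obtain x y where "e = {x, y}" "adjacent x y" using e unfolding edges_meeting_def by blast
    then show ?thesis by (metis adjacent_cases)
  qed
  have prodH: "(\<Prod>x\<in>{(a, b), (a + 1, b)}. \<omega> x) = -1 \<longleftrightarrow> \<omega> (a, b) \<noteq> \<omega> (a + 1, b)" for a b
    using strip_spins_cases[OF \<omega>, of "(a, b)"] strip_spins_cases[OF \<omega>, of "(a + 1, b)"] by auto
  have prodV: "(\<Prod>x\<in>{(a, b), (a, b + 1)}. \<omega> x) = -1 \<longleftrightarrow> \<omega> (a, b) \<noteq> \<omega> (a, b + 1)" for a b
    using strip_spins_cases[OF \<omega>, of "(a, b)"] strip_spins_cases[OF \<omega>, of "(a, b + 1)"] by auto
  have dH: "dual_edge {(a, b), (a + 1, b)} = edge (a, b - 1) North" for a b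
    unfolding dual_edge_horizontal by (simp add: edge_def)
  have dV: "dual_edge {(a, b), (a, b + 1)} = edge (a - 1, b) East" for a b
    unfolding dual_edge_vertical by (simp add: edge_def)
  have "inj_on dual_edge (edges_meeting (box l n n'))"
  proof (rule inj_onI)
    fix e f assume ef: "e \<in> edges_meeting (box l n n')" "f \<in> edges_meeting (box l n n')" "dual_edge e = dual_edge f"
    obtain a b where e: "e = {(a, b), (a + 1, b)} \<or> e = {(a, b), (a, b + 1)}" using form[OF ef(1)] by blast
    obtain a' b' where f: "f = {(a', b'), (a' + 1, b')} \<or> f = {(a', b'), (a', b' + 1)}" using form[OF ef(2)] by blast
    show "e = f" using e f ef(3) by (elim disjE) (simp_all add: dH dV)
  qed
  then have inj: "inj_on dual_edge ?A" by (rule inj_on_subset) auto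
  have "dual_edge ` ?A = ?B"
  proof (intro equalityI subsetI)
    fix d assume "d \<in> dual_edge ` ?A"
    then obtain e where e: "e \<in> edges_meeting (box l n n')" "(\<Prod>x\<in>e. \<omega> x) = -1" "d = dual_edge e" by auto
    obtain x y where xy: "e = {x, y}" "{x, y} \<inter> box l n n' \<noteq> {}" using e(1) unfolding edges_meeting_def by blast
    obtain a b where ab: "e = {(a, b), (a + 1, b)} \<or> e = {(a, b), (a, b + 1)}" using form[OF e(1)] by blast
    then show "d \<in> ?B"
    proof
      assume H: "e = {(a, b), (a + 1, b)}"
      then have "0 \<le> a" "a \<le> int l" "- int n < b" "b < int n'" using xy by (auto simp: box_def)
      then have "(a, b - 1) \<in> dual_box l n n'" "shift (a, b - 1) North \<in> dual_box l n n'" "0 \<le> a" "a \<le> int l"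
        using n' by (auto simp: mem_dual_box)
      then have "d \<in> grid_edges (dual_box l n n')" "0 \<le> a" "a \<le> int l"
        unfolding e(3) H dH grid_edges_def by blast+
      moreover have "d \<in> disagreement_edges (strip l) \<omega>"
        using e(2) \<open>0 \<le> a\<close> \<open>a \<le> int l\<close> unfolding e(3) H dH prodH by (simp add: mem_disagreement[OF l])
      ultimately show ?thesis by simp
    next
      assume H: "e = {(a, b), (a, b + 1)}"
      then have r: "1 \<le> a" "a \<le> int l" "- int n \<le> b" "b < int n'" using xy by (auto simp: box_def)
      then have "(a - 1, b) \<in> dual_box l n n'" "shift (a - 1, b) East \<in> dual_box l n n'"
        using n' by (auto simp: mem_dual_box)
      then have "d \<in> grid_edges (dual_box l n n')"
        unfolding e(3) H dV grid_edges_def by blast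
      moreover have "d \<in> disagreement_edges (strip l) \<omega>"
        using e(2) r unfolding e(3) H dV prodV by (simp add: mem_disagreement[OF l])
      ultimately show ?thesis by simp
    qed
  next
    fix d assume d: "d \<in> ?B"
    then have "d \<in> grid_edges (dual_box l n n')" by simp
    then show "d \<in> dual_edge ` ?A"
    proof (cases rule: grid_edges_cases)
      case (vertical x y)
      have r: "0 \<le> x" "x \<le> int l" "- int n \<le> y" "y + 1 < int n'" using vertical n' by (auto simp: mem_dual_box)
      have deq: "d = edge (x, y) North" using vertical by (simp add: edge_def)
      let ?e = "{(x, y + 1), (x + 1, y + 1)}"
      have "d \<in> disagreement_edges (strip l) \<omega>" using d by simp
      then have "\<omega> (x, y + 1) \<noteq> \<omega> (x + 1, y + 1)" unfolding deq by (simp add: mem_disagreement[OF l])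
      moreover have "?e \<in> edges_meeting (box l n n')"
      proof -
        have "{(x, y + 1), (x + 1, y + 1)} \<inter> box l n n' \<noteq> {}" using r l by (cases "x = 0") (auto simp: box_def)
        then show ?thesis unfolding edges_meeting_def using adjacent_horizontal by blast
      qed
      moreover have "d = dual_edge ?e" unfolding dH deq by simp
      ultimately show ?thesis using prodH by blast
    next
      case (horizontal x y)
      have r: "0 \<le> x" "x < int l" "- int n \<le> y" "y < int n'" using horizontal n' by (auto simp: mem_dual_box)
      have deq: "d = edge (x, y) East" using horizontal by (simp add: edge_def)
      let ?e = "{(x + 1, y), (x + 1, y + 1)}"
      have "d \<in> disagreement_edges (strip l) \<omega>" using d by simp
      then have "\<omega> (x + 1, y) \<noteq> \<omega> (x + 1, y + 1)" unfolding deq by (simp add: mem_disagreement[OF l])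
      moreover have "?e \<in> edges_meeting (box l n n')"
      proof -
        have "{(x + 1, y), (x + 1, y + 1)} \<inter> box l n n' \<noteq> {}" using r n n' by (cases "y = - int n") (auto simp: box_def)
        then show ?thesis unfolding edges_meeting_def using adjacent_vertical by blast
      qed
      moreover have "d = dual_edge ?e" unfolding dV deq by simp
      ultimately show ?thesis using prodV by blast
    qed
  qed
  then show ?thesis using inj by (simp add: bij_betw_def)
qed

lemma boltzmann_weight_resampled:
  assumes "\<tau> \<in> box l n n' \<rightarrow>\<^sub>E {-1, 1}"
  shows "boltzmann_weight \<beta> (box l n n') (resampled \<tau>) =
    exp (\<beta> * card (edges_meeting (box l n n'))) * (\<Prod>e\<in>resampled_edges \<tau>. exp (- 2 * \<beta>))"
proof -
  let ?EM = "edges_meeting (box l n n')" and ?\<omega> = "resampled \<tau>"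
  let ?D = "{e \<in> ?EM. (\<Prod>x\<in>e. ?\<omega> x) = -1}"
  note \<omega> = resampled_spins(1)[OF assms]
  have fin: "finite ?EM" by (rule finite_edges_meeting) (simp add: box_def)
  have pm: "(\<Prod>x\<in>e. ?\<omega> x) = 1 \<or> (\<Prod>x\<in>e. ?\<omega> x) = -1" for e
  proof (induction e rule: infinite_finite_induct)
    case (insert x F)
    then show ?case using strip_spins_cases[OF \<omega>, of x] by auto
  qed simp_all
  have "(\<Sum>e\<in>?EM. real_of_int (\<Prod>x\<in>e. ?\<omega> x)) = (\<Sum>e\<in>?EM. 1 - 2 * (if (\<Prod>x\<in>e. ?\<omega> x) = -1 then 1 else 0))"
  proof (rule sum.cong[OF refl])
    have "real_of_int k = 1 - 2 * (if k = -1 then 1 else 0)" if "k = 1 \<or> k = -1" for k using that by auto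
    then show "real_of_int (\<Prod>x\<in>e. ?\<omega> x) = 1 - 2 * (if (\<Prod>x\<in>e. ?\<omega> x) = -1 then 1 else 0)" for e using pm by blast
  qed
  also have "\<dots> = real (card ?EM) - 2 * (\<Sum>e\<in>?EM. if (\<Prod>x\<in>e. ?\<omega> x) = -1 then 1 else 0)"
    by (simp add: sum_subtractf sum_distrib_left)
  also have "(\<Sum>e\<in>?EM. if (\<Prod>x\<in>e. ?\<omega> x) = -1 then 1 else 0 :: real) = card ?D"
    using fin by (simp add: sum.inter_filter[symmetric])
  also have "card ?D = card (resampled_edges \<tau>)"
    unfolding resampled_edges_def by (rule bij_betw_same_card[OF bij_dual_edge[OF \<omega>]])
  finally have eq: "(\<Sum>e\<in>?EM. real_of_int (\<Prod>x\<in>e. ?\<omega> x)) = real (card ?EM) - 2 * real (card (resampled_edges \<tau>))" by simp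
  have "- \<beta> * energy (box l n n') ?\<omega> = \<beta> * card ?EM + card (resampled_edges \<tau>) * (- 2 * \<beta>)"
    unfolding energy_def eq by (simp add: algebra_simps)
  then show ?thesis unfolding boltzmann_weight_def prod_constant by (simp only: exp_add exp_of_nat_mult)
qed

text \<open>The kernel is a quotient of sums over subgraphs with odd vertices \<open>(0, 0)\<close>
  and \<open>(l, 0)\<close>. For the upper bound the event forces the walk to end at
  \<open>(l, 0)\<close>; for the lower bound its complement forces the walk to hit the row.\<close>

lemma ising_kernel_bounds:
  fixes \<beta> :: real and A :: "(site \<Rightarrow> int) set" and ord :: "dual_site \<Rightarrow> dir \<Rightarrow> dir list"
  assumes \<beta>: "\<beta> > 0" and nn: "n' < n"
    and A: "\<And>\<tau>. \<tau> \<in> box l n n' \<rightarrow>\<^sub>E {-1, 1} \<Longrightarrow> override_on \<sigma> \<tau> (box l n n') \<in> A \<Longrightarrow>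
        walk row_below ord (resampled_edges \<tau>) (0, 0) ds (int l, 0)"
      "\<And>\<tau>. \<tau> \<in> box l n n' \<rightarrow>\<^sub>E {-1, 1} \<Longrightarrow> override_on \<sigma> \<tau> (box l n n') \<notin> A \<Longrightarrow>
        \<exists>z\<in>row_below. walk row_below ord (resampled_edges \<tau>) (0, 0) ds z"
  defines "t \<equiv> exp (- 2 * \<beta>)" and "G \<equiv> two_point (exp (- 2 * \<beta>)) (dual_box l n n') (0, 0)"
  shows "ising_kernel \<beta> (strip l) strip_bc (box l n n') \<sigma> A \<le>
      two_point t ({0..int l} \<times> {0..int (n' - 1)}) (0, 0) (int l, 0) / G (int l, 0)"
    and "1 - G (int l, -2) / G (int l, 0) \<le> ising_kernel \<beta> (strip l) strip_bc (box l n n') \<sigma> A"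
proof -
  let ?T = "box l n n' \<rightarrow>\<^sub>E {-1, 1 :: int}" and ?U = "grid_edges (dual_box l n n')"
  let ?Fs = "{F. F \<subseteq> ?U \<and> boundary F = sdiff {(0, 0)} {(int l, 0)}}"
  let ?Z = "\<lambda>U. subgraph_sum (\<lambda>_. t) U"
  have t: "0 < t" "t < 1" using \<beta> by (simp_all add: t_def)
  define K where "K = exp (\<beta> * card (edges_meeting (box l n n')))"
  have K: "K > 0" by (simp add: K_def)
  have finT: "finite ?T" by (intro finite_PiE) (auto simp: box_def)
  have w: "boltzmann_weight \<beta> (box l n n') (override_on strip_bc (override_on \<sigma> \<tau> (box l n n')) (strip l)) = K * (\<Prod>e\<in>resampled_edges \<tau>. t)"
    if "\<tau> \<in> ?T" for \<tau>
    using boltzmann_weight_resampled[OF that, of \<beta>] by (simp add: resampled_def K_def t_def)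
  have reindex: "(\<Sum>\<tau>\<in>?T. f (resampled_edges \<tau>)) = (\<Sum>F\<in>?Fs. f F)" for f :: "_ \<Rightarrow> real"
    by (rule sum.reindex_bij_betw[OF bij_resampled_edges])
  define Z where "Z = ?Z ?U (sdiff {(0, 0)} {(int l, 0)})"
  have den: "(\<Sum>\<tau>\<in>?T. boltzmann_weight \<beta> (box l n n') (override_on strip_bc (override_on \<sigma> \<tau> (box l n n')) (strip l))) = K * Z"
  proof -
    have "(\<Sum>\<tau>\<in>?T. boltzmann_weight \<beta> (box l n n') (override_on strip_bc (override_on \<sigma> \<tau> (box l n n')) (strip l)))
      = K * (\<Sum>\<tau>\<in>?T. \<Prod>e\<in>resampled_edges \<tau>. t)"
      unfolding sum_distrib_left by (rule sum.cong[OF refl w])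
    then show ?thesis using reindex[of "\<lambda>F. \<Prod>e\<in>F. t"] by (simp add: Z_def subgraph_sum_def)
  qed
  have "?T \<noteq> {}" by (simp add: PiE_eq_empty_iff)
  then have "0 < (\<Sum>\<tau>\<in>?T. boltzmann_weight \<beta> (box l n n') (override_on strip_bc (override_on \<sigma> \<tau> (box l n n')) (strip l)))"
    using finT by (intro sum_pos) (auto simp: boltzmann_weight_def)
  then have Z: "Z > 0" using K by (simp add: den zero_less_mult_iff)
  define I where "I \<tau> = (indicator A (override_on \<sigma> \<tau> (box l n n')) :: real)" for \<tau>
  have ker: "ising_kernel \<beta> (strip l) strip_bc (box l n n') \<sigma> A = (\<Sum>\<tau>\<in>?T. (\<Prod>e\<in>resampled_edges \<tau>. t) * I \<tau>) / Z"
  proof -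
    have "(\<Sum>\<tau>\<in>?T. boltzmann_weight \<beta> (box l n n') (override_on strip_bc (override_on \<sigma> \<tau> (box l n n')) (strip l)) * I \<tau>)
      = K * (\<Sum>\<tau>\<in>?T. (\<Prod>e\<in>resampled_edges \<tau>. t) * I \<tau>)"
      unfolding sum_distrib_left by (intro sum.cong refl) (simp add: w)
    then show ?thesis unfolding ising_kernel_def den I_def[symmetric] using K by simp
  qed
  have walk_eq: "walk_sum row_below ord t (int l, 0) Zs ?U (0, 0) ds =
      (\<Sum>\<tau>\<in>?T. (\<Prod>e\<in>resampled_edges \<tau>. t) * of_bool (\<exists>z\<in>Zs. walk row_below ord (resampled_edges \<tau>) (0, 0) ds z))" for Zs
  proof -
    have "walk_sum row_below ord t (int l, 0) Zs ?U (0, 0) ds =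
      (\<Sum>F\<in>?Fs. if \<exists>z\<in>Zs. walk row_below ord F (0, 0) ds z then \<Prod>e\<in>F. t else 0)"
      unfolding walk_sum_def
      using finite_grid_edges[OF finite_dual_box, of l n n'] by (subst sum.inter_filter[symmetric]) (auto intro!: sum.cong)
    also have "\<dots> = (\<Sum>F\<in>?Fs. (\<Prod>e\<in>F. t) * of_bool (\<exists>z\<in>Zs. walk row_below ord F (0, 0) ds z))"
      by (intro sum.cong) auto
    finally show ?thesis using reindex[of "\<lambda>F. (\<Prod>e\<in>F. t) * of_bool (\<exists>z\<in>Zs. walk row_below ord F (0, 0) ds z)"] by simp
  qed
  have G: "G v = ?Z ?U (sdiff {(0, 0)} {v}) / ?Z ?U {}" for v by (simp only: G_def two_point_def t_def)
  have V: "finite (dual_box l n n')" by (rule finite_dual_box)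
  have U1: "finite ?U" by (rule finite_grid_edges[OF V])
  have U2: "finite e" if "e \<in> ?U" for e using grid_edges_subset[OF that] V by (rule finite_subset)
  have U3: "\<exists>v d. e = edge v d" if "e \<in> ?U" for e using that unfolding grid_edges_def by blast
  note U = U1 U2 U3
  have ZU: "?Z ?U {} > 0" using subgraph_sum_pos[OF U(1), of "\<lambda>_. t"] t by simp
  have up: "{e \<in> ?U. \<forall>p\<in>e. snd p \<ge> 0} = grid_edges ({0..int l} \<times> {0..int (n' - 1)})" (is "?up = grid_edges ?V'")
  proof -
    have V': "v \<in> ?V' \<longleftrightarrow> v \<in> dual_box l n n' \<and> snd v \<ge> 0" for v
      using n' by (cases v) (auto simp: mem_dual_box of_nat_diff)
    have "(\<forall>p\<in>edge v d. snd p \<ge> 0) \<longleftrightarrow> snd v \<ge> 0 \<and> snd (shift v d) \<ge> 0" for v d by (simp add: edge_def)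
    then show ?thesis unfolding grid_edges_def V' by blast
  qed
  have Zup: "?Z ?up {} > 0" using subgraph_sum_pos[of ?up "\<lambda>_. t"] U(1) t by simp
  have "(\<Sum>\<tau>\<in>?T. (\<Prod>e\<in>resampled_edges \<tau>. t) * I \<tau>) \<le> walk_sum row_below ord t (int l, 0) {(int l, 0)} ?U (0, 0) ds"
    unfolding walk_eq
  proof (intro sum_mono mult_left_mono)
    fix \<tau> assume "\<tau> \<in> ?T"
    then show "I \<tau> \<le> of_bool (\<exists>z\<in>{(int l, 0)}. walk row_below ord (resampled_edges \<tau>) (0, 0) ds z)"
      using A(1)[of \<tau>] by (auto simp: I_def indicator_def)
  qed (use t in \<open>auto intro: prod_nonneg\<close>)
  also have "\<dots> \<le> ?Z ?up (sdiff {(0, 0)} {(int l, 0)}) * ?Z ?U {} / ?Z ?up {}"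
    using walk_sum_avoid_le[of ?U "(0, 0)" "(int l, 0)" t ord ds] U t Zup by (simp add: pos_le_divide_eq)
  finally have "(\<Sum>\<tau>\<in>?T. (\<Prod>e\<in>resampled_edges \<tau>. t) * I \<tau>) / Z \<le>
      ?Z ?up (sdiff {(0, 0)} {(int l, 0)}) * ?Z ?U {} / ?Z ?up {} / Z"
    using Z by (intro divide_right_mono) auto
  also have "\<dots> = two_point t ?V' (0, 0) (int l, 0) / G (int l, 0)"
    unfolding G up by (simp add: two_point_def Z_def)
  finally show "ising_kernel \<beta> (strip l) strip_bc (box l n n') \<sigma> A \<le> two_point t ?V' (0, 0) (int l, 0) / G (int l, 0)"
    unfolding ker .
  have touch: "walk_sum row_below ord t (int l, 0) row_below ?U (0, 0) ds \<le> ?Z ?U (sdiff {(0, 0)} {mirror (int l, 0)})"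
  proof (rule walk_sum_touch_le[OF V U(3)])
    fix e assume e: "e \<in> ?U" "\<exists>p\<in>e. snd p \<ge> 0"
    \<comment> \<open>The top height \<open>n' - 1\<close> is reflected to \<open>- n' - 1\<close>,
      which lies in the box because \<open>n' < n\<close>.\<close>
    have mem: "mirror p \<in> dual_box l n n'" if "p \<in> dual_box l n n'" "snd p \<ge> -1" for p
      using that nn n' by (cases p) (auto simp: mem_dual_box mirror_def)
    have sym: "mirror ` {x, y} = {mirror x, mirror y}" for x y by simp
    from e(1) show "mirror ` e \<in> ?U"
    proof (cases rule: grid_edges_cases)
      case (vertical x y)
      then have "mirror (x, y) \<in> dual_box l n n'" "mirror (x, y + 1) \<in> dual_box l n n'" using e(2) by (auto intro!: mem)
      then have "{(x, - 3 - y), (x, - 3 - y + 1)} \<in> ?U" by (intro vertical_mem) (simp_all add: mirror_def)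
      moreover have "mirror ` e = {(x, - 3 - y), (x, - 3 - y + 1)}" unfolding vertical by (auto simp: mirror_def)
      ultimately show ?thesis by simp
    next
      case (horizontal x y)
      then have "mirror (x, y) \<in> dual_box l n n'" "mirror (x + 1, y) \<in> dual_box l n n'" using e(2) by (auto intro!: mem)
      then have "{(x, - 2 - y), (x + 1, - 2 - y)} \<in> ?U" by (intro horizontal_mem) (auto simp: mirror_def)
      then show ?thesis unfolding horizontal sym by (simp add: mirror_def)
    qed
  next
    fix p assume "p \<in> dual_box l n n'" "snd p \<ge> 0"
    then show "mirror p \<in> dual_box l n n'" using nn n' by (cases p) (auto simp: mem_dual_box mirror_def)
  qed (use n' t grid_edges_subset in \<open>auto simp: mem_dual_box\<close>)
  have "Z \<le> (\<Sum>\<tau>\<in>?T. (\<Prod>e\<in>resampled_edges \<tau>. t) * I \<tau>) + walk_sum row_below ord t (int l, 0) row_below ?U (0, 0) ds"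
  proof -
    have "Z = (\<Sum>\<tau>\<in>?T. \<Prod>e\<in>resampled_edges \<tau>. t)" using reindex[of "\<lambda>F. \<Prod>e\<in>F. t"] by (simp add: Z_def subgraph_sum_def)
    also have "\<dots> \<le> (\<Sum>\<tau>\<in>?T. (\<Prod>e\<in>resampled_edges \<tau>. t) * I \<tau> +
        (\<Prod>e\<in>resampled_edges \<tau>. t) * of_bool (\<exists>z\<in>row_below. walk row_below ord (resampled_edges \<tau>) (0, 0) ds z))"
    proof (rule sum_mono)
      fix \<tau> assume "\<tau> \<in> ?T"
      then have "1 \<le> I \<tau> + of_bool (\<exists>z\<in>row_below. walk row_below ord (resampled_edges \<tau>) (0, 0) ds z)"
        using A(2)[of \<tau>] by (auto simp: I_def indicator_def)
      moreover have "0 \<le> (\<Prod>e\<in>resampled_edges \<tau>. t)" using t by (intro prod_nonneg) auto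
      ultimately have "(\<Prod>e\<in>resampled_edges \<tau>. t) * 1 \<le> (\<Prod>e\<in>resampled_edges \<tau>. t) *
          (I \<tau> + of_bool (\<exists>z\<in>row_below. walk row_below ord (resampled_edges \<tau>) (0, 0) ds z))" by (rule mult_left_mono)
      then show "(\<Prod>e\<in>resampled_edges \<tau>. t) \<le> (\<Prod>e\<in>resampled_edges \<tau>. t) * I \<tau> +
        (\<Prod>e\<in>resampled_edges \<tau>. t) * of_bool (\<exists>z\<in>row_below. walk row_below ord (resampled_edges \<tau>) (0, 0) ds z)"
        by (simp only: distrib_left mult_1_right)
    qed
    also have "\<dots> = (\<Sum>\<tau>\<in>?T. (\<Prod>e\<in>resampled_edges \<tau>. t) * I \<tau>) + walk_sum row_below ord t (int l, 0) row_below ?U (0, 0) ds"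
      unfolding walk_eq by (rule sum.distrib)
    finally show ?thesis .
  qed
  then have "(Z - ?Z ?U (sdiff {(0, 0)} {(int l, -2)})) / Z \<le> (\<Sum>\<tau>\<in>?T. (\<Prod>e\<in>resampled_edges \<tau>. t) * I \<tau>) / Z"
    using touch Z by (intro divide_right_mono) (auto simp: mirror_def)
  moreover have "(Z - ?Z ?U (sdiff {(0, 0)} {(int l, -2)})) / Z = 1 - G (int l, -2) / G (int l, 0)"
    using Z ZU by (simp add: diff_divide_distrib G Z_def[symmetric])
  ultimately show "1 - G (int l, -2) / G (int l, 0) \<le> ising_kernel \<beta> (strip l) strip_bc (box l n n') \<sigma> A"
    unfolding ker by simp
qed

end

section \<open>Gibbs measures\<close>

definition lattice_edges :: "dual_site set set" where
  "lattice_edges = {edge v d | v d. True}"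

lemma pred_lattice_edges:
  assumes "\<And>e. e \<in> lattice_edges \<Longrightarrow> Measurable.pred M (\<lambda>x. P x e)"
  shows "Measurable.pred M (\<lambda>x. \<forall>e\<in>lattice_edges. P x e)" "Measurable.pred M (\<lambda>x. \<exists>e\<in>lattice_edges. P x e)"
proof -
  have "(\<forall>e\<in>lattice_edges. P x e) \<longleftrightarrow> (\<forall>v d. P x (edge v d))" "(\<exists>e\<in>lattice_edges. P x e) \<longleftrightarrow> (\<exists>v d. P x (edge v d))" for x
    unfolding lattice_edges_def by blast+
  moreover have "Measurable.pred M (\<lambda>x. P x (edge v d))" for v d
    by (rule assms) (unfold lattice_edges_def, blast)
  ultimately show "Measurable.pred M (\<lambda>x. \<forall>e\<in>lattice_edges. P x e)" "Measurable.pred M (\<lambda>x. \<exists>e\<in>lattice_edges. P x e)"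
    by (simp_all only: pred_intros_countable)
qed

text \<open>A periodic sequence is given by one period. Quantifying over lists, a countable type,
  makes loops accessible to countable unions.\<close>

lemma is_loop_list:
  "is_loop E \<gamma> \<longleftrightarrow> (\<exists>xs. xs \<noteq> [] \<and> (let p = \<lambda>k. xs ! (k mod length xs) in
     inj_on (\<lambda>k. {p k, p (Suc k)}) {..<length xs} \<and> \<gamma> = (\<lambda>k. {p k, p (Suc k)}) ` {..<length xs} \<and>
     (\<forall>k. joined E (p (Suc k)) {p k, p (Suc k)} {p (Suc k), p (Suc (Suc k))})))" (is "?L \<longleftrightarrow> (\<exists>xs. ?P xs)")
proof
  assume ?L
  then obtain n and p :: "nat \<Rightarrow> dual_site" where n: "n > 0" and per: "\<And>k. p (k + n) = p k"
    and p: "inj_on (\<lambda>k. {p k, p (Suc k)}) {..<n}" "\<gamma> = (\<lambda>k. {p k, p (Suc k)}) ` {..<n}"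
      "\<forall>k. joined E (p (Suc k)) {p k, p (Suc k)} {p (Suc k), p (Suc (Suc k))}"
    unfolding is_loop_def by blast
  have per': "p (k + j * n) = p k" for k j
    by (induction j) (simp_all add: per add.assoc[symmetric] add.commute[of n])
  have "p k = p (k mod n)" for k using per'[of "k mod n" "k div n"] by simp
  then have eq: "(\<lambda>k. map p [0..<n] ! (k mod length (map p [0..<n]))) = p" using n by auto
  have "?P (map p [0..<n])" unfolding eq Let_def using n p by auto
  then show "\<exists>xs. ?P xs" ..
next
  assume "\<exists>xs. ?P xs"
  then obtain xs where xs: "?P xs" ..
  then show ?L unfolding is_loop_def Let_def
    by (intro exI[of _ "length xs"] conjI exI[of _ "\<lambda>k. xs ! (k mod length xs)"]) auto
qed

context
  fixes M :: "'a measure" and E :: "'a \<Rightarrow> dual_site set set"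
  assumes E: "\<And>x. E x \<subseteq> lattice_edges"
    and meas: "\<And>e. Measurable.pred M (\<lambda>x. e \<in> E x)"
begin

lemma pred_joined: "Measurable.pred M (\<lambda>x. joined (E x) v f g)"
proof -
  let ?K = "range (edge v)"
  have K: "{h \<in> E x. v \<in> h} = {h \<in> ?K. h \<in> E x}" for x
  proof (intro set_eqI iffI)
    fix h assume h: "h \<in> {h \<in> E x. v \<in> h}"
    then obtain a d where "h = edge a d" using E unfolding lattice_edges_def by blast
    then obtain d' where "h = edge v d'" using mem_edge h by blast
    then show "h \<in> {h \<in> ?K. h \<in> E x}" using h by auto
  qed (auto simp: edge_def)
  \<comment> \<open>The degree condition becomes a finite disjunction over the possible sets of
    edges at \<open>v\<close>.\<close>
  have "card {h \<in> E x. v \<in> h} \<ge> 3 \<longleftrightarrow> (\<exists>X\<in>{X \<in> Pow ?K. card X \<ge> 3}. \<forall>h\<in>?K. h \<in> E x \<longleftrightarrow> h \<in> X)" for x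
  proof
    assume "card {h \<in> E x. v \<in> h} \<ge> 3"
    then show "\<exists>X\<in>{X \<in> Pow ?K. card X \<ge> 3}. \<forall>h\<in>?K. h \<in> E x \<longleftrightarrow> h \<in> X" unfolding K by (intro bexI[of _ "{h \<in> ?K. h \<in> E x}"]) auto
  next
    assume "\<exists>X\<in>{X \<in> Pow ?K. card X \<ge> 3}. \<forall>h\<in>?K. h \<in> E x \<longleftrightarrow> h \<in> X"
    then obtain X where X: "X \<subseteq> ?K" "card X \<ge> 3" "\<forall>h\<in>?K. h \<in> E x \<longleftrightarrow> h \<in> X" by blast
    then have "{h \<in> ?K. h \<in> E x} = X" by blast
    then show "card {h \<in> E x. v \<in> h} \<ge> 3" unfolding K using X by simp
  qed
  note eq = this
  have "Measurable.pred M (\<lambda>x. \<exists>X\<in>{X \<in> Pow ?K. card X \<ge> 3}. \<forall>h\<in>?K. h \<in> E x \<longleftrightarrow> h \<in> X)"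
    by (intro pred_intros_finite pred_intros_logic meas) auto
  then show ?thesis unfolding joined_def eq by (intro pred_intros_logic meas) auto
qed

definition joined_rel :: "'a \<Rightarrow> (dual_site set \<times> dual_site set) set" where
  "joined_rel x = {(f, g). \<exists>v. joined (E x) v f g}"

lemma joined_rel_subset: "joined_rel x \<subseteq> lattice_edges \<times> lattice_edges"
  using E[of x] by (auto simp: joined_rel_def joined_def)

lemma pred_joined_rel: "Measurable.pred M (\<lambda>x. (f, g) \<in> joined_rel x)"
  unfolding joined_rel_def mem_Collect_eq prod.case by (intro pred_intros_countable pred_joined)

lemma pred_joined_rtrancl: "Measurable.pred M (\<lambda>x. (f, g) \<in> (joined_rel x)\<^sup>*)"
proof -
  have "Measurable.pred M (\<lambda>x. (f, g) \<in> joined_rel x ^^ n)" for n g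
  proof (induction n arbitrary: g)
    case (Suc n)
    have "(f, g) \<in> joined_rel x ^^ Suc n \<longleftrightarrow> (\<exists>h\<in>lattice_edges. (f, h) \<in> joined_rel x ^^ n \<and> (h, g) \<in> joined_rel x)" for x
      using joined_rel_subset[of x] by auto
    then show ?case
      by (simp only:) (intro pred_lattice_edges pred_intros_logic Suc pred_joined_rel)
  qed simp
  then show ?thesis unfolding rtrancl_power by (intro pred_intros_countable)
qed

lemma contour_subset: "f \<in> lattice_edges \<Longrightarrow> (joined_rel x)\<^sup>* `` {f} \<subseteq> lattice_edges"
  using joined_rel_subset[of x] by (auto elim: rtranclE)

lemma pred_is_loop:
  assumes f: "f \<in> lattice_edges"
  shows "Measurable.pred M (\<lambda>x. is_loop (E x) ((joined_rel x)\<^sup>* `` {f}))"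
proof -
  have eq: "(joined_rel x)\<^sup>* `` {f} = X \<longleftrightarrow> X \<subseteq> lattice_edges \<and> (\<forall>h\<in>lattice_edges. (f, h) \<in> (joined_rel x)\<^sup>* \<longleftrightarrow> h \<in> X)" for x X
    using contour_subset[OF f, of x] by blast
  show ?thesis unfolding is_loop_list Let_def eq
    by (intro pred_intros_countable pred_lattice_edges pred_intros_logic
        pred_joined pred_joined_rtrancl) simp_all
qed

text \<open>There are uncountably many sets of edges, so a contour is quantified over through a
  representative edge, and equality of contours is tested edge by edge.\<close>

lemma pred_unique_open_contour:
  "Measurable.pred M (\<lambda>x. \<exists>\<gamma>. {\<gamma> \<in> contours (E x). \<not> is_loop (E x) \<gamma>} = {\<gamma>} \<and> \<Union>\<gamma> \<inter> D = {})"
proof -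
  define C where "C x f = (joined_rel x)\<^sup>* `` {f}" for x f
  have cont: "contours (E x) = C x ` E x" for x
    by (auto simp: contours_def quotient_def C_def joined_rel_def)
  have eqC: "C x g = C x f \<longleftrightarrow> (\<forall>h\<in>lattice_edges. (g, h) \<in> (joined_rel x)\<^sup>* \<longleftrightarrow> (f, h) \<in> (joined_rel x)\<^sup>*)"
    if "f \<in> lattice_edges" "g \<in> lattice_edges" for x f g
    using contour_subset[OF that(1), of x] contour_subset[OF that(2), of x] unfolding C_def by blast
  have disj: "\<Union>(C x f) \<inter> D = {} \<longleftrightarrow> (\<forall>h\<in>lattice_edges. (f, h) \<in> (joined_rel x)\<^sup>* \<longrightarrow> h \<inter> D = {})"
    if "f \<in> lattice_edges" for x f
    using contour_subset[OF that, of x] unfolding C_def by blast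
  have "(\<exists>\<gamma>. {\<gamma> \<in> contours (E x). \<not> is_loop (E x) \<gamma>} = {\<gamma>} \<and> \<Union>\<gamma> \<inter> D = {}) \<longleftrightarrow>
      (\<exists>f\<in>E x. \<not> is_loop (E x) (C x f) \<and> (\<forall>g\<in>E x. \<not> is_loop (E x) (C x g) \<longrightarrow> C x g = C x f) \<and> \<Union>(C x f) \<inter> D = {})" (is "?L \<longleftrightarrow> ?R") for x
  proof
    assume ?L
    then obtain \<gamma> where \<gamma>: "{\<gamma> \<in> contours (E x). \<not> is_loop (E x) \<gamma>} = {\<gamma>}" "\<Union>\<gamma> \<inter> D = {}" by blast
    have iff: "\<delta> \<in> C x ` E x \<and> \<not> is_loop (E x) \<delta> \<longleftrightarrow> \<delta> = \<gamma>" for \<delta>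
      using \<gamma>(1) unfolding cont by blast
    then obtain f where f: "f \<in> E x" "\<gamma> = C x f" using iff[of \<gamma>] by blast
    have "C x g = C x f" if "g \<in> E x" "\<not> is_loop (E x) (C x g)" for g using iff[of "C x g"] that f by blast
    moreover have "\<not> is_loop (E x) (C x f)" using iff[of \<gamma>] f by simp
    moreover have "\<Union>(C x f) \<inter> D = {}" using \<gamma>(2) f by simp
    ultimately show ?R using f(1) by blast
  next
    assume ?R
    then obtain f where f: "f \<in> E x" "\<not> is_loop (E x) (C x f)"
      "\<forall>g\<in>E x. \<not> is_loop (E x) (C x g) \<longrightarrow> C x g = C x f" "\<Union>(C x f) \<inter> D = {}" by blast
    then have "{\<gamma> \<in> contours (E x). \<not> is_loop (E x) \<gamma>} = {C x f}" unfolding cont by blast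
    then show ?L using f(4) by blast
  qed
  also have "?R x \<longleftrightarrow> (\<exists>f\<in>lattice_edges. f \<in> E x \<and> \<not> is_loop (E x) ((joined_rel x)\<^sup>* `` {f}) \<and>
      (\<forall>g\<in>lattice_edges. g \<in> E x \<longrightarrow> \<not> is_loop (E x) ((joined_rel x)\<^sup>* `` {g}) \<longrightarrow>
         (\<forall>h\<in>lattice_edges. (g, h) \<in> (joined_rel x)\<^sup>* \<longleftrightarrow> (f, h) \<in> (joined_rel x)\<^sup>*)) \<and>
      (\<forall>h\<in>lattice_edges. (f, h) \<in> (joined_rel x)\<^sup>* \<longrightarrow> h \<inter> D = {}))" for x
  proof -
    have sub: "(\<exists>f\<in>E x. P f) \<longleftrightarrow> (\<exists>f\<in>lattice_edges. f \<in> E x \<and> P f)" "(\<forall>f\<in>E x. P f) \<longleftrightarrow> (\<forall>f\<in>lattice_edges. f \<in> E x \<longrightarrow> P f)" for P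
      using E[of x] by blast+
    show ?thesis unfolding sub C_def[symmetric] by (intro bex_cong refl) (auto simp: eqC disj)
  qed
  finally have eq: "(\<exists>\<gamma>. {\<gamma> \<in> contours (E x). \<not> is_loop (E x) \<gamma>} = {\<gamma>} \<and> \<Union>\<gamma> \<inter> D = {}) \<longleftrightarrow>
     (\<exists>f\<in>lattice_edges. f \<in> E x \<and> \<not> is_loop (E x) ((joined_rel x)\<^sup>* `` {f}) \<and>
      (\<forall>g\<in>lattice_edges. g \<in> E x \<longrightarrow> \<not> is_loop (E x) ((joined_rel x)\<^sup>* `` {g}) \<longrightarrow>
         (\<forall>h\<in>lattice_edges. (g, h) \<in> (joined_rel x)\<^sup>* \<longleftrightarrow> (f, h) \<in> (joined_rel x)\<^sup>*)) \<and>
      (\<forall>h\<in>lattice_edges. (f, h) \<in> (joined_rel x)\<^sup>* \<longrightarrow> h \<inter> D = {}))" for x .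
  show ?thesis unfolding eq
    by (intro pred_lattice_edges pred_intros_logic meas pred_is_loop pred_joined_rtrancl) simp_all
qed

end

section \<open>Gibbs kernels and finite energy\<close>

lemma finite_PiE_spins: "finite \<Lambda> \<Longrightarrow> finite (\<Lambda> \<rightarrow>\<^sub>E {-1, 1 :: int})"
  by (rule finite_PiE) auto

lemma partition_sum_pos:
  "finite \<Lambda> \<Longrightarrow> 0 < (\<Sum>\<tau>\<in>\<Lambda> \<rightarrow>\<^sub>E {-1, 1 :: int}. boltzmann_weight \<beta> \<Lambda> (f \<tau>))"
  by (intro sum_pos finite_PiE_spins) (simp_all add: boltzmann_weight_def PiE_eq_empty_iff)

lemma ising_kernel_nonneg: "0 \<le> ising_kernel \<beta> S \<eta> \<Lambda> \<sigma> A"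
  unfolding ising_kernel_def by (intro divide_nonneg_nonneg sum_nonneg) (auto simp: boltzmann_weight_def)

lemma ising_kernel_le_1:
  assumes "finite \<Lambda>"
  shows "ising_kernel \<beta> S \<eta> \<Lambda> \<sigma> A \<le> 1"
  unfolding ising_kernel_def using partition_sum_pos[OF assms]
  by (subst divide_le_eq_1_pos) (auto intro!: sum_mono simp: boltzmann_weight_def indicator_def)

text \<open>Properness of the kernel: an event not affected by resampling factors out.\<close>

lemma ising_kernel_inter:
  assumes "\<And>\<tau>. \<tau> \<in> \<Lambda> \<rightarrow>\<^sub>E {-1, 1} \<Longrightarrow> override_on \<sigma> \<tau> \<Lambda> \<in> B \<longleftrightarrow> \<sigma> \<in> B"
  shows "ising_kernel \<beta> S \<eta> \<Lambda> \<sigma> (A \<inter> B) = indicator B \<sigma> * ising_kernel \<beta> S \<eta> \<Lambda> \<sigma> A"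
proof -
  have "(\<Sum>\<tau>\<in>\<Lambda> \<rightarrow>\<^sub>E {-1, 1}. boltzmann_weight \<beta> \<Lambda> (override_on \<eta> (override_on \<sigma> \<tau> \<Lambda>) S) * indicator (A \<inter> B) (override_on \<sigma> \<tau> \<Lambda>)) =
    (\<Sum>\<tau>\<in>\<Lambda> \<rightarrow>\<^sub>E {-1, 1}. indicator B \<sigma> * (boltzmann_weight \<beta> \<Lambda> (override_on \<eta> (override_on \<sigma> \<tau> \<Lambda>) S) * indicator A (override_on \<sigma> \<tau> \<Lambda>)))"
    using assms by (intro sum.cong refl) (auto simp: indicator_def)
  then show ?thesis unfolding ising_kernel_def by (simp add: sum_distrib_left)
qed

lemma energy_bound:
  assumes "\<And>x. \<tau> x \<in> {-1, 1}" "finite \<Lambda>"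
  shows "\<bar>energy \<Lambda> \<tau>\<bar> \<le> card (edges_meeting \<Lambda>)"
proof -
  have "\<bar>real_of_int (\<Prod>x\<in>e. \<tau> x)\<bar> = 1" for e
  proof -
    have "\<bar>\<Prod>x\<in>e. \<tau> x\<bar> = (\<Prod>x\<in>e. 1)" unfolding abs_prod
    proof (rule prod.cong)
      show "\<bar>\<tau> x\<bar> = 1" for x using assms(1)[of x] by (elim insertE emptyE) simp_all
    qed simp
    then show ?thesis by (simp only: of_int_abs[symmetric] prod.neutral_const of_int_1)
  qed
  then have "(\<Sum>e\<in>edges_meeting \<Lambda>. \<bar>real_of_int (\<Prod>x\<in>e. \<tau> x)\<bar>) = card (edges_meeting \<Lambda>)" by simp
  then show ?thesis unfolding energy_def
    using sum_abs[of "\<lambda>e. real_of_int (\<Prod>x\<in>e. \<tau> x)" "edges_meeting \<Lambda>"] by simp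
qed

lemma card_edges_meeting:
  assumes "finite \<Lambda>"
  shows "card (edges_meeting \<Lambda>) \<le> 4 * card \<Lambda>"
proof -
  let ?N = "\<lambda>x :: site. {(fst x + 1, snd x), (fst x - 1, snd x), (fst x, snd x + 1), (fst x, snd x - 1)}"
  have N: "y \<in> ?N x" if "adjacent x y" for x y
    using that unfolding adjacent_def by (cases x; cases y) (auto simp: abs_if split: if_splits)
  have sym: "adjacent y x" if "adjacent x y" for x y
    using that unfolding adjacent_def by (simp add: abs_minus_commute)
  have "edges_meeting \<Lambda> \<subseteq> (\<Union>x\<in>\<Lambda>. (\<lambda>y. {x, y}) ` ?N x)"
  proof
    fix e assume "e \<in> edges_meeting \<Lambda>"
    then obtain x y where "e = {x, y}" "adjacent x y" "x \<in> \<Lambda> \<or> y \<in> \<Lambda>" unfolding edges_meeting_def by blast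
    then obtain x y where "e = {x, y}" "adjacent x y" "x \<in> \<Lambda>" by (metis insert_commute sym)
    then show "e \<in> (\<Union>x\<in>\<Lambda>. (\<lambda>y. {x, y}) ` ?N x)" using N by blast
  qed
  then have "card (edges_meeting \<Lambda>) \<le> card (\<Union>x\<in>\<Lambda>. (\<lambda>y. {x, y}) ` ?N x)"
    using assms by (intro card_mono) auto
  also have "\<dots> \<le> (\<Sum>x\<in>\<Lambda>. card ((\<lambda>y. {x, y}) ` ?N x))" by (rule card_UN_le[OF assms])
  also have "\<dots> \<le> (\<Sum>x\<in>\<Lambda>. 4)"
  proof (rule sum_mono)
    fix x
    have "card ((\<lambda>y. {x, y}) ` ?N x) \<le> card (?N x)" by (rule card_image_le) simp
    also have "\<dots> \<le> 4" by (simp add: card_insert_if)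
    finally show "card ((\<lambda>y. {x, y}) ` ?N x) \<le> 4" .
  qed
  finally show ?thesis by simp
qed

text \<open>With m resampled sites the energy is at most 4 m in absolute value, so all weights lie
  within a factor \<open>exp (8 * \<beta> * m)\<close> of each other. A single one of the
  \<open>2 ^ m\<close> configurations then has at least the subtracted probability, whatever the
  surroundings.\<close>

lemma ising_kernel_finite_energy:
  assumes fin: "finite \<Lambda>" and \<beta>: "\<beta> \<ge> 0" and \<eta>: "\<And>x. \<eta> x \<in> {-1, 1}" and \<sigma>: "\<And>x. x \<in> S \<Longrightarrow> \<sigma> x \<in> {-1, 1}"
    and \<rho>: "\<rho> \<in> \<Lambda> \<rightarrow>\<^sub>E {-1, 1}" "override_on \<sigma> \<rho> \<Lambda> \<notin> A"
  shows "ising_kernel \<beta> S \<eta> \<Lambda> \<sigma> A \<le> 1 - exp (- 8 * \<beta> * card \<Lambda>) / 2 ^ card \<Lambda>"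
proof -
  let ?T = "\<Lambda> \<rightarrow>\<^sub>E {-1, 1 :: int}" and ?m = "real (card \<Lambda>)"
  define w where "w \<tau> = boltzmann_weight \<beta> \<Lambda> (override_on \<eta> (override_on \<sigma> \<tau> \<Lambda>) S)" for \<tau>
  have w: "exp (- 4 * \<beta> * ?m) \<le> w \<tau> \<and> w \<tau> \<le> exp (4 * \<beta> * ?m)" if "\<tau> \<in> ?T" for \<tau>
  proof -
    have "override_on \<eta> (override_on \<sigma> \<tau> \<Lambda>) S x \<in> {-1, 1}" for x
      using \<eta>[of x] \<sigma>[of x] that by (auto simp: override_on_def PiE_iff)
    then have "\<bar>energy \<Lambda> (override_on \<eta> (override_on \<sigma> \<tau> \<Lambda>) S)\<bar> \<le> 4 * ?m"
      using energy_bound[of "override_on \<eta> (override_on \<sigma> \<tau> \<Lambda>) S", OF _ fin] card_edges_meeting[OF fin] by fastforce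
    then have "\<beta> * \<bar>energy \<Lambda> (override_on \<eta> (override_on \<sigma> \<tau> \<Lambda>) S)\<bar> \<le> \<beta> * (4 * ?m)"
      using \<beta> by (rule mult_left_mono)
    then have "\<bar>\<beta> * energy \<Lambda> (override_on \<eta> (override_on \<sigma> \<tau> \<Lambda>) S)\<bar> \<le> 4 * \<beta> * ?m"
      using \<beta> by (simp add: abs_mult)
    then show ?thesis unfolding w_def boltzmann_weight_def by (simp add: abs_le_iff)
  qed
  have finT: "finite ?T" by (rule finite_PiE_spins[OF fin])
  have pos: "0 < sum w ?T" unfolding w_def by (rule partition_sum_pos[OF fin])
  have "sum w ?T \<le> (\<Sum>\<tau>\<in>?T. exp (4 * \<beta> * ?m))" by (rule sum_mono) (use w in blast)
  also have "\<dots> = 2 ^ card \<Lambda> * exp (4 * \<beta> * ?m)" using fin by (simp add: card_PiE numeral_2_eq_2)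
  finally have up: "sum w ?T \<le> 2 ^ card \<Lambda> * exp (4 * \<beta> * ?m)" .
  have "exp (- 8 * \<beta> * ?m) / 2 ^ card \<Lambda> * sum w ?T \<le> exp (- 8 * \<beta> * ?m) / 2 ^ card \<Lambda> * (2 ^ card \<Lambda> * exp (4 * \<beta> * ?m))"
    using up by (rule mult_left_mono) simp
  also have "\<dots> = exp (- 4 * \<beta> * ?m)" by (simp add: exp_add[symmetric])
  also have "\<dots> \<le> w \<rho>" using w[OF \<rho>(1)] by simp
  finally have low: "exp (- 8 * \<beta> * ?m) / 2 ^ card \<Lambda> * sum w ?T \<le> w \<rho>" .
  have "(\<Sum>\<tau>\<in>?T. w \<tau> * indicator A (override_on \<sigma> \<tau> \<Lambda>)) = (\<Sum>\<tau>\<in>?T - {\<rho>}. w \<tau> * indicator A (override_on \<sigma> \<tau> \<Lambda>))"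
    using \<rho> finT by (subst sum.remove[of _ \<rho>]) simp_all
  also have "\<dots> \<le> (\<Sum>\<tau>\<in>?T - {\<rho>}. w \<tau>)"
    by (intro sum_mono) (auto simp: indicator_def w_def boltzmann_weight_def)
  also have "\<dots> = sum w ?T - w \<rho>" using \<rho> finT by (simp add: sum_diff1)
  also have "\<dots> \<le> (1 - exp (- 8 * \<beta> * ?m) / 2 ^ card \<Lambda>) * sum w ?T" using low by (simp add: left_diff_distrib)
  finally show ?thesis unfolding ising_kernel_def w_def[symmetric] using pos by (simp add: pos_divide_le_eq)
qed

lemma measurable_ising_kernel:
  assumes A: "A \<in> sets (config_space S)" and \<Lambda>: "\<Lambda> \<subseteq> S"
  shows "(\<lambda>\<sigma>. ising_kernel \<beta> S \<eta> \<Lambda> \<sigma> A) \<in> borel_measurable (config_space S)"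
proof -
  have coord: "(\<lambda>\<sigma>. real_of_int (override_on \<eta> (override_on \<sigma> \<tau> \<Lambda>) S x)) \<in> borel_measurable (config_space S)" for \<tau> x
  proof (cases "x \<in> S - \<Lambda>")
    case True
    have "(\<lambda>\<sigma>. \<sigma> x) \<in> measurable (config_space S) (count_space {-1, 1})"
      unfolding config_space_def using True by (intro measurable_component_singleton) auto
    then have "(\<lambda>\<sigma>. real_of_int (\<sigma> x)) \<in> borel_measurable (config_space S)"
      by (rule measurable_compose) simp
    then show ?thesis using True by (simp add: override_on_def)
  next
    case False
    then show ?thesis by (cases "x \<in> S") (simp_all add: override_on_def)
  qed
  have over: "(\<lambda>\<sigma>. override_on \<sigma> \<tau> \<Lambda>) \<in> measurable (config_space S) (config_space S)" if \<tau>: "\<tau> \<in> \<Lambda> \<rightarrow>\<^sub>E {-1, 1}" for \<tau>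
    unfolding config_space_def
  proof (rule measurable_PiM_single')
    fix x assume x: "x \<in> S"
    show "(\<lambda>\<sigma>. override_on \<sigma> \<tau> \<Lambda> x) \<in> measurable (Pi\<^sub>M S (\<lambda>_. count_space {-1, 1})) (count_space {-1, 1})"
    proof (cases "x \<in> \<Lambda>")
      case True
      then show ?thesis using \<tau> by (auto simp: override_on_def PiE_iff intro!: measurable_const)
    next
      case False
      then show ?thesis using x by (simp add: override_on_def)
    qed
  next
    show "(\<lambda>\<sigma>. override_on \<sigma> \<tau> \<Lambda>) \<in> space (Pi\<^sub>M S (\<lambda>_. count_space {-1, 1})) \<rightarrow> (\<Pi>\<^sub>E i\<in>S. space (count_space {-1, 1}))"
      unfolding space_PiM space_count_space
    proof (intro Pi_I PiE_I)
      fix \<sigma> x assume \<sigma>: "\<sigma> \<in> S \<rightarrow>\<^sub>E {-1, 1 :: int}" and x: "x \<in> S"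
      show "override_on \<sigma> \<tau> \<Lambda> x \<in> {-1, 1}"
        using PiE_mem[OF \<sigma> x] PiE_mem[OF \<tau>, of x] by (cases "x \<in> \<Lambda>") (simp_all only: override_on_apply_in override_on_apply_notin not_False_eq_True)
    next
      fix \<sigma> x assume \<sigma>: "\<sigma> \<in> S \<rightarrow>\<^sub>E {-1, 1 :: int}" and x: "x \<notin> S"
      then have "x \<notin> \<Lambda>" using \<Lambda> by blast
      then show "override_on \<sigma> \<tau> \<Lambda> x = undefined" using PiE_arb[OF \<sigma> x] by simp
    qed
  qed
  have w: "(\<lambda>\<sigma>. boltzmann_weight \<beta> \<Lambda> (override_on \<eta> (override_on \<sigma> \<tau> \<Lambda>) S)) \<in> borel_measurable (config_space S)" for \<tau>
    unfolding boltzmann_weight_def energy_def of_int_prod using coord by measurable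
  have i: "(\<lambda>\<sigma>. indicator A (override_on \<sigma> \<tau> \<Lambda>) :: real) \<in> borel_measurable (config_space S)" if "\<tau> \<in> \<Lambda> \<rightarrow>\<^sub>E {-1, 1}" for \<tau>
    using over[OF that] borel_measurable_indicator[OF A] by (rule measurable_compose)
  show ?thesis unfolding ising_kernel_def
    by (intro borel_measurable_divide borel_measurable_sum borel_measurable_times w i)
qed

text \<open>At the critical point \<open>exp (2 * \<beta>)\<close> is \<open>1 + sqrt 2\<close>,
  whose inverse is \<open>sqrt 2 - 1\<close>; the condition \<open>t < sqrt 2 - 1\<close> is the
  same as \<open>(t + 1)\<^sup>2 < 2\<close>.\<close>

lemma subcritical_exp:
  assumes "\<beta> > critical_beta"
  shows "\<beta> > 0" "subcritical (exp (- 2 * \<beta>))"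
proof -
  have "0 < ln (1 + sqrt 2)" by (rule ln_gt_zero) simp
  then have cb: "0 < critical_beta" by (simp add: critical_beta_def)
  then show "\<beta> > 0" using assms by simp
  have "exp (2 * critical_beta) = 1 + sqrt 2" by (simp add: critical_beta_def add_pos_pos)
  then have "1 + sqrt 2 < exp (2 * \<beta>)" using assms by (metis exp_less_mono mult_less_cancel_left_pos zero_less_numeral)
  then have "exp (- 2 * \<beta>) * (1 + sqrt 2) < exp (- 2 * \<beta>) * exp (2 * \<beta>)" by (rule mult_strict_left_mono) simp
  also have "\<dots> = 1" by (simp add: exp_add[symmetric])
  finally have "exp (- 2 * \<beta>) * (1 + sqrt 2) * (sqrt 2 - 1) < 1 * (sqrt 2 - 1)"
    by (rule mult_strict_right_mono) simp
  moreover have "(1 + sqrt 2) * (sqrt 2 - 1) = 1" by (simp add: algebra_simps)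
  ultimately have "exp (- 2 * \<beta>) + 1 < sqrt 2" by (simp add: mult.assoc)
  then have "(exp (- 2 * \<beta>) + 1)\<^sup>2 < (sqrt 2)\<^sup>2" by (rule power_strict_mono) (simp_all add: add_nonneg_nonneg)
  then have "(exp (- 2 * \<beta>))\<^sup>2 + 2 * exp (- 2 * \<beta>) < 1" unfolding power2_sum by simp
  then show "subcritical (exp (- 2 * \<beta>))" by unfold_locales simp_all
qed

lemma space_config_space: "space (config_space S) = S \<rightarrow>\<^sub>E {-1, 1}"
  by (simp add: config_space_def space_PiM)

lemma override_on_config_space:
  assumes "\<sigma> \<in> space (config_space S)" "\<tau> \<in> \<Lambda> \<rightarrow>\<^sub>E {-1, 1}" "\<Lambda> \<subseteq> S"
  shows "override_on \<sigma> \<tau> \<Lambda> \<in> space (config_space S)"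
  unfolding space_config_space
proof (rule PiE_I)
  fix x assume "x \<in> S"
  then show "override_on \<sigma> \<tau> \<Lambda> x \<in> {-1, 1}"
    using PiE_mem[OF assms(1)[unfolded space_config_space], of x] PiE_mem[OF assms(2), of x]
    by (cases "x \<in> \<Lambda>") (simp_all only: override_on_apply_in override_on_apply_notin not_False_eq_True)
next
  fix x assume "x \<notin> S"
  then show "override_on \<sigma> \<tau> \<Lambda> x = undefined"
    using PiE_arb[OF assms(1)[unfolded space_config_space], of x] assms(3) by (auto simp: override_on_def)
qed

lemma pred_spin: "p \<in> S \<Longrightarrow> Measurable.pred (config_space S) (\<lambda>\<sigma>. \<sigma> p = a)"
  unfolding config_space_def
  by (rule measurable_compose[OF measurable_component_singleton]) simp_all

text \<open>The DLR equation applied to \<open>A \<inter> B\<close>, where \<open>B\<close> looks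
  only at unresampled spins. Bounds are required almost everywhere on \<open>B\<close> because they
  will be known only for configurations with good rows.\<close>

lemma ising_gibbs_inter:
  assumes gibbs: "ising_gibbs_measure \<beta> S \<eta> \<pi>" and \<Lambda>: "finite \<Lambda>" "\<Lambda> \<subseteq> S"
    and A: "A \<in> sets (config_space S)" and B: "B \<in> sets (config_space S)"
    and inv: "\<And>\<sigma> \<tau>. \<sigma> \<in> space (config_space S) \<Longrightarrow> \<tau> \<in> \<Lambda> \<rightarrow>\<^sub>E {-1, 1} \<Longrightarrow> override_on \<sigma> \<tau> \<Lambda> \<in> B \<longleftrightarrow> \<sigma> \<in> B"
  shows "(AE \<sigma> in \<pi>. \<sigma> \<in> B \<longrightarrow> ising_kernel \<beta> S \<eta> \<Lambda> \<sigma> A \<le> hi) \<Longrightarrow> measure \<pi> (A \<inter> B) \<le> hi * measure \<pi> B"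
    and "(AE \<sigma> in \<pi>. \<sigma> \<in> B \<longrightarrow> lo \<le> ising_kernel \<beta> S \<eta> \<Lambda> \<sigma> A) \<Longrightarrow> lo * measure \<pi> B \<le> measure \<pi> (A \<inter> B)"
proof -
  interpret prob_space \<pi> using gibbs by (simp add: ising_gibbs_measure_def)
  have sets: "sets \<pi> = sets (config_space S)" using gibbs by (simp add: ising_gibbs_measure_def)
  have space: "space \<pi> = space (config_space S)" by (rule sets_eq_imp_space_eq[OF sets])
  let ?f = "\<lambda>\<sigma>. indicator B \<sigma> * ising_kernel \<beta> S \<eta> \<Lambda> \<sigma> A"
  have "measure \<pi> (A \<inter> B) = (\<integral>\<sigma>. ising_kernel \<beta> S \<eta> \<Lambda> \<sigma> (A \<inter> B) \<partial>\<pi>)"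
    using gibbs \<Lambda> A B unfolding ising_gibbs_measure_def sets by blast
  also have "\<dots> = (\<integral>\<sigma>. ?f \<sigma> \<partial>\<pi>)"
    by (intro Bochner_Integration.integral_cong refl ising_kernel_inter inv) (simp_all add: space)
  finally have m: "measure \<pi> (A \<inter> B) = (\<integral>\<sigma>. ?f \<sigma> \<partial>\<pi>)" .
  have meas: "?f \<in> borel_measurable \<pi>"
    unfolding measurable_cong_sets[OF sets refl]
    by (intro borel_measurable_times borel_measurable_indicator B measurable_ising_kernel A \<Lambda>)
  have int: "integrable \<pi> ?f"
  proof (rule integrable_const_bound[of _ 1])
    show "AE \<sigma> in \<pi>. norm (?f \<sigma>) \<le> 1"
      using ising_kernel_nonneg[of \<beta> S \<eta> \<Lambda> _ A] ising_kernel_le_1[OF \<Lambda>(1), of \<beta> S \<eta> _ A]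
      by (intro AE_I2) (simp add: indicator_def)
  qed (rule meas)
  have intB: "integrable \<pi> (\<lambda>\<sigma>. c * indicator B \<sigma>)" for c :: real
    using B by (intro integrable_mult_right integrable_real_indicator) (simp_all add: sets emeasure_eq_measure)
  have B': "(\<integral>\<sigma>. c * indicator B \<sigma> \<partial>\<pi>) = c * measure \<pi> B" for c :: real
    using B by (simp add: sets)
  show "measure \<pi> (A \<inter> B) \<le> hi * measure \<pi> B" if "AE \<sigma> in \<pi>. \<sigma> \<in> B \<longrightarrow> ising_kernel \<beta> S \<eta> \<Lambda> \<sigma> A \<le> hi"
  proof -
    have "AE \<sigma> in \<pi>. ?f \<sigma> \<le> hi * indicator B \<sigma>" using that by eventually_elim (simp add: indicator_def)
    from integral_mono_AE[OF int intB this] show ?thesis unfolding m B' .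
  qed
  show "lo * measure \<pi> B \<le> measure \<pi> (A \<inter> B)" if "AE \<sigma> in \<pi>. \<sigma> \<in> B \<longrightarrow> lo \<le> ising_kernel \<beta> S \<eta> \<Lambda> \<sigma> A"
  proof -
    have "AE \<sigma> in \<pi>. lo * indicator B \<sigma> \<le> ?f \<sigma>" using that by eventually_elim (simp add: indicator_def)
    from integral_mono_AE[OF intB int this] show ?thesis unfolding m B' .
  qed
qed

section \<open>Existence of monochromatic rows\<close>

definition row_gap :: "real \<Rightarrow> nat \<Rightarrow> real" where
  "row_gap \<beta> l = 1 - exp (- 8 * \<beta> * real l) / 2 ^ l"

lemma row_gap_bounds:
  assumes "\<beta> \<ge> 0"
  shows "0 \<le> row_gap \<beta> l" "row_gap \<beta> l < 1"
proof -
  have "exp (- 8 * \<beta> * real l) \<le> 1" using assms by simp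
  also have "1 \<le> (2 :: real) ^ l" by simp
  finally show "0 \<le> row_gap \<beta> l" by (simp add: row_gap_def)
  show "row_gap \<beta> l < 1" by (simp add: row_gap_def)
qed

text \<open>Resampling one row makes it monochromatic with a probability bounded below for any
  surroundings, and it leaves the other rows alone. So each further row costs one more factor
  \<open>row_gap \<beta> l\<close>.\<close>

lemma monochromatic_rows_missing:
  fixes y :: "nat \<Rightarrow> int"
  assumes gibbs: "ising_gibbs_measure \<beta> (strip l) strip_bc \<pi>" and \<beta>: "\<beta> \<ge> 0" and y: "inj y" and s: "s \<in> {-1, 1}"
  shows "measure \<pi> {\<sigma> \<in> space (config_space (strip l)). \<forall>k<m. \<not> (\<forall>x\<in>{1..int l}. \<sigma> (x, y k) = s)} \<le> row_gap \<beta> l ^ m"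
proof (induction m)
  case 0
  interpret prob_space \<pi> using gibbs by (simp add: ising_gibbs_measure_def)
  show ?case by (simp add: prob_le_1)
next
  case (Suc m)
  let ?M = "config_space (strip l)" and ?\<Lambda> = "{1..int l} \<times> {y m}"
  let ?row = "\<lambda>k \<sigma>. \<forall>x\<in>{1..int l}. \<sigma> (x, y k) = s"
  let ?A = "{\<sigma> \<in> space ?M. \<not> ?row m \<sigma>}" and ?B = "{\<sigma> \<in> space ?M. \<forall>k<m. \<not> ?row k \<sigma>}"
  have \<Lambda>: "finite ?\<Lambda>" "?\<Lambda> \<subseteq> strip l" "card ?\<Lambda> = l" by (auto simp: strip_def)
  have row: "Measurable.pred ?M (?row k)" for k
    by (intro pred_intros_finite pred_spin) (auto simp: strip_def)
  have A: "?A \<in> sets ?M" by (intro predE pred_intros_logic row)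
  have B: "?B \<in> sets ?M" by (intro predE pred_intros_countable pred_intros_logic row) simp
  have inv: "override_on \<sigma> \<tau> ?\<Lambda> \<in> ?B \<longleftrightarrow> \<sigma> \<in> ?B" if "\<sigma> \<in> space ?M" "\<tau> \<in> ?\<Lambda> \<rightarrow>\<^sub>E {-1, 1}" for \<sigma> \<tau>
  proof -
    have "override_on \<sigma> \<tau> ?\<Lambda> (x, y k) = \<sigma> (x, y k)" if "k < m" for x k
      using that injD[OF y, of k m] by (auto simp: override_on_def)
    then have "(\<forall>k<m. \<not> ?row k (override_on \<sigma> \<tau> ?\<Lambda>)) \<longleftrightarrow> (\<forall>k<m. \<not> ?row k \<sigma>)" by simp
    then show ?thesis using override_on_config_space[OF that \<Lambda>(2)] that(1) by blast
  qed
  have ker: "ising_kernel \<beta> (strip l) strip_bc ?\<Lambda> \<sigma> ?A \<le> row_gap \<beta> l" if "\<sigma> \<in> space ?M" for \<sigma>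
  proof -
    let ?\<rho> = "restrict (\<lambda>_. s) ?\<Lambda>"
    have "?row m (override_on \<sigma> ?\<rho> ?\<Lambda>)" by (simp add: override_on_def)
    then have "override_on \<sigma> ?\<rho> ?\<Lambda> \<notin> ?A" by blast
    moreover have "?\<rho> \<in> ?\<Lambda> \<rightarrow>\<^sub>E {-1, 1}" using s by auto
    moreover have "strip_bc x \<in> {-1, 1}" for x by (cases x) (simp add: strip_bc_def)
    moreover have "\<sigma> x \<in> {-1, 1}" if "x \<in> strip l" for x
      using PiE_mem[OF \<open>\<sigma> \<in> space ?M\<close>[unfolded space_config_space] that] .
    ultimately have "ising_kernel \<beta> (strip l) strip_bc ?\<Lambda> \<sigma> ?A \<le> 1 - exp (- 8 * \<beta> * card ?\<Lambda>) / 2 ^ card ?\<Lambda>"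
      by (intro ising_kernel_finite_energy \<Lambda> \<beta>)
    then show ?thesis unfolding \<Lambda>(3) row_gap_def .
  qed
  have "space \<pi> = space ?M" using gibbs by (intro sets_eq_imp_space_eq) (simp add: ising_gibbs_measure_def)
  then have "measure \<pi> (?A \<inter> ?B) \<le> row_gap \<beta> l * measure \<pi> ?B"
    using ker by (intro ising_gibbs_inter(1)[OF gibbs \<Lambda>(1,2) A B inv] AE_I2) simp_all
  also have "\<dots> \<le> row_gap \<beta> l * row_gap \<beta> l ^ m" by (rule mult_left_mono[OF Suc row_gap_bounds(1)[OF \<beta>]])
  also have "?A \<inter> ?B = {\<sigma> \<in> space ?M. \<forall>k<Suc m. \<not> ?row k \<sigma>}" by (auto simp: less_Suc_eq)
  finally show ?case by simp
qed

lemma plus_minus_rows_missing: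
  assumes "ising_gibbs_measure \<beta> (strip l) strip_bc \<pi>" "\<beta> \<ge> 0"
  shows "measure \<pi> {\<sigma> \<in> space (config_space (strip l)). \<forall>k<m. \<not> plus_row l (N + k) \<sigma>} \<le> row_gap \<beta> l ^ m"
    and "measure \<pi> {\<sigma> \<in> space (config_space (strip l)). \<forall>k<m. \<not> minus_row l (N + k) \<sigma>} \<le> row_gap \<beta> l ^ m"
  unfolding plus_row_def minus_row_def using assms
  by (intro monochromatic_rows_missing; simp add: inj_def)+

lemma pred_rows:
  "Measurable.pred (config_space (strip l)) (plus_row l n)" "Measurable.pred (config_space (strip l)) (minus_row l n)"
  unfolding plus_row_def minus_row_def by (intro pred_intros_finite pred_spin; auto simp: strip_def)+

lemma AE_good_rows:
  assumes gibbs: "ising_gibbs_measure \<beta> (strip l) strip_bc \<pi>" and \<beta>: "\<beta> \<ge> 0"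
  shows "AE \<sigma> in \<pi>. good_rows l \<sigma>"
proof -
  interpret prob_space \<pi> using gibbs by (simp add: ising_gibbs_measure_def)
  let ?M = "config_space (strip l)"
  have sets: "sets \<pi> = sets ?M" using gibbs by (simp add: ising_gibbs_measure_def)
  have space: "space \<pi> = space ?M" by (rule sets_eq_imp_space_eq[OF sets])
  have *: "AE \<sigma> in \<pi>. \<exists>n\<ge>N. R n \<sigma>"
    if R: "\<And>n. Measurable.pred ?M (R n)" and b: "\<And>m. measure \<pi> {\<sigma> \<in> space ?M. \<forall>k<m. \<not> R (N + k) \<sigma>} \<le> row_gap \<beta> l ^ m" for R and N :: nat
  proof -
    let ?D = "{\<sigma> \<in> space ?M. \<forall>n. \<not> R (N + n) \<sigma>}"
    have D: "?D \<in> events" unfolding sets by (intro predE pred_intros_countable pred_intros_logic R)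
    have "measure \<pi> ?D \<le> row_gap \<beta> l ^ m" for m
    proof -
      have "{\<sigma> \<in> space ?M. \<forall>k<m. \<not> R (N + k) \<sigma>} \<in> events"
        unfolding sets by (intro predE pred_intros_countable pred_intros_logic R) simp
      then have "measure \<pi> ?D \<le> measure \<pi> {\<sigma> \<in> space ?M. \<forall>k<m. \<not> R (N + k) \<sigma>}"
        by (rule finite_measure_mono[rotated]) blast
      then show ?thesis using b[of m] by linarith
    qed
    moreover have "(\<lambda>m. row_gap \<beta> l ^ m) \<longlonglongrightarrow> 0" by (rule LIMSEQ_realpow_zero[OF row_gap_bounds[OF \<beta>]])
    ultimately have "measure \<pi> ?D \<le> 0" by (intro LIMSEQ_le_const) auto
    then have "measure \<pi> ?D = 0" using measure_nonneg[of \<pi> ?D] by linarith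
    then have "AE \<sigma> in \<pi>. \<sigma> \<notin> ?D" using D by (subst (asm) prob_eq_0) simp_all
    then show ?thesis
    proof (rule AE_mp, intro AE_I2 impI)
      fix \<sigma> assume "\<sigma> \<in> space \<pi>" "\<sigma> \<notin> ?D"
      then obtain n where "R (N + n) \<sigma>" unfolding space by blast
      then show "\<exists>n\<ge>N. R n \<sigma>" by (intro exI[of _ "N + n"]) simp
    qed
  qed
  have "AE \<sigma> in \<pi>. \<exists>n\<ge>N. plus_row l n \<sigma>" "AE \<sigma> in \<pi>. \<exists>n\<ge>N. minus_row l n \<sigma>" for N
    by (rule *; rule pred_rows plus_minus_rows_missing[OF gibbs \<beta>])+
  then show ?thesis unfolding good_rows_def AE_all_countable by simp
qed

lemma stays_above_event_sets:
  assumes l: "l \<ge> 1"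
  shows "stays_above_event l \<in> sets (config_space (strip l))"
proof -
  let ?M = "config_space (strip l)" and ?E = "\<lambda>\<sigma>. disagreement_edges (strip l) (override_on strip_bc \<sigma> (strip l))"
  have sub: "?E \<sigma> \<subseteq> lattice_edges" for \<sigma> by (auto simp: disagreement_edges_strip lattice_edges_def)
  have neq: "Measurable.pred ?M (\<lambda>\<sigma>. override_on strip_bc \<sigma> (strip l) p \<noteq> override_on strip_bc \<sigma> (strip l) q)" for p q
  proof -
    have eq: "override_on strip_bc \<sigma> (strip l) p = override_on strip_bc \<sigma> (strip l) q \<longleftrightarrow>
        (\<exists>a. override_on strip_bc \<sigma> (strip l) p = a \<and> override_on strip_bc \<sigma> (strip l) q = a)" for \<sigma> by auto
    have "Measurable.pred ?M (\<lambda>\<sigma>. override_on strip_bc \<sigma> (strip l) p = a)" for p a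
      by (cases "p \<in> strip l") (simp_all add: pred_spin)
    then show ?thesis unfolding eq by (intro pred_intros_logic pred_intros_countable)
  qed
  have pred: "Measurable.pred ?M (\<lambda>\<sigma>. e \<in> ?E \<sigma>)" for e
  proof (cases "e \<in> lattice_edges")
    case True
    then obtain i j d where e: "e = edge (i, j) d" unfolding lattice_edges_def by force
    show ?thesis unfolding e by (cases d; simp only: mem_disagreement[OF l]; intro pred_intros_logic neq; simp)
  next
    case False
    then have "e \<notin> ?E \<sigma>" for \<sigma> using sub by blast
    then show ?thesis by simp
  qed
  show ?thesis unfolding stays_above_event_def open_contours_def Let_def
    by (rule predE) (rule pred_unique_open_contour[OF sub pred])
qed

lemma ising_kernel_stays_above:
  assumes "\<beta> > critical_beta"
  obtains c C where "c > 0" "C > 0"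
    "\<And>l. l \<ge> 1 \<Longrightarrow> \<exists>N. \<forall>n n' \<sigma>. N < n' \<longrightarrow> n' < n \<longrightarrow> \<sigma> \<in> space (config_space (strip l)) \<longrightarrow> good_rows l \<sigma> \<longrightarrow>
       plus_row l n \<sigma> \<longrightarrow> minus_row l n' \<sigma> \<longrightarrow>
       c / real l \<le> ising_kernel \<beta> (strip l) strip_bc (box l n n') \<sigma> (stays_above_event l) \<and>
       ising_kernel \<beta> (strip l) strip_bc (box l n n') \<sigma> (stays_above_event l) \<le> C / real l"
proof -
  define t where "t = exp (- 2 * \<beta>)"
  have \<beta>: "\<beta> > 0" by (rule subcritical_exp(1)[OF assms])
  interpret subcritical t unfolding t_def by (rule subcritical_exp(2)[OF assms])
  obtain k where k: "k > 0" "\<forall>l\<ge>1. \<exists>M0. \<forall>M\<ge>M0. \<forall>M'\<ge>M0. two_point t (grid l M M') (0, 0) (int l, -2)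
      \<le> (1 - k / real l) * two_point t (grid l M M') (0, 0) (int l, 0)" by (rule grid_reflected_le) (rule that)
  obtain C where C: "C > 0" "\<forall>l\<ge>1. \<exists>M0. \<forall>n. \<forall>M\<ge>M0. \<forall>M'\<ge>M0. two_point t ({0..int l} \<times> {0..int n}) (0, 0) (int l, 0)
      \<le> C / real l * two_point t (grid l M M') (0, 0) (int l, 0)" by (rule half_strip_le) (rule that)
  show thesis
  proof (rule that[OF k(1) C(1)])
    fix l :: nat assume l: "l \<ge> 1"
    obtain M1 where M1: "\<forall>M\<ge>M1. \<forall>M'\<ge>M1. two_point t (grid l M M') (0, 0) (int l, -2)
      \<le> (1 - k / real l) * two_point t (grid l M M') (0, 0) (int l, 0)" using k(2) l by blast
    obtain M2 where M2: "\<forall>n. \<forall>M\<ge>M2. \<forall>M'\<ge>M2. two_point t ({0..int l} \<times> {0..int n}) (0, 0) (int l, 0)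
      \<le> C / real l * two_point t (grid l M M') (0, 0) (int l, 0)" using C(2) l by blast
    show "\<exists>N. \<forall>n n' \<sigma>. N < n' \<longrightarrow> n' < n \<longrightarrow> \<sigma> \<in> space (config_space (strip l)) \<longrightarrow> good_rows l \<sigma> \<longrightarrow>
       plus_row l n \<sigma> \<longrightarrow> minus_row l n' \<sigma> \<longrightarrow>
       k / real l \<le> ising_kernel \<beta> (strip l) strip_bc (box l n n') \<sigma> (stays_above_event l) \<and>
       ising_kernel \<beta> (strip l) strip_bc (box l n n') \<sigma> (stays_above_event l) \<le> C / real l"
    \<comment> \<open>The inequality \<open>M1 + M2 < n'\<close> is strict because the dual box has
      height \<open>n' - 1\<close> above row 0.\<close>
    proof (intro exI[of _ "M1 + M2"] allI impI)
      fix n n' \<sigma> assume N: "M1 + M2 < n'" and nn: "n' < n" and \<sigma>: "\<sigma> \<in> space (config_space (strip l))"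
        and good: "good_rows l \<sigma>" and rows: "plus_row l n \<sigma>" "minus_row l n' \<sigma>"
      have n: "n \<ge> 1" "n' \<ge> 1" using N nn by simp_all
      have \<sigma>': "\<sigma> \<in> strip l \<rightarrow>\<^sub>E {-1, 1}" using \<sigma> by (simp add: space_config_space)
      let ?\<Lambda> = "box l n n'" and ?ord = "interface_graph.next_dirs (int l, 0)" and ?ds = "[South, North, East]"
      let ?K = "ising_kernel \<beta> (strip l) strip_bc ?\<Lambda> \<sigma> (stays_above_event l)"
      note res = resampled_spins[OF l n \<sigma>' rows]
      \<comment> \<open>Only rows strictly between \<open>- n\<close> and \<open>n'\<close> are
        resampled, and infinitely many good rows lie outside.\<close>
      have good': "good_rows l (resampled l n n' \<sigma> \<tau>)" for \<tau>
      proof -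
        have "plus_row l k (resampled l n n' \<sigma> \<tau>) \<longleftrightarrow> plus_row l k \<sigma>" if "k \<ge> n" for k
          using that by (auto simp: plus_row_def resampled_def[OF l n \<sigma>' rows] override_on_def box_def strip_def)
        moreover have "minus_row l k (resampled l n n' \<sigma> \<tau>) \<longleftrightarrow> minus_row l k \<sigma>" if "k \<ge> n'" for k
          using that by (auto simp: minus_row_def resampled_def[OF l n \<sigma>' rows] override_on_def box_def strip_def)
        moreover have "\<exists>k\<ge>m. k \<ge> n \<and> plus_row l k \<sigma>" "\<exists>k\<ge>m. k \<ge> n' \<and> minus_row l k \<sigma>" for m
          using good unfolding good_rows_def by (metis max.bounded_iff)+
        ultimately show ?thesis unfolding good_rows_def by blast
      qed
      have walk: "override_on \<sigma> \<tau> ?\<Lambda> \<in> stays_above_event l \<Longrightarrow> walk row_below ?ord (resampled_edges l n n' \<sigma> \<tau>) (0, 0) ?ds (int l, 0)"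
        "override_on \<sigma> \<tau> ?\<Lambda> \<notin> stays_above_event l \<Longrightarrow> \<exists>z\<in>row_below. walk row_below ?ord (resampled_edges l n n' \<sigma> \<tau>) (0, 0) ?ds z"
        if \<tau>: "\<tau> \<in> ?\<Lambda> \<rightarrow>\<^sub>E {-1, 1}" for \<tau>
      proof -
        have "override_on \<sigma> \<tau> ?\<Lambda> \<in> space (config_space (strip l))"
          by (rule override_on_config_space[OF \<sigma> \<tau>]) (auto simp: box_def strip_def)
        note w = stays_above_walk[OF l this, folded resampled_def[OF l n \<sigma>' rows], OF res(1)[OF \<tau>] good' res(2,3)[OF \<tau>] n(2),
          folded resampled_edges_def[OF l n \<sigma>' rows]]
        show "override_on \<sigma> \<tau> ?\<Lambda> \<in> stays_above_event l \<Longrightarrow> walk row_below ?ord (resampled_edges l n n' \<sigma> \<tau>) (0, 0) ?ds (int l, 0)"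
          by (rule w(1))
        show "override_on \<sigma> \<tau> ?\<Lambda> \<notin> stays_above_event l \<Longrightarrow> \<exists>z\<in>row_below. walk row_below ?ord (resampled_edges l n n' \<sigma> \<tau>) (0, 0) ?ds z"
          by (rule w(2))
      qed
      let ?G = "two_point t (dual_box l n n') (0, 0)" and ?P = "two_point t ({0..int l} \<times> {0..int (n' - 1)}) (0, 0) (int l, 0)"
      have K: "?K \<le> ?P / ?G (int l, 0)" "1 - ?G (int l, -2) / ?G (int l, 0) \<le> ?K"
        using ising_kernel_bounds[OF l n \<sigma>' rows \<beta> nn walk] unfolding t_def by blast+
      \<comment> \<open>If the denominator were \<open>0\<close>, then both quotients would be \<open>0\<close> and \<open>1 \<le> 0\<close>.\<close>
      have "?G (int l, 0) \<noteq> 0" using K by auto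
      moreover have "?G (int l, 0) \<ge> 0" using t0 by (intro two_point_nonneg) auto
      ultimately have G: "?G (int l, 0) > 0" by simp
      have "?G (int l, -2) \<le> (1 - k / real l) * ?G (int l, 0)" unfolding dual_box_def using M1 N nn by simp
      then have "?G (int l, -2) / ?G (int l, 0) \<le> 1 - k / real l" using G by (simp add: pos_divide_le_eq)
      moreover have "n \<ge> M2" "n' - 1 \<ge> M2" using N nn by auto
      then have "?P \<le> C / real l * ?G (int l, 0)" unfolding dual_box_def using M2 by blast
      then have "?P / ?G (int l, 0) \<le> C / real l" using G by (simp add: pos_divide_le_eq)
      ultimately show "k / real l \<le> ?K \<and> ?K \<le> C / real l" using K by linarith
    qed
  qed
qed

lemma (in prob_space) partition_bounds:
  assumes I: "finite I" and B: "\<And>i. i \<in> I \<Longrightarrow> B i \<in> events" "disjoint_family_on B I" and A: "A \<in> events"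
    and rest: "prob (space M - (\<Union>i\<in>I. B i)) \<le> \<epsilon>" and lo: "lo \<ge> 0" and hi: "hi \<ge> 0"
    and b: "\<And>i. i \<in> I \<Longrightarrow> lo * prob (B i) \<le> prob (A \<inter> B i)" "\<And>i. i \<in> I \<Longrightarrow> prob (A \<inter> B i) \<le> hi * prob (B i)"
  shows "lo * (1 - \<epsilon>) \<le> prob A" "prob A \<le> hi + \<epsilon>"
proof -
  let ?U = "\<Union>i\<in>I. B i"
  have U: "?U \<in> events" using I B(1) by (intro sets.finite_UN)
  have pU: "prob ?U = (\<Sum>i\<in>I. prob (B i))" using I B by (intro finite_measure_finite_Union) auto
  have "prob (\<Union>i\<in>I. A \<inter> B i) = (\<Sum>i\<in>I. prob (A \<inter> B i))"
    using I B A by (intro finite_measure_finite_Union) (auto simp: disjoint_family_on_def)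
  moreover have "(\<Union>i\<in>I. A \<inter> B i) = A \<inter> ?U" by blast
  ultimately have pA: "prob (A \<inter> ?U) = (\<Sum>i\<in>I. prob (A \<inter> B i))" by simp
  have "1 - \<epsilon> \<le> prob ?U" using rest prob_compl[OF U] by simp
  then have "lo * (1 - \<epsilon>) \<le> lo * prob ?U" using lo by (rule mult_left_mono)
  also have "\<dots> \<le> prob (A \<inter> ?U)" unfolding pU pA sum_distrib_left by (rule sum_mono[OF b(1)])
  also have "\<dots> \<le> prob A" using A by (intro finite_measure_mono) auto
  finally show "lo * (1 - \<epsilon>) \<le> prob A" .
  have "prob A \<le> prob ((A \<inter> ?U) \<union> (space M - ?U))"
    using A U sets.sets_into_space[OF A] by (intro finite_measure_mono) auto
  also have "\<dots> \<le> prob (A \<inter> ?U) + prob (space M - ?U)" using A U by (intro measure_Un_le) auto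
  also have "prob (A \<inter> ?U) \<le> hi * prob ?U" unfolding pU pA sum_distrib_left by (rule sum_mono[OF b(2)])
  also have "\<dots> \<le> hi" using hi by (simp add: mult_left_le prob_le_1)
  finally show "prob A \<le> hi + \<epsilon>" using rest by linarith
qed

lemma last_index:
  fixes a b :: nat
  assumes "k \<in> {a..<b}" "P k"
  shows "\<exists>k\<in>{a..<b}. P k \<and> (\<forall>j\<in>{k<..<b}. \<not> P j)"
proof -
  let ?K = "{k \<in> {a..<b}. P k}"
  have K: "finite ?K" "?K \<noteq> {}" using assms by auto
  have "\<not> P j" if j: "j \<in> {Max ?K<..<b}" for j
  proof
    assume "P j"
    then have "j \<in> ?K" using j Max_in[OF K] by auto
    then have "j \<le> Max ?K" by (rule Max_ge[OF K(1)])
    then show False using j unfolding greaterThanLessThan_iff by linarith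
  qed
  then show ?thesis using Max_in[OF K] by blast
qed

theorem theorem5p1:
  fixes \<beta> :: real
  assumes "\<beta> > critical_beta"
  shows "\<exists>c>0. \<exists>C>0. \<forall>l::nat. l \<ge> 1 \<longrightarrow>
           (\<forall>\<pi>. ising_gibbs_measure \<beta> (strip l) strip_bc \<pi> \<longrightarrow>
              c / real l \<le> measure \<pi> (stays_above_event l) \<and>
              measure \<pi> (stays_above_event l) \<le> C / real l)"
proof -
  obtain c C where cC: "c > 0" "C > 0" and ker:
    "\<And>l. l \<ge> 1 \<Longrightarrow> \<exists>N. \<forall>n n' \<sigma>. N < n' \<longrightarrow> n' < n \<longrightarrow> \<sigma> \<in> space (config_space (strip l)) \<longrightarrow> good_rows l \<sigma> \<longrightarrow>
       plus_row l n \<sigma> \<longrightarrow> minus_row l n' \<sigma> \<longrightarrow>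
       c / real l \<le> ising_kernel \<beta> (strip l) strip_bc (box l n n') \<sigma> (stays_above_event l) \<and>
       ising_kernel \<beta> (strip l) strip_bc (box l n n') \<sigma> (stays_above_event l) \<le> C / real l"
    using ising_kernel_stays_above[OF assms] by metis
  have \<beta>: "\<beta> \<ge> 0" using subcritical_exp(1)[OF assms] by simp
  have "c / real l \<le> measure \<pi> (stays_above_event l) \<and> measure \<pi> (stays_above_event l) \<le> C / real l"
    if l: "l \<ge> 1" and gibbs: "ising_gibbs_measure \<beta> (strip l) strip_bc \<pi>" for l \<pi>
  proof -
    interpret prob_space \<pi> using gibbs by (simp add: ising_gibbs_measure_def)
    let ?M = "config_space (strip l)" and ?A = "stays_above_event l"
    have sets: "sets \<pi> = sets ?M" using gibbs by (simp add: ising_gibbs_measure_def)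
    have space: "space \<pi> = space ?M" by (rule sets_eq_imp_space_eq[OF sets])
    have A: "?A \<in> sets ?M" by (rule stays_above_event_sets[OF l])
    obtain N where N: "\<And>n n' \<sigma>. N < n' \<Longrightarrow> n' < n \<Longrightarrow> \<sigma> \<in> space ?M \<Longrightarrow> good_rows l \<sigma> \<Longrightarrow> plus_row l n \<sigma> \<Longrightarrow> minus_row l n' \<sigma> \<Longrightarrow>
       c / real l \<le> ising_kernel \<beta> (strip l) strip_bc (box l n n') \<sigma> ?A \<and>
       ising_kernel \<beta> (strip l) strip_bc (box l n n') \<sigma> ?A \<le> C / real l" using ker[OF l] by blast
    have good: "AE \<sigma> in \<pi>. good_rows l \<sigma>" by (rule AE_good_rows[OF gibbs \<beta>])
    have bounds: "c / real l * (1 - 2 * row_gap \<beta> l ^ m) \<le> prob ?A" "prob ?A \<le> C / real l + 2 * row_gap \<beta> l ^ m" for m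
    proof -
      define N1 where "N1 = Suc N"
      \<comment> \<open>Plus rows are sought at depths beyond the range of the minus rows, so that
        \<open>n' < n\<close> holds for every pair and the reflected upper half fits into the
        box.\<close>
      define N2 where "N2 = N1 + m"
      define I where "I = {N2..<N2 + m} \<times> {N1..<N1 + m}"
      \<comment> \<open>\<open>B i\<close> fixes the outermost plus and minus rows within their
        windows. This makes the events disjoint, and they depend only on spins outside the box
        between the two rows, as \<open>ising_gibbs_inter\<close> requires.\<close>
      define B where "B i = {\<sigma> \<in> space ?M. plus_row l (fst i) \<sigma> \<and> (\<forall>k\<in>{fst i<..<N2 + m}. \<not> plus_row l k \<sigma>) \<and>
        minus_row l (snd i) \<sigma> \<and> (\<forall>k\<in>{snd i<..<N1 + m}. \<not> minus_row l k \<sigma>)}" for i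
      have sB: "B i \<in> sets ?M" for i unfolding B_def
        by (intro predE pred_intros_finite pred_intros_logic pred_rows) simp_all
      have disj: "disjoint_family_on B I"
        unfolding disjoint_family_on_def
      proof (intro ballI impI)
        fix i j assume ij: "i \<in> I" "j \<in> I" "i \<noteq> j"
        have "fst i < fst j \<or> fst j < fst i \<or> snd i < snd j \<or> snd j < snd i" using ij(3) by (auto simp: prod_eq_iff)
        then show "B i \<inter> B j = {}" using ij(1,2) unfolding B_def I_def by auto
      qed
      have sub: "space \<pi> - (\<Union>i\<in>I. B i) \<subseteq> {\<sigma> \<in> space ?M. \<forall>k<m. \<not> plus_row l (N2 + k) \<sigma>} \<union> {\<sigma> \<in> space ?M. \<forall>k<m. \<not> minus_row l (N1 + k) \<sigma>}"
      proof
        fix \<sigma> assume \<sigma>: "\<sigma> \<in> space \<pi> - (\<Union>i\<in>I. B i)"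
        show "\<sigma> \<in> {\<sigma> \<in> space ?M. \<forall>k<m. \<not> plus_row l (N2 + k) \<sigma>} \<union> {\<sigma> \<in> space ?M. \<forall>k<m. \<not> minus_row l (N1 + k) \<sigma>}"
        proof (rule ccontr)
          assume "\<not> ?thesis"
          then obtain k k' where k: "k < m" "plus_row l (N2 + k) \<sigma>" and k': "k' < m" "minus_row l (N1 + k') \<sigma>"
            using \<sigma> unfolding space by blast
          obtain n where n: "n \<in> {N2..<N2 + m}" "plus_row l n \<sigma>" "\<forall>j\<in>{n<..<N2 + m}. \<not> plus_row l j \<sigma>"
            using last_index[of "N2 + k" N2 "N2 + m" "\<lambda>n. plus_row l n \<sigma>"] k by auto
          obtain n' where n': "n' \<in> {N1..<N1 + m}" "minus_row l n' \<sigma>" "\<forall>j\<in>{n'<..<N1 + m}. \<not> minus_row l j \<sigma>"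
            using last_index[of "N1 + k'" N1 "N1 + m" "\<lambda>n. minus_row l n \<sigma>"] k' by auto
          have "\<sigma> \<in> space ?M" using \<sigma> space by blast
          then have "(n, n') \<in> I" "\<sigma> \<in> B (n, n')" using n n' unfolding I_def B_def fst_conv snd_conv by blast+
          then show False using \<sigma> by blast
        qed
      qed
      have S: "{\<sigma> \<in> space ?M. \<forall>k<m. \<not> plus_row l (N2 + k) \<sigma>} \<in> events" "{\<sigma> \<in> space ?M. \<forall>k<m. \<not> minus_row l (N1 + k) \<sigma>} \<in> events"
        unfolding sets by (intro predE pred_intros_countable pred_intros_logic pred_rows; simp add: pred_rows)+
      have "prob (space \<pi> - (\<Union>i\<in>I. B i)) \<le> prob ({\<sigma> \<in> space ?M. \<forall>k<m. \<not> plus_row l (N2 + k) \<sigma>} \<union> {\<sigma> \<in> space ?M. \<forall>k<m. \<not> minus_row l (N1 + k) \<sigma>})"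
        by (rule finite_measure_mono[OF sub sets.Un[OF S]])
      also have "\<dots> \<le> row_gap \<beta> l ^ m + row_gap \<beta> l ^ m"
        by (rule order_trans[OF measure_Un_le[OF S] add_mono[OF plus_minus_rows_missing[OF gibbs \<beta>]]])
      finally have rest: "prob (space \<pi> - (\<Union>i\<in>I. B i)) \<le> 2 * row_gap \<beta> l ^ m" by simp
      have b: "c / real l * prob (B i) \<le> prob (?A \<inter> B i) \<and> prob (?A \<inter> B i) \<le> C / real l * prob (B i)" if "i \<in> I" for i
      proof -
        obtain n n' where i: "i = (n, n')" by (cases i)
        have nn: "N < n'" "n' < n" using that by (auto simp: I_def i N2_def N1_def)
        let ?\<Lambda> = "box l n n'"
        have \<Lambda>: "finite ?\<Lambda>" "?\<Lambda> \<subseteq> strip l" by (auto simp: box_def strip_def)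
        have inv: "override_on \<sigma> \<tau> ?\<Lambda> \<in> B i \<longleftrightarrow> \<sigma> \<in> B i" if "\<sigma> \<in> space ?M" "\<tau> \<in> ?\<Lambda> \<rightarrow>\<^sub>E {-1, 1}" for \<sigma> \<tau>
        proof -
          have p: "plus_row l k (override_on \<sigma> \<tau> ?\<Lambda>) \<longleftrightarrow> plus_row l k \<sigma>" if "k \<ge> n" for k
            using that by (auto simp: plus_row_def override_on_def box_def)
          have m: "minus_row l k (override_on \<sigma> \<tau> ?\<Lambda>) \<longleftrightarrow> minus_row l k \<sigma>" if "k \<ge> n'" for k
            using that by (auto simp: minus_row_def override_on_def box_def)
          show ?thesis using override_on_config_space[OF that \<Lambda>(2)] that(1) by (simp add: B_def i p m)
        qed
        have k: "AE \<sigma> in \<pi>. \<sigma> \<in> B i \<longrightarrow> c / real l \<le> ising_kernel \<beta> (strip l) strip_bc ?\<Lambda> \<sigma> ?A \<and>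
            ising_kernel \<beta> (strip l) strip_bc ?\<Lambda> \<sigma> ?A \<le> C / real l"
          using good by eventually_elim (use N[OF nn] in \<open>auto simp: B_def i\<close>)
        then have "AE \<sigma> in \<pi>. \<sigma> \<in> B i \<longrightarrow> c / real l \<le> ising_kernel \<beta> (strip l) strip_bc ?\<Lambda> \<sigma> ?A"
          "AE \<sigma> in \<pi>. \<sigma> \<in> B i \<longrightarrow> ising_kernel \<beta> (strip l) strip_bc ?\<Lambda> \<sigma> ?A \<le> C / real l"
          by (eventually_elim, blast)+
        then show ?thesis using ising_gibbs_inter[OF gibbs \<Lambda> A sB inv] by blast
      qed
      have I: "finite I" by (simp add: I_def)
      show "c / real l * (1 - 2 * row_gap \<beta> l ^ m) \<le> prob ?A" "prob ?A \<le> C / real l + 2 * row_gap \<beta> l ^ m"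
        using partition_bounds[OF I sB[folded sets] disj A[folded sets] rest _ _ conjunct1[OF b] conjunct2[OF b]] cC by simp_all
    qed
    have lim: "(\<lambda>m. row_gap \<beta> l ^ m) \<longlonglongrightarrow> 0" by (rule LIMSEQ_realpow_zero[OF row_gap_bounds[OF \<beta>]])
    have "(\<lambda>m. c / real l * (1 - 2 * row_gap \<beta> l ^ m)) \<longlonglongrightarrow> c / real l * (1 - 2 * 0)"
      by (intro tendsto_intros lim)
    then have "c / real l * (1 - 2 * 0) \<le> prob ?A" by (rule LIMSEQ_le_const2) (use bounds(1) in blast)
    moreover have "(\<lambda>m. C / real l + 2 * row_gap \<beta> l ^ m) \<longlonglongrightarrow> C / real l + 2 * 0" by (intro tendsto_intros lim)
    then have "prob ?A \<le> C / real l + 2 * 0" by (rule LIMSEQ_le_const) (use bounds(2) in blast)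
    ultimately show ?thesis by simp
  qed
  then show ?thesis using cC by blast
qed

end
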